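(* Consider the DZOVR iteration (defined in the context) for the problem $\min_{x\in\mathbb{R}^d} f(x)=\frac1n\sum_{i=1}^n f_i(x)$, $f_i(x)=\mathbb{E}_{\xi_i}F_i(x;\xi_i)$. Suppose that: (i) $W$ is doubly stochastic and primitive, i.e. $W1_n=1_n$, $1_n^\top W=1_n^\top$ and $W^k>0$ entrywise for some positive integer $k$; (ii) each $f_i$ is $L$-smooth, and $F_i(\cdot;\xi_i)$ is $L$-smooth for almost all $\xi_i$; (iii) for all $x\in\mathbb{R}^d$ and all $i$, $\mathbb{E}_{\xi_i}[\nabla F_i(x;\xi_i)]=\nabla f_i(x)$ and $\mathbb{E}_{\xi_i}\|\nabla F_i(x;\xi_i)-\nabla f_i(x)\|^2\le\sigma_0^2\|\nabla f_i(x)\|^2+\sigma_1^2$; (iv) for all $x\in\mathbb{R}^d$ and all $i$, $\|\nabla f_i(x)-\nabla f(x)\|^2\le\sigma_2^2\|\nabla f(x)\|^2+\sigma_3^2$. Run the algorithm with $$\alpha=\frac1{100L}\cdot\frac{n^{2/3}}{d^{2/3}K^{1/3}},\quad\beta=\frac{n^{1/3}}{d^{1/3}K^{2/3}},\quad b_0=\left\lceil d^{2/3}(nK)^{1/3}\right\rceil,\quad t_k=\frac{\beta}{d^2(k+1)^{1/4}}.$$ Then, for $K\ge\frac{(100L)^3n^2}{d^2a_0^3}$ (with $a_0$ as defined in the context), $$\frac1K\sum_{k=0}^{K-1}\mathbb{E}\|\nabla f(\bar x^k)\|^2=\mathcal{O}\left(\left(\frac d{nK}\right)^{2/3}\right),\qquad\bar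 x^k=\frac1n\sum_{i=1}^nx_i^k.$$
   Context: Setting. $\mathcal G=(\mathcal V,\mathcal E)$ is an undirected graph on $\mathcal V=\{1,\dots,n\}$. $W=(w_{ij})\in\mathbb{R}^{n\times n}$ is the consensus matrix: $w_{ij}>0$ if $(i,j)\in\mathcal E$ or $i=j$, and $w_{ij}=0$ otherwise. $1_n$ is the all-ones vector, $\|\cdot\|$ is the Euclidean norm of a vector or the spectral norm of a matrix, and $\rho:=\|W-\frac{1_n1_n^\top}{n}\|$ (under hypothesis (i), $\rho\in[0,1)$). $L>0$ and $\sigma_0,\sigma_1,\sigma_2,\sigma_3\ge0$ are constants. A function is $L$-smooth if it is differentiable with $L$-Lipschitz gradient. The optimal value $f^*=\inf_{x}f(x)$ is finite. Zeroth-order estimator. For $t>0$, $d\ge1$, $x\in\mathbb{R}^d$ and $u$ in the unit sphere $\mathbb{S}_{d-1}\subset\mathbb{R}^d$, $\hat\nabla f_i(x;u,\xi)=d\,\frac{F_i(x+tu;\xi)-F_i(x-tu;\xi)}{2t}\,u$; in iteration $k$ one uses $t=t_k$. DZOVR algorithm. Parameters: $W$, given initial points $x_i^0\in\mathbb{R}^d$ ($i=1,\dots,n$), $g_i^0=m_i^{-1}=0$, integer $b_0\ge1$, $\alpha>0$, $0\le\beta<1$, positive sequence $(t_k)_{k\ge0}$. Iteration $0$: each node $i$ draws independent samples $\{u_{i,s}^0,\xi_{i,s}^0\}_{s=1}^{b_0}$ with $u_{i,s}^0$ uniform on $\mathbb{S}_{d-1}$ and $\xi_{i,s}^0$ distributed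 as $\xi_i$, and sets $m_i^0=\frac1{b_0}\sum_{s=1}^{b_0}\hat\nabla f_i(x_i^0;u_{i,s}^0,\xi_{i,s}^0)$ (with $t=t_0$). Iteration $k\ge1$: each node $i$ draws $\xi_i^k$ distributed as $\xi_i$ and $u_i^k$ uniform on $\mathbb{S}_{d-1}$, and sets (with $t=t_k$ in all estimators) $$m_i^k=\beta\hat\nabla f_i(x_i^k;u_i^k,\xi_i^k)+(1-\beta)\left(m_i^{k-1}+\hat\nabla f_i(x_i^k;u_i^k,\xi_i^k)-\hat\nabla f_i(x_i^{k-1};u_i^k,\xi_i^k)\right).$$ In every iteration $k\ge0$: $$g_i^{k+1}=\sum_{j=1}^nw_{ij}(g_j^k+m_j^k-m_j^{k-1}),\qquad x_i^{k+1}=\sum_{j=1}^nw_{ij}(x_j^k-\alpha g_j^{k+1}).$$ All samples are independent across nodes, batch indices and iterations, and $u$-samples are independent of $\xi$-samples. Constants: $$a_0=\min\left\{1,\frac1{2L},\frac{1-\rho^2}{\sqrt{360d}\,L\rho^2},\frac{(1-\rho^2)^2}{284\sqrt d\,L\rho^2},\frac1{2\sqrt{c_3}},\frac{Ld}{2\sqrt{nc_0c_3}},\frac1{4\sqrt{c_1c_3}},\sqrt{\frac{c_4}{4c_3}}\right\},$$ $$c_0=\frac{L^2}{n}+\frac{32dL^2(1+\sigma_0^2)}{n^2}+\frac{48L^2}{n},$$ $$c_1=\frac{64d(1+\sigma_0^2)(1+\sigma_2^2)}{n}+48+\frac{3277000\alpha^2d^2L^2\rho^4(1+\sigma_0^2)(1+\sigma_2^2)}{(1-\rho^2)^4},$$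 $$c_3=\frac{72dL^2}{n}+\frac{1073000d^2L^2\rho^4}{(1-\rho^2)^4},\qquad c_4=\frac1{\sqrt{54(1-\rho^2)(1+\sigma_0^2)}}$$ (the $\alpha$ in $c_1$ is the step size). If $\rho=0$, terms having $\rho^2$ in the denominator are read as $+\infty$.
   Formalization: Added: initial disagreement (1/n)Σ|x_i^0−x̄^0|² ≤ Dα, the O-constant depending on D (for fixed unequal x_i^0 the rate can fail). The constant is uniform in n, d and the problem only if α ≤ a_0 (automatic if L ≥ 1/100); otherwise it depends on the problem and x^0. *)

theory Defs
  imports "HOL-Probability.Probability"
begin

text \<open>
  The hidden constant in the claimed rate must not depend on the dimension, so the dimension has to be
  a term and not a type. We therefore realise \<open>\<real>\<^sup>d\<close> as the coordinate subspace \<open>euclid d\<close> of the inner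
  product space of finitely supported real sequences; on that subspace the inner product, the norm
  and the Borel sets are the usual ones of \<open>\<real>\<^sup>d\<close>.
\<close>

typedef rvec = "{x :: nat \<Rightarrow> real. finite {j. x j \<noteq> 0}}"
  morphisms coord Abs_rvec
  by (rule exI[of _ "\<lambda>_. 0"]) simp

setup_lifting type_definition_rvec

lemma finite_coord: "finite {j. coord x j \<noteq> 0}"
  using coord[of x] by simp

instantiation rvec :: real_inner
begin

lift_definition zero_rvec :: rvec is "\<lambda>_. 0" by simp

lift_definition plus_rvec :: "rvec \<Rightarrow> rvec \<Rightarrow> rvec" is "\<lambda>x y j. x j + y j"
proof -
  fix x y :: "nat \<Rightarrow> real"
  assume "finite {j. x j \<noteq> 0}" "finite {j. y j \<noteq> 0}"
  then have "finite ({j. x j \<noteq> 0} \<union> {j. y j \<noteq> 0})" by simp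
  then show "finite {j. x j + y j \<noteq> 0}" by (rule rev_finite_subset) auto
qed

lift_definition minus_rvec :: "rvec \<Rightarrow> rvec \<Rightarrow> rvec" is "\<lambda>x y j. x j - y j"
proof -
  fix x y :: "nat \<Rightarrow> real"
  assume "finite {j. x j \<noteq> 0}" "finite {j. y j \<noteq> 0}"
  then have "finite ({j. x j \<noteq> 0} \<union> {j. y j \<noteq> 0})" by simp
  then show "finite {j. x j - y j \<noteq> 0}" by (rule rev_finite_subset) auto
qed

lift_definition uminus_rvec :: "rvec \<Rightarrow> rvec" is "\<lambda>x j. - x j" by simp

lift_definition scaleR_rvec :: "real \<Rightarrow> rvec \<Rightarrow> rvec" is "\<lambda>r x j. r * x j"
  by (erule rev_finite_subset) auto

definition inner_rvec :: "rvec \<Rightarrow> rvec \<Rightarrow> real" where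
  "inner_rvec x y = (\<Sum>j | coord x j \<noteq> 0. coord x j * coord y j)"

definition norm_rvec :: "rvec \<Rightarrow> real" where
  "norm_rvec x = sqrt (inner x x)"

definition dist_rvec :: "rvec \<Rightarrow> rvec \<Rightarrow> real" where
  "dist_rvec x y = norm (x - y)"

definition sgn_rvec :: "rvec \<Rightarrow> rvec" where
  "sgn_rvec x = inverse (norm x) *\<^sub>R x"

definition uniformity_rvec :: "(rvec \<times> rvec) filter" where
  "uniformity_rvec = (INF e\<in>{0<..}. principal {(x, y). dist x y < e})"

definition open_rvec :: "rvec set \<Rightarrow> bool" where
  "open_rvec U \<longleftrightarrow> (\<forall>x\<in>U. \<forall>\<^sub>F (x', y) in uniformity. x' = x \<longrightarrow> y \<in> U)"

lemma inner_rvec_superset: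
  assumes "finite S" "{j. coord x j \<noteq> 0} \<subseteq> S"
  shows "inner x y = (\<Sum>j\<in>S. coord x j * coord y j)"
  unfolding inner_rvec_def using assms by (intro sum.mono_neutral_left) auto

instance
proof
  fix x y z :: rvec and a b r :: real
  let ?S = "{j. coord x j \<noteq> 0} \<union> {j. coord y j \<noteq> 0}"
  have S: "finite ?S" by (simp add: finite_coord)
  show "x + y + z = x + (y + z)" by transfer (simp add: add.assoc)
  show "x + y = y + x" by transfer (simp add: add.commute)
  show "0 + x = x" by transfer simp
  show "- x + x = 0" by transfer simp
  show "x - y = x + - y" by transfer simp
  show "a *\<^sub>R (x + y) = a *\<^sub>R x + a *\<^sub>R y" by transfer (simp add: distrib_left)
  show "(a + b) *\<^sub>R x = a *\<^sub>R x + b *\<^sub>R x" by transfer (simp add: distrib_right)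
  show "a *\<^sub>R b *\<^sub>R x = (a * b) *\<^sub>R x" by transfer (simp add: mult.assoc)
  show "1 *\<^sub>R x = x" by transfer simp
  show "sgn x = inverse (norm x) *\<^sub>R x" by (rule sgn_rvec_def)
  show "dist x y = norm (x - y)" by (rule dist_rvec_def)
  show "uniformity = (INF e\<in>{0<..}. principal {(x, y :: rvec). dist x y < e})"
    by (rule uniformity_rvec_def)
  show "open U \<longleftrightarrow> (\<forall>x\<in>U. \<forall>\<^sub>F (x', y) in uniformity. x' = x \<longrightarrow> y \<in> U)" for U :: "rvec set"
    by (rule open_rvec_def)
  show "norm x = sqrt (inner x x)" by (rule norm_rvec_def)
  show "inner x y = inner y x"
    using inner_rvec_superset[OF S, of x y] inner_rvec_superset[OF S, of y x]
    by (simp add: mult.commute)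
  have add_supp: "{j. coord (x + y) j \<noteq> 0} \<subseteq> ?S"
    by (auto simp: plus_rvec.rep_eq)
  show "inner (x + y) z = inner x z + inner y z"
    using inner_rvec_superset[OF S, of x z] inner_rvec_superset[OF S, of y z]
      inner_rvec_superset[OF S add_supp, of z]
    by (simp add: plus_rvec.rep_eq distrib_right sum.distrib)
  have scale_supp: "{j. coord (r *\<^sub>R x) j \<noteq> 0} \<subseteq> {j. coord x j \<noteq> 0}"
    by (auto simp: scaleR_rvec.rep_eq)
  show "inner (r *\<^sub>R x) y = r * inner x y"
    using inner_rvec_superset[OF finite_coord scale_supp, of y]
    by (simp add: inner_rvec_def scaleR_rvec.rep_eq sum_distrib_left mult.assoc)
  show "0 \<le> inner x x"
    unfolding inner_rvec_def by (intro sum_nonneg) simp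
  show "inner x x = 0 \<longleftrightarrow> x = 0"
  proof
    assume "inner x x = 0"
    then have "\<forall>j\<in>{j. coord x j \<noteq> 0}. coord x j * coord x j = 0"
      unfolding inner_rvec_def by (subst (asm) sum_nonneg_eq_0_iff) (auto simp: finite_coord)
    then have "coord x = coord 0" by (auto simp: zero_rvec.rep_eq)
    then show "x = 0" by (simp add: coord_inject)
  qed (simp add: inner_rvec_def zero_rvec.rep_eq)
qed

end

definition euclid :: "nat \<Rightarrow> rvec set" where
  "euclid d = {x. \<forall>j\<ge>d. coord x j = 0}"

definition vec_on :: "nat set \<Rightarrow> (nat \<Rightarrow> real) \<Rightarrow> rvec" where
  "vec_on J c = Abs_rvec (\<lambda>j. if j \<in> J then c j else 0)"

lemma coord_vec_on: "finite J \<Longrightarrow> coord (vec_on J c) j = (if j \<in> J then c j else 0)"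
  unfolding vec_on_def by (subst Abs_rvec_inverse) (auto intro: rev_finite_subset)

lemma vec_on_eq_sum:
  assumes "finite J"
  shows "vec_on J c = (\<Sum>j\<in>J. c j *\<^sub>R vec_on {j} (\<lambda>_. 1))"
proof -
  have *: "coord (\<Sum>j\<in>I. c j *\<^sub>R vec_on {j} (\<lambda>_. 1)) i = (\<Sum>j\<in>I. c j * (if i = j then 1 else 0))"
    if "finite I" for i I
    using that by (induction I rule: finite_induct)
      (auto simp: zero_rvec.rep_eq plus_rvec.rep_eq scaleR_rvec.rep_eq coord_vec_on)
  have "coord (vec_on J c) = coord (\<Sum>j\<in>J. c j *\<^sub>R vec_on {j} (\<lambda>_. 1))"
    using assms by (auto simp: * coord_vec_on if_distrib cong: if_cong)
  then show ?thesis by (simp add: coord_inject)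
qed

lemma norm_vec_on: "finite J \<Longrightarrow> norm (vec_on J c) = L2_set c J"
proof -
  assume J: "finite J"
  have "inner (vec_on J c) (vec_on J c) = (\<Sum>j\<in>J. coord (vec_on J c) j * coord (vec_on J c) j)"
    using J by (intro inner_rvec_superset) (auto simp: coord_vec_on)
  also have "\<dots> = (\<Sum>j\<in>J. (c j)\<^sup>2)"
    using J by (intro sum.cong) (auto simp: coord_vec_on power2_eq_square)
  finally show ?thesis by (simp add: norm_eq_sqrt_inner L2_set_def)
qed

lemma vec_on_measurable:
  assumes J: "finite J" and f: "\<And>j. j \<in> J \<Longrightarrow> f j \<in> borel_measurable N"
  shows "(\<lambda>c. vec_on J (\<lambda>j. f j c)) \<in> borel_measurable N"
proof -
  define h where "h = (\<lambda>c j. if j \<in> J then f j c else 0)"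
  have "h \<in> measurable N (Pi\<^sub>M UNIV (\<lambda>_. borel))"
    unfolding h_def
  proof (rule measurable_PiM_single')
    show "(\<lambda>c. if j \<in> J then f j c else 0) \<in> borel_measurable N" for j
      by (cases "j \<in> J") (simp_all add: f)
  qed (simp add: space_PiM)
  then have h: "h \<in> borel_measurable N"
    by (simp cong: measurable_cong_sets add: sets_PiM_equal_borel)
  have "continuous_on UNIV (\<lambda>c :: nat \<Rightarrow> real. \<Sum>j\<in>J. c j *\<^sub>R vec_on {j} (\<lambda>_. 1))"
    by (intro continuous_intros) (rule continuous_on_product_coordinates)
  then have "(\<lambda>c :: nat \<Rightarrow> real. vec_on J c) \<in> borel_measurable borel"
    using borel_measurable_continuous_onI vec_on_eq_sum[OF J] by simp
  from measurable_compose[OF h this] have "(\<lambda>c. vec_on J (h c)) \<in> borel_measurable N" .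
  moreover have "vec_on J (h c) = vec_on J (\<lambda>j. f j c)" for c
    unfolding vec_on_def h_def by (rule arg_cong[of _ _ Abs_rvec]) auto
  ultimately show ?thesis by simp
qed

text \<open>
  The normalised surface measure of the unit sphere, i.e. the law of \<open>y / norm y\<close> for \<open>y\<close>
  uniformly distributed in the unit ball (\<open>y = 0\<close> has probability zero).
\<close>

definition unit_sphere :: "nat \<Rightarrow> rvec set" where
  "unit_sphere d = {u \<in> euclid d. norm u = 1}"

definition unif_sphere :: "nat \<Rightarrow> rvec measure" where
  "unif_sphere d =
     distr (uniform_measure (\<Pi>\<^sub>M j\<in>{..<d}. lborel)
             {c \<in> space (\<Pi>\<^sub>M j\<in>{..<d}. (lborel :: real measure)). L2_set c {..<d} \<le> 1})
       borel (\<lambda>c. sgn (vec_on {..<d} c))"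

lemma sgn_vec_on_measurable:
  "(\<lambda>c. sgn (vec_on {..<d} c)) \<in> borel_measurable (\<Pi>\<^sub>M j\<in>{..<d}. (lborel :: real measure))"
proof -
  have "sgn (vec_on {..<d} c) = vec_on {..<d} (\<lambda>j. inverse (L2_set c {..<d}) * c j)" for c
  proof -
    have "coord (sgn (vec_on {..<d} c)) = coord (vec_on {..<d} (\<lambda>j. inverse (L2_set c {..<d}) * c j))"
      by (auto simp: sgn_div_norm scaleR_rvec.rep_eq coord_vec_on norm_vec_on)
    then show ?thesis by (simp add: coord_inject)
  qed
  moreover have "(\<lambda>c. vec_on {..<d} (\<lambda>j. inverse (L2_set c {..<d}) * c j))
      \<in> borel_measurable (\<Pi>\<^sub>M j\<in>{..<d}. (lborel :: real measure))"
    unfolding L2_set_def by (intro vec_on_measurable) (auto, measurable)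
  ultimately show ?thesis by simp
qed

lemma prob_space_unif_sphere:
  assumes "d \<ge> 1"
  shows "prob_space (unif_sphere d)"
proof -
  let ?P = "\<Pi>\<^sub>M j\<in>{..<d}. (lborel :: real measure)"
  let ?B = "{c \<in> space ?P. L2_set c {..<d} \<le> 1}"
  have "?B = {f. sqrt (\<Sum>i\<in>{..<d}. (f i)\<^sup>2) \<le> 1} \<inter> space ?P"
    by (auto simp: L2_set_def)
  then have e: "emeasure ?P ?B = ennreal (unit_ball_vol (real d) * 1 ^ d)"
    using emeasure_cball_aux[of "{..<d}" 1] by simp
  interpret U: prob_space "uniform_measure ?P ?B"
    by (rule prob_space_uniform_measure) (simp_all add: e less_imp_neq[OF unit_ball_vol_pos[OF of_nat_0_le_iff], symmetric])
  show ?thesis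
    unfolding unif_sphere_def
    by (rule U.prob_space_distr)
       (use sgn_vec_on_measurable in \<open>simp cong: measurable_cong_sets add: measurable_def\<close>)
qed

definition grad :: "nat \<Rightarrow> (rvec \<Rightarrow> real) \<Rightarrow> rvec \<Rightarrow> rvec" where
  "grad d \<phi> x =
     (THE g. g \<in> euclid d \<and> (\<phi> has_derivative (\<lambda>h. g \<bullet> h)) (at x within euclid d))"

definition smooth_fun :: "nat \<Rightarrow> real \<Rightarrow> (rvec \<Rightarrow> real) \<Rightarrow> bool" where
  "smooth_fun d L \<phi> \<longleftrightarrow>
     (\<forall>x\<in>euclid d. \<phi> differentiable (at x within euclid d)) \<and> L-lipschitz_on (euclid d) (grad d \<phi>)"

text \<open>
  Matrices indexed by the nodes \<open>{1..n}\<close>. The operator \<open>mat_op n A\<close> ignores the coordinates outside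
  \<open>{1..n}\<close>, so its operator norm is the spectral norm of the \<open>n \<times> n\<close> matrix.
\<close>

definition mat_op :: "nat \<Rightarrow> (nat \<Rightarrow> nat \<Rightarrow> real) \<Rightarrow> rvec \<Rightarrow> rvec" where
  "mat_op n A v = vec_on {1..n} (\<lambda>i. \<Sum>j=1..n. A i j * coord v j)"

definition spectral_norm :: "nat \<Rightarrow> (nat \<Rightarrow> nat \<Rightarrow> real) \<Rightarrow> real" where
  "spectral_norm n A = onorm (mat_op n A)"

fun mat_pow :: "nat \<Rightarrow> (nat \<Rightarrow> nat \<Rightarrow> real) \<Rightarrow> nat \<Rightarrow> nat \<Rightarrow> nat \<Rightarrow> real" where
  "mat_pow n A 0 i j = (if i = j then 1 else 0)"
| "mat_pow n A (Suc k) i j = (\<Sum>l=1..n. A i l * mat_pow n A k l j)"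

definition consensus_rho :: "nat \<Rightarrow> (nat \<Rightarrow> nat \<Rightarrow> real) \<Rightarrow> real" where
  "consensus_rho n W = spectral_norm n (\<lambda>i j. W i j - 1 / real n)"

definition node_avg :: "nat \<Rightarrow> (nat \<Rightarrow> rvec) \<Rightarrow> rvec" where
  "node_avg n y = (1 / real n) *\<^sub>R (\<Sum>i=1..n. y i)"

definition local_obj :: "(nat \<Rightarrow> 'x measure) \<Rightarrow> (nat \<Rightarrow> rvec \<Rightarrow> 'x \<Rightarrow> real) \<Rightarrow> nat \<Rightarrow> rvec \<Rightarrow> real" where
  "local_obj \<Xi> F i x = (\<integral>z. F i x z \<partial>\<Xi> i)"

definition global_obj :: "nat \<Rightarrow> (nat \<Rightarrow> 'x measure) \<Rightarrow> (nat \<Rightarrow> rvec \<Rightarrow> 'x \<Rightarrow> real) \<Rightarrow> rvec \<Rightarrow> real" where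
  "global_obj n \<Xi> F x = 1 / real n * (\<Sum>i=1..n. local_obj \<Xi> F i x)"

text \<open>
  \<open>\<Xi> i\<close> is the law of \<open>\<xi>\<^sub>i\<close>. The measurability of \<open>F\<close> and the integrability of \<open>F\<close> and of its
  gradient only say that the expectations in the problem are meaningful.
\<close>

locale decentralized_problem =
  fixes n d :: nat
    and E :: "(nat \<times> nat) set"
    and W :: "nat \<Rightarrow> nat \<Rightarrow> real"
    and \<Xi> :: "nat \<Rightarrow> 'x measure"
    and F :: "nat \<Rightarrow> rvec \<Rightarrow> 'x \<Rightarrow> real"
    and L \<sigma>0 \<sigma>1 \<sigma>2 \<sigma>3 :: real
  assumes n_pos: "n \<ge> 1" and d_pos: "d \<ge> 1"
    and constants: "L > 0" "\<sigma>0 \<ge> 0" "\<sigma>1 \<ge> 0" "\<sigma>2 \<ge> 0" "\<sigma>3 \<ge> 0"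
    and graph: "E \<subseteq> {1..n} \<times> {1..n}" "sym E"
    and weights: "\<And>i j. i \<in> {1..n} \<Longrightarrow> j \<in> {1..n} \<Longrightarrow>
          (if (i, j) \<in> E \<or> i = j then W i j > 0 else W i j = 0)"
    and doubly_stochastic:
          "\<And>i. i \<in> {1..n} \<Longrightarrow> (\<Sum>j=1..n. W i j) = 1"
          "\<And>j. j \<in> {1..n} \<Longrightarrow> (\<Sum>i=1..n. W i j) = 1"
    and primitive: "\<exists>k\<ge>1. \<forall>i\<in>{1..n}. \<forall>j\<in>{1..n}. mat_pow n W k i j > 0"
    and prob: "\<And>i. i \<in> {1..n} \<Longrightarrow> prob_space (\<Xi> i)"
    and F_measurable: "\<And>i. i \<in> {1..n} \<Longrightarrow>
          (\<lambda>(x, z). F i x z) \<in> borel_measurable (restrict_space borel (euclid d) \<Otimes>\<^sub>M \<Xi> i)"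
    and F_integrable: "\<And>i x. i \<in> {1..n} \<Longrightarrow> x \<in> euclid d \<Longrightarrow> integrable (\<Xi> i) (F i x)"
    and bounded_below: "bdd_below (global_obj n \<Xi> F ` euclid d)"
    and local_smooth: "\<And>i. i \<in> {1..n} \<Longrightarrow> smooth_fun d L (local_obj \<Xi> F i)"
    and sample_smooth: "\<And>i. i \<in> {1..n} \<Longrightarrow> AE z in \<Xi> i. smooth_fun d L (\<lambda>x. F i x z)"
    and grad_integrable: "\<And>i x j. i \<in> {1..n} \<Longrightarrow> x \<in> euclid d \<Longrightarrow> j < d \<Longrightarrow>
          integrable (\<Xi> i) (\<lambda>z. coord (grad d (\<lambda>y. F i y z) x) j)"
    and grad_unbiased: "\<And>i x j. i \<in> {1..n} \<Longrightarrow> x \<in> euclid d \<Longrightarrow> j < d \<Longrightarrow>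
          (\<integral>z. coord (grad d (\<lambda>y. F i y z) x) j \<partial>\<Xi> i) = coord (grad d (local_obj \<Xi> F i) x) j"
    and grad_variance: "\<And>i x. i \<in> {1..n} \<Longrightarrow> x \<in> euclid d \<Longrightarrow>
          (\<integral>\<^sup>+z. ennreal ((norm (grad d (\<lambda>y. F i y z) x - grad d (local_obj \<Xi> F i) x))\<^sup>2) \<partial>\<Xi> i)
            \<le> ennreal (\<sigma>0\<^sup>2 * (norm (grad d (local_obj \<Xi> F i) x))\<^sup>2 + \<sigma>1\<^sup>2)"
    and heterogeneity: "\<And>i x. i \<in> {1..n} \<Longrightarrow> x \<in> euclid d \<Longrightarrow>
          (norm (grad d (local_obj \<Xi> F i) x - grad d (global_obj n \<Xi> F) x))\<^sup>2
            \<le> \<sigma>2\<^sup>2 * (norm (grad d (global_obj n \<Xi> F) x))\<^sup>2 + \<sigma>3\<^sup>2"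

definition zo_grad :: "nat \<Rightarrow> real \<Rightarrow> (rvec \<Rightarrow> 'x \<Rightarrow> real) \<Rightarrow> rvec \<Rightarrow> rvec \<Rightarrow> 'x \<Rightarrow> rvec" where
  "zo_grad d t \<phi> x u z = (real d * ((\<phi> (x + t *\<^sub>R u) z - \<phi> (x - t *\<^sub>R u) z) / (2 * t))) *\<^sub>R u"

text \<open>
  The sample of node \<open>i\<close>, iteration \<open>k\<close> and batch position \<open>s\<close> has index \<open>(i, k, s)\<close>; iterations
  \<open>k \<ge> 1\<close> use only \<open>s = 1\<close>.
\<close>

definition sample_index :: "nat \<Rightarrow> nat \<Rightarrow> (nat \<times> nat \<times> nat) set" where
  "sample_index n b0 = {(i, k, s). i \<in> {1..n} \<and> (if k = 0 then s \<in> {1..b0} else s = 1)}"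

text \<open>
  In a run, \<open>x k i\<close>, \<open>g k i\<close> and \<open>m k i\<close> are the iterates of node \<open>i\<close> as random vectors. Independence
  of the pairs together with independence inside each pair is joint independence of all samples.
\<close>

locale dzovr_run = prob_space M
  for M :: "'w measure" +
  fixes n d :: nat
    and W :: "nat \<Rightarrow> nat \<Rightarrow> real"
    and \<Xi> :: "nat \<Rightarrow> 'x measure"
    and F :: "nat \<Rightarrow> rvec \<Rightarrow> 'x \<Rightarrow> real"
    and x0 :: "nat \<Rightarrow> rvec"
    and b0 :: nat
    and \<alpha> \<beta> :: real
    and t :: "nat \<Rightarrow> real"
    and u :: "nat \<times> nat \<times> nat \<Rightarrow> 'w \<Rightarrow> rvec"
    and \<xi> :: "nat \<times> nat \<times> nat \<Rightarrow> 'w \<Rightarrow> 'x"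
    and x g m :: "nat \<Rightarrow> nat \<Rightarrow> 'w \<Rightarrow> rvec"
  assumes parameters: "b0 \<ge> 1" "\<alpha> > 0" "0 \<le> \<beta>" "\<beta> < 1" "\<And>k. t k > 0"
    and u_sphere: "\<And>p \<omega>. p \<in> sample_index n b0 \<Longrightarrow> \<omega> \<in> space M \<Longrightarrow> u p \<omega> \<in> unit_sphere d"
    and u_law: "\<And>p. p \<in> sample_index n b0 \<Longrightarrow>
          u p \<in> borel_measurable M \<and> distr M borel (u p) = unif_sphere d"
    and \<xi>_law: "\<And>i k s. (i, k, s) \<in> sample_index n b0 \<Longrightarrow>
          \<xi> (i, k, s) \<in> measurable M (\<Xi> i) \<and> distr M (\<Xi> i) (\<xi> (i, k, s)) = \<Xi> i"
    and samples_indep: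
          "indep_vars (\<lambda>(i, k, s). borel \<Otimes>\<^sub>M \<Xi> i) (\<lambda>p \<omega>. (u p \<omega>, \<xi> p \<omega>)) (sample_index n b0)"
    and pair_indep: "\<And>p A B. p \<in> sample_index n b0 \<Longrightarrow> A \<in> sets borel \<Longrightarrow> B \<in> sets (\<Xi> (fst p)) \<Longrightarrow>
          prob {\<omega> \<in> space M. u p \<omega> \<in> A \<and> \<xi> p \<omega> \<in> B}
            = prob {\<omega> \<in> space M. u p \<omega> \<in> A} * prob {\<omega> \<in> space M. \<xi> p \<omega> \<in> B}"
    and x_init: "\<And>i \<omega>. i \<in> {1..n} \<Longrightarrow> \<omega> \<in> space M \<Longrightarrow> x 0 i \<omega> = x0 i"
    and g_init: "\<And>i \<omega>. i \<in> {1..n} \<Longrightarrow> \<omega> \<in> space M \<Longrightarrow> g 0 i \<omega> = 0"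
    and m_init: "\<And>i \<omega>. i \<in> {1..n} \<Longrightarrow> \<omega> \<in> space M \<Longrightarrow>
          m 0 i \<omega> = (1 / real b0) *\<^sub>R
            (\<Sum>s=1..b0. zo_grad d (t 0) (F i) (x 0 i \<omega>) (u (i, 0, s) \<omega>) (\<xi> (i, 0, s) \<omega>))"
    and m_step: "\<And>k i \<omega>. k \<ge> 1 \<Longrightarrow> i \<in> {1..n} \<Longrightarrow> \<omega> \<in> space M \<Longrightarrow>
          m k i \<omega> =
            \<beta> *\<^sub>R zo_grad d (t k) (F i) (x k i \<omega>) (u (i, k, 1) \<omega>) (\<xi> (i, k, 1) \<omega>)
            + (1 - \<beta>) *\<^sub>R (m (k - 1) i \<omega>
                + zo_grad d (t k) (F i) (x k i \<omega>) (u (i, k, 1) \<omega>) (\<xi> (i, k, 1) \<omega>)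
                - zo_grad d (t k) (F i) (x (k - 1) i \<omega>) (u (i, k, 1) \<omega>) (\<xi> (i, k, 1) \<omega>))"
    and g_step: "\<And>k i \<omega>. i \<in> {1..n} \<Longrightarrow> \<omega> \<in> space M \<Longrightarrow>
          g (Suc k) i \<omega> =
            (\<Sum>j=1..n. W i j *\<^sub>R (g k j \<omega> + m k j \<omega> - (if k = 0 then 0 else m (k - 1) j \<omega>)))"
    and x_step: "\<And>k i \<omega>. i \<in> {1..n} \<Longrightarrow> \<omega> \<in> space M \<Longrightarrow>
          x (Suc k) i \<omega> = (\<Sum>j=1..n. W i j *\<^sub>R (x k j \<omega> - \<alpha> *\<^sub>R g (Suc k) j \<omega>))"

definition c0 :: "nat \<Rightarrow> nat \<Rightarrow> real \<Rightarrow> real \<Rightarrow> real" where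
  "c0 n d L \<sigma>0 = L\<^sup>2 / n + 32 * d * L\<^sup>2 * (1 + \<sigma>0\<^sup>2) / n\<^sup>2 + 48 * L\<^sup>2 / n"

definition c1 :: "nat \<Rightarrow> nat \<Rightarrow> real \<Rightarrow> real \<Rightarrow> real \<Rightarrow> real \<Rightarrow> real \<Rightarrow> real" where
  "c1 n d L \<sigma>0 \<sigma>2 \<rho> \<alpha> =
     64 * d * (1 + \<sigma>0\<^sup>2) * (1 + \<sigma>2\<^sup>2) / n + 48
     + 3277000 * \<alpha>\<^sup>2 * d\<^sup>2 * L\<^sup>2 * \<rho> ^ 4 * (1 + \<sigma>0\<^sup>2) * (1 + \<sigma>2\<^sup>2) / (1 - \<rho>\<^sup>2) ^ 4"

definition c3 :: "nat \<Rightarrow> nat \<Rightarrow> real \<Rightarrow> real \<Rightarrow> real" where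
  "c3 n d L \<rho> = 72 * d * L\<^sup>2 / n + 1073000 * d\<^sup>2 * L\<^sup>2 * \<rho> ^ 4 / (1 - \<rho>\<^sup>2) ^ 4"

definition c4 :: "real \<Rightarrow> real \<Rightarrow> real" where
  "c4 \<sigma>0 \<rho> = 1 / sqrt (54 * (1 - \<rho>\<^sup>2) * (1 + \<sigma>0\<^sup>2))"

definition a0 :: "nat \<Rightarrow> nat \<Rightarrow> real \<Rightarrow> real \<Rightarrow> real \<Rightarrow> real \<Rightarrow> real \<Rightarrow> real" where
  "a0 n d L \<sigma>0 \<sigma>2 \<rho> \<alpha> = Min
     ({1, 1 / (2 * L),
       1 / (2 * sqrt (c3 n d L \<rho>)),
       L * d / (2 * sqrt (n * c0 n d L \<sigma>0 * c3 n d L \<rho>)),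
       1 / (4 * sqrt (c1 n d L \<sigma>0 \<sigma>2 \<rho> \<alpha> * c3 n d L \<rho>)),
       sqrt (c4 \<sigma>0 \<rho> / (4 * c3 n d L \<rho>))}
      \<union> (if \<rho> = 0 then {}
         else {(1 - \<rho>\<^sup>2) / (sqrt (360 * d) * L * \<rho>\<^sup>2),
               (1 - \<rho>\<^sup>2)\<^sup>2 / (284 * sqrt d * L * \<rho>\<^sup>2)}))"

definition alpha_par :: "real \<Rightarrow> nat \<Rightarrow> nat \<Rightarrow> nat \<Rightarrow> real" where
  "alpha_par L n d K = 1 / (100 * L) * (n powr (2/3) / (d powr (2/3) * K powr (1/3)))"

definition beta_par :: "nat \<Rightarrow> nat \<Rightarrow> nat \<Rightarrow> real" where
  "beta_par n d K = n powr (1/3) / (d powr (1/3) * K powr (2/3))"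

definition b0_par :: "nat \<Rightarrow> nat \<Rightarrow> nat \<Rightarrow> nat" where
  "b0_par n d K = nat \<lceil>d powr (2/3) * (real n * real K) powr (1/3)\<rceil>"

definition t_par :: "nat \<Rightarrow> nat \<Rightarrow> nat \<Rightarrow> nat \<Rightarrow> real" where
  "t_par n d K k = beta_par n d K / (d\<^sup>2 * (real k + 1) powr (1/4))"

text \<open>
  The average over \<open>k < K\<close> of the expectation of the squared gradient norm at the mean iterate. The
  Lebesgue integral takes values in \<^typ>\<open>ennreal\<close>, so a finite bound includes finiteness of the
  expectations.
\<close>

definition mean_sq_grad ::
    "nat \<Rightarrow> nat \<Rightarrow> (nat \<Rightarrow> 'x measure) \<Rightarrow> (nat \<Rightarrow> rvec \<Rightarrow> 'x \<Rightarrow> real) \<Rightarrow> 'w measure \<Rightarrow>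
     (nat \<Rightarrow> nat \<Rightarrow> 'w \<Rightarrow> rvec) \<Rightarrow> nat \<Rightarrow> ennreal" where
  "mean_sq_grad n d \<Xi> F M x K =
     ennreal (1 / real K) *
       (\<Sum>k<K. \<integral>\<^sup>+\<omega>. ennreal ((norm (grad d (global_obj n \<Xi> F) (node_avg n (\<lambda>i. x k i \<omega>))))\<^sup>2) \<partial>M)"

end

theory Submission
  imports Defs
begin

text \<open>
  The method is gradient descent on the mean iterate with an inexact direction: since \<open>W\<close> preserves
  averages and the tracking variables start at zero, the mean of \<open>g (Suc k)\<close> is the mean of \<open>m k\<close>, and
  the mean iterate moves by \<open>- \<alpha>\<close> times it. The descent inequality (\<open>descent_step\<close>) therefore bounds
  the summed squared gradients by the initial gap divided by \<open>\<alpha>\<close> plus the summed squared distance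
  between the mean direction and the gradient. Three things separate the two: the error of the
  recursive estimator, its bias, and the disagreement of the nodes.

  The estimator is controlled around its own mean \<open>est_mean\<close> and not around the gradient. The
  difference \<open>err\<close> obeys a contraction with factor \<open>1 - \<beta>\<close>; its innovation has mean zero given the
  past, and the innovations of different nodes are orthogonal, so that averaging divides their
  variance by \<open>n\<close> (\<open>errbar_recursion\<close>). The variance of an innovation is of order \<open>\<beta>\<^sup>2 d\<close> times the
  gradient moments plus \<open>d L\<^sup>2\<close> times the squared move of the iterate, because a difference of two
  estimators with the same sample is small when the points are close (\<open>est_difference_moment\<close>). As
  \<open>\<alpha>\<^sup>2 L\<^sup>2 d / n\<close> is a small multiple of \<open>\<beta>\<close>, the move of the mean is absorbed by the descent, and what
  remains is \<open>\<beta> d / n\<close>, which is the claimed rate. At a fixed point the mean of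
  the estimator moves by at most \<open>d L\<close> times the change of the radius (\<open>central_diff_radius\<close>), and
  these changes telescope. Mean and variance of the estimator are found by comparison with a linear
  function, for which it is \<open>d (g \<bullet> u) u\<close>; the second moments of \<open>u\<close> follow from the invariance of
  the ball under quarter turns.

  The disagreement passes twice through the mixing matrix, once for \<open>g\<close> and once for \<open>x\<close>, and so
  carries \<open>\<rho>\<^sup>4 / (1 - \<rho>\<^sup>2)\<^sup>4\<close> and \<open>\<alpha>\<^sup>2\<close> times the summed squared changes of \<open>m\<close> (\<open>sum_spread\<close>). That
  \<open>\<rho> < 1\<close> follows from primitivity and the positive diagonal of \<open>W\<close> (\<open>mixing_gap\<close>). All bounds feed
  back into each other linearly; under \<open>\<alpha> \<le> a0\<close> the feedback has total weight below one
  (\<open>step_conditions\<close>, \<open>feedback_closed\<close>), and the terms that remain are constants times the rate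
  (\<open>rate_bound\<close>). This gives the constant \<open>C\<close>. For a fixed problem, \<open>\<alpha> \<le> a0\<close> holds for all large \<open>K\<close>,
  and for the remaining finitely many \<open>K\<close> a bound that grows with \<open>k\<close> but is the same for all runs
  (\<open>iterates_crude\<close>) is enough for the constant \<open>C'\<close>.
\<close>

section \<open>Finitely supported sequences\<close>

lemma coord_zero [simp]: "coord 0 j = 0"
  by (simp add: zero_rvec.rep_eq)

lemma coord_add [simp]: "coord (x + y) j = coord x j + coord y j"
  by (simp add: plus_rvec.rep_eq)

lemma coord_diff [simp]: "coord (x - y) j = coord x j - coord y j"
  by (simp add: minus_rvec.rep_eq)

lemma coord_minus [simp]: "coord (- x) j = - coord x j"
  by (simp add: uminus_rvec.rep_eq)

lemma coord_scaleR [simp]: "coord (r *\<^sub>R x) j = r * coord x j"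
  by (simp add: scaleR_rvec.rep_eq)

lemma coord_sum: "coord (\<Sum>i\<in>I. f i) j = (\<Sum>i\<in>I. coord (f i) j)"
  by (induction I rule: infinite_finite_induct) auto

lemma rvec_eqI: "(\<And>j. coord x j = coord y j) \<Longrightarrow> x = y"
  by (simp add: coord_inject[symmetric] fun_eq_iff)

definition axis_vec :: "nat \<Rightarrow> rvec" where
  "axis_vec j = vec_on {j} (\<lambda>_. 1)"

lemma coord_axis_vec [simp]: "coord (axis_vec j) i = (if i = j then 1 else 0)"
  by (simp add: axis_vec_def coord_vec_on)

lemma inner_axis_vec: "inner (axis_vec j) y = coord y j"
  using inner_rvec_superset[of "{j}" "axis_vec j" y] by auto

lemma abs_coord_le_norm: "\<bar>coord x j\<bar> \<le> norm x"
proof -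
  have "norm (axis_vec j) = 1"
    using inner_axis_vec[of j "axis_vec j"] by (simp add: norm_eq_sqrt_inner)
  then show ?thesis
    using Cauchy_Schwarz_ineq2[of "axis_vec j" x] by (simp add: inner_axis_vec)
qed

lemma norm_vec_on_le: "finite J \<Longrightarrow> norm (vec_on J c) \<le> (\<Sum>j\<in>J. \<bar>c j\<bar>)"
  by (simp add: norm_vec_on L2_set_le_sum_abs)

lemma rational_vector_near:
  assumes "e > 0"
  shows "\<exists>xs :: rat list. norm (x - vec_on {..<length xs} (\<lambda>j. of_rat (xs ! j))) < e"
proof -
  obtain N where N: "{j. coord x j \<noteq> 0} \<subseteq> {..<N}"
    using finite_coord[of x] by (metis finite_nat_set_iff_bounded lessThan_iff subsetI)
  define \<delta> where "\<delta> = e / (N + 1)"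
  have \<delta>: "\<delta> > 0" using assms by (simp add: \<delta>_def)
  have "\<exists>q. \<bar>coord x j - real_of_rat q\<bar> < \<delta>" for j
  proof -
    obtain q where "coord x j - \<delta> < real_of_rat q" "real_of_rat q < coord x j"
      using of_rat_dense[of "coord x j - \<delta>" "coord x j"] \<delta> by auto
    then show ?thesis by (intro exI[of _ q]) auto
  qed
  then obtain q where q: "\<And>j. \<bar>coord x j - real_of_rat (q j)\<bar> < \<delta>" by metis
  define xs where "xs = map q [0..<N]"
  have len: "length xs = N" by (simp add: xs_def)
  have "x - vec_on {..<length xs} (\<lambda>j. of_rat (xs ! j))
        = vec_on {..<N} (\<lambda>j. coord x j - of_rat (q j))"
    using N by (intro rvec_eqI) (auto simp: coord_vec_on len xs_def)
  then have "norm (x - vec_on {..<length xs} (\<lambda>j. of_rat (xs ! j)))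
        \<le> (\<Sum>j<N. \<bar>coord x j - of_rat (q j)\<bar>)"
    by (simp add: norm_vec_on_le)
  also have "\<dots> \<le> (\<Sum>j<N. \<delta>)"
    using q by (intro sum_mono) (simp add: less_imp_le)
  also have "\<dots> < e"
    using assms by (simp add: \<delta>_def field_simps)
  finally show ?thesis by blast
qed

text \<open>
  Vectors with finitely many rational coordinates are dense. Second countability makes sums, inner
  products and norms of Borel measurable random vectors measurable.
\<close>

instance rvec :: second_countable_topology
proof
  define c :: "rat list \<Rightarrow> rvec" where "c xs = vec_on {..<length xs} (\<lambda>j. of_rat (xs ! j))" for xs
  define B where "B = (\<lambda>(xs, k). ball (c xs) (1 / real (Suc k))) ` UNIV"
  have "topological_basis B"
  proof (rule topological_basisI)
    fix U :: "rvec set" and x assume U: "open U" "x \<in> U"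
    then obtain e where e: "e > 0" "ball x e \<subseteq> U" by (meson openE)
    obtain k where k: "1 / real (Suc k) < e / 2"
      using e reals_Archimedean[of "e / 2"] by (auto simp: inverse_eq_divide)
    obtain xs where xs: "norm (x - c xs) < 1 / real (Suc k)"
      using rational_vector_near[of "1 / real (Suc k)" x] by (auto simp: c_def)
    have "ball (c xs) (1 / real (Suc k)) \<subseteq> ball x e"
    proof
      fix y assume "y \<in> ball (c xs) (1 / real (Suc k))"
      then have "dist (c xs) y < e / 2" using k by simp
      moreover have "dist x (c xs) < e / 2" using xs k by (simp add: dist_norm)
      ultimately show "y \<in> ball x e" using dist_triangle[of x y "c xs"] by simp
    qed
    then show "\<exists>B'\<in>B. x \<in> B' \<and> B' \<subseteq> U"
      using e xs by (intro bexI[of _ "ball (c xs) (1 / real (Suc k))"])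
        (auto simp: B_def dist_norm norm_minus_commute)
  qed (auto simp: B_def)
  moreover have "countable B" by (simp add: B_def)
  ultimately show "\<exists>B :: rvec set set. countable B \<and> open = generate_topology B"
    by (blast intro: topological_basis_imp_subbasis)
qed

lemma continuous_coord: "continuous_on UNIV (\<lambda>x. coord x j)"
proof -
  have "continuous_on UNIV (\<lambda>x. inner (axis_vec j) x)" by (intro continuous_intros)
  then show ?thesis by (simp add: inner_axis_vec)
qed

lemma measurable_coord [measurable]: "(\<lambda>x. coord x j) \<in> borel_measurable borel"
  by (rule borel_measurable_continuous_onI[OF continuous_coord])

lemma subspace_euclid: "subspace (euclid d)"
  by (auto simp: subspace_def euclid_def)

lemma closed_euclid: "closed (euclid d)"
proof -
  have "euclid d = (\<Inter>j\<in>{d..}. {x. coord x j = 0})" by (auto simp: euclid_def)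
  moreover have "closed {x. coord x j = 0}" for j
    by (rule closed_Collect_eq[OF continuous_coord]) simp
  ultimately show ?thesis by auto
qed

lemma euclid_borel [measurable]: "euclid d \<in> sets borel"
  by (rule borel_closed[OF closed_euclid])

lemma unit_sphere_borel [measurable]: "unit_sphere d \<in> sets borel"
proof -
  have "unit_sphere d = euclid d \<inter> sphere 0 1" by (auto simp: unit_sphere_def)
  moreover have "sphere (0::rvec) 1 \<in> sets borel"
    by (rule borel_closed) (simp add: closed_Collect_eq continuous_intros sphere_def dist_norm)
  ultimately show ?thesis by (simp add: sets.Int)
qed

lemma euclid_add [intro]: "x \<in> euclid d \<Longrightarrow> y \<in> euclid d \<Longrightarrow> x + y \<in> euclid d"
  and euclid_diff [intro]: "x \<in> euclid d \<Longrightarrow> y \<in> euclid d \<Longrightarrow> x - y \<in> euclid d"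
  and euclid_scaleR [intro]: "x \<in> euclid d \<Longrightarrow> r *\<^sub>R x \<in> euclid d"
  and euclid_zero [simp, intro]: "0 \<in> euclid d"
  by (auto simp: euclid_def)

lemma euclid_sum [intro]: "(\<And>i. i \<in> I \<Longrightarrow> f i \<in> euclid d) \<Longrightarrow> (\<Sum>i\<in>I. f i) \<in> euclid d"
  by (rule subspace_sum[OF subspace_euclid])

lemma euclid_vec_on [simp, intro]: "vec_on {..<d} c \<in> euclid d"
  by (auto simp: euclid_def coord_vec_on)

lemma inner_euclid: "x \<in> euclid d \<Longrightarrow> inner x y = (\<Sum>j<d. coord x j * coord y j)"
  by (rule inner_rvec_superset) (auto simp: euclid_def not_le[symmetric])

lemma norm_euclid: "x \<in> euclid d \<Longrightarrow> (norm x)\<^sup>2 = (\<Sum>j<d. (coord x j)\<^sup>2)"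
  unfolding power2_norm_eq_inner by (simp add: inner_euclid power2_eq_square)

lemma euclid_expand: "x \<in> euclid d \<Longrightarrow> x = (\<Sum>j<d. coord x j *\<^sub>R axis_vec j)"
  by (intro rvec_eqI) (auto simp: coord_sum euclid_def not_le[symmetric] if_distrib cong: if_cong)

lemma node_avg_euclid: "(\<And>i. i \<in> {1..n} \<Longrightarrow> y i \<in> euclid d) \<Longrightarrow> node_avg n y \<in> euclid d"
  unfolding node_avg_def by (intro euclid_scaleR euclid_sum) auto

text \<open>
  Means of random vectors are only accessible through their inner products with fixed vectors. Testing
  with the mean itself turns a bound on all inner products into a bound on the norm.
\<close>

lemma norm_le_of_inner_le:
  assumes "g \<in> euclid d" "\<And>v. v \<in> euclid d \<Longrightarrow> inner v g \<le> c * norm v" "0 \<le> c"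
  shows "norm g \<le> c"
proof (cases "g = 0")
  case True
  with assms show ?thesis by simp
next
  case False
  have "(norm g)\<^sup>2 \<le> c * norm g" using assms(2)[OF assms(1)] by (simp add: power2_norm_eq_inner)
  then show ?thesis using False by (simp add: power2_eq_square)
qed

text \<open>The weighted forms of \<open>(a + b)\<^sup>2 \<le> 2 a\<^sup>2 + 2 b\<^sup>2\<close> that keep one of the factors close to one.\<close>

lemma norm_add_sq_young:
  fixes a b :: "'a::real_inner"
  assumes "\<eta> > 0"
  shows "(norm (a + b))\<^sup>2 \<le> (1 + \<eta>) * (norm a)\<^sup>2 + (1 + 1 / \<eta>) * (norm b)\<^sup>2"
proof -
  have "0 \<le> (norm (sqrt \<eta> *\<^sub>R a - (1 / sqrt \<eta>) *\<^sub>R b))\<^sup>2" by simp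
  also have "\<dots> = \<eta> * (norm a)\<^sup>2 + 1 / \<eta> * (norm b)\<^sup>2 - 2 * inner a b"
    using assms by (simp add: power2_norm_eq_inner inner_diff_left inner_diff_right inner_commute
        field_simps)
  finally show ?thesis
    by (simp add: power2_norm_eq_inner inner_add_left inner_add_right inner_commute algebra_simps)
qed

lemma norm_add_sq: "(norm (a + b))\<^sup>2 \<le> 2 * (norm a)\<^sup>2 + 2 * (norm (b::'a::real_inner))\<^sup>2"
  using norm_add_sq_young[of 1 a b] by simp

lemma norm_diff_sq: "(norm (a - b))\<^sup>2 \<le> 2 * (norm a)\<^sup>2 + 2 * (norm (b::'a::real_inner))\<^sup>2"
  using norm_add_sq[of a "- b"] by simp

lemma norm_add_sq_54: "(norm (a + b))\<^sup>2 \<le> 5/4 * (norm a)\<^sup>2 + 5 * (norm (b::'a::real_inner))\<^sup>2"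
  using norm_add_sq_young[of "1/4" a b] by simp

section \<open>Gradients on a coordinate subspace\<close>

definition has_gradient :: "nat \<Rightarrow> (rvec \<Rightarrow> real) \<Rightarrow> rvec \<Rightarrow> rvec \<Rightarrow> bool" where
  "has_gradient d \<phi> g x \<longleftrightarrow>
     g \<in> euclid d \<and> (\<phi> has_derivative (\<lambda>h. g \<bullet> h)) (at x within euclid d)"

lemma has_derivative_along_line:
  assumes "x \<in> euclid d" "h \<in> euclid d"
    and "(\<phi> has_derivative f') (at (x + s *\<^sub>R h) within euclid d)"
  shows "((\<lambda>s. \<phi> (x + s *\<^sub>R h)) has_real_derivative f' h) (at s)"
proof -
  have "((\<lambda>s. x + s *\<^sub>R h) has_derivative (\<lambda>r. r *\<^sub>R h)) (at s)"
    by (auto intro!: derivative_eq_intros)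
  moreover have "(\<lambda>s. x + s *\<^sub>R h) ` UNIV \<subseteq> euclid d"
    using assms by auto
  ultimately have "((\<lambda>s. \<phi> (x + s *\<^sub>R h)) has_derivative (\<lambda>r. f' (r *\<^sub>R h))) (at s)"
    using has_derivative_in_compose[of "\<lambda>s. x + s *\<^sub>R h" "\<lambda>r. r *\<^sub>R h" s UNIV \<phi> f']
      has_derivative_subset[OF assms(3)] by blast
  moreover have "f' (r *\<^sub>R h) = f' h * r" for r
    using has_derivative_linear[OF assms(3)] by (simp add: linear_scale mult.commute)
  ultimately show ?thesis by (simp add: has_field_derivative_def)
qed

lemma has_gradient_unique:
  assumes "x \<in> euclid d" "has_gradient d \<phi> g x" "has_gradient d \<phi> g' x"
  shows "g = g'"
proof -
  have g: "g - g' \<in> euclid d" using assms by (auto simp: has_gradient_def)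
  have "g \<bullet> (g - g') = g' \<bullet> (g - g')"
    using has_derivative_along_line[OF assms(1) g, of \<phi> "\<lambda>h. g \<bullet> h" 0]
      has_derivative_along_line[OF assms(1) g, of \<phi> "\<lambda>h. g' \<bullet> h" 0] assms
    by (auto simp: has_gradient_def intro: DERIV_unique)
  then have "(g - g') \<bullet> (g - g') = 0" by (simp add: inner_diff_left)
  then show ?thesis by simp
qed

lemma grad_eqI: "x \<in> euclid d \<Longrightarrow> has_gradient d \<phi> g x \<Longrightarrow> grad d \<phi> x = g"
  unfolding grad_def using has_gradient_unique
  by (intro the_equality) (auto simp: has_gradient_def)

text \<open>
  A derivative relative to \<open>euclid d\<close> is determined there by its values on the unit vectors; they are
  the coordinates of the gradient.
\<close>

lemma differentiable_has_gradient:
  assumes "x \<in> euclid d" "\<phi> differentiable (at x within euclid d)"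
  shows "has_gradient d \<phi> (grad d \<phi> x) x"
proof -
  obtain f' where f': "(\<phi> has_derivative f') (at x within euclid d)"
    using assms by (auto simp: differentiable_def)
  have lin: "linear f'" by (rule has_derivative_linear[OF f'])
  define g where "g = vec_on {..<d} (\<lambda>j. f' (axis_vec j))"
  have eq: "f' h = g \<bullet> h" if "h \<in> euclid d" for h
  proof -
    have "f' h = (\<Sum>j<d. coord h j * f' (axis_vec j))"
      by (subst euclid_expand[OF that]) (simp add: linear_sum[OF lin] linear_scale[OF lin])
    also have "\<dots> = g \<bullet> h"
      by (subst inner_euclid[of g d]) (auto simp: g_def coord_vec_on mult.commute)
    finally show ?thesis .
  qed
  have "has_gradient d \<phi> g x"
    unfolding has_gradient_def
  proof
    show "(\<phi> has_derivative (\<lambda>h. g \<bullet> h)) (at x within euclid d)"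
      unfolding has_derivative_within
    proof
      show "bounded_linear (\<lambda>h. g \<bullet> h)" by (rule bounded_linear_inner_right)
      have "((\<lambda>y. (1 / norm (y - x)) *\<^sub>R (\<phi> y - (\<phi> x + f' (y - x)))) \<longlongrightarrow> 0) (at x within euclid d)"
        using f' by (simp add: has_derivative_within)
      moreover have "\<forall>\<^sub>F y in at x within euclid d.
          (1 / norm (y - x)) *\<^sub>R (\<phi> y - (\<phi> x + f' (y - x)))
          = (1 / norm (y - x)) *\<^sub>R (\<phi> y - (\<phi> x + g \<bullet> (y - x)))"
        using assms(1) by (auto simp: eventually_at_filter eq euclid_diff)
      ultimately show "((\<lambda>y. (1 / norm (y - x)) *\<^sub>R (\<phi> y - (\<phi> x + g \<bullet> (y - x)))) \<longlongrightarrow> 0)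
          (at x within euclid d)"
        by (rule Lim_transform_eventually)
    qed
  qed (simp add: g_def)
  with assms show ?thesis by (simp add: grad_eqI)
qed

lemma smooth_fun_has_gradient:
  "smooth_fun d L \<phi> \<Longrightarrow> x \<in> euclid d \<Longrightarrow> has_gradient d \<phi> (grad d \<phi> x) x"
  by (auto simp: smooth_fun_def intro: differentiable_has_gradient)

lemma grad_euclid: "smooth_fun d L \<phi> \<Longrightarrow> x \<in> euclid d \<Longrightarrow> grad d \<phi> x \<in> euclid d"
  using smooth_fun_has_gradient[of d L \<phi> x] by (simp add: has_gradient_def)

lemma smooth_fun_lipschitz:
  "smooth_fun d L \<phi> \<Longrightarrow> x \<in> euclid d \<Longrightarrow> y \<in> euclid d \<Longrightarrow>
     norm (grad d \<phi> x - grad d \<phi> y) \<le> L * norm (x - y)"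
  using lipschitz_onD[of L "euclid d" "grad d \<phi>" x y] by (simp add: smooth_fun_def dist_norm)

lemma smooth_fun_nonneg: "smooth_fun d L \<phi> \<Longrightarrow> 0 \<le> L"
  by (auto simp: smooth_fun_def intro: lipschitz_on_nonneg)

lemma smooth_fun_along_line:
  assumes "smooth_fun d L \<phi>" "x \<in> euclid d" "h \<in> euclid d"
  shows "((\<lambda>s. \<phi> (x + s *\<^sub>R h)) has_real_derivative grad d \<phi> (x + s *\<^sub>R h) \<bullet> h) (at s)"
  using assms smooth_fun_has_gradient[OF assms(1), of "x + s *\<^sub>R h"]
  by (intro has_derivative_along_line) (auto simp: has_gradient_def)

lemma grad_continuous: "smooth_fun d L \<phi> \<Longrightarrow> continuous_on (euclid d) (grad d \<phi>)"
  by (auto simp: smooth_fun_def intro: lipschitz_on_continuous_on)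

text \<open>
  Adding or subtracting the quadratic \<open>L / 2 * s\<^sup>2 * norm h ^ 2\<close> makes the remainder monotone along the
  segment, because the slope of the remainder is at most \<open>L * s * norm h ^ 2\<close> in absolute value.
\<close>

lemma smooth_fun_taylor:
  assumes \<phi>: "smooth_fun d L \<phi>" and x: "x \<in> euclid d" and h: "h \<in> euclid d"
  shows "\<bar>\<phi> (x + h) - \<phi> x - grad d \<phi> x \<bullet> h\<bar> \<le> L / 2 * (norm h)\<^sup>2"
proof -
  have L: "0 \<le> L" by (rule smooth_fun_nonneg[OF \<phi>])
  have key: "\<bar>grad d \<phi> (x + s *\<^sub>R h) \<bullet> h - grad d \<phi> x \<bullet> h\<bar> \<le> L * s * (norm h)\<^sup>2" if "0 \<le> s" for s
  proof -
    have "\<bar>(grad d \<phi> (x + s *\<^sub>R h) - grad d \<phi> x) \<bullet> h\<bar>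
        \<le> norm (grad d \<phi> (x + s *\<^sub>R h) - grad d \<phi> x) * norm h"
      by (simp add: Cauchy_Schwarz_ineq2)
    also have "\<dots> \<le> (L * norm (s *\<^sub>R h)) * norm h"
      using smooth_fun_lipschitz[OF \<phi>, of "x + s *\<^sub>R h" x] x h
      by (intro mult_right_mono) auto
    finally show ?thesis using that by (simp add: inner_diff_left power2_eq_square mult.assoc)
  qed
  define up where "up = (\<lambda>s. \<phi> (x + s *\<^sub>R h) - s * (grad d \<phi> x \<bullet> h) - L / 2 * s\<^sup>2 * (norm h)\<^sup>2)"
  define lo where "lo = (\<lambda>s. \<phi> (x + s *\<^sub>R h) - s * (grad d \<phi> x \<bullet> h) + L / 2 * s\<^sup>2 * (norm h)\<^sup>2)"
  note [derivative_intros] = smooth_fun_along_line[OF \<phi> x h]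
  have "up 1 \<le> up 0"
  proof (rule DERIV_nonpos_imp_nonincreasing[of 0 1 up])
    fix s :: real assume s: "0 \<le> s" "s \<le> 1"
    have "(up has_real_derivative
        grad d \<phi> (x + s *\<^sub>R h) \<bullet> h - grad d \<phi> x \<bullet> h - L * s * (norm h)\<^sup>2) (at s)"
      unfolding up_def by (auto intro!: derivative_eq_intros)
    with key[OF s(1)] show "\<exists>y. (up has_real_derivative y) (at s) \<and> y \<le> 0" by force
  qed simp
  moreover have "lo 0 \<le> lo 1"
  proof (rule DERIV_nonneg_imp_nondecreasing[of 0 1 lo])
    fix s :: real assume s: "0 \<le> s" "s \<le> 1"
    have "(lo has_real_derivative
        grad d \<phi> (x + s *\<^sub>R h) \<bullet> h - grad d \<phi> x \<bullet> h + L * s * (norm h)\<^sup>2) (at s)"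
      unfolding lo_def by (auto intro!: derivative_eq_intros)
    with key[OF s(1)] show "\<exists>y. (lo has_real_derivative y) (at s) \<and> 0 \<le> y" by force
  qed simp
  ultimately have "\<phi> (x + h) - grad d \<phi> x \<bullet> h - L / 2 * (norm h)\<^sup>2 \<le> \<phi> x"
    "\<phi> x \<le> \<phi> (x + h) - grad d \<phi> x \<bullet> h + L / 2 * (norm h)\<^sup>2"
    by (simp_all add: up_def lo_def)
  then show ?thesis by linarith
qed

definition central_diff :: "real \<Rightarrow> (rvec \<Rightarrow> real) \<Rightarrow> rvec \<Rightarrow> rvec \<Rightarrow> real" where
  "central_diff t \<phi> x u = (\<phi> (x + t *\<^sub>R u) - \<phi> (x - t *\<^sub>R u)) / (2 * t)"

text \<open>
  The two Taylor remainders have size \<open>L / 2 * t\<^sup>2\<close> each, and the difference is divided by \<open>2 * t\<close>.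
\<close>

lemma central_diff_approx:
  assumes \<phi>: "smooth_fun d L \<phi>" and x: "x \<in> euclid d" and u: "u \<in> unit_sphere d" and t: "t > 0"
  shows "\<bar>central_diff t \<phi> x u - grad d \<phi> x \<bullet> u\<bar> \<le> L * t / 2"
proof -
  have u': "u \<in> euclid d" "norm u = 1" using u by (auto simp: unit_sphere_def)
  have "\<bar>\<phi> (x + t *\<^sub>R u) - \<phi> x - t * (grad d \<phi> x \<bullet> u)\<bar> \<le> L / 2 * t\<^sup>2"
    using smooth_fun_taylor[OF \<phi> x, of "t *\<^sub>R u"] u' by auto
  moreover have "\<bar>\<phi> (x - t *\<^sub>R u) - \<phi> x + t * (grad d \<phi> x \<bullet> u)\<bar> \<le> L / 2 * t\<^sup>2"
    using smooth_fun_taylor[OF \<phi> x, of "(- t) *\<^sub>R u"] u' euclid_scaleR[of u d "- t"] by simp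
  ultimately have "\<bar>\<phi> (x + t *\<^sub>R u) - \<phi> (x - t *\<^sub>R u) - 2 * t * (grad d \<phi> x \<bullet> u)\<bar> \<le> L * t\<^sup>2"
    by linarith
  moreover have "central_diff t \<phi> x u - grad d \<phi> x \<bullet> u
      = (\<phi> (x + t *\<^sub>R u) - \<phi> (x - t *\<^sub>R u) - 2 * t * (grad d \<phi> x \<bullet> u)) / (2 * t)"
    using t by (simp add: central_diff_def field_simps)
  ultimately have "\<bar>central_diff t \<phi> x u - grad d \<phi> x \<bullet> u\<bar> \<le> (L * t\<^sup>2) / (2 * t)"
    using t by (simp add: abs_divide divide_right_mono)
  then show ?thesis using t by (simp add: power2_eq_square)
qed

text \<open>
  The radius enters only through the direction \<open>u\<close> scaled by it: comparing the two difference
  quotients along the common parameter \<open>\<tau>\<close>, with arguments \<open>\<tau> t\<close> and \<open>\<tau> s\<close>, avoids differentiating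
  a quotient.
\<close>

lemma central_diff_radius:
  assumes \<phi>: "smooth_fun d L \<phi>" and x: "x \<in> euclid d" and u: "u \<in> unit_sphere d"
    and ts: "t > 0" "s > 0"
  shows "\<bar>central_diff t \<phi> x u - central_diff s \<phi> x u\<bar> \<le> L * \<bar>t - s\<bar>"
proof -
  have L: "0 \<le> L" by (rule smooth_fun_nonneg[OF \<phi>])
  have u': "u \<in> euclid d" "norm u = 1" using u by (auto simp: unit_sphere_def)
  define \<psi> where "\<psi> r \<tau> = \<phi> (x + \<tau> *\<^sub>R (r *\<^sub>R u))" for r \<tau>
  define g where "g r \<tau> = grad d \<phi> (x + \<tau> *\<^sub>R (r *\<^sub>R u)) \<bullet> u" for r \<tau>
  have der [derivative_intros]: "(\<psi> r has_real_derivative r * g r \<tau>) (at \<tau>)" for r \<tau>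
    using smooth_fun_along_line[OF \<phi> x, of "r *\<^sub>R u" \<tau>] u'
    by (auto simp: \<psi>_def[abs_def] g_def)
  define D where "D \<tau> = (\<psi> t \<tau> - \<psi> (-t) \<tau>) / (2 * t) - (\<psi> s \<tau> - \<psi> (-s) \<tau>) / (2 * s)" for \<tau>
  have D: "(D has_real_derivative (g t \<tau> + g (-t) \<tau>) / 2 - (g s \<tau> + g (-s) \<tau>) / 2) (at \<tau>)" for \<tau>
    unfolding D_def[abs_def] using ts
    by (auto intro!: derivative_eq_intros simp: field_simps)
  have gdiff: "\<bar>g a \<tau> - g b \<tau>\<bar> \<le> L * \<bar>a - b\<bar>" if "0 \<le> \<tau>" "\<tau> \<le> 1" for a b \<tau>
  proof -
    have "\<bar>g a \<tau> - g b \<tau>\<bar> \<le> norm (grad d \<phi> (x + \<tau> *\<^sub>R (a *\<^sub>R u)) - grad d \<phi> (x + \<tau> *\<^sub>R (b *\<^sub>R u)))"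
      using Cauchy_Schwarz_ineq2[of "grad d \<phi> (x + \<tau> *\<^sub>R (a *\<^sub>R u)) - grad d \<phi> (x + \<tau> *\<^sub>R (b *\<^sub>R u))" u]
      by (simp add: g_def inner_diff_left u')
    also have "\<dots> \<le> L * norm (\<tau> *\<^sub>R (a *\<^sub>R u) - \<tau> *\<^sub>R (b *\<^sub>R u))"
      using smooth_fun_lipschitz[OF \<phi>, of "x + \<tau> *\<^sub>R (a *\<^sub>R u)" "x + \<tau> *\<^sub>R (b *\<^sub>R u)"] x u'
      by (simp add: euclid_add euclid_scaleR)
    also have "\<tau> *\<^sub>R (a *\<^sub>R u) - \<tau> *\<^sub>R (b *\<^sub>R u) = (\<tau> * (a - b)) *\<^sub>R u"
      by (simp add: algebra_simps)
    also have "L * norm \<dots> \<le> L * \<bar>a - b\<bar>"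
      using that L u' by (intro mult_left_mono) (auto simp: abs_mult mult_left_le_one_le)
    finally show ?thesis .
  qed
  obtain z where z: "0 < z" "z < 1"
      "D 1 - D 0 = (1 - 0) * ((g t z + g (-t) z) / 2 - (g s z + g (-s) z) / 2)"
    using MVT2[of 0 1 D "\<lambda>\<tau>. (g t \<tau> + g (-t) \<tau>) / 2 - (g s \<tau> + g (-s) \<tau>) / 2"] D by auto
  have "\<bar>D 1 - D 0\<bar> \<le> L * \<bar>t - s\<bar>"
  proof -
    have "\<bar>g t z - g s z\<bar> \<le> L * \<bar>t - s\<bar>" "\<bar>g (-t) z - g (-s) z\<bar> \<le> L * \<bar>t - s\<bar>"
      using z gdiff[of z t s] gdiff[of z "-t" "-s"] by (auto simp: abs_minus_commute)
    moreover have "D 1 - D 0 = ((g t z - g s z) + (g (-t) z - g (-s) z)) / 2"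
      using z(3) by (simp add: field_simps)
    ultimately show ?thesis by (simp add: abs_if split: if_splits)
  qed
  moreover have "D 0 = 0" by (simp add: D_def \<psi>_def)
  moreover have "D 1 = central_diff t \<phi> x u - central_diff s \<phi> x u"
    by (simp add: D_def \<psi>_def central_diff_def)
  ultimately show ?thesis by simp
qed

section \<open>Second moments of the uniform law on the sphere\<close>

lemma sets_unif_sphere [simp, measurable_cong]: "sets (unif_sphere d) = sets borel"
  and space_unif_sphere [simp]: "space (unif_sphere d) = UNIV"
  by (simp_all add: unif_sphere_def)

abbreviation lebesgue_coords :: "nat \<Rightarrow> (nat \<Rightarrow> real) measure" where
  "lebesgue_coords d \<equiv> (\<Pi>\<^sub>M j\<in>{..<d}. lborel)"

abbreviation coord_ball :: "nat \<Rightarrow> (nat \<Rightarrow> real) set" where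
  "coord_ball d \<equiv> {c \<in> space (lebesgue_coords d). L2_set c {..<d} \<le> 1}"

lemma coord_ball_sets [measurable]: "coord_ball d \<in> sets (lebesgue_coords d)"
  unfolding L2_set_def by measurable

lemma emeasure_coord_ball: "emeasure (lebesgue_coords d) (coord_ball d) = ennreal (unit_ball_vol (real d))"
proof -
  have "coord_ball d = {f. sqrt (\<Sum>i\<in>{..<d}. (f i)\<^sup>2) \<le> 1} \<inter> space (lebesgue_coords d)"
    by (auto simp: L2_set_def)
  then show ?thesis
    using emeasure_cball_aux[of "{..<d}" 1] by simp
qed

definition quarter_turn :: "nat \<Rightarrow> nat \<Rightarrow> (nat \<Rightarrow> real) \<Rightarrow> nat \<Rightarrow> real" where
  "quarter_turn a b c = c(a := c b, b := - c a)"

lemma quarter_turn_measurable [measurable]: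
  assumes "a < d" "b < d"
  shows "quarter_turn a b \<in> measurable (lebesgue_coords d) (lebesgue_coords d)"
proof (rule measurable_PiM_single'[where f = "\<lambda>j c. quarter_turn a b c j"])
  show "(\<lambda>c. quarter_turn a b c j) \<in> measurable (lebesgue_coords d) lborel" if "j \<in> {..<d}" for j
    using assms that unfolding quarter_turn_def fun_upd_def
    by (cases "j = b"; cases "j = a") simp_all
  show "(\<lambda>c j. quarter_turn a b c j) \<in> space (lebesgue_coords d) \<rightarrow> (\<Pi>\<^sub>E j\<in>{..<d}. space lborel)"
    using assms by (auto simp: quarter_turn_def space_PiM PiE_def extensional_def)
qed

lemma L2_set_quarter_turn:
  assumes "a < d" "b < d" "a \<noteq> b"
  shows "L2_set (quarter_turn a b c) {..<d} = L2_set c {..<d}"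
proof -
  have I: "{..<d} = insert a (insert b ({..<d} - {a, b}))" using assms by auto
  show ?thesis
    unfolding L2_set_def
    by (subst (1 2) I) (use assms in \<open>simp add: quarter_turn_def\<close>)
qed

text \<open>
  A box is turned into the box with the two sides exchanged and one of them reflected, and Lebesgue
  measure on the line is invariant under reflection.
\<close>

lemma distr_quarter_turn:
  assumes ab: "a < d" "b < d" "a \<noteq> b"
  shows "distr (lebesgue_coords d) (lebesgue_coords d) (quarter_turn a b) = lebesgue_coords d"
proof -
  interpret product_sigma_finite "\<lambda>_. lborel :: real measure" ..
  note [measurable] = quarter_turn_measurable[OF ab(1,2)]
  show ?thesis
  proof (rule PiM_eqI)
    fix A :: "nat \<Rightarrow> real set" assume A: "\<And>j. j \<in> {..<d} \<Longrightarrow> A j \<in> sets lborel"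
    define A' where "A' = A(a := uminus -` A b, b := A a)"
    have mb: "uminus -` X \<in> sets lborel" if "X \<in> sets lborel" for X :: "real set"
      using that measurable_sets[of uminus borel borel X] by simp
    have A': "A' j \<in> sets lborel" if "j < d" for j
      using A ab mb that by (auto simp: A'_def)
    have box: "quarter_turn a b -` Pi\<^sub>E {..<d} A \<inter> space (lebesgue_coords d) = Pi\<^sub>E {..<d} A'"
    proof (intro set_eqI iffI)
      fix c assume "c \<in> quarter_turn a b -` Pi\<^sub>E {..<d} A \<inter> space (lebesgue_coords d)"
      then have c: "\<And>j. j < d \<Longrightarrow> quarter_turn a b c j \<in> A j" "c \<in> extensional {..<d}"
        by (auto simp: space_PiM PiE_def)
      show "c \<in> Pi\<^sub>E {..<d} A'"
      proof (rule PiE_I)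
        fix j assume "j \<in> {..<d}"
        then show "c j \<in> A' j"
          using c(1)[of j] c(1)[OF ab(1)] c(1)[OF ab(2)] ab
          by (auto simp: A'_def quarter_turn_def)
      qed (use c(2) in \<open>auto simp: extensional_def\<close>)
    next
      fix c assume c: "c \<in> Pi\<^sub>E {..<d} A'"
      then have c': "\<And>j. j < d \<Longrightarrow> c j \<in> A' j" by auto
      have "quarter_turn a b c j \<in> A j" if "j < d" for j
        using c'[OF that] c'[OF ab(1)] c'[OF ab(2)] ab
        by (auto simp: A'_def quarter_turn_def split: if_splits)
      then show "c \<in> quarter_turn a b -` Pi\<^sub>E {..<d} A \<inter> space (lebesgue_coords d)"
        using c ab by (auto simp: space_PiM PiE_def extensional_def quarter_turn_def)
    qed
    have refl: "emeasure lborel (uminus -` X) = emeasure lborel X"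
      if "X \<in> sets lborel" for X :: "real set"
    proof -
      have "emeasure (distr lborel borel uminus) X = emeasure lborel (uminus -` X)"
        using that by (subst emeasure_distr) auto
      then show ?thesis by (simp add: lborel_distr_uminus)
    qed
    have I: "{..<d} = insert a (insert b ({..<d} - {a, b}))" using ab by auto
    have "emeasure (distr (lebesgue_coords d) (lebesgue_coords d) (quarter_turn a b)) (Pi\<^sub>E {..<d} A)
        = emeasure (lebesgue_coords d) (Pi\<^sub>E {..<d} A')"
      using A by (subst emeasure_distr) (auto simp: box intro!: sets_PiM_I_finite)
    also have "\<dots> = (\<Prod>j<d. emeasure lborel (A' j))"
      using A' by (subst emeasure_PiM) auto
    also have "\<dots> = (\<Prod>j<d. emeasure lborel (A j))"
      by (subst (1 2) I)
        (use ab A in \<open>simp add: A'_def refl mult_ac\<close>)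
    finally show "emeasure (distr (lebesgue_coords d) (lebesgue_coords d) (quarter_turn a b)) (Pi\<^sub>E {..<d} A)
        = (\<Prod>j\<in>{..<d}. emeasure lborel (A j))" .
  qed simp_all
qed

definition unif_ball :: "nat \<Rightarrow> (nat \<Rightarrow> real) measure" where
  "unif_ball d = uniform_measure (lebesgue_coords d) (coord_ball d)"

lemma sets_unif_ball [simp, measurable_cong]: "sets (unif_ball d) = sets (lebesgue_coords d)"
  and space_unif_ball [simp]: "space (unif_ball d) = space (lebesgue_coords d)"
  by (simp_all add: unif_ball_def)

lemma unif_sphere_eq: "unif_sphere d = distr (unif_ball d) borel (\<lambda>c. sgn (vec_on {..<d} c))"
  by (simp add: unif_sphere_def unif_ball_def)

lemma sgn_vec_on_measurable_unif_ball [measurable]: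
  "(\<lambda>c. sgn (vec_on {..<d} c)) \<in> borel_measurable (unif_ball d)"
  using sgn_vec_on_measurable[of d] by (simp cong: measurable_cong_sets)

lemma distr_unif_ball_quarter_turn:
  assumes ab: "a < d" "b < d" "a \<noteq> b"
  shows "distr (unif_ball d) (unif_ball d) (quarter_turn a b) = unif_ball d"
proof (rule measure_eqI)
  note [measurable] = quarter_turn_measurable[OF ab(1,2)]
  fix X assume "X \<in> sets (distr (unif_ball d) (unif_ball d) (quarter_turn a b))"
  then have X [measurable]: "X \<in> sets (lebesgue_coords d)" by simp
  let ?P = "lebesgue_coords d"
  have T: "c \<in> space ?P \<Longrightarrow> quarter_turn a b c \<in> space ?P" for c
    using measurable_space[OF quarter_turn_measurable[OF ab(1,2)]] .
  have pre: "coord_ball d \<inter> (quarter_turn a b -` X \<inter> space ?P)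
      = quarter_turn a b -` (coord_ball d \<inter> X) \<inter> space ?P"
    using T by (auto simp: L2_set_quarter_turn[OF ab])
  have "emeasure ?P (quarter_turn a b -` (coord_ball d \<inter> X) \<inter> space ?P)
      = emeasure (distr ?P ?P (quarter_turn a b)) (coord_ball d \<inter> X)"
    by (subst emeasure_distr) auto
  also have "\<dots> = emeasure ?P (coord_ball d \<inter> X)" by (simp only: distr_quarter_turn[OF ab])
  finally have "emeasure (unif_ball d) (quarter_turn a b -` X \<inter> space ?P) = emeasure (unif_ball d) X"
    unfolding unif_ball_def by (subst (1 2) emeasure_uniform_measure) (simp_all add: pre)
  then show "emeasure (distr (unif_ball d) (unif_ball d) (quarter_turn a b)) X = emeasure (unif_ball d) X"
    by (subst emeasure_distr) (simp_all cong: measurable_cong_sets)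
qed simp

lemma coord_sgn_vec_on:
  "j < d \<Longrightarrow> coord (sgn (vec_on {..<d} c)) j = c j / L2_set c {..<d}"
  by (simp add: sgn_div_norm coord_vec_on norm_vec_on divide_inverse_commute)

lemma coord_sgn_quarter_turn:
  assumes ab: "a < d" "b < d" "a \<noteq> b"
  shows "coord (sgn (vec_on {..<d} (quarter_turn a b c))) a = coord (sgn (vec_on {..<d} c)) b"
    and "coord (sgn (vec_on {..<d} (quarter_turn a b c))) b = - coord (sgn (vec_on {..<d} c)) a"
  using ab by (simp_all add: coord_sgn_vec_on L2_set_quarter_turn) (simp_all add: quarter_turn_def)

text \<open>
  Only the origin is not mapped to the sphere by normalisation, and it is a null set as \<open>d \<ge> 1\<close>.
\<close>

lemma AE_unif_sphere:
  assumes d: "d \<ge> 1"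
  shows "AE u in unif_sphere d. u \<in> unit_sphere d"
proof -
  interpret product_sigma_finite "\<lambda>_. lborel :: real measure" ..
  let ?P = "lebesgue_coords d"
  have "emeasure ?P (\<Pi>\<^sub>E j\<in>{..<d}. {0}) = (\<Prod>j<d. emeasure lborel {0::real})"
    by (subst emeasure_PiM) auto
  also have "\<dots> = 0" using d by (auto simp: prod_zero_iff)
  finally have "emeasure ?P (\<Pi>\<^sub>E j\<in>{..<d}. {0}) = 0" .
  moreover have "(\<Pi>\<^sub>E j\<in>{..<d}. {0}) \<in> sets ?P"
    by (rule sets_PiM_I_finite) auto
  ultimately have "(\<Pi>\<^sub>E j\<in>{..<d}. {0}) \<in> null_sets ?P" by (rule null_setsI)
  then have "AE c in ?P. c \<notin> (\<Pi>\<^sub>E j\<in>{..<d}. {0})" by (rule AE_not_in)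
  then have "AE c in ?P. c \<in> coord_ball d \<longrightarrow> sgn (vec_on {..<d} c) \<in> unit_sphere d"
  proof (rule AE_mp[OF _ AE_I2], intro impI)
    fix c assume c: "c \<in> space ?P" "c \<notin> (\<Pi>\<^sub>E j\<in>{..<d}. {0})"
    have "\<exists>j<d. c j \<noteq> 0"
    proof (rule ccontr)
      assume "\<not> (\<exists>j<d. c j \<noteq> 0)"
      then have "c \<in> (\<Pi>\<^sub>E j\<in>{..<d}. {0})"
        using c(1) by (intro PiE_I) (auto simp: space_PiM PiE_def extensional_def)
      with c(2) show False by contradiction
    qed
    then obtain j where j: "j < d" "c j \<noteq> 0" by blast
    then have "coord (vec_on {..<d} c) j \<noteq> coord 0 j" by (simp add: coord_vec_on)
    then have "vec_on {..<d} c \<noteq> 0" by metis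
    then show "sgn (vec_on {..<d} c) \<in> unit_sphere d"
      by (simp add: unit_sphere_def norm_sgn) (simp add: sgn_div_norm euclid_scaleR)
  qed
  moreover have "emeasure ?P (coord_ball d) \<noteq> 0" "emeasure ?P (coord_ball d) \<noteq> \<infinity>"
    unfolding emeasure_coord_ball using unit_ball_vol_pos[OF of_nat_0_le_iff, of d]
    by (metis ennreal_less_zero_iff less_irrefl) simp
  ultimately have "AE c in unif_ball d. sgn (vec_on {..<d} c) \<in> unit_sphere d"
    unfolding unif_ball_def by (subst AE_uniform_measure) (auto simp: top.not_eq_extremum)
  then show ?thesis
    unfolding unif_sphere_eq by (subst AE_distr_iff) auto
qed

definition sphere_moment :: "nat \<Rightarrow> nat \<Rightarrow> nat \<Rightarrow> real" where
  "sphere_moment d a b = (\<integral>u. coord u a * coord u b \<partial>unif_sphere d)"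

lemma integrable_coord_mult_coord:
  assumes d: "d \<ge> 1"
  shows "integrable (unif_sphere d) (\<lambda>u. coord u a * coord u b)"
proof -
  interpret prob_space "unif_sphere d" by (rule prob_space_unif_sphere[OF d])
  show ?thesis
  proof (rule integrable_const_bound[where B = 1])
    show "AE u in unif_sphere d. norm (coord u a * coord u b) \<le> 1"
      using AE_unif_sphere[OF d]
    proof eventually_elim
      fix u assume "u \<in> unit_sphere d"
      then have "norm u = 1" by (simp add: unit_sphere_def)
      then have "\<bar>coord u a\<bar> \<le> 1" "\<bar>coord u b\<bar> \<le> 1"
        using abs_coord_le_norm[of u] by auto
      then show "norm (coord u a * coord u b) \<le> 1"
        by (simp add: abs_mult mult_le_one)
    qed
  qed measurable
qed

text \<open>
  Invariance under the quarter turn gives both \<open>E u\<^sub>a\<^sup>2 = E u\<^sub>b\<^sup>2\<close> and \<open>E u\<^sub>a u\<^sub>b = - E u\<^sub>a u\<^sub>b\<close>; the common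
  value of the diagonal moments follows from \<open>norm u = 1\<close>.
\<close>

lemma sphere_moment_turn:
  assumes ab: "a < d" "b < d" "a \<noteq> b"
  shows "sphere_moment d a a = sphere_moment d b b" and "sphere_moment d a b = 0"
proof -
  have T [measurable]: "quarter_turn a b \<in> measurable (unif_ball d) (unif_ball d)"
    using quarter_turn_measurable[OF ab(1,2)] by (simp cong: measurable_cong_sets)
  define s where "s c = sgn (vec_on {..<d} c)" for c
  have [measurable]: "s \<in> borel_measurable (unif_ball d)"
    unfolding s_def[abs_def] by simp
  have mom: "sphere_moment d i j = (\<integral>c. coord (s c) i * coord (s c) j \<partial>unif_ball d)" for i j
    unfolding sphere_moment_def unif_sphere_eq s_def by (subst integral_distr) auto
  have mom': "sphere_moment d i j
      = (\<integral>c. coord (s (quarter_turn a b c)) i * coord (s (quarter_turn a b c)) j \<partial>unif_ball d)" for i j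
    unfolding mom by (subst (1) distr_unif_ball_quarter_turn[OF ab, symmetric], subst integral_distr) auto
  note turn = coord_sgn_quarter_turn[OF ab, folded s_def]
  show "sphere_moment d a a = sphere_moment d b b"
    using mom'[of a a] mom[of b b] by (simp add: turn)
  have "sphere_moment d a b = - sphere_moment d b a"
    using mom'[of a b] mom[of b a] by (simp add: turn)
  then show "sphere_moment d a b = 0"
    by (simp add: sphere_moment_def mult.commute)
qed

lemma sphere_moment_eq:
  assumes "a < d" "b < d"
  shows "sphere_moment d a b = (if a = b then 1 / real d else 0)"
proof -
  have d: "d \<ge> 1" using assms by simp
  interpret prob_space "unif_sphere d" by (rule prob_space_unif_sphere[OF d])
  have "(\<Sum>j<d. sphere_moment d j j) = (\<integral>u. (\<Sum>j<d. coord u j * coord u j) \<partial>unif_sphere d)"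
    unfolding sphere_moment_def
    by (rule Bochner_Integration.integral_sum[symmetric]) (rule integrable_coord_mult_coord[OF d])
  also have "\<dots> = (\<integral>u. 1 \<partial>unif_sphere d)"
  proof (rule integral_cong_AE)
    show "AE u in unif_sphere d. (\<Sum>j<d. coord u j * coord u j) = 1"
      using AE_unif_sphere[OF d]
    proof eventually_elim
      fix u assume "u \<in> unit_sphere d"
      then show "(\<Sum>j<d. coord u j * coord u j) = 1"
        using norm_euclid[of u d] by (auto simp: unit_sphere_def power2_eq_square)
    qed
  qed measurable
  also have "\<dots> = 1" using prob_space by simp
  finally have sum1: "(\<Sum>j<d. sphere_moment d j j) = 1" .
  have "(\<Sum>j<d. sphere_moment d j j) = (\<Sum>j<d. sphere_moment d a a)"
    using assms sphere_moment_turn(1)[of _ d a] by (intro sum.cong) (metis lessThan_iff)+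
  with sum1 have "sphere_moment d a a = 1 / real d" using d by (simp add: field_simps)
  then show ?thesis using assms sphere_moment_turn(2)[of a d b] by auto
qed

text \<open>
  The second moment matrix of the direction is \<open>1 / d\<close> times the identity; this makes the estimator of
  a linear function unbiased and determines its variance.
\<close>

lemma sphere_inner_mult:
  assumes d: "d \<ge> 1" and g: "g \<in> euclid d" and v: "v \<in> euclid d"
  shows "integrable (unif_sphere d) (\<lambda>u. (g \<bullet> u) * (v \<bullet> u))"
    and "(\<integral>u. (g \<bullet> u) * (v \<bullet> u) \<partial>unif_sphere d) = (g \<bullet> v) / real d"
proof -
  have eq: "(g \<bullet> u) * (v \<bullet> u)
      = (\<Sum>a<d. \<Sum>b<d. (coord g a * coord v b) * (coord u a * coord u b))" for u
    by (simp add: inner_euclid[OF g] inner_euclid[OF v] sum_product mult_ac)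
  have int: "integrable (unif_sphere d) (\<lambda>u. (coord g a * coord v b) * (coord u a * coord u b))" for a b
    by (intro integrable_mult_right integrable_coord_mult_coord d)
  show "integrable (unif_sphere d) (\<lambda>u. (g \<bullet> u) * (v \<bullet> u))"
    unfolding eq by (intro Bochner_Integration.integrable_sum int)
  have "(\<integral>u. (g \<bullet> u) * (v \<bullet> u) \<partial>unif_sphere d)
      = (\<Sum>a<d. \<Sum>b<d. (coord g a * coord v b) * sphere_moment d a b)"
    unfolding eq sphere_moment_def
    by (simp add: Bochner_Integration.integral_sum Bochner_Integration.integrable_sum int
        integrable_coord_mult_coord[OF d])
  also have "\<dots> = (\<Sum>a<d. \<Sum>b<d. if a = b then (coord g a * coord v b) / real d else 0)"
    by (intro sum.cong) (auto simp: sphere_moment_eq)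
  also have "\<dots> = (\<Sum>a<d. coord g a * coord v a / real d)"
    by (intro sum.cong refl) (simp add: sum.delta)
  also have "\<dots> = (g \<bullet> v) / real d"
    by (simp add: inner_euclid[OF g] sum_divide_distrib)
  finally show "(\<integral>u. (g \<bullet> u) * (v \<bullet> u) \<partial>unif_sphere d) = (g \<bullet> v) / real d" .
qed

lemma nn_integral_sphere_inner:
  assumes d: "d \<ge> 1" and g: "g \<in> euclid d"
  shows "(\<integral>\<^sup>+u. ennreal ((g \<bullet> u)\<^sup>2) \<partial>unif_sphere d) = ennreal ((norm g)\<^sup>2 / real d)"
proof -
  have "(\<integral>\<^sup>+u. ennreal ((g \<bullet> u)\<^sup>2) \<partial>unif_sphere d) = ennreal (\<integral>u. (g \<bullet> u)\<^sup>2 \<partial>unif_sphere d)"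
    using sphere_inner_mult(1)[OF d g g]
    by (intro nn_integral_eq_integral) (auto simp: power2_eq_square)
  also have "(\<integral>u. (g \<bullet> u)\<^sup>2 \<partial>unif_sphere d) = (norm g)\<^sup>2 / real d"
    using sphere_inner_mult(2)[OF d g g] by (simp add: power2_eq_square power2_norm_eq_inner[unfolded power2_eq_square])
  finally show ?thesis .
qed

section \<open>Square integrable random vectors\<close>

text \<open>
  The inner product space is not complete, so expectations of random vectors are formed
  coordinate by coordinate.
\<close>

definition vec_mean :: "nat \<Rightarrow> 'a measure \<Rightarrow> ('a \<Rightarrow> rvec) \<Rightarrow> rvec" where
  "vec_mean d N h = vec_on {..<d} (\<lambda>j. \<integral>p. coord (h p) j \<partial>N)"

definition sq_integrable :: "'a measure \<Rightarrow> ('a \<Rightarrow> rvec) \<Rightarrow> bool" where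
  "sq_integrable N h \<longleftrightarrow> h \<in> borel_measurable N \<and> integrable N (\<lambda>p. (norm (h p))\<^sup>2)"

lemma sq_integrableD:
  assumes "sq_integrable N h"
  shows sq_integrable_measurable: "h \<in> borel_measurable N"
    and sq_integrable_integrable: "integrable N (\<lambda>p. (norm (h p))\<^sup>2)"
  using assms by (auto simp: sq_integrable_def)

lemma sq_integrableI_nn:
  assumes "h \<in> borel_measurable N" "(\<integral>\<^sup>+p. ennreal ((norm (h p))\<^sup>2) \<partial>N) < \<infinity>"
  shows "sq_integrable N h"
  unfolding sq_integrable_def using assms by (auto intro!: integrableI_bounded)

lemma sq_integrable_bound:
  assumes "g \<in> borel_measurable N" "integrable N B" "AE p in N. (norm (g p))\<^sup>2 \<le> B p"
  shows "sq_integrable N g"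
  unfolding sq_integrable_def
proof
  show "integrable N (\<lambda>p. (norm (g p))\<^sup>2)"
    by (rule Bochner_Integration.integrable_bound[OF assms(2)]) (use assms in auto)
qed fact

lemma sq_integrable_add:
  assumes "sq_integrable N f" "sq_integrable N g"
  shows "sq_integrable N (\<lambda>p. f p + g p)"
  using assms
  by (intro sq_integrable_bound[where B = "\<lambda>p. 2 * (norm (f p))\<^sup>2 + 2 * (norm (g p))\<^sup>2"])
    (auto simp: sq_integrable_def norm_add_sq)

lemma sq_integrable_scaleR:
  "sq_integrable N f \<Longrightarrow> sq_integrable N (\<lambda>p. c *\<^sub>R f p)"
  by (auto simp: sq_integrable_def power_mult_distrib)

lemma sq_integrable_diff:
  assumes "sq_integrable N f" "sq_integrable N g"
  shows "sq_integrable N (\<lambda>p. f p - g p)"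
  using sq_integrable_add[OF assms(1) sq_integrable_scaleR[OF assms(2), of "-1"]] by simp

lemma sq_integrable_zero [simp]: "sq_integrable N (\<lambda>_. 0)"
  by (simp add: sq_integrable_def)

lemma sq_integrable_sum:
  "(\<And>i. i \<in> I \<Longrightarrow> sq_integrable N (f i)) \<Longrightarrow> sq_integrable N (\<lambda>p. \<Sum>i\<in>I. f i p)"
  by (induction I rule: infinite_finite_induct) (auto intro: sq_integrable_add)

lemma (in finite_measure) sq_integrable_const: "sq_integrable M (\<lambda>_. c)"
  by (simp add: sq_integrable_def)

lemma sq_integrable_inner:
  assumes "sq_integrable N f" "sq_integrable N g"
  shows "integrable N (\<lambda>p. f p \<bullet> g p)"
proof (rule Bochner_Integration.integrable_bound)
  show "integrable N (\<lambda>p. (norm (f p))\<^sup>2 + (norm (g p))\<^sup>2)"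
    using assms by (auto simp: sq_integrable_def)
  show "(\<lambda>p. f p \<bullet> g p) \<in> borel_measurable N"
    using assms by (auto simp: sq_integrable_def)
  have "\<bar>f p \<bullet> g p\<bar> \<le> (norm (f p))\<^sup>2 + (norm (g p))\<^sup>2" for p
  proof -
    have "2 * (norm (f p) * norm (g p)) \<le> (norm (f p))\<^sup>2 + (norm (g p))\<^sup>2"
      using sum_squares_bound[of "norm (f p)" "norm (g p)"] by simp
    moreover have "0 \<le> norm (f p) * norm (g p)" by simp
    ultimately show ?thesis using Cauchy_Schwarz_ineq2[of "f p" "g p"] by linarith
  qed
  then show "AE p in N. norm (f p \<bullet> g p) \<le> norm ((norm (f p))\<^sup>2 + (norm (g p))\<^sup>2)" by auto
qed

lemma vec_mean_euclid [simp, intro]: "vec_mean d N h \<in> euclid d"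
  by (simp add: vec_mean_def)

context prob_space
begin

lemma sq_integrable_coord:
  assumes "sq_integrable M h"
  shows "integrable M (\<lambda>p. coord (h p) j)"
  using sq_integrable_inner[OF sq_integrable_const[of "axis_vec j"] assms] by (simp add: inner_axis_vec)

lemma inner_vec_mean:
  assumes h: "sq_integrable M h" and v: "v \<in> euclid d"
  shows "(\<integral>p. v \<bullet> h p \<partial>M) = v \<bullet> vec_mean d M h"
proof -
  have "(\<integral>p. v \<bullet> h p \<partial>M) = (\<integral>p. (\<Sum>j<d. coord v j * coord (h p) j) \<partial>M)"
    by (simp add: inner_euclid[OF v])
  also have "\<dots> = (\<Sum>j<d. coord v j * (\<integral>p. coord (h p) j \<partial>M))"
    by (simp add: Bochner_Integration.integral_sum sq_integrable_coord[OF h])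
  also have "\<dots> = v \<bullet> vec_mean d M h"
    by (simp add: inner_euclid[OF v] vec_mean_def coord_vec_on)
  finally show ?thesis .
qed

lemma inner_vec_mean_centred:
  assumes h: "sq_integrable M h" and v: "v \<in> euclid d"
  shows "(\<integral>p. v \<bullet> (h p - vec_mean d M h) \<partial>M) = 0"
  using inner_vec_mean[OF h v] sq_integrable_inner[OF sq_integrable_const[of v] h]
  by (simp add: inner_diff_right prob_space)

lemma vec_mean_variance:
  assumes h: "sq_integrable M h"
  shows "(\<integral>p. (norm (h p - vec_mean d M h))\<^sup>2 \<partial>M)
      = (\<integral>p. (norm (h p))\<^sup>2 \<partial>M) - (norm (vec_mean d M h))\<^sup>2"
proof -
  let ?m = "vec_mean d M h"
  have "(\<integral>p. (norm (h p - ?m))\<^sup>2 \<partial>M) = (\<integral>p. (norm (h p))\<^sup>2 - 2 * (?m \<bullet> h p) + (norm ?m)\<^sup>2 \<partial>M)"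
    by (simp add: power2_norm_eq_inner inner_diff_left inner_diff_right inner_commute algebra_simps)
  also have "\<dots> = (\<integral>p. (norm (h p))\<^sup>2 \<partial>M) - 2 * (?m \<bullet> ?m) + (norm ?m)\<^sup>2"
    using sq_integrable_integrable[OF h] sq_integrable_inner[OF sq_integrable_const[of ?m] h]
    by (simp add: inner_vec_mean[OF h] prob_space)
  finally show ?thesis by (simp add: power2_norm_eq_inner)
qed

lemma vec_mean_variance_le:
  "sq_integrable M h \<Longrightarrow> (\<integral>p. (norm (h p - vec_mean d M h))\<^sup>2 \<partial>M) \<le> (\<integral>p. (norm (h p))\<^sup>2 \<partial>M)"
  by (simp add: vec_mean_variance)

lemma norm_vec_mean_sq_le:
  "sq_integrable M h \<Longrightarrow> (norm (vec_mean d M h))\<^sup>2 \<le> (\<integral>p. (norm (h p))\<^sup>2 \<partial>M)"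
  using vec_mean_variance[of h d] Bochner_Integration.integral_nonneg[of M "\<lambda>p. (norm (h p - vec_mean d M h))\<^sup>2"]
  by simp

lemma vec_mean_scaleR: "vec_mean d M (\<lambda>p. c *\<^sub>R f p) = c *\<^sub>R vec_mean d M f"
  by (rule rvec_eqI) (simp add: vec_mean_def coord_vec_on)

lemma vec_mean_diff:
  assumes "sq_integrable M f" "sq_integrable M g"
  shows "vec_mean d M (\<lambda>p. f p - g p) = vec_mean d M f - vec_mean d M g"
  by (rule rvec_eqI) (simp add: vec_mean_def coord_vec_on sq_integrable_coord assms)

lemma norm_vec_mean_le:
  assumes h: "sq_integrable M h" and c: "0 \<le> c" "AE p in M. norm (h p) \<le> c"
  shows "norm (vec_mean d M h) \<le> c"
proof (rule norm_le_of_inner_le[OF _ _ c(1)])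
  fix v assume v: "v \<in> euclid d"
  have "v \<bullet> vec_mean d M h = (\<integral>p. v \<bullet> h p \<partial>M)" by (simp add: inner_vec_mean[OF h v])
  also have "\<dots> \<le> (\<integral>p. c * norm v \<partial>M)"
  proof (rule integral_mono_AE)
    show "integrable M (\<lambda>p. v \<bullet> h p)" by (rule sq_integrable_inner[OF sq_integrable_const h])
    show "AE p in M. v \<bullet> h p \<le> c * norm v" using c(2)
    proof eventually_elim
      fix p assume "norm (h p) \<le> c"
      then have "norm v * norm (h p) \<le> c * norm v"
        using mult_left_mono[of "norm (h p)" c "norm v"] by (simp add: mult.commute)
      then show "v \<bullet> h p \<le> c * norm v" using norm_cauchy_schwarz[of v "h p"] by linarith
    qed
  qed simp
  finally show "v \<bullet> vec_mean d M h \<le> c * norm v" by (simp add: prob_space)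
qed simp

end

lemma expectation_norm_add_orthogonal:
  assumes "finite I" "sq_integrable N V" "\<And>i. i \<in> I \<Longrightarrow> sq_integrable N (\<nu> i)"
    and "\<And>i. i \<in> I \<Longrightarrow> (\<integral>p. V p \<bullet> \<nu> i p \<partial>N) = 0"
    and "\<And>i j. i \<in> I \<Longrightarrow> j \<in> I \<Longrightarrow> i \<noteq> j \<Longrightarrow> (\<integral>p. \<nu> i p \<bullet> \<nu> j p \<partial>N) = 0"
  shows "(\<integral>p. (norm (V p + (\<Sum>i\<in>I. \<nu> i p)))\<^sup>2 \<partial>N)
      = (\<integral>p. (norm (V p))\<^sup>2 \<partial>N) + (\<Sum>i\<in>I. \<integral>p. (norm (\<nu> i p))\<^sup>2 \<partial>N)"
  using assms
proof (induction I rule: finite_induct)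
  case empty
  then show ?case by simp
next
  case (insert a I)
  let ?S = "\<lambda>p. V p + (\<Sum>i\<in>I. \<nu> i p)"
  have S: "sq_integrable N ?S"
    using insert.prems by (auto intro!: sq_integrable_add sq_integrable_sum)
  have a: "sq_integrable N (\<nu> a)" using insert.prems by auto
  have "(\<integral>p. ?S p \<bullet> \<nu> a p \<partial>N) = (\<integral>p. V p \<bullet> \<nu> a p + (\<Sum>i\<in>I. \<nu> i p \<bullet> \<nu> a p) \<partial>N)"
    by (simp add: inner_add_left inner_sum_left)
  also have "\<dots> = (\<integral>p. V p \<bullet> \<nu> a p \<partial>N) + (\<Sum>i\<in>I. \<integral>p. \<nu> i p \<bullet> \<nu> a p \<partial>N)"
    using insert.prems
    by (simp add: Bochner_Integration.integral_sum sq_integrable_inner Bochner_Integration.integrable_sum)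
  also have "\<dots> = 0"
    using insert by (auto intro!: sum.neutral)
  finally have orth: "(\<integral>p. ?S p \<bullet> \<nu> a p \<partial>N) = 0" .
  have "(\<integral>p. (norm (V p + (\<Sum>i\<in>insert a I. \<nu> i p)))\<^sup>2 \<partial>N)
      = (\<integral>p. (norm (?S p))\<^sup>2 + 2 * (?S p \<bullet> \<nu> a p) + (norm (\<nu> a p))\<^sup>2 \<partial>N)"
    using insert.hyps
    by (intro Bochner_Integration.integral_cong refl)
      (simp add: power2_norm_eq_inner inner_add_left inner_add_right inner_commute algebra_simps)
  also have "\<dots> = (\<integral>p. (norm (?S p))\<^sup>2 \<partial>N) + (\<integral>p. (norm (\<nu> a p))\<^sup>2 \<partial>N)"
    using S a orth sq_integrable_inner[OF S a] by (simp add: sq_integrable_integrable)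
  also have "(\<integral>p. (norm (?S p))\<^sup>2 \<partial>N)
      = (\<integral>p. (norm (V p))\<^sup>2 \<partial>N) + (\<Sum>i\<in>I. \<integral>p. (norm (\<nu> i p))\<^sup>2 \<partial>N)"
    using insert.prems by (intro insert.IH) auto
  finally show ?case using insert.hyps by simp
qed

section \<open>The zeroth-order estimator at a fixed point\<close>

lemma AE_pair_fst:
  assumes "prob_space A" "prob_space B" "AE x in A. P x"
  shows "AE p in A \<Otimes>\<^sub>M B. P (fst p)"
proof -
  interpret A: prob_space A by fact
  interpret B: prob_space B by fact
  interpret pair_prob_space A B ..
  obtain N where N: "{x \<in> space A. \<not> P x} \<subseteq> N" "N \<in> sets A" "emeasure A N = 0"
    using AE_E[OF assms(3)] by metis
  show ?thesis
  proof (rule AE_I)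
    show "{p \<in> space (A \<Otimes>\<^sub>M B). \<not> P (fst p)} \<subseteq> N \<times> space B"
      using N(1) by (auto simp: space_pair_measure)
    show "emeasure (A \<Otimes>\<^sub>M B) (N \<times> space B) = 0"
      using N by (simp add: B.emeasure_pair_measure_Times)
    show "N \<times> space B \<in> sets (A \<Otimes>\<^sub>M B)" using N by auto
  qed
qed

lemma AE_pair_snd:
  assumes "prob_space A" "prob_space B" "AE x in B. P x"
  shows "AE p in A \<Otimes>\<^sub>M B. P (snd p)"
proof -
  interpret A: prob_space A by fact
  interpret B: prob_space B by fact
  interpret pair_prob_space A B ..
  obtain N where N: "{x \<in> space B. \<not> P x} \<subseteq> N" "N \<in> sets B" "emeasure B N = 0"
    using AE_E[OF assms(3)] by metis
  show ?thesis
  proof (rule AE_I)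
    show "{p \<in> space (A \<Otimes>\<^sub>M B). \<not> P (snd p)} \<subseteq> space A \<times> N"
      using N(1) by (auto simp: space_pair_measure)
    show "emeasure (A \<Otimes>\<^sub>M B) (space A \<times> N) = 0"
      using N by (simp add: B.emeasure_pair_measure_Times)
    show "space A \<times> N \<in> sets (A \<Otimes>\<^sub>M B)" using N by auto
  qed
qed

lemma rvec_eq_of_inner_eq:
  assumes "g \<in> euclid d" "h \<in> euclid d" "\<And>v. v \<in> euclid d \<Longrightarrow> v \<bullet> g = v \<bullet> h"
  shows "g = h"
proof -
  have "(g - h) \<bullet> (g - h) = 0"
    using assms(3)[OF euclid_diff[OF assms(1,2)]] by (simp add: inner_diff_right)
  then show ?thesis by simp
qed

context decentralized_problem
begin

definition law :: "nat \<Rightarrow> (rvec \<times> 'x) measure" where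
  "law i = unif_sphere d \<Otimes>\<^sub>M \<Xi> i"

lemma sets_law [simp, measurable_cong]: "sets (law i) = sets (borel \<Otimes>\<^sub>M \<Xi> i)"
  unfolding law_def by (rule sets_pair_measure_cong) simp_all

lemma prob_space_law: "i \<in> {1..n} \<Longrightarrow> prob_space (law i)"
  unfolding law_def using prob_space_unif_sphere[OF d_pos] prob[of i]
  by (intro prob_space_pair) auto

definition lgrad :: "nat \<Rightarrow> rvec \<Rightarrow> rvec" where
  "lgrad i x = grad d (local_obj \<Xi> F i) x"

definition ggrad :: "rvec \<Rightarrow> rvec" where
  "ggrad x = grad d (global_obj n \<Xi> F) x"

lemma lgrad_euclid [intro]: "i \<in> {1..n} \<Longrightarrow> x \<in> euclid d \<Longrightarrow> lgrad i x \<in> euclid d"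
  unfolding lgrad_def by (rule grad_euclid[OF local_smooth])

lemma lgrad_lipschitz:
  "i \<in> {1..n} \<Longrightarrow> x \<in> euclid d \<Longrightarrow> y \<in> euclid d \<Longrightarrow> norm (lgrad i x - lgrad i y) \<le> L * norm (x - y)"
  unfolding lgrad_def by (rule smooth_fun_lipschitz[OF local_smooth])

lemma ggrad_has_gradient:
  assumes x: "x \<in> euclid d"
  shows "has_gradient d (global_obj n \<Xi> F) ((1 / real n) *\<^sub>R (\<Sum>i=1..n. lgrad i x)) x"
  unfolding has_gradient_def
proof
  show "(1 / real n) *\<^sub>R (\<Sum>i=1..n. lgrad i x) \<in> euclid d"
    using x by (intro euclid_scaleR euclid_sum) auto
  have der: "(local_obj \<Xi> F i has_derivative (\<lambda>h. lgrad i x \<bullet> h)) (at x within euclid d)"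
    if "i \<in> {1..n}" for i
    using smooth_fun_has_gradient[OF local_smooth[OF that] x] by (simp add: has_gradient_def lgrad_def)
  have "((\<lambda>x. 1 / real n * (\<Sum>i=1..n. local_obj \<Xi> F i x)) has_derivative
      (\<lambda>h. 1 / real n * (\<Sum>i=1..n. lgrad i x \<bullet> h))) (at x within euclid d)"
    by (intro has_derivative_mult_right has_derivative_sum der)
  then show "(global_obj n \<Xi> F has_derivative (\<lambda>h. ((1 / real n) *\<^sub>R (\<Sum>i=1..n. lgrad i x)) \<bullet> h))
      (at x within euclid d)"
    by (simp add: global_obj_def[abs_def] inner_sum_left)
qed

lemma ggrad_eq: "x \<in> euclid d \<Longrightarrow> ggrad x = node_avg n (\<lambda>i. lgrad i x)"
  unfolding ggrad_def node_avg_def by (rule grad_eqI[OF _ ggrad_has_gradient])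

lemma ggrad_euclid [intro]: "x \<in> euclid d \<Longrightarrow> ggrad x \<in> euclid d"
  by (auto simp: ggrad_eq intro!: node_avg_euclid)

lemma norm_node_avg_le:
  assumes "\<And>i. i \<in> {1..n} \<Longrightarrow> norm (y i) \<le> c"
  shows "norm (node_avg n y) \<le> c"
proof -
  have "norm (\<Sum>i=1..n. y i) \<le> (\<Sum>i=1..n. c)"
    using assms by (intro sum_norm_le) auto
  then show ?thesis using n_pos by (simp add: node_avg_def field_simps)
qed

lemma node_avg_diff: "node_avg n (\<lambda>i. y i - z i) = node_avg n y - node_avg n z"
  by (simp add: node_avg_def sum_subtractf algebra_simps)

lemma node_avg_add: "node_avg n (\<lambda>i. y i + z i) = node_avg n y + node_avg n z"
  by (simp add: node_avg_def sum.distrib algebra_simps)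

lemma node_avg_scaleR: "node_avg n (\<lambda>i. c *\<^sub>R y i) = c *\<^sub>R node_avg n y"
  by (simp add: node_avg_def scaleR_sum_right[symmetric] mult.commute)

lemma node_avg_cong: "(\<And>i. i \<in> {1..n} \<Longrightarrow> y i = z i) \<Longrightarrow> node_avg n y = node_avg n z"
  by (simp add: node_avg_def)

lemma global_smooth: "smooth_fun d L (global_obj n \<Xi> F)"
  unfolding smooth_fun_def
proof
  show "\<forall>x\<in>euclid d. global_obj n \<Xi> F differentiable (at x within euclid d)"
    using ggrad_has_gradient by (auto simp: has_gradient_def differentiable_def)
  show "L-lipschitz_on (euclid d) (grad d (global_obj n \<Xi> F))"
  proof (rule lipschitz_onI)
    fix x y assume xy: "x \<in> euclid d" "y \<in> euclid d"
    have "ggrad x - ggrad y = node_avg n (\<lambda>i. lgrad i x - lgrad i y)"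
      using xy by (simp add: ggrad_eq node_avg_diff)
    then have "norm (ggrad x - ggrad y) \<le> L * norm (x - y)"
      using xy by (auto intro!: norm_node_avg_le lgrad_lipschitz)
    then show "dist (grad d (global_obj n \<Xi> F) x) (grad d (global_obj n \<Xi> F) y) \<le> L * dist x y"
      by (simp add: dist_norm ggrad_def)
  qed (use constants in simp)
qed

lemma ggrad_lipschitz:
  "x \<in> euclid d \<Longrightarrow> y \<in> euclid d \<Longrightarrow> norm (ggrad x - ggrad y) \<le> L * norm (x - y)"
  unfolding ggrad_def by (rule smooth_fun_lipschitz[OF global_smooth])

text \<open>
  The sample gradient, cut down to its first \<open>d\<close> coordinates so that it is a measurable function of
  the sample; it is the gradient itself for almost every sample.
\<close>

definition sgrad :: "nat \<Rightarrow> rvec \<Rightarrow> 'x \<Rightarrow> rvec" where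
  "sgrad i x z = vec_on {..<d} (\<lambda>j. coord (grad d (\<lambda>y. F i y z) x) j)"

lemma sgrad_euclid [simp, intro]: "sgrad i x z \<in> euclid d"
  by (simp add: sgrad_def)

lemma sgrad_eq:
  assumes "smooth_fun d L (\<lambda>y. F i y z)" "x \<in> euclid d"
  shows "sgrad i x z = grad d (\<lambda>y. F i y z) x"
  using grad_euclid[OF assms]
  by (intro rvec_eqI) (auto simp: sgrad_def coord_vec_on euclid_def not_less)

lemma sgrad_measurable:
  "i \<in> {1..n} \<Longrightarrow> x \<in> euclid d \<Longrightarrow> sgrad i x \<in> borel_measurable (\<Xi> i)"
  unfolding sgrad_def[abs_def] using grad_integrable[of i x] by (intro vec_on_measurable) auto

text \<open>
  Bias and variance decomposition of the second moment of the sample gradient: the variance assumption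
  enters with factor one, which the smallness conditions on the step size rely on.
\<close>

lemma sgrad_moments:
  assumes i: "i \<in> {1..n}" and x: "x \<in> euclid d"
  shows "sq_integrable (\<Xi> i) (sgrad i x)"
    and "vec_mean d (\<Xi> i) (sgrad i x) = lgrad i x"
    and "(\<integral>z. (norm (sgrad i x z))\<^sup>2 \<partial>\<Xi> i) \<le> (1 + \<sigma>0\<^sup>2) * (norm (lgrad i x))\<^sup>2 + \<sigma>1\<^sup>2"
proof -
  interpret prob_space "\<Xi> i" by (rule prob[OF i])
  note [measurable] = sgrad_measurable[OF i x]
  have "(\<integral>\<^sup>+z. ennreal ((norm (sgrad i x z - lgrad i x))\<^sup>2) \<partial>\<Xi> i)
      = (\<integral>\<^sup>+z. ennreal ((norm (grad d (\<lambda>y. F i y z) x - lgrad i x))\<^sup>2) \<partial>\<Xi> i)"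
    using sample_smooth[OF i]
    by (intro nn_integral_cong_AE) (auto elim!: eventually_mono simp: sgrad_eq x)
  also have "\<dots> \<le> ennreal (\<sigma>0\<^sup>2 * (norm (lgrad i x))\<^sup>2 + \<sigma>1\<^sup>2)"
    unfolding lgrad_def by (rule grad_variance[OF i x])
  finally have var: "(\<integral>\<^sup>+z. ennreal ((norm (sgrad i x z - lgrad i x))\<^sup>2) \<partial>\<Xi> i)
      \<le> ennreal (\<sigma>0\<^sup>2 * (norm (lgrad i x))\<^sup>2 + \<sigma>1\<^sup>2)" .
  then have "(\<integral>\<^sup>+z. ennreal ((norm (sgrad i x z - lgrad i x))\<^sup>2) \<partial>\<Xi> i) < \<infinity>"
    by (rule le_less_trans) simp
  then have "sq_integrable (\<Xi> i) (\<lambda>z. sgrad i x z - lgrad i x)"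
    by (intro sq_integrableI_nn) auto
  from sq_integrable_add[OF this sq_integrable_const[of "lgrad i x"]]
  show sq: "sq_integrable (\<Xi> i) (sgrad i x)" by simp
  show mean: "vec_mean d (\<Xi> i) (sgrad i x) = lgrad i x"
    using lgrad_euclid[OF i x]
    by (intro rvec_eqI) (auto simp: vec_mean_def sgrad_def coord_vec_on grad_unbiased[OF i x]
        lgrad_def[symmetric] euclid_def not_less)
  have "ennreal (\<integral>z. (norm (sgrad i x z - lgrad i x))\<^sup>2 \<partial>\<Xi> i)
      \<le> ennreal (\<sigma>0\<^sup>2 * (norm (lgrad i x))\<^sup>2 + \<sigma>1\<^sup>2)"
    using var sq_integrable_integrable[OF sq_integrable_diff[OF sq sq_integrable_const[of "lgrad i x"]]]
    by (simp add: nn_integral_eq_integral)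
  then have "(\<integral>z. (norm (sgrad i x z - lgrad i x))\<^sup>2 \<partial>\<Xi> i) \<le> \<sigma>0\<^sup>2 * (norm (lgrad i x))\<^sup>2 + \<sigma>1\<^sup>2"
    by (subst (asm) ennreal_le_iff) auto
  then show "(\<integral>z. (norm (sgrad i x z))\<^sup>2 \<partial>\<Xi> i) \<le> (1 + \<sigma>0\<^sup>2) * (norm (lgrad i x))\<^sup>2 + \<sigma>1\<^sup>2"
    using vec_mean_variance[OF sq, of d] by (simp add: mean algebra_simps)
qed

lemma AE_law:
  assumes i: "i \<in> {1..n}"
  shows "AE p in law i. fst p \<in> unit_sphere d \<and> smooth_fun d L (\<lambda>y. F i y (snd p))"
  unfolding law_def
  using AE_pair_fst[OF prob_space_unif_sphere[OF d_pos] prob[OF i] AE_unif_sphere[OF d_pos]]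
    AE_pair_snd[OF prob_space_unif_sphere[OF d_pos] prob[OF i] sample_smooth[OF i]]
  by eventually_elim auto

text \<open>
  Integrating the direction first replaces \<open>(h \<bullet> u)\<^sup>2\<close> by \<open>norm h ^ 2 / d\<close>; one factor \<open>d\<close> of the second
  moment of the estimator is gained here.
\<close>

lemma law_inner_sq:
  assumes i: "i \<in> {1..n}" and h: "sq_integrable (\<Xi> i) h" "\<And>z. h z \<in> euclid d"
  shows "integrable (law i) (\<lambda>p. (h (snd p) \<bullet> fst p)\<^sup>2)"
    and "(\<integral>p. (h (snd p) \<bullet> fst p)\<^sup>2 \<partial>law i) = (\<integral>z. (norm (h z))\<^sup>2 \<partial>\<Xi> i) / real d"
proof -
  interpret U: prob_space "unif_sphere d" by (rule prob_space_unif_sphere[OF d_pos])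
  interpret X: prob_space "\<Xi> i" by (rule prob[OF i])
  interpret pair_prob_space "unif_sphere d" "\<Xi> i" ..
  note [measurable] = sq_integrable_measurable[OF h(1)]
  have "(\<integral>\<^sup>+p. ennreal ((h (snd p) \<bullet> fst p)\<^sup>2) \<partial>law i)
      = (\<integral>\<^sup>+z. \<integral>\<^sup>+u. ennreal ((h z \<bullet> u)\<^sup>2) \<partial>unif_sphere d \<partial>\<Xi> i)"
    unfolding law_def by (subst nn_integral_snd[symmetric]) auto
  also have "\<dots> = (\<integral>\<^sup>+z. ennreal ((norm (h z))\<^sup>2 / real d) \<partial>\<Xi> i)"
    by (simp add: nn_integral_sphere_inner[OF d_pos h(2)])
  also have "\<dots> = ennreal ((\<integral>z. (norm (h z))\<^sup>2 \<partial>\<Xi> i) / real d)"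
    using sq_integrable_integrable[OF h(1)] by (subst nn_integral_eq_integral) auto
  finally have nn: "(\<integral>\<^sup>+p. ennreal ((h (snd p) \<bullet> fst p)\<^sup>2) \<partial>law i)
      = ennreal ((\<integral>z. (norm (h z))\<^sup>2 \<partial>\<Xi> i) / real d)" .
  have "has_bochner_integral (law i) (\<lambda>p. (h (snd p) \<bullet> fst p)\<^sup>2) ((\<integral>z. (norm (h z))\<^sup>2 \<partial>\<Xi> i) / real d)"
    by (rule has_bochner_integral_nn_integral[OF _ _ _ nn]) auto
  then show "integrable (law i) (\<lambda>p. (h (snd p) \<bullet> fst p)\<^sup>2)"
    and "(\<integral>p. (h (snd p) \<bullet> fst p)\<^sup>2 \<partial>law i) = (\<integral>z. (norm (h z))\<^sup>2 \<partial>\<Xi> i) / real d"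
    by (auto simp: has_bochner_integral_iff)
qed

text \<open>
  For a linear function the estimator is \<open>d (g \<bullet> u) u\<close>, which is unbiased because the second
  moment matrix of \<open>u\<close> is \<open>1/d\<close> times the identity.
\<close>

definition lin_est :: "nat \<Rightarrow> rvec \<Rightarrow> rvec \<times> 'x \<Rightarrow> rvec" where
  "lin_est i x p = (real d * (sgrad i x (snd p) \<bullet> fst p)) *\<^sub>R fst p"

lemma sq_integrable_lin_est:
  assumes i: "i \<in> {1..n}" and x: "x \<in> euclid d"
  shows "sq_integrable (law i) (lin_est i x)"
proof (rule sq_integrable_bound)
  note [measurable] = sgrad_measurable[OF i x]
  show "lin_est i x \<in> borel_measurable (law i)"
    unfolding lin_est_def[abs_def] by measurable
  show "integrable (law i) (\<lambda>p. (real d)\<^sup>2 * (sgrad i x (snd p) \<bullet> fst p)\<^sup>2)"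
    using law_inner_sq(1)[OF i sgrad_moments(1)[OF i x]] by simp
  show "AE p in law i. (norm (lin_est i x p))\<^sup>2 \<le> (real d)\<^sup>2 * (sgrad i x (snd p) \<bullet> fst p)\<^sup>2"
    using AE_law[OF i] by eventually_elim (auto simp: lin_est_def unit_sphere_def power_mult_distrib)
qed

lemma vec_mean_lin_est:
  assumes i: "i \<in> {1..n}" and x: "x \<in> euclid d"
  shows "vec_mean d (law i) (lin_est i x) = lgrad i x"
proof (rule rvec_eq_of_inner_eq)
  fix v assume v: "v \<in> euclid d"
  interpret U: prob_space "unif_sphere d" by (rule prob_space_unif_sphere[OF d_pos])
  interpret X: prob_space "\<Xi> i" by (rule prob[OF i])
  interpret pair_prob_space "unif_sphere d" "\<Xi> i" ..
  interpret law: prob_space "law i" by (rule prob_space_law[OF i])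
  note sq = sq_integrable_lin_est[OF i x]
  have int: "integrable (law i) (\<lambda>p. v \<bullet> lin_est i x p)"
    by (rule sq_integrable_inner[OF law.sq_integrable_const sq])
  have "v \<bullet> vec_mean d (law i) (lin_est i x) = (\<integral>p. v \<bullet> lin_est i x p \<partial>law i)"
    by (simp add: law.inner_vec_mean[OF sq v])
  also have "\<dots> = (\<integral>z. \<integral>u. v \<bullet> lin_est i x (u, z) \<partial>unif_sphere d \<partial>\<Xi> i)"
    using int unfolding law_def
    by (subst integral_snd) (simp_all add: case_prod_beta')
  also have "\<dots> = (\<integral>z. real d * (\<integral>u. (sgrad i x z \<bullet> u) * (v \<bullet> u) \<partial>unif_sphere d) \<partial>\<Xi> i)"
    by (simp add: lin_est_def mult.assoc)
  also have "\<dots> = (\<integral>z. v \<bullet> sgrad i x z \<partial>\<Xi> i)"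
  proof -
    have "(\<integral>u. (sgrad i x z \<bullet> u) * (v \<bullet> u) \<partial>unif_sphere d) = (v \<bullet> sgrad i x z) / real d" for z
      by (simp only: sphere_inner_mult(2)[OF d_pos sgrad_euclid v] inner_commute[of "sgrad i x z" v])
    then show ?thesis using d_pos by simp
  qed
  also have "\<dots> = v \<bullet> lgrad i x"
    by (simp add: X.inner_vec_mean[OF sgrad_moments(1)[OF i x] v] sgrad_moments(2)[OF i x])
  finally show "v \<bullet> vec_mean d (law i) (lin_est i x) = v \<bullet> lgrad i x" .
qed (use i x in auto)

text \<open>
  The estimator as a function of the point and the sample pair. It agrees with \<^const>\<open>zo_grad\<close> on the
  arguments that occur in a run, and the cut-off makes it jointly measurable, although \<open>F i\<close> is only
  assumed measurable on \<open>euclid d\<close>.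
\<close>

definition est :: "real \<Rightarrow> nat \<Rightarrow> rvec \<Rightarrow> rvec \<times> 'x \<Rightarrow> rvec" where
  "est t i x p = (if x \<in> euclid d \<and> fst p \<in> unit_sphere d
     then (real d * central_diff t (\<lambda>y. F i y (snd p)) x (fst p)) *\<^sub>R fst p else 0)"

lemma est_eq_zo_grad:
  "x \<in> euclid d \<Longrightarrow> u \<in> unit_sphere d \<Longrightarrow> est t i x (u, z) = zo_grad d t (F i) x u z"
  by (simp add: est_def zo_grad_def central_diff_def)

lemma est_euclid [intro]: "est t i x p \<in> euclid d"
  by (auto simp: est_def unit_sphere_def)

lemma est_measurable [measurable]:
  assumes i: "i \<in> {1..n}"
  shows "(\<lambda>q. est t i (fst q) (snd q)) \<in> borel_measurable (borel \<Otimes>\<^sub>M (borel \<Otimes>\<^sub>M \<Xi> i))"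
proof -
  define proj where "proj x = (if x \<in> euclid d then x else 0)" for x :: rvec
  have proj_eq: "x \<in> euclid d \<Longrightarrow> proj x = x" for x by (simp add: proj_def)
  have [measurable]: "proj \<in> measurable borel (restrict_space borel (euclid d))"
    by (rule measurable_restrict_space2) (auto simp: proj_def[abs_def])
  have FP [measurable]: "(\<lambda>q. F i (proj (fst q)) (snd q)) \<in> borel_measurable (borel \<Otimes>\<^sub>M \<Xi> i)"
  proof -
    have "(\<lambda>q. (proj (fst q), snd q)) \<in> measurable (borel \<Otimes>\<^sub>M \<Xi> i) (restrict_space borel (euclid d) \<Otimes>\<^sub>M \<Xi> i)"
      by measurable
    from measurable_compose[OF this F_measurable[OF i]] show ?thesis by (simp add: case_prod_beta')
  qed
  have sh [measurable]: "(\<lambda>q. F i (proj (fst q + r *\<^sub>R fst (snd q))) (snd (snd q)))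
      \<in> borel_measurable (borel \<Otimes>\<^sub>M (borel \<Otimes>\<^sub>M \<Xi> i))" for r
  proof -
    have "(\<lambda>q. (fst q + r *\<^sub>R fst (snd q), snd (snd q)))
        \<in> measurable (borel \<Otimes>\<^sub>M (borel \<Otimes>\<^sub>M \<Xi> i)) ((borel :: rvec measure) \<Otimes>\<^sub>M \<Xi> i)"
      by measurable
    from measurable_compose[OF this FP] show ?thesis by simp
  qed
  have "(\<lambda>q. est t i (fst q) (snd q)) = (\<lambda>q. if fst q \<in> euclid d \<and> fst (snd q) \<in> unit_sphere d
      then (real d * ((F i (proj (fst q + t *\<^sub>R fst (snd q))) (snd (snd q))
            - F i (proj (fst q + (- t) *\<^sub>R fst (snd q))) (snd (snd q))) / (2 * t))) *\<^sub>R fst (snd q) else 0)"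
    by (rule ext)
      (auto simp: est_def central_diff_def unit_sphere_def proj_eq euclid_add euclid_diff euclid_scaleR)
  also have "\<dots> \<in> borel_measurable (borel \<Otimes>\<^sub>M (borel \<Otimes>\<^sub>M \<Xi> i))"
    by measurable
  finally show ?thesis .
qed

lemma est_measurable_compose:
  assumes i: "i \<in> {1..n}" and "f \<in> borel_measurable N" "g \<in> measurable N (borel \<Otimes>\<^sub>M \<Xi> i)"
  shows "(\<lambda>\<omega>. est t i (f \<omega>) (g \<omega>)) \<in> borel_measurable N"
  using measurable_compose[OF measurable_Pair[OF assms(2,3)] est_measurable[OF i, of t]] by simp

lemma est_measurable_law: "i \<in> {1..n} \<Longrightarrow> est t i x \<in> borel_measurable (law i)"
  by (rule est_measurable_compose) (simp_all cong: measurable_cong_sets)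

lemma AE_est_near_linear:
  assumes i: "i \<in> {1..n}" and x: "x \<in> euclid d" and t: "t > 0"
  shows "AE p in law i. norm (est t i x p - lin_est i x p) \<le> real d * (L * t / 2)"
  using AE_law[OF i]
proof eventually_elim
  fix p assume p: "fst p \<in> unit_sphere d \<and> smooth_fun d L (\<lambda>y. F i y (snd p))"
  have "est t i x p - lin_est i x p
      = (real d * (central_diff t (\<lambda>y. F i y (snd p)) x (fst p) - sgrad i x (snd p) \<bullet> fst p)) *\<^sub>R fst p"
    using p x by (simp add: est_def lin_est_def algebra_simps)
  also have "norm \<dots> = real d * \<bar>central_diff t (\<lambda>y. F i y (snd p)) x (fst p) - sgrad i x (snd p) \<bullet> fst p\<bar>"
    using p by (simp add: unit_sphere_def abs_mult)
  also have "\<dots> \<le> real d * (L * t / 2)"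
    using central_diff_approx[of d L "\<lambda>y. F i y (snd p)" x "fst p" t] p x t
    by (intro mult_left_mono) (simp_all add: sgrad_eq)
  finally show "norm (est t i x p - lin_est i x p) \<le> real d * (L * t / 2)" .
qed

text \<open>
  The weight \<open>5/4\<close> on the linear part is chosen close to one because this term carries the gradient
  and feeds back into the descent; the Taylor error can bear the large weight.
\<close>

lemma est_second_moment:
  assumes i: "i \<in> {1..n}" and x: "x \<in> euclid d" and t: "t > 0"
  shows "sq_integrable (law i) (est t i x)"
    and "(\<integral>p. (norm (est t i x p))\<^sup>2 \<partial>law i)
      \<le> 5/4 * real d * ((1 + \<sigma>0\<^sup>2) * (norm (lgrad i x))\<^sup>2 + \<sigma>1\<^sup>2) + 5/4 * (real d * L * t)\<^sup>2"
proof -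
  interpret law: prob_space "law i" by (rule prob_space_law[OF i])
  let ?B = "\<lambda>p. 5/4 * (real d)\<^sup>2 * (sgrad i x (snd p) \<bullet> fst p)\<^sup>2 + 5/4 * (real d * L * t)\<^sup>2"
  note sg = sgrad_moments[OF i x]
  have B: "integrable (law i) ?B" using law_inner_sq(1)[OF i sg(1)] by simp
  have bound: "AE p in law i. (norm (est t i x p))\<^sup>2 \<le> ?B p"
    using AE_est_near_linear[OF assms] AE_law[OF i]
  proof eventually_elim
    fix p assume e: "norm (est t i x p - lin_est i x p) \<le> real d * (L * t / 2)"
      and p: "fst p \<in> unit_sphere d \<and> smooth_fun d L (\<lambda>y. F i y (snd p))"
    have "(norm (est t i x p))\<^sup>2 \<le> 5/4 * (norm (lin_est i x p))\<^sup>2 + 5 * (norm (est t i x p - lin_est i x p))\<^sup>2"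
      using norm_add_sq_54[of "lin_est i x p" "est t i x p - lin_est i x p"] by simp
    moreover have "(norm (est t i x p - lin_est i x p))\<^sup>2 \<le> (real d * (L * t / 2))\<^sup>2"
      by (rule power_mono[OF e]) simp
    moreover have "(norm (lin_est i x p))\<^sup>2 = (real d)\<^sup>2 * (sgrad i x (snd p) \<bullet> fst p)\<^sup>2"
      using p by (simp add: lin_est_def unit_sphere_def power_mult_distrib)
    ultimately show "(norm (est t i x p))\<^sup>2 \<le> ?B p" by (simp add: power_mult_distrib power_divide)
  qed
  show sq: "sq_integrable (law i) (est t i x)"
    by (rule sq_integrable_bound[OF est_measurable_law[OF i] B bound])
  have "(\<integral>p. (norm (est t i x p))\<^sup>2 \<partial>law i) \<le> (\<integral>p. ?B p \<partial>law i)"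
    by (rule integral_mono_AE[OF sq_integrable_integrable[OF sq] B bound])
  also have "\<dots> = 5/4 * real d * (\<integral>z. (norm (sgrad i x z))\<^sup>2 \<partial>\<Xi> i) + 5/4 * (real d * L * t)\<^sup>2"
    using law_inner_sq[OF i sg(1)] law.prob_space d_pos
    by (simp add: power2_eq_square)
  also have "\<dots> \<le> 5/4 * real d * ((1 + \<sigma>0\<^sup>2) * (norm (lgrad i x))\<^sup>2 + \<sigma>1\<^sup>2) + 5/4 * (real d * L * t)\<^sup>2"
    using sg(3) by (intro add_right_mono mult_left_mono) auto
  finally show "(\<integral>p. (norm (est t i x p))\<^sup>2 \<partial>law i)
      \<le> 5/4 * real d * ((1 + \<sigma>0\<^sup>2) * (norm (lgrad i x))\<^sup>2 + \<sigma>1\<^sup>2) + 5/4 * (real d * L * t)\<^sup>2" .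
qed

text \<open>
  Variance reduction: with a common sample the linear parts differ by \<open>d\<close> times the inner product of
  \<open>u\<close> with a difference of sample gradients, which is at most \<open>L * norm (x - y)\<close> in norm.
\<close>

lemma est_difference_moment:
  assumes i: "i \<in> {1..n}" and x: "x \<in> euclid d" and y: "y \<in> euclid d" and t: "t > 0"
  shows "(\<integral>p. (norm (est t i x p - est t i y p))\<^sup>2 \<partial>law i)
      \<le> 2 * real d * L\<^sup>2 * (norm (x - y))\<^sup>2 + 2 * (real d * L * t)\<^sup>2"
proof -
  interpret law: prob_space "law i" by (rule prob_space_law[OF i])
  interpret X: prob_space "\<Xi> i" by (rule prob[OF i])
  define h where "h z = sgrad i x z - sgrad i y z" for z
  have h: "sq_integrable (\<Xi> i) h" "\<And>z. h z \<in> euclid d"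
    unfolding h_def[abs_def] using sgrad_moments(1)[OF i x] sgrad_moments(1)[OF i y]
    by (auto intro: sq_integrable_diff)
  let ?B = "\<lambda>p. 2 * (real d)\<^sup>2 * (h (snd p) \<bullet> fst p)\<^sup>2 + 2 * (real d * L * t)\<^sup>2"
  have B: "integrable (law i) ?B" using law_inner_sq(1)[OF i h] by simp
  have bound: "AE p in law i. (norm (est t i x p - est t i y p))\<^sup>2 \<le> ?B p"
    using AE_est_near_linear[OF i x t] AE_est_near_linear[OF i y t] AE_law[OF i]
  proof eventually_elim
    fix p assume e: "norm (est t i x p - lin_est i x p) \<le> real d * (L * t / 2)"
      "norm (est t i y p - lin_est i y p) \<le> real d * (L * t / 2)"
      and p: "fst p \<in> unit_sphere d \<and> smooth_fun d L (\<lambda>y. F i y (snd p))"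
    let ?r = "(est t i x p - lin_est i x p) - (est t i y p - lin_est i y p)"
    have "norm ?r \<le> real d * L * t"
      using e norm_triangle_ineq4[of "est t i x p - lin_est i x p" "est t i y p - lin_est i y p"]
      by simp
    then have "(norm ?r)\<^sup>2 \<le> (real d * L * t)\<^sup>2" by (rule power_mono) simp
    moreover have "(norm (est t i x p - est t i y p))\<^sup>2
        \<le> 2 * (norm (lin_est i x p - lin_est i y p))\<^sup>2 + 2 * (norm ?r)\<^sup>2"
      using norm_add_sq[of "lin_est i x p - lin_est i y p" ?r] by simp
    moreover have "lin_est i x p - lin_est i y p = (real d * (h (snd p) \<bullet> fst p)) *\<^sub>R fst p"
      by (simp add: lin_est_def h_def inner_diff_left algebra_simps)
    then have "(norm (lin_est i x p - lin_est i y p))\<^sup>2 = (real d)\<^sup>2 * (h (snd p) \<bullet> fst p)\<^sup>2"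
      using p by (simp add: unit_sphere_def power_mult_distrib)
    ultimately show "(norm (est t i x p - est t i y p))\<^sup>2 \<le> ?B p" by simp
  qed
  have "(\<integral>p. (norm (est t i x p - est t i y p))\<^sup>2 \<partial>law i) \<le> (\<integral>p. ?B p \<partial>law i)"
    using est_second_moment(1)[OF i x t] est_second_moment(1)[OF i y t]
    by (intro integral_mono_AE[OF _ B bound] sq_integrable_integrable sq_integrable_diff)
  also have "\<dots> = 2 * real d * (\<integral>z. (norm (h z))\<^sup>2 \<partial>\<Xi> i) + 2 * (real d * L * t)\<^sup>2"
    using law_inner_sq[OF i h] law.prob_space d_pos by (simp add: power2_eq_square)
  also have "(\<integral>z. (norm (h z))\<^sup>2 \<partial>\<Xi> i) \<le> (\<integral>z. (L * norm (x - y))\<^sup>2 \<partial>\<Xi> i)"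
  proof (rule integral_mono_AE[OF sq_integrable_integrable[OF h(1)]])
    show "AE z in \<Xi> i. (norm (h z))\<^sup>2 \<le> (L * norm (x - y))\<^sup>2"
      using sample_smooth[OF i]
    proof eventually_elim
      fix z assume z: "smooth_fun d L (\<lambda>y. F i y z)"
      show "(norm (h z))\<^sup>2 \<le> (L * norm (x - y))\<^sup>2"
        using smooth_fun_lipschitz[OF z x y] by (intro power_mono) (simp_all add: h_def sgrad_eq z x y)
    qed
  qed simp
  also have "\<dots> = L\<^sup>2 * (norm (x - y))\<^sup>2" using X.prob_space by (simp add: power_mult_distrib)
  finally show ?thesis by (simp add: mult_left_mono mult.assoc)
qed

text \<open>
  The gradient of a smoothed objective: it is close to \<^const>\<open>lgrad\<close> and, at a fixed point, varies
  slowly with the radius.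
\<close>

definition est_mean :: "real \<Rightarrow> nat \<Rightarrow> rvec \<Rightarrow> rvec" where
  "est_mean t i x = vec_mean d (law i) (est t i x)"

lemma est_mean_euclid [simp, intro]: "est_mean t i x \<in> euclid d"
  by (simp add: est_mean_def)

lemma est_mean_measurable [measurable]:
  assumes i: "i \<in> {1..n}"
  shows "est_mean t i \<in> borel_measurable borel"
proof -
  interpret law: prob_space "law i" by (rule prob_space_law[OF i])
  have "(\<lambda>q. est t i (fst q) (snd q)) \<in> borel_measurable (borel \<Otimes>\<^sub>M law i)"
    using est_measurable[OF i, of t] by (simp cong: measurable_cong_sets)
  then have "(\<lambda>(x, p). coord (est t i x p) j) \<in> borel_measurable (borel \<Otimes>\<^sub>M law i)" for j
    using measurable_compose[OF _ measurable_coord[of j]] by (auto simp: case_prod_beta')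
  then show ?thesis
    unfolding est_mean_def[abs_def] vec_mean_def
    by (intro vec_on_measurable law.borel_measurable_lebesgue_integral) auto
qed

lemma est_mean_bias:
  assumes i: "i \<in> {1..n}" and x: "x \<in> euclid d" and t: "t > 0"
  shows "norm (est_mean t i x - lgrad i x) \<le> real d * L * t / 2"
proof -
  interpret law: prob_space "law i" by (rule prob_space_law[OF i])
  note sq = est_second_moment(1)[OF assms] sq_integrable_lin_est[OF i x]
  have "est_mean t i x - lgrad i x = vec_mean d (law i) (\<lambda>p. est t i x p - lin_est i x p)"
    using law.vec_mean_diff[OF sq] by (simp add: est_mean_def vec_mean_lin_est[OF i x])
  also have "norm \<dots> \<le> real d * (L * t / 2)"
    using constants t
    by (intro law.norm_vec_mean_le sq_integrable_diff sq AE_est_near_linear assms) auto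
  finally show ?thesis by simp
qed

lemma est_mean_radius:
  assumes i: "i \<in> {1..n}" and x: "x \<in> euclid d" and t: "t > 0" "s > 0"
  shows "norm (est_mean t i x - est_mean s i x) \<le> real d * L * \<bar>t - s\<bar>"
proof -
  interpret law: prob_space "law i" by (rule prob_space_law[OF i])
  note sq = est_second_moment(1)[OF i x t(1)] est_second_moment(1)[OF i x t(2)]
  have "est_mean t i x - est_mean s i x = vec_mean d (law i) (\<lambda>p. est t i x p - est s i x p)"
    using law.vec_mean_diff[OF sq] by (simp add: est_mean_def)
  also have "norm \<dots> \<le> real d * L * \<bar>t - s\<bar>"
  proof (intro law.norm_vec_mean_le sq_integrable_diff sq)
    show "AE p in law i. norm (est t i x p - est s i x p) \<le> real d * L * \<bar>t - s\<bar>"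
      using AE_law[OF i]
    proof eventually_elim
      fix p assume p: "fst p \<in> unit_sphere d \<and> smooth_fun d L (\<lambda>y. F i y (snd p))"
      let ?c = "\<lambda>r. central_diff r (\<lambda>y. F i y (snd p)) x (fst p)"
      have "est t i x p - est s i x p = (real d * (?c t - ?c s)) *\<^sub>R fst p"
        using p x by (simp add: est_def algebra_simps)
      then have "norm (est t i x p - est s i x p) = real d * \<bar>?c t - ?c s\<bar>"
        using p by (simp add: unit_sphere_def abs_mult)
      also have "\<dots> \<le> real d * (L * \<bar>t - s\<bar>)"
        using central_diff_radius[of d L "\<lambda>y. F i y (snd p)" x "fst p" t s] p x t
        by (intro mult_left_mono) auto
      finally show "norm (est t i x p - est s i x p) \<le> real d * L * \<bar>t - s\<bar>" by (simp add: mult.assoc)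
    qed
  qed (use constants in auto)
  finally show ?thesis .
qed

lemma norm_est_mean_sq_le:
  assumes i: "i \<in> {1..n}" and x: "x \<in> euclid d" and t: "t > 0"
  shows "(norm (est_mean t i x))\<^sup>2 \<le> (\<integral>p. (norm (est t i x p))\<^sup>2 \<partial>law i)"
proof -
  interpret law: prob_space "law i" by (rule prob_space_law[OF i])
  show ?thesis unfolding est_mean_def by (rule law.norm_vec_mean_sq_le[OF est_second_moment(1)[OF assms]])
qed

end

section \<open>Consensus\<close>

lemma bounded_linear_mat_op: "bounded_linear (mat_op n A)"
proof (rule bounded_linear_intro)
  show "mat_op n A (x + y) = mat_op n A x + mat_op n A y" for x y
    by (rule rvec_eqI) (simp add: mat_op_def coord_vec_on algebra_simps sum.distrib)
  show "mat_op n A (r *\<^sub>R x) = r *\<^sub>R mat_op n A x" for r x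
    by (rule rvec_eqI) (simp add: mat_op_def coord_vec_on sum_distrib_left mult_ac)
  fix v
  have "norm (mat_op n A v) \<le> (\<Sum>i=1..n. \<bar>\<Sum>j=1..n. A i j * coord v j\<bar>)"
    unfolding mat_op_def by (rule norm_vec_on_le) simp
  also have "\<dots> \<le> (\<Sum>i=1..n. \<Sum>j=1..n. \<bar>A i j\<bar> * norm v)"
    by (intro sum_mono order_trans[OF sum_abs])
      (auto simp: abs_mult intro!: sum_mono mult_left_mono abs_coord_le_norm)
  also have "\<dots> = norm v * (\<Sum>i=1..n. \<Sum>j=1..n. \<bar>A i j\<bar>)"
    by (simp add: sum_distrib_left mult.commute)
  finally show "norm (mat_op n A v) \<le> norm v * (\<Sum>i=1..n. \<Sum>j=1..n. \<bar>A i j\<bar>)" .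
qed

lemma spectral_norm_nonneg: "0 \<le> spectral_norm n A"
  unfolding spectral_norm_def by (rule onorm_pos_le[OF bounded_linear_mat_op])

lemma spectral_norm_scalars:
  "(\<Sum>i=1..n. (\<Sum>j=1..n. A i j * c j)\<^sup>2) \<le> (spectral_norm n A)\<^sup>2 * (\<Sum>j=1..n. (c j)\<^sup>2)"
proof -
  let ?v = "vec_on {1..n} c"
  have "mat_op n A ?v = vec_on {1..n} (\<lambda>i. \<Sum>j=1..n. A i j * c j)"
    by (rule rvec_eqI) (simp add: mat_op_def coord_vec_on)
  then have l: "(norm (mat_op n A ?v))\<^sup>2 = (\<Sum>i=1..n. (\<Sum>j=1..n. A i j * c j)\<^sup>2)"
    by (simp add: norm_vec_on L2_set_def sum_nonneg)
  have "(norm (mat_op n A ?v))\<^sup>2 \<le> (spectral_norm n A * norm ?v)\<^sup>2"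
    unfolding spectral_norm_def by (intro power_mono onorm bounded_linear_mat_op) simp
  also have "\<dots> = (spectral_norm n A)\<^sup>2 * (\<Sum>j=1..n. (c j)\<^sup>2)"
    by (simp add: power_mult_distrib norm_vec_on L2_set_def sum_nonneg)
  finally show ?thesis unfolding l .
qed

text \<open>
  The matrix acts on each coordinate of the node vectors separately.
\<close>

lemma spectral_norm_vectors:
  assumes y: "\<And>j. j \<in> {1..n} \<Longrightarrow> y j \<in> euclid d"
  shows "(\<Sum>i=1..n. (norm (\<Sum>j=1..n. A i j *\<^sub>R y j))\<^sup>2) \<le> (spectral_norm n A)\<^sup>2 * (\<Sum>j=1..n. (norm (y j))\<^sup>2)"
proof -
  have "(\<Sum>i=1..n. (norm (\<Sum>j=1..n. A i j *\<^sub>R y j))\<^sup>2)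
      = (\<Sum>i=1..n. \<Sum>l<d. (\<Sum>j=1..n. A i j * coord (y j) l)\<^sup>2)"
    using y by (intro sum.cong refl, subst norm_euclid[of _ d])
      (auto simp: coord_sum intro!: euclid_sum)
  also have "\<dots> = (\<Sum>l<d. \<Sum>i=1..n. (\<Sum>j=1..n. A i j * coord (y j) l)\<^sup>2)"
    by (rule sum.swap)
  also have "\<dots> \<le> (\<Sum>l<d. (spectral_norm n A)\<^sup>2 * (\<Sum>j=1..n. (coord (y j) l)\<^sup>2))"
    by (intro sum_mono spectral_norm_scalars)
  also have "\<dots> = (spectral_norm n A)\<^sup>2 * (\<Sum>j=1..n. \<Sum>l<d. (coord (y j) l)\<^sup>2)"
    unfolding sum_distrib_left[symmetric] by (simp only: sum.swap[of _ "{..<d}" "{1..n}"])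
  also have "(\<Sum>j=1..n. \<Sum>l<d. (coord (y j) l)\<^sup>2) = (\<Sum>j=1..n. (norm (y j))\<^sup>2)"
    using y by (intro sum.cong refl norm_euclid[symmetric]) auto
  finally show ?thesis .
qed

lemma sum_deviation_sq:
  fixes y :: "'a \<Rightarrow> 'b::real_inner"
  assumes "finite I" "I \<noteq> {}"
  defines "m \<equiv> (1 / real (card I)) *\<^sub>R (\<Sum>i\<in>I. y i)"
  shows "(\<Sum>i\<in>I. (norm (y i - m))\<^sup>2) = (\<Sum>i\<in>I. (norm (y i))\<^sup>2) - real (card I) * (norm m)\<^sup>2"
proof -
  have s: "(\<Sum>i\<in>I. y i) = real (card I) *\<^sub>R m"
    using assms by (simp add: m_def)
  have "(\<Sum>i\<in>I. (norm (y i - m))\<^sup>2) = (\<Sum>i\<in>I. (norm (y i))\<^sup>2 - 2 * (y i \<bullet> m) + (norm m)\<^sup>2)"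
    by (simp add: power2_norm_eq_inner inner_diff_left inner_diff_right inner_commute algebra_simps)
  also have "\<dots> = (\<Sum>i\<in>I. (norm (y i))\<^sup>2) - 2 * ((\<Sum>i\<in>I. y i) \<bullet> m) + real (card I) * (norm m)\<^sup>2"
    by (simp add: sum.distrib sum_subtractf sum_distrib_left inner_sum_left)
  also have "\<dots> = (\<Sum>i\<in>I. (norm (y i))\<^sup>2) - real (card I) * (norm m)\<^sup>2"
    by (simp add: s power2_norm_eq_inner)
  finally show ?thesis .
qed

text \<open>
  With the last term added on the left, the inequality is an invariant of the recursion; as \<open>r \<le> 1\<close>,
  this term pays for its own summand.
\<close>

lemma sum_contraction:
  fixes a b :: "nat \<Rightarrow> real"
  assumes "\<And>k. Suc k < K \<Longrightarrow> a (Suc k) \<le> (1 - r) * a k + b k" "r \<le> 1" "K \<ge> 1"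
    and "\<And>k. k < K \<Longrightarrow> 0 \<le> a k"
  shows "r * (\<Sum>k<K. a k) \<le> a 0 + (\<Sum>k<K - 1. b k)"
proof -
  have "r * (\<Sum>k<k'. a k) + a k' \<le> a 0 + (\<Sum>k<k'. b k)" if "k' < K" for k'
    using that
  proof (induction k')
    case (Suc k')
    then show ?case using assms(1)[of k'] by (simp add: algebra_simps)
  qed simp
  from this[of "K - 1"] have "r * (\<Sum>k<K - 1. a k) + a (K - 1) \<le> a 0 + (\<Sum>k<K - 1. b k)"
    using assms(3) by simp
  moreover have "(\<Sum>k<K. a k) = (\<Sum>k<K - 1. a k) + a (K - 1)"
    using assms(3) by (cases K) auto
  moreover have "r * a (K - 1) \<le> a (K - 1)"
    using assms(2) assms(4)[of "K - 1"] assms(3) mult_right_mono[of r 1 "a (K - 1)"] by simp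
  ultimately show ?thesis by (simp add: algebra_simps)
qed

text \<open>
  The weight in Young's inequality is chosen so that half of the gap \<open>1 - \<rho>\<^sup>2\<close> remains.
\<close>

lemma contraction_young:
  fixes v w :: "'a::real_inner"
  assumes "0 \<le> \<rho>" "\<rho> < 1"
  defines "r \<equiv> (1 - \<rho>\<^sup>2) / 2"
  shows "\<rho>\<^sup>2 * (norm (v + w))\<^sup>2 \<le> (1 - r) * (norm v)\<^sup>2 + \<rho>\<^sup>2 / r * (norm w)\<^sup>2"
proof (cases "\<rho> = 0")
  case True
  then show ?thesis by (simp add: r_def)
next
  case False
  have \<rho>: "0 < \<rho>\<^sup>2" "\<rho>\<^sup>2 < 1" using assms False by (auto simp: power_less_one_iff)
  define \<eta> where "\<eta> = r / \<rho>\<^sup>2"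
  have \<eta>: "\<eta> > 0" using \<rho> by (simp add: \<eta>_def r_def)
  have "\<rho>\<^sup>2 * (norm (v + w))\<^sup>2 \<le> \<rho>\<^sup>2 * ((1 + \<eta>) * (norm v)\<^sup>2 + (1 + 1 / \<eta>) * (norm w)\<^sup>2)"
    by (intro mult_left_mono norm_add_sq_young \<eta>) simp
  also have "\<dots> = (\<rho>\<^sup>2 * (1 + \<eta>)) * (norm v)\<^sup>2 + (\<rho>\<^sup>2 * (1 + 1 / \<eta>)) * (norm w)\<^sup>2"
    by (simp add: algebra_simps)
  also have "\<rho>\<^sup>2 * (1 + \<eta>) = 1 - r" using \<rho> by (simp add: \<eta>_def r_def field_simps)
  also have "\<rho>\<^sup>2 * (1 + 1 / \<eta>) = \<rho>\<^sup>2 / r * (r + \<rho>\<^sup>2)"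
    using \<rho> by (simp add: \<eta>_def r_def field_simps)
  also have "(1 - r) * (norm v)\<^sup>2 + \<rho>\<^sup>2 / r * (r + \<rho>\<^sup>2) * (norm w)\<^sup>2
      \<le> (1 - r) * (norm v)\<^sup>2 + \<rho>\<^sup>2 / r * 1 * (norm w)\<^sup>2"
    using \<rho> by (intro add_left_mono mult_right_mono mult_left_mono) (auto simp: r_def field_simps)
  finally show ?thesis by simp
qed

context decentralized_problem
begin

lemma W_nonneg: "i \<in> {1..n} \<Longrightarrow> j \<in> {1..n} \<Longrightarrow> 0 \<le> W i j"
  using weights[of i j] by (auto split: if_splits)

lemma W_diag_pos: "i \<in> {1..n} \<Longrightarrow> 0 < W i i"
  using weights[of i i] by simp

text \<open>
  Primitivity and the positive diagonal give a spectral gap without eigenvalues: the loss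
  \<open>norm y ^ 2 - norm (W y) ^ 2\<close> is the weighted variance of the values \<open>y j\<close> seen by each node, so it
  controls the differences of \<open>y\<close> along edges, hence along paths, hence \<open>y\<close> itself when its mean
  vanishes.
\<close>

lemma mixing_loss:
  fixes y :: "nat \<Rightarrow> real"
  defines "s \<equiv> \<lambda>i. \<Sum>j=1..n. W i j * y j"
  shows "(\<Sum>i=1..n. \<Sum>j=1..n. W i j * (y j - s i)\<^sup>2) = (\<Sum>j=1..n. (y j)\<^sup>2) - (\<Sum>i=1..n. (s i)\<^sup>2)"
proof -
  have "(\<Sum>j=1..n. W i j * (y j - s i)\<^sup>2) = (\<Sum>j=1..n. W i j * (y j)\<^sup>2) - (s i)\<^sup>2" if i: "i \<in> {1..n}" for i
  proof -
    have "(\<Sum>j=1..n. W i j * (y j - s i)\<^sup>2)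
        = (\<Sum>j=1..n. W i j * (y j)\<^sup>2) - 2 * s i * (\<Sum>j=1..n. W i j * y j) + (\<Sum>j=1..n. W i j) * (s i)\<^sup>2"
      by (simp add: power2_diff algebra_simps sum.distrib sum_subtractf sum_distrib_left sum_distrib_right)
    also have "(\<Sum>j=1..n. W i j * y j) = s i" by (simp add: s_def)
    finally show ?thesis
      unfolding doubly_stochastic(1)[OF i] by (simp add: power2_eq_square)
  qed
  then have "(\<Sum>i=1..n. \<Sum>j=1..n. W i j * (y j - s i)\<^sup>2)
      = (\<Sum>i=1..n. \<Sum>j=1..n. W i j * (y j)\<^sup>2) - (\<Sum>i=1..n. (s i)\<^sup>2)"
    by (simp add: sum_subtractf)
  also have "(\<Sum>i=1..n. \<Sum>j=1..n. W i j * (y j)\<^sup>2) = (\<Sum>j=1..n. (\<Sum>i=1..n. W i j) * (y j)\<^sup>2)"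
    by (subst sum.swap) (simp add: sum_distrib_right)
  also have "\<dots> = (\<Sum>j=1..n. (y j)\<^sup>2)"
    using doubly_stochastic(2) by simp
  finally show ?thesis .
qed

lemma mixing_gap:
  obtains c where "0 < c"
    "\<And>y :: nat \<Rightarrow> real. (\<Sum>j=1..n. y j) = 0 \<Longrightarrow>
      (\<Sum>i=1..n. (\<Sum>j=1..n. W i j * y j)\<^sup>2) \<le> (1 - c) * (\<Sum>j=1..n. (y j)\<^sup>2)"
proof -
  obtain k where k: "k \<ge> 1" "\<And>i j. i \<in> {1..n} \<Longrightarrow> j \<in> {1..n} \<Longrightarrow> mat_pow n W k i j > 0"
    using primitive by blast
  let ?S = "(\<lambda>(i, j). if W i j > 0 then W i j else 1) ` ({1..n} \<times> {1..n})"
  define w where "w = Min ?S"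
  have S: "finite ?S" "?S \<noteq> {}" using n_pos by auto
  have w0: "w > 0" unfolding w_def using S by (subst Min_gr_iff) auto
  have w: "w \<le> W i j" if "i \<in> {1..n}" "j \<in> {1..n}" "W i j > 0" for i j
    unfolding w_def using that S by (intro Min_le) (auto intro!: image_eqI[of _ _ "(i, j)"])
  define c where "c = w / (4 * real n * (real k)\<^sup>2)"
  have c0: "c > 0" using w0 k n_pos by (simp add: c_def)
  have main: "(\<Sum>i=1..n. (\<Sum>j=1..n. W i j * y j)\<^sup>2) \<le> (1 - c) * (\<Sum>j=1..n. (y j)\<^sup>2)"
    if y0: "(\<Sum>j=1..n. y j) = 0" for y :: "nat \<Rightarrow> real"
  proof -
    define s where "s = (\<lambda>i. \<Sum>j=1..n. W i j * y j)"
    define T where "T = (\<Sum>i=1..n. \<Sum>j=1..n. W i j * (y j - s i)\<^sup>2)"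
    define \<tau> where "\<tau> = sqrt (4 * T / w)"
    have pos: "0 \<le> W i j * (y j - s i)\<^sup>2" if "i \<in> {1..n}" "j \<in> {1..n}" for i j
      using W_nonneg[OF that] by simp
    have T0: "0 \<le> T" unfolding T_def by (intro sum_nonneg pos)
    have wT: "w * (y j - s i)\<^sup>2 \<le> T" if ij: "i \<in> {1..n}" "j \<in> {1..n}" "W i j > 0" for i j
    proof -
      have "w * (y j - s i)\<^sup>2 \<le> W i j * (y j - s i)\<^sup>2"
        using w[OF ij] by (intro mult_right_mono) auto
      also have "\<dots> \<le> (\<Sum>j=1..n. W i j * (y j - s i)\<^sup>2)"
        using ij pos by (intro member_le_sum[of j]) auto
      also have "\<dots> \<le> T" unfolding T_def
        using ij pos by (intro member_le_sum[of i "{1..n}" "\<lambda>i. \<Sum>j=1..n. W i j * (y j - s i)\<^sup>2"])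
          (auto intro!: sum_nonneg)
      finally show ?thesis .
    qed
    \<comment> \<open>Both \<open>y i\<close> and \<open>y j\<close> occur in the average \<open>s i\<close>, the former by the positive diagonal.\<close>
    have edge: "\<bar>y i - y j\<bar> \<le> \<tau>" if ij: "i \<in> {1..n}" "j \<in> {1..n}" "W i j > 0" for i j
    proof -
      have "w * (y i - y j)\<^sup>2 \<le> w * (2 * (y i - s i)\<^sup>2 + 2 * (y j - s i)\<^sup>2)"
        using norm_diff_sq[of "y i - s i" "y j - s i"] w0 by (intro mult_left_mono) auto
      also have "\<dots> \<le> 4 * T"
        using wT[OF ij] wT[OF ij(1) ij(1) W_diag_pos[OF ij(1)]] by (simp add: algebra_simps)
      finally have "(y i - y j)\<^sup>2 \<le> 4 * T / w" using w0 by (simp add: field_simps)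
      then show ?thesis unfolding \<tau>_def by (metis real_sqrt_abs real_sqrt_le_mono)
    qed
    have path: "mat_pow n W l i j > 0 \<Longrightarrow> i \<in> {1..n} \<Longrightarrow> \<bar>y i - y j\<bar> \<le> real l * \<tau>"
      if "j \<in> {1..n}" for l i j
    proof (induction l arbitrary: i)
      case 0
      then show ?case by (auto split: if_splits)
    next
      case (Suc l)
      have "\<exists>h\<in>{1..n}. W i h * mat_pow n W l h j > 0"
      proof (rule ccontr)
        assume "\<not> ?thesis"
        then have "(\<Sum>h=1..n. W i h * mat_pow n W l h j) \<le> 0" by (intro sum_nonpos) force
        then show False using Suc.prems by simp
      qed
      then obtain h where h: "h \<in> {1..n}" "W i h * mat_pow n W l h j > 0" by blast
      then have "W i h > 0" "mat_pow n W l h j > 0"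
        using W_nonneg[OF Suc.prems(2) h(1)] by (auto simp: zero_less_mult_iff)
      then show ?case using edge[OF Suc.prems(2) h(1)] Suc.IH[of h] h(1)
        by (simp add: algebra_simps)
    qed
    have ybound: "\<bar>y i\<bar> \<le> real k * \<tau>" if i: "i \<in> {1..n}" for i
    proof -
      have "real n * y i = (\<Sum>j=1..n. y i - y j)" using y0 by (simp add: sum_subtractf)
      then have "real n * \<bar>y i\<bar> = \<bar>\<Sum>j=1..n. y i - y j\<bar>" by (metis abs_mult abs_of_nat)
      also have "\<dots> \<le> (\<Sum>j=1..n. real k * \<tau>)"
        using path k(2) i by (intro order_trans[OF sum_abs] sum_mono) auto
      finally show ?thesis using n_pos by simp
    qed
    have "(\<Sum>j=1..n. (y j)\<^sup>2) \<le> (\<Sum>j=1..n. (real k * \<tau>)\<^sup>2)"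
      using ybound by (intro sum_mono) (metis abs_ge_zero power2_abs power_mono)
    also have "\<dots> = T / c"
      using T0 w0 k n_pos by (simp add: \<tau>_def c_def power_mult_distrib field_simps)
    finally have "c * (\<Sum>j=1..n. (y j)\<^sup>2) \<le> T" using c0 by (simp add: field_simps)
    then show ?thesis
      using mixing_loss[of y] by (simp add: T_def s_def algebra_simps)
  qed
  show ?thesis by (rule that[OF c0 main])
qed

lemma centred_row:
  assumes i: "i \<in> {1..n}"
  shows "(\<Sum>j=1..n. (W i j - 1 / real n) *\<^sub>R y j)
      = (\<Sum>j=1..n. W i j *\<^sub>R (y j - (1 / real n) *\<^sub>R (\<Sum>j=1..n. y j :: 'b::real_vector)))"
  using doubly_stochastic(1)[OF i]
  by (simp add: scaleR_left_diff_distrib scaleR_right_diff_distrib sum_subtractf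
      scaleR_sum_left[symmetric] scaleR_sum_right[symmetric] sum_divide_distrib[symmetric])

lemma consensus_rho_bounds: "0 \<le> consensus_rho n W" "consensus_rho n W < 1"
proof -
  show "0 \<le> consensus_rho n W" unfolding consensus_rho_def by (rule spectral_norm_nonneg)
  obtain c where c: "0 < c" "\<And>y :: nat \<Rightarrow> real. (\<Sum>j=1..n. y j) = 0 \<Longrightarrow>
      (\<Sum>i=1..n. (\<Sum>j=1..n. W i j * y j)\<^sup>2) \<le> (1 - c) * (\<Sum>j=1..n. (y j)\<^sup>2)"
    using mixing_gap by blast
  define q where "q = max 0 (1 - c)"
  have "consensus_rho n W \<le> sqrt q"
    unfolding consensus_rho_def spectral_norm_def
  proof (rule onorm_bound)
    fix v
    define y where "y j = coord v j - 1 / real n * (\<Sum>j=1..n. coord v j)" for j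
    have y0: "(\<Sum>j=1..n. y j) = 0" using n_pos by (simp add: y_def sum_subtractf)
    have "(norm (mat_op n (\<lambda>i j. W i j - 1 / real n) v))\<^sup>2
        = (\<Sum>i=1..n. (\<Sum>j=1..n. W i j * y j)\<^sup>2)"
      using centred_row[of _ "\<lambda>j. coord v j"]
      by (simp add: mat_op_def norm_vec_on L2_set_def sum_nonneg y_def)
    also have "\<dots> \<le> (1 - c) * (\<Sum>j=1..n. (y j)\<^sup>2)" by (rule c(2)[OF y0])
    also have "\<dots> \<le> q * (\<Sum>j=1..n. (y j)\<^sup>2)"
      by (intro mult_right_mono sum_nonneg) (auto simp: q_def)
    also have "(\<Sum>j=1..n. (y j)\<^sup>2) \<le> (\<Sum>j=1..n. (coord v j)\<^sup>2)"
      using sum_deviation_sq[of "{1..n}" "\<lambda>j. coord v j"] n_pos by (simp add: y_def)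
    also have "(\<Sum>j=1..n. (coord v j)\<^sup>2) \<le> (norm v)\<^sup>2"
    proof -
      have fin: "finite ({1..n} \<union> {j. coord v j \<noteq> 0})" by (simp add: finite_coord)
      have "(norm v)\<^sup>2 = (\<Sum>j\<in>{1..n} \<union> {j. coord v j \<noteq> 0}. coord v j * coord v j)"
        unfolding power2_norm_eq_inner by (rule inner_rvec_superset[OF fin]) simp
      moreover have "(\<Sum>j=1..n. coord v j * coord v j) \<le> \<dots>"
        by (rule sum_mono2[OF fin]) auto
      ultimately show ?thesis by (simp add: power2_eq_square)
    qed
    finally have "(norm (mat_op n (\<lambda>i j. W i j - 1 / real n) v))\<^sup>2 \<le> q * (norm v)\<^sup>2"
      by (simp add: mult_left_mono q_def)
    then have "sqrt ((norm (mat_op n (\<lambda>i j. W i j - 1 / real n) v))\<^sup>2) \<le> sqrt (q * (norm v)\<^sup>2)"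
      by (rule real_sqrt_le_mono)
    then show "norm (mat_op n (\<lambda>i j. W i j - 1 / real n) v) \<le> sqrt q * norm v"
      by (simp add: real_sqrt_mult)
  qed (simp add: q_def)
  also have "\<dots> < 1" using c(1) by (simp add: q_def)
  finally show "consensus_rho n W < 1" .
qed

definition mix :: "(nat \<Rightarrow> rvec) \<Rightarrow> nat \<Rightarrow> rvec" where
  "mix y i = (\<Sum>j=1..n. W i j *\<^sub>R y j)"

definition spread :: "(nat \<Rightarrow> rvec) \<Rightarrow> real" where
  "spread y = 1 / real n * (\<Sum>i=1..n. (norm (y i - node_avg n y))\<^sup>2)"

lemma spread_nonneg: "0 \<le> spread y"
  by (simp add: spread_def sum_nonneg)

lemma spread_cong: "(\<And>i. i \<in> {1..n} \<Longrightarrow> y i = z i) \<Longrightarrow> spread y = spread z"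
  by (simp add: spread_def node_avg_def)

lemma spread_scaleR: "spread (\<lambda>i. c *\<^sub>R y i) = c\<^sup>2 * spread y"
  by (simp add: spread_def node_avg_scaleR scaleR_diff_right[symmetric] power_mult_distrib
      sum_distrib_left[symmetric])

lemma spread_le: "spread y \<le> 1 / real n * (\<Sum>i=1..n. (norm (y i))\<^sup>2)"
proof -
  have "(\<Sum>i=1..n. (norm (y i - node_avg n y))\<^sup>2) \<le> (\<Sum>i=1..n. (norm (y i))\<^sup>2)"
    using sum_deviation_sq[of "{1..n}" y] n_pos by (simp add: node_avg_def)
  then show ?thesis by (simp add: spread_def divide_right_mono)
qed

lemma norm_node_avg_sq_le: "(norm (node_avg n y))\<^sup>2 \<le> 1 / real n * (\<Sum>i=1..n. (norm (y i))\<^sup>2)"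
proof -
  have "0 \<le> (\<Sum>i=1..n. (norm (y i - node_avg n y))\<^sup>2)" by (simp add: sum_nonneg)
  also have "\<dots> = (\<Sum>i=1..n. (norm (y i))\<^sup>2) - real n * (norm (node_avg n y))\<^sup>2"
    using sum_deviation_sq[of "{1..n}" y] n_pos by (simp add: node_avg_def)
  finally show ?thesis using n_pos by (simp add: field_simps)
qed

lemma node_avg_mix: "node_avg n (mix y) = node_avg n y"
proof -
  have "(\<Sum>i=1..n. mix y i) = (\<Sum>j=1..n. (\<Sum>i=1..n. W i j) *\<^sub>R y j)"
    unfolding mix_def by (subst sum.swap) (simp add: scaleR_sum_left)
  also have "\<dots> = (\<Sum>j=1..n. y j)" using doubly_stochastic(2) by simp
  finally show ?thesis by (simp add: node_avg_def)
qed

text \<open>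
  The rows of \<open>W - 1/n\<close> sum to zero. Therefore \<open>W - 1/n\<close>, applied to the deviations of the vectors from
  their mean, gives the deviations of the mixed vectors from the same mean.
\<close>

lemma spread_mix:
  assumes y: "\<And>j. j \<in> {1..n} \<Longrightarrow> y j \<in> euclid d"
  shows "spread (mix y) \<le> (consensus_rho n W)\<^sup>2 * spread y"
proof -
  let ?z = "\<lambda>j. y j - node_avg n y"
  have z: "?z j \<in> euclid d" if "j \<in> {1..n}" for j
    using y that by (intro euclid_diff node_avg_euclid) auto
  have "mix y i - node_avg n y = (\<Sum>j=1..n. (W i j - 1 / real n) *\<^sub>R ?z j)" if i: "i \<in> {1..n}" for i
  proof -
    have "(\<Sum>j=1..n. ?z j) = 0"
      using n_pos by (simp add: node_avg_def sum_subtractf sum_constant_scaleR)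
    then show ?thesis
      using centred_row[OF i, of ?z] doubly_stochastic(1)[OF i]
      by (simp add: mix_def scaleR_diff_right sum_subtractf scaleR_sum_left[symmetric])
  qed
  then have "(\<Sum>i=1..n. (norm (mix y i - node_avg n (mix y)))\<^sup>2)
      = (\<Sum>i=1..n. (norm (\<Sum>j=1..n. (W i j - 1 / real n) *\<^sub>R ?z j))\<^sup>2)"
    by (simp add: node_avg_mix)
  also have "\<dots> \<le> (consensus_rho n W)\<^sup>2 * (\<Sum>j=1..n. (norm (?z j))\<^sup>2)"
    unfolding consensus_rho_def by (rule spectral_norm_vectors[OF z])
  finally show ?thesis using n_pos by (simp add: spread_def field_simps)
qed

lemma spread_mix_add:
  assumes y: "\<And>j. j \<in> {1..n} \<Longrightarrow> y j \<in> euclid d" and w: "\<And>j. j \<in> {1..n} \<Longrightarrow> w j \<in> euclid d"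
  defines "\<rho> \<equiv> consensus_rho n W"
  defines "r \<equiv> (1 - \<rho>\<^sup>2) / 2"
  shows "spread (mix (\<lambda>j. y j + w j)) \<le> (1 - r) * spread y + \<rho>\<^sup>2 / r * spread w"
proof -
  have "spread (mix (\<lambda>j. y j + w j)) \<le> \<rho>\<^sup>2 * spread (\<lambda>j. y j + w j)"
    unfolding \<rho>_def by (rule spread_mix) (use y w in auto)
  also have "\<dots> = 1 / real n * (\<Sum>i=1..n. \<rho>\<^sup>2 * (norm ((y i - node_avg n y) + (w i - node_avg n w)))\<^sup>2)"
    by (simp add: spread_def node_avg_add sum_distrib_left algebra_simps)
  also have "\<dots> \<le> 1 / real n * (\<Sum>i=1..n. (1 - r) * (norm (y i - node_avg n y))\<^sup>2
      + \<rho>\<^sup>2 / r * (norm (w i - node_avg n w))\<^sup>2)"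
    using contraction_young[of \<rho>] consensus_rho_bounds
    by (intro mult_left_mono sum_mono) (auto simp: r_def \<rho>_def)
  also have "\<dots> = (1 - r) * spread y + \<rho>\<^sup>2 / r * spread w"
    unfolding spread_def sum.distrib sum_distrib_left[symmetric] by (simp only: distrib_left mult_ac)
  finally show ?thesis .
qed

end

section \<open>Samples and filtration of a run\<close>

locale dzovr_analysis =
  decentralized_problem n d E W \<Xi> F L \<sigma>0 \<sigma>1 \<sigma>2 \<sigma>3 +
  dzovr_run M n d W \<Xi> F x0 b0 \<alpha> \<beta> t u \<xi> x g m
  for n d :: nat and E W and \<Xi> :: "nat \<Rightarrow> 'x measure" and F L \<sigma>0 \<sigma>1 \<sigma>2 \<sigma>3
    and M :: "'w measure" and x0 b0 \<alpha> \<beta> t u \<xi> x g m +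
  assumes x0_euclid: "\<And>i. i \<in> {1..n} \<Longrightarrow> x0 i \<in> euclid d"
    and beta_pos: "0 < \<beta>"
    and radius_le: "\<And>k. t k \<le> \<beta> / (real d)\<^sup>2"
    and radius_decreasing: "\<And>k. t (Suc k) \<le> t k"
begin

abbreviation I where "I \<equiv> sample_index n b0"

definition Z :: "nat \<times> nat \<times> nat \<Rightarrow> 'w \<Rightarrow> rvec \<times> 'x" where
  "Z p \<omega> = (u p \<omega>, \<xi> p \<omega>)"

abbreviation zspace :: "nat \<times> nat \<times> nat \<Rightarrow> (rvec \<times> 'x) measure" where
  "zspace p \<equiv> borel \<Otimes>\<^sub>M \<Xi> (fst p)"

lemma index_node: "p \<in> I \<Longrightarrow> fst p \<in> {1..n}"
  by (auto simp: sample_index_def)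

lemma Z_measurable: "p \<in> I \<Longrightarrow> Z p \<in> measurable M (zspace p)"
  unfolding Z_def[abs_def] using u_law[of p] \<xi>_law[of "fst p" "fst (snd p)" "snd (snd p)"]
  by (intro measurable_Pair) auto

lemma Z_law:
  assumes p: "p \<in> I"
  shows "distr M (zspace p) (Z p) = law (fst p)"
proof -
  have i: "fst p \<in> {1..n}" by (rule index_node[OF p])
  interpret U: prob_space "unif_sphere d" by (rule prob_space_unif_sphere[OF d_pos])
  interpret X: prob_space "\<Xi> (fst p)" by (rule prob[OF i])
  have um: "u p \<in> borel_measurable M" "distr M borel (u p) = unif_sphere d"
    using u_law[OF p] by auto
  have xm: "\<xi> p \<in> measurable M (\<Xi> (fst p))" "distr M (\<Xi> (fst p)) (\<xi> p) = \<Xi> (fst p)"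
    using \<xi>_law[of "fst p" "fst (snd p)" "snd (snd p)"] p by auto
  have "unif_sphere d \<Otimes>\<^sub>M \<Xi> (fst p) = distr M (zspace p) (Z p)"
  proof (rule pair_measure_eqI)
    show "sigma_finite_measure (unif_sphere d)" "sigma_finite_measure (\<Xi> (fst p))" ..
    show "sets (unif_sphere d \<Otimes>\<^sub>M \<Xi> (fst p)) = sets (distr M (zspace p) (Z p))"
      using sets_law[of "fst p"] by (simp add: law_def)
    fix A B assume "A \<in> sets (unif_sphere d)" and B: "B \<in> sets (\<Xi> (fst p))"
    then have A: "A \<in> sets borel" by simp
    have "emeasure (unif_sphere d) A = prob {\<omega> \<in> space M. u p \<omega> \<in> A}"
      unfolding um(2)[symmetric] using um(1) A
      by (subst emeasure_distr) (auto simp: emeasure_eq_measure vimage_def Int_def conj_commute)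
    moreover have "emeasure (\<Xi> (fst p)) B = prob {\<omega> \<in> space M. \<xi> p \<omega> \<in> B}"
      by (subst xm(2)[symmetric], subst emeasure_distr[OF xm(1) B])
        (auto simp: emeasure_eq_measure vimage_def Int_def conj_commute)
    moreover have "emeasure (distr M (zspace p) (Z p)) (A \<times> B)
        = prob {\<omega> \<in> space M. u p \<omega> \<in> A \<and> \<xi> p \<omega> \<in> B}"
      using Z_measurable[OF p] A B
      by (subst emeasure_distr) (auto simp: emeasure_eq_measure vimage_def Int_def conj_commute Z_def)
    ultimately show "emeasure (unif_sphere d) A * emeasure (\<Xi> (fst p)) B
        = emeasure (distr M (zspace p) (Z p)) (A \<times> B)"
      using pair_indep[OF p A B] by (simp add: ennreal_mult)
  qed
  then show ?thesis by (simp add: law_def)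
qed

definition sample_events :: "nat \<times> nat \<times> nat \<Rightarrow> 'w set set" where
  "sample_events q = {Z q -` A \<inter> space M | A. A \<in> sets (zspace q)}"

definition filt :: "(nat \<times> nat \<times> nat) set \<Rightarrow> 'w measure" where
  "filt Q = sigma (space M) (\<Union>q\<in>Q. sample_events q)"

lemma sample_events_subset: "(\<Union>q\<in>Q. sample_events q) \<subseteq> Pow (space M)"
  by (auto simp: sample_events_def)

lemma space_filt [simp]: "space (filt Q) = space M"
  unfolding filt_def by (rule space_measure_of[OF sample_events_subset])

lemma sets_filt: "sets (filt Q) = sigma_sets (space M) (\<Union>q\<in>Q. sample_events q)"
  unfolding filt_def by (rule sets_measure_of[OF sample_events_subset])

lemma filt_mono: "Q \<subseteq> Q' \<Longrightarrow> f \<in> measurable (filt Q) N \<Longrightarrow> f \<in> measurable (filt Q') N"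
  by (rule measurable_from_subalg[rotated], assumption)
    (use sigma_sets_mono'[OF UN_mono[of Q Q' sample_events sample_events]]
      in \<open>simp add: subalgebra_def sets_filt\<close>)

lemma sets_filt_le: "Q \<subseteq> I \<Longrightarrow> sets (filt Q) \<subseteq> sets M"
  unfolding sets_filt using Z_measurable
  by (intro sets.sigma_sets_subset) (auto simp: sample_events_def intro: measurable_sets)

lemma measurable_filt_M: "Q \<subseteq> I \<Longrightarrow> f \<in> measurable (filt Q) N \<Longrightarrow> f \<in> measurable M N"
  by (rule measurable_from_subalg[rotated]) (auto simp: subalgebra_def dest: sets_filt_le)

lemma measurable_ident_filt: "Q \<subseteq> I \<Longrightarrow> (\<lambda>\<omega>. \<omega>) \<in> measurable M (filt Q)"
  using measurable_filt_M[OF _ measurable_ident] by (simp add: id_def)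

lemma Z_measurable_filt: "q \<in> Q \<Longrightarrow> Q \<subseteq> I \<Longrightarrow> Z q \<in> measurable (filt Q) (zspace q)"
  using measurable_space[OF Z_measurable[of q]]
  by (intro measurableI) (auto simp: sets_filt sample_events_def intro!: sigma_sets.Basic)

text \<open>
  Samples with different indices are independent, so the \<open>\<sigma>\<close>-algebras generated by disjoint sets of
  samples are independent.
\<close>

lemma indep_filt_sample:
  assumes p: "p \<in> I" "p \<notin> Q" and Q: "Q \<subseteq> I"
    and A: "A \<in> sets (filt Q)" and B: "B \<in> sets (zspace p)"
  shows "prob (A \<inter> (Z p -` B \<inter> space M)) = prob A * prob (Z p -` B \<inter> space M)"
proof -
  let ?J = "case_bool Q {p}"
  have base: "indep_sets sample_events I"
    using samples_indep unfolding indep_vars_def2 sample_events_def Z_def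
    by (simp add: case_prod_unfold)
  have "indep_sets (\<lambda>j. sigma_sets (space M) (\<Union>q\<in>?J j. sample_events q)) UNIV"
  proof (rule indep_sets_collect_sigma)
    show "indep_sets sample_events (\<Union>j\<in>UNIV. ?J j)"
      by (rule indep_sets_mono_index[OF _ base]) (use p Q in \<open>auto simp: UNIV_bool\<close>)
    show "Int_stable (sample_events q)" for q
    proof (rule Int_stableI)
      fix X Y assume "X \<in> sample_events q" "Y \<in> sample_events q"
      then obtain A B where "X = Z q -` A \<inter> space M" "A \<in> sets (zspace q)"
        "Y = Z q -` B \<inter> space M" "B \<in> sets (zspace q)"
        by (auto simp: sample_events_def)
      then show "X \<inter> Y \<in> sample_events q"
        unfolding sample_events_def by (intro CollectI exI[of _ "A \<inter> B"]) auto
    qed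
    show "disjoint_family_on ?J UNIV"
      using p by (auto simp: disjoint_family_on_def split: bool.splits)
  qed
  then have "indep_set (sets (filt Q)) (sigma_sets (space M) (sample_events p))"
    unfolding indep_set_def
    by (rule indep_sets_mono_sets) (auto simp: sets_filt split: bool.splits)
  then show ?thesis
    by (rule indep_setD[OF _ A]) (use B in \<open>auto simp: sample_events_def intro!: sigma_sets.Basic\<close>)
qed

text \<open>
  The identity map into \<open>filt Q\<close> serves as the random element that represents the past, so the iterates
  can remain functions on the probability space.
\<close>

lemma joint_law:
  assumes p: "p \<in> I" "p \<notin> Q" and Q: "Q \<subseteq> I"
  shows "distr M (filt Q \<Otimes>\<^sub>M zspace p) (\<lambda>\<omega>. (\<omega>, Z p \<omega>)) = distr M (filt Q) (\<lambda>\<omega>. \<omega>) \<Otimes>\<^sub>M law (fst p)"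
proof (rule pair_measure_eqI[symmetric])
  interpret law: prob_space "law (fst p)" by (rule prob_space_law[OF index_node[OF p(1)]])
  interpret P: prob_space "distr M (filt Q) (\<lambda>\<omega>. \<omega>)"
    by (rule prob_space_distr[OF measurable_ident_filt[OF Q]])
  show "sigma_finite_measure (distr M (filt Q) (\<lambda>\<omega>. \<omega>))" "sigma_finite_measure (law (fst p))" ..
  show "sets (distr M (filt Q) (\<lambda>\<omega>. \<omega>) \<Otimes>\<^sub>M law (fst p))
      = sets (distr M (filt Q \<Otimes>\<^sub>M zspace p) (\<lambda>\<omega>. (\<omega>, Z p \<omega>)))"
    by (simp cong: sets_pair_measure_cong)
  fix A B assume "A \<in> sets (distr M (filt Q) (\<lambda>\<omega>. \<omega>))" "B \<in> sets (law (fst p))"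
  then have A: "A \<in> sets (filt Q)" and B: "B \<in> sets (zspace p)" by simp_all
  have AM: "A \<in> sets M" using A sets_filt_le[OF Q] by blast
  then have sub: "A \<subseteq> space M" by (rule sets.sets_into_space)
  have "emeasure (distr M (filt Q) (\<lambda>\<omega>. \<omega>)) A = prob A"
    using A sub measurable_ident_filt[OF Q]
    by (subst emeasure_distr) (auto simp: emeasure_eq_measure vimage_def Int_absorb1 Int_absorb2)
  moreover have "emeasure (law (fst p)) B = prob (Z p -` B \<inter> space M)"
    unfolding Z_law[OF p(1), symmetric] using B Z_measurable[OF p(1)]
    by (subst emeasure_distr) (auto simp: emeasure_eq_measure)
  moreover have "emeasure (distr M (filt Q \<Otimes>\<^sub>M zspace p) (\<lambda>\<omega>. (\<omega>, Z p \<omega>))) (A \<times> B)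
      = prob (A \<inter> (Z p -` B \<inter> space M))"
    using A B sub measurable_Pair[OF measurable_ident_filt[OF Q] Z_measurable[OF p(1)]]
    by (subst emeasure_distr)
      (auto simp: emeasure_eq_measure vimage_def Int_def intro!: arg_cong[where f = prob])
  ultimately show "emeasure (distr M (filt Q) (\<lambda>\<omega>. \<omega>)) A * emeasure (law (fst p)) B
      = emeasure (distr M (filt Q \<Otimes>\<^sub>M zspace p) (\<lambda>\<omega>. (\<omega>, Z p \<omega>))) (A \<times> B)"
    using indep_filt_sample[OF p Q A B] by (simp add: ennreal_mult)
qed

lemma measurable_graph:
  "p \<in> I \<Longrightarrow> Q \<subseteq> I \<Longrightarrow> (\<lambda>\<omega>. (\<omega>, Z p \<omega>)) \<in> measurable M (filt Q \<Otimes>\<^sub>M zspace p)"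
  by (intro measurable_Pair measurable_ident_filt Z_measurable)

text \<open>
  Freezing the past: a sample that was not used to generate \<open>filt Q\<close> may be integrated out with
  respect to its own law.
\<close>

lemma nn_integral_fresh_sample:
  assumes p: "p \<in> I" "p \<notin> Q" and Q: "Q \<subseteq> I"
    and h: "h \<in> borel_measurable (filt Q \<Otimes>\<^sub>M zspace p)"
  shows "(\<integral>\<^sup>+\<omega>. h (\<omega>, Z p \<omega>) \<partial>M) = (\<integral>\<^sup>+\<omega>. \<integral>\<^sup>+z. h (\<omega>, z) \<partial>law (fst p) \<partial>M)"
proof -
  interpret law: prob_space "law (fst p)" by (rule prob_space_law[OF index_node[OF p(1)]])
  note [measurable] = measurable_graph[OF p(1) Q] measurable_ident_filt[OF Q] h
  have "sets (filt Q \<Otimes>\<^sub>M law (fst p)) = sets (filt Q \<Otimes>\<^sub>M zspace p)"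
    by (rule sets_pair_measure_cong) simp_all
  then have h' [measurable]: "h \<in> borel_measurable (filt Q \<Otimes>\<^sub>M law (fst p))"
    using h measurable_cong_sets by blast
  have "sets (distr M (filt Q) (\<lambda>\<omega>. \<omega>) \<Otimes>\<^sub>M law (fst p)) = sets (filt Q \<Otimes>\<^sub>M zspace p)"
    by (rule sets_pair_measure_cong) simp_all
  then have h'': "h \<in> borel_measurable (distr M (filt Q) (\<lambda>\<omega>. \<omega>) \<Otimes>\<^sub>M law (fst p))"
    using h measurable_cong_sets by blast
  have "(\<integral>\<^sup>+\<omega>. h (\<omega>, Z p \<omega>) \<partial>M) = (\<integral>\<^sup>+q. h q \<partial>distr M (filt Q \<Otimes>\<^sub>M zspace p) (\<lambda>\<omega>. (\<omega>, Z p \<omega>)))"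
    by (subst nn_integral_distr) simp_all
  also have "\<dots> = (\<integral>\<^sup>+q. h q \<partial>(distr M (filt Q) (\<lambda>\<omega>. \<omega>) \<Otimes>\<^sub>M law (fst p)))"
    by (simp only: joint_law[OF p Q])
  also have "\<dots> = (\<integral>\<^sup>+\<omega>. \<integral>\<^sup>+z. h (\<omega>, z) \<partial>law (fst p) \<partial>distr M (filt Q) (\<lambda>\<omega>. \<omega>))"
    by (rule law.nn_integral_fst[OF h'', symmetric])
  also have "\<dots> = (\<integral>\<^sup>+\<omega>. \<integral>\<^sup>+z. h (\<omega>, z) \<partial>law (fst p) \<partial>M)"
    by (subst nn_integral_distr) simp_all
  finally show ?thesis .
qed

lemma fresh_sample_second_moment:
  assumes p: "p \<in> I" "p \<notin> Q" and Q: "Q \<subseteq> I"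
    and H: "H \<in> borel_measurable (filt Q \<Otimes>\<^sub>M zspace p)"
    and b: "integrable M b"
    and le: "\<And>\<omega>. \<omega> \<in> space M \<Longrightarrow> sq_integrable (law (fst p)) (\<lambda>z. H (\<omega>, z)) \<and>
        (\<integral>z. (norm (H (\<omega>, z)))\<^sup>2 \<partial>law (fst p)) \<le> b \<omega>"
  shows "sq_integrable M (\<lambda>\<omega>. H (\<omega>, Z p \<omega>))"
    and "(\<integral>\<omega>. (norm (H (\<omega>, Z p \<omega>)))\<^sup>2 \<partial>M) \<le> (\<integral>\<omega>. b \<omega> \<partial>M)"
proof -
  have b0: "0 \<le> b \<omega>" if "\<omega> \<in> space M" for \<omega>
  proof -
    have "0 \<le> (\<integral>z. (norm (H (\<omega>, z)))\<^sup>2 \<partial>law (fst p))"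
      by (rule Bochner_Integration.integral_nonneg) simp
    then show ?thesis using le[OF that] by linarith
  qed
  have "(\<integral>\<^sup>+\<omega>. ennreal ((norm (H (\<omega>, Z p \<omega>)))\<^sup>2) \<partial>M)
      = (\<integral>\<^sup>+\<omega>. \<integral>\<^sup>+z. ennreal ((norm (H (\<omega>, z)))\<^sup>2) \<partial>law (fst p) \<partial>M)"
    using H by (intro nn_integral_fresh_sample[OF p Q, of "\<lambda>q. ennreal ((norm (H q))\<^sup>2)"]) measurable
  also have "\<dots> \<le> (\<integral>\<^sup>+\<omega>. ennreal (b \<omega>) \<partial>M)"
  proof (rule nn_integral_mono)
    fix \<omega> assume "\<omega> \<in> space M"
    then show "(\<integral>\<^sup>+z. ennreal ((norm (H (\<omega>, z)))\<^sup>2) \<partial>law (fst p)) \<le> ennreal (b \<omega>)"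
      using le[of \<omega>] by (subst nn_integral_eq_integral) (auto intro: sq_integrable_integrable ennreal_leI)
  qed
  also have "\<dots> = ennreal (\<integral>\<omega>. b \<omega> \<partial>M)"
    using b b0 by (intro nn_integral_eq_integral) auto
  finally have nn: "(\<integral>\<^sup>+\<omega>. ennreal ((norm (H (\<omega>, Z p \<omega>)))\<^sup>2) \<partial>M) \<le> ennreal (\<integral>\<omega>. b \<omega> \<partial>M)" .
  have meas: "(\<lambda>\<omega>. H (\<omega>, Z p \<omega>)) \<in> borel_measurable M"
    by (rule measurable_compose[OF measurable_graph[OF p(1) Q] H])
  show sq: "sq_integrable M (\<lambda>\<omega>. H (\<omega>, Z p \<omega>))"
    using nn by (intro sq_integrableI_nn[OF meas]) (auto intro: le_less_trans)
  have "ennreal (\<integral>\<omega>. (norm (H (\<omega>, Z p \<omega>)))\<^sup>2 \<partial>M) \<le> ennreal (\<integral>\<omega>. b \<omega> \<partial>M)"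
    using nn sq_integrable_integrable[OF sq] by (simp add: nn_integral_eq_integral)
  moreover have "0 \<le> (\<integral>\<omega>. b \<omega> \<partial>M)" using b0 by (intro Bochner_Integration.integral_nonneg_AE) auto
  ultimately show "(\<integral>\<omega>. (norm (H (\<omega>, Z p \<omega>)))\<^sup>2 \<partial>M) \<le> (\<integral>\<omega>. b \<omega> \<partial>M)"
    by (subst (asm) ennreal_le_iff) auto
qed

text \<open>
  Conditionally centred increments are orthogonal to everything measurable with respect to the past.
\<close>

lemma fresh_sample_orthogonal:
  assumes p: "p \<in> I" "p \<notin> Q" and Q: "Q \<subseteq> I"
    and H: "H \<in> borel_measurable (filt Q \<Otimes>\<^sub>M zspace p)" "sq_integrable M (\<lambda>\<omega>. H (\<omega>, Z p \<omega>))"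
    and V: "V \<in> borel_measurable (filt Q)" "sq_integrable M V"
    and centred: "\<And>\<omega>. \<omega> \<in> space M \<Longrightarrow> (\<integral>z. V \<omega> \<bullet> H (\<omega>, z) \<partial>law (fst p)) = 0"
  shows "(\<integral>\<omega>. V \<omega> \<bullet> H (\<omega>, Z p \<omega>) \<partial>M) = 0"
proof -
  interpret law: prob_space "law (fst p)" by (rule prob_space_law[OF index_node[OF p(1)]])
  let ?P = "distr M (filt Q) (\<lambda>\<omega>. \<omega>)"
  interpret R: prob_space ?P by (rule prob_space_distr[OF measurable_ident_filt[OF Q]])
  interpret RL: pair_prob_space ?P "law (fst p)" ..
  let ?h = "\<lambda>q. V (fst q) \<bullet> H q"
  note [measurable] = measurable_graph[OF p(1) Q] H(1) V(1)
  have h: "?h \<in> borel_measurable (filt Q \<Otimes>\<^sub>M zspace p)" by measurable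
  have int: "integrable M (\<lambda>\<omega>. ?h (\<omega>, Z p \<omega>))"
    using sq_integrable_inner[OF V(2) H(2)] by simp
  have "integrable (distr M (filt Q \<Otimes>\<^sub>M zspace p) (\<lambda>\<omega>. (\<omega>, Z p \<omega>))) ?h"
    using int h by (subst integrable_distr_eq) simp_all
  then have int': "integrable (?P \<Otimes>\<^sub>M law (fst p)) ?h" by (simp only: joint_law[OF p Q])
  have "(\<integral>\<omega>. V \<omega> \<bullet> H (\<omega>, Z p \<omega>) \<partial>M)
      = (\<integral>q. ?h q \<partial>distr M (filt Q \<Otimes>\<^sub>M zspace p) (\<lambda>\<omega>. (\<omega>, Z p \<omega>)))"
    using h by (subst integral_distr) simp_all
  also have "\<dots> = (\<integral>q. ?h q \<partial>(?P \<Otimes>\<^sub>M law (fst p)))" by (simp only: joint_law[OF p Q])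
  also have "\<dots> = (\<integral>\<omega>. (\<integral>z. ?h (\<omega>, z) \<partial>law (fst p)) \<partial>?P)"
    using RL.integral_fst'[OF int'] by simp
  also have "\<dots> = (\<integral>\<omega>. 0 \<partial>?P)"
    using centred by (intro Bochner_Integration.integral_cong) auto
  finally show ?thesis by simp
qed

section \<open>Adaptedness and finite second moments\<close>

definition past :: "nat \<Rightarrow> (nat \<times> nat \<times> nat) set" where
  "past k = {p \<in> I. fst (snd p) < k}"

lemma past_subset: "past k \<subseteq> I"
  by (auto simp: past_def)

lemma past_mono: "k \<le> l \<Longrightarrow> past k \<subseteq> past l"
  by (auto simp: past_def)

lemma init_index: "i \<in> {1..n} \<Longrightarrow> s \<in> {1..b0} \<Longrightarrow> (i, 0, s) \<in> I"
  and step_index: "i \<in> {1..n} \<Longrightarrow> (i, Suc k, 1) \<in> I"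
  by (auto simp: sample_index_def)

definition mprev :: "nat \<Rightarrow> nat \<Rightarrow> 'w \<Rightarrow> rvec" where
  "mprev k i \<omega> = (if k = 0 then 0 else m (k - 1) i \<omega>)"

lemma mprev_Suc [simp]: "mprev (Suc k) i \<omega> = m k i \<omega>"
  and mprev_0 [simp]: "mprev 0 i \<omega> = 0"
  by (simp_all add: mprev_def)

lemma g_Suc: "i \<in> {1..n} \<Longrightarrow> \<omega> \<in> space M \<Longrightarrow>
    g (Suc k) i \<omega> = mix (\<lambda>j. g k j \<omega> + (m k j \<omega> - mprev k j \<omega>)) i"
  by (simp add: g_step mix_def mprev_def add_diff_eq)

lemma x_Suc: "i \<in> {1..n} \<Longrightarrow> \<omega> \<in> space M \<Longrightarrow>
    x (Suc k) i \<omega> = mix (\<lambda>j. x k j \<omega> + (- \<alpha>) *\<^sub>R g (Suc k) j \<omega>) i"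
  by (simp add: x_step mix_def)

lemma mix_euclid: "(\<And>j. j \<in> {1..n} \<Longrightarrow> y j \<in> euclid d) \<Longrightarrow> mix y i \<in> euclid d"
  unfolding mix_def by (intro euclid_sum) auto

lemma zo_grad_euclid: "v \<in> unit_sphere d \<Longrightarrow> zo_grad d r \<phi> y v z \<in> euclid d"
  by (auto simp: zo_grad_def unit_sphere_def)

lemma iterates_euclid:
  assumes \<omega>: "\<omega> \<in> space M"
  shows "i \<in> {1..n} \<Longrightarrow> x k i \<omega> \<in> euclid d" (is "_ \<Longrightarrow> ?x k i")
    and "i \<in> {1..n} \<Longrightarrow> g k i \<omega> \<in> euclid d" (is "_ \<Longrightarrow> ?g k i")
    and "i \<in> {1..n} \<Longrightarrow> m k i \<omega> \<in> euclid d" (is "_ \<Longrightarrow> ?m k i")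
    and "i \<in> {1..n} \<Longrightarrow> mprev k i \<omega> \<in> euclid d" (is "_ \<Longrightarrow> ?p k i")
proof -
  have "\<forall>i\<in>{1..n}. ?x k i \<and> ?g k i \<and> ?m k i \<and> ?p k i"
  proof (induction k)
    case 0
    then show ?case
      using \<omega> by (auto simp: x_init g_init m_init x0_euclid intro!: euclid_scaleR euclid_sum zo_grad_euclid
          u_sphere init_index)
  next
    case (Suc k)
    have g': "?g (Suc k) i" if "i \<in> {1..n}" for i
      using Suc that \<omega> by (subst g_Suc) (auto intro!: mix_euclid euclid_add euclid_diff)
    have x': "?x (Suc k) i" if "i \<in> {1..n}" for i
      using Suc that \<omega> g' by (subst x_Suc) (auto intro!: mix_euclid euclid_add euclid_scaleR simp del: scaleR_minus_left)
    have m': "?m (Suc k) i" if "i \<in> {1..n}" for i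
      using Suc that \<omega> u_sphere[OF step_index[OF that] \<omega>, of k]
      by (subst m_step) (auto intro!: euclid_add euclid_diff euclid_scaleR zo_grad_euclid)
    show ?case using g' x' m' Suc by auto
  qed
  then show "i \<in> {1..n} \<Longrightarrow> ?x k i" "i \<in> {1..n} \<Longrightarrow> ?g k i" "i \<in> {1..n} \<Longrightarrow> ?m k i" "i \<in> {1..n} \<Longrightarrow> ?p k i"
    by auto
qed

lemma m_init_est:
  assumes "i \<in> {1..n}" "\<omega> \<in> space M"
  shows "m 0 i \<omega> = (1 / real b0) *\<^sub>R (\<Sum>s=1..b0. est (t 0) i (x0 i) (Z (i, 0, s) \<omega>))"
  using assms by (simp add: m_init x_init Z_def est_eq_zo_grad x0_euclid u_sphere init_index)

lemma m_Suc_est: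
  fixes k :: nat
  assumes i: "i \<in> {1..n}" and \<omega>: "\<omega> \<in> space M"
  defines "p \<equiv> (i, Suc k, 1)" and "r \<equiv> t (Suc k)"
  shows "m (Suc k) i \<omega> = est r i (x (Suc k) i \<omega>) (Z p \<omega>)
      + (1 - \<beta>) *\<^sub>R (m k i \<omega> - est r i (x k i \<omega>) (Z p \<omega>))"
proof -
  have *: "est r i (x l i \<omega>) (Z p \<omega>) = zo_grad d r (F i) (x l i \<omega>) (u p \<omega>) (\<xi> p \<omega>)" for l
    unfolding Z_def p_def
    using iterates_euclid(1)[OF \<omega> i] u_sphere[OF step_index[OF i] \<omega>] by (intro est_eq_zo_grad)
  show ?thesis
    unfolding * using m_step[of "Suc k" i \<omega>] i \<omega>
    by (simp add: p_def r_def algebra_simps)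
qed

lemma est_filt_measurable:
  assumes "i \<in> {1..n}" "f \<in> borel_measurable N" "h \<in> measurable N (zspace (i, k, s))"
  shows "(\<lambda>\<omega>. est r i (f \<omega>) (h \<omega>)) \<in> borel_measurable N"
  by (rule est_measurable_compose) (use assms in auto)

text \<open>
  The direction \<open>m k\<close> uses the samples of iteration \<open>k\<close>, whereas \<open>x k\<close> and \<open>g k\<close> do not.
\<close>

lemma iterates_adapted:
  shows x_adapted: "i \<in> {1..n} \<Longrightarrow> x k i \<in> borel_measurable (filt (past k))"
    and g_adapted: "i \<in> {1..n} \<Longrightarrow> g k i \<in> borel_measurable (filt (past k))"
    and m_adapted: "i \<in> {1..n} \<Longrightarrow> m k i \<in> borel_measurable (filt (past (Suc k)))"
    and mprev_adapted: "i \<in> {1..n} \<Longrightarrow> mprev k i \<in> borel_measurable (filt (past k))"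
proof -
  have "\<forall>i\<in>{1..n}. x k i \<in> borel_measurable (filt (past k)) \<and> g k i \<in> borel_measurable (filt (past k))
      \<and> m k i \<in> borel_measurable (filt (past (Suc k))) \<and> mprev k i \<in> borel_measurable (filt (past k))"
  proof (induction k)
    case 0
    have "m 0 i \<in> borel_measurable (filt (past (Suc 0)))" if i: "i \<in> {1..n}" for i
    proof -
      have z: "Z (i, 0, s) \<in> measurable (filt (past (Suc 0))) (zspace (i, 0, s))" if "s \<in> {1..b0}" for s
        using init_index[OF i that] by (intro Z_measurable_filt past_subset) (auto simp: past_def)
      have "(\<lambda>\<omega>. (1 / real b0) *\<^sub>R (\<Sum>s=1..b0. est (t 0) i (x0 i) (Z (i, 0, s) \<omega>)))
          \<in> borel_measurable (filt (past (Suc 0)))"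
        by (intro borel_measurable_scaleR borel_measurable_const borel_measurable_sum
            est_filt_measurable[OF i _ z])
      then show ?thesis
        by (rule measurable_cong[THEN iffD1, rotated]) (rule m_init_est[OF i, symmetric], simp)
    qed
    moreover have "x 0 i \<in> borel_measurable (filt (past 0))" if "i \<in> {1..n}" for i
      by (rule measurable_cong[THEN iffD1, OF _ borel_measurable_const[of "x0 i"]])
        (rule x_init[OF that, symmetric], simp)
    moreover have "g 0 i \<in> borel_measurable (filt (past 0))" if "i \<in> {1..n}" for i
      by (rule measurable_cong[THEN iffD1, OF _ borel_measurable_const[of "0"]])
        (rule g_init[OF that, symmetric], simp)
    ultimately show ?case by (simp add: mprev_def[abs_def])
  next
    case (Suc k)
    let ?F = "filt (past (Suc k))"
    have up: "f \<in> borel_measurable (filt (past k)) \<Longrightarrow> f \<in> borel_measurable ?F" for f :: "'w \<Rightarrow> rvec"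
      by (rule filt_mono[OF past_mono]) auto
    have up': "f \<in> borel_measurable ?F \<Longrightarrow> f \<in> borel_measurable (filt (past (Suc (Suc k))))" for f :: "'w \<Rightarrow> rvec"
      by (rule filt_mono[OF past_mono]) auto
    have g': "g (Suc k) i \<in> borel_measurable ?F" if i: "i \<in> {1..n}" for i
    proof -
      have "(\<lambda>\<omega>. mix (\<lambda>j. g k j \<omega> + (m k j \<omega> - mprev k j \<omega>)) i) \<in> borel_measurable ?F"
        unfolding mix_def using Suc
        by (intro borel_measurable_sum borel_measurable_scaleR borel_measurable_const
            borel_measurable_add borel_measurable_diff) (auto intro: up)
      then show ?thesis by (rule measurable_cong[THEN iffD1, rotated]) (rule g_Suc[OF i, symmetric], simp)
    qed
    have x': "x (Suc k) i \<in> borel_measurable ?F" if i: "i \<in> {1..n}" for i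
    proof -
      have "(\<lambda>\<omega>. mix (\<lambda>j. x k j \<omega> + (- \<alpha>) *\<^sub>R g (Suc k) j \<omega>) i) \<in> borel_measurable ?F"
        unfolding mix_def using Suc g'
        by (intro borel_measurable_sum borel_measurable_scaleR borel_measurable_const
            borel_measurable_add) (auto intro: up)
      then show ?thesis by (rule measurable_cong[THEN iffD1, rotated]) (rule x_Suc[OF i, symmetric], simp)
    qed
    have m': "m (Suc k) i \<in> borel_measurable (filt (past (Suc (Suc k))))" if i: "i \<in> {1..n}" for i
    proof -
      have z: "Z (i, Suc k, 1) \<in> measurable (filt (past (Suc (Suc k)))) (zspace (i, Suc k, 1))"
        using step_index[OF i, of k] by (intro Z_measurable_filt past_subset) (auto simp: past_def)
      have "(\<lambda>\<omega>. est (t (Suc k)) i (x (Suc k) i \<omega>) (Z (i, Suc k, 1) \<omega>)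
          + (1 - \<beta>) *\<^sub>R (m k i \<omega> - est (t (Suc k)) i (x k i \<omega>) (Z (i, Suc k, 1) \<omega>)))
          \<in> borel_measurable (filt (past (Suc (Suc k))))"
        using Suc x' i
        by (intro borel_measurable_add borel_measurable_scaleR borel_measurable_const
            borel_measurable_diff est_filt_measurable[OF i _ z]) (auto intro!: up' intro: up)
      then show ?thesis by (rule measurable_cong[THEN iffD1, rotated]) (rule m_Suc_est[OF i, symmetric], simp)
    qed
    show ?case using x' g' m' Suc by (auto simp: mprev_def[abs_def])
  qed
  then show "i \<in> {1..n} \<Longrightarrow> x k i \<in> borel_measurable (filt (past k))"
    "i \<in> {1..n} \<Longrightarrow> g k i \<in> borel_measurable (filt (past k))"
    "i \<in> {1..n} \<Longrightarrow> m k i \<in> borel_measurable (filt (past (Suc k)))"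
    "i \<in> {1..n} \<Longrightarrow> mprev k i \<in> borel_measurable (filt (past k))" by auto
qed

lemma iterates_measurable:
  assumes "i \<in> {1..n}"
  shows "x k i \<in> borel_measurable M" "g k i \<in> borel_measurable M" "m k i \<in> borel_measurable M"
    "mprev k i \<in> borel_measurable M"
  using measurable_filt_M[OF past_subset x_adapted[OF assms]] measurable_filt_M[OF past_subset g_adapted[OF assms]]
    measurable_filt_M[OF past_subset m_adapted[OF assms]] measurable_filt_M[OF past_subset mprev_adapted[OF assms]]
  by auto

end

text \<open>
  A majorant for the second moments of \<open>x\<close>, \<open>g\<close> and \<open>m\<close> at a node, where \<open>c\<close> is the growth constant of the
  estimator, \<open>N\<close> the number of nodes and \<open>X\<close> the size of the initial points.
\<close>

fun crude_bound :: "real \<Rightarrow> real \<Rightarrow> real \<Rightarrow> real \<Rightarrow> nat \<Rightarrow> real" where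
  "crude_bound c N \<alpha> X 0 = (1 + c) * (1 + X)"
| "crude_bound c N \<alpha> X (Suc k) =
    (let B = crude_bound c N \<alpha> X k; Y = N\<^sup>2 * (2 + 20 * \<alpha>\<^sup>2 * N\<^sup>2) * B
     in B + 10 * N\<^sup>2 * B + Y + 2 * c * (1 + Y) + 4 * B + 4 * c * (1 + B))"

lemma crude_bound_nonneg: "0 \<le> c \<Longrightarrow> 0 \<le> X \<Longrightarrow> 0 \<le> crude_bound c N \<alpha> X k"
  by (induction k) (auto simp: Let_def)

lemma integral_norm_add_sq_le:
  assumes "sq_integrable N f" "sq_integrable N g"
  shows "(\<integral>p. (norm (f p + g p))\<^sup>2 \<partial>N) \<le> 2 * (\<integral>p. (norm (f p))\<^sup>2 \<partial>N) + 2 * (\<integral>p. (norm (g p))\<^sup>2 \<partial>N)"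
proof -
  have "(\<integral>p. (norm (f p + g p))\<^sup>2 \<partial>N) \<le> (\<integral>p. 2 * (norm (f p))\<^sup>2 + 2 * (norm (g p))\<^sup>2 \<partial>N)"
    using assms by (intro integral_mono norm_add_sq sq_integrable_integrable sq_integrable_add)
      (auto intro!: sq_integrable_integrable)
  then show ?thesis using assms by (simp add: sq_integrable_integrable)
qed

lemma integral_norm_diff_sq_le:
  assumes "sq_integrable N f" "sq_integrable N g"
  shows "(\<integral>p. (norm (f p - g p))\<^sup>2 \<partial>N) \<le> 2 * (\<integral>p. (norm (f p))\<^sup>2 \<partial>N) + 2 * (\<integral>p. (norm (g p))\<^sup>2 \<partial>N)"
  using integral_norm_add_sq_le[OF assms(1) sq_integrable_scaleR[OF assms(2), of "-1"]] by simp

lemma sq_integrable_cong: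
  assumes "\<And>p. p \<in> space N \<Longrightarrow> f p = g p"
  shows "sq_integrable N f \<longleftrightarrow> sq_integrable N g"
proof -
  have "f \<in> borel_measurable N \<longleftrightarrow> g \<in> borel_measurable N" by (rule measurable_cong[OF assms])
  moreover have "integrable N (\<lambda>p. (norm (f p))\<^sup>2) \<longleftrightarrow> integrable N (\<lambda>p. (norm (g p))\<^sup>2)"
    by (rule Bochner_Integration.integrable_cong) (simp_all add: assms)
  ultimately show ?thesis by (simp add: sq_integrable_def)
qed

context decentralized_problem
begin

lemma W_le_1:
  assumes "i \<in> {1..n}" "j \<in> {1..n}"
  shows "W i j \<le> 1"
proof -
  have "W i j \<le> (\<Sum>j=1..n. W i j)"
    using assms W_nonneg by (intro member_le_sum) auto
  then show ?thesis using doubly_stochastic(1)[OF assms(1)] by simp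
qed

lemma norm_mix_sq_le:
  assumes i: "i \<in> {1..n}"
  shows "(norm (mix y i))\<^sup>2 \<le> real n * (\<Sum>j=1..n. (norm (y j))\<^sup>2)"
proof -
  have "mix y i = real n *\<^sub>R node_avg n (\<lambda>j. W i j *\<^sub>R y j)"
    using n_pos by (simp add: mix_def node_avg_def)
  then have "(norm (mix y i))\<^sup>2 = (real n)\<^sup>2 * (norm (node_avg n (\<lambda>j. W i j *\<^sub>R y j)))\<^sup>2"
    by (simp add: power_mult_distrib)
  also have "\<dots> \<le> (real n)\<^sup>2 * (1 / real n * (\<Sum>j=1..n. (norm (W i j *\<^sub>R y j))\<^sup>2))"
    by (intro mult_left_mono norm_node_avg_sq_le) simp
  also have "\<dots> \<le> (real n)\<^sup>2 * (1 / real n * (\<Sum>j=1..n. (norm (y j))\<^sup>2))"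
    using W_nonneg[OF i] W_le_1[OF i]
    by (intro mult_left_mono sum_mono power_mono) (auto intro: mult_left_le_one_le)
  also have "\<dots> = real n * (\<Sum>j=1..n. (norm (y j))\<^sup>2)"
    using n_pos by (simp add: power2_eq_square)
  finally show ?thesis .
qed

definition est_growth :: real where
  "est_growth = 5/4 * real d * ((1 + \<sigma>0\<^sup>2) * (2 * (\<Sum>i=1..n. (norm (lgrad i 0))\<^sup>2) + 2 * L\<^sup>2) + \<sigma>1\<^sup>2)
     + 5/4 * L\<^sup>2"

lemma est_growth_nonneg: "0 \<le> est_growth"
  unfolding est_growth_def by (intro add_nonneg_nonneg mult_nonneg_nonneg sum_nonneg) auto

lemma lipschitz_growth:
  assumes "\<And>x y. x \<in> euclid d \<Longrightarrow> y \<in> euclid d \<Longrightarrow> norm (f x - f y) \<le> L * norm (x - y)"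
    and x: "x \<in> euclid d"
  shows "(norm (f x :: rvec))\<^sup>2 \<le> 2 * (norm (f 0))\<^sup>2 + 2 * L\<^sup>2 * (norm x)\<^sup>2"
proof -
  have "(norm (f x))\<^sup>2 \<le> 2 * (norm (f 0))\<^sup>2 + 2 * (norm (f x - f 0))\<^sup>2"
    using norm_add_sq[of "f 0" "f x - f 0"] by simp
  also have "(norm (f x - f 0))\<^sup>2 \<le> (L * norm x)\<^sup>2"
    using assms(1)[OF x euclid_zero] by (intro power_mono) auto
  finally show ?thesis by (simp add: power_mult_distrib)
qed

lemma est_growth:
  assumes i: "i \<in> {1..n}" and x: "x \<in> euclid d" and t: "0 < t" "real d * t \<le> 1"
  shows "(\<integral>p. (norm (est t i x p))\<^sup>2 \<partial>law i) \<le> est_growth * (1 + (norm x)\<^sup>2)"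
proof -
  have g: "(norm (lgrad i x))\<^sup>2
      \<le> (2 * (\<Sum>i=1..n. (norm (lgrad i 0))\<^sup>2) + 2 * L\<^sup>2) * (1 + (norm x)\<^sup>2)"
  proof -
    have "(norm (lgrad i x))\<^sup>2 \<le> 2 * (norm (lgrad i 0))\<^sup>2 + 2 * L\<^sup>2 * (norm x)\<^sup>2"
      by (rule lipschitz_growth[OF lgrad_lipschitz[OF i] x])
    moreover have "(norm (lgrad i 0))\<^sup>2 \<le> (\<Sum>i=1..n. (norm (lgrad i 0))\<^sup>2)"
      using i by (intro member_le_sum) auto
    moreover have "0 \<le> (\<Sum>i=1..n. (norm (lgrad i 0))\<^sup>2) * (norm x)\<^sup>2" by (simp add: sum_nonneg)
    moreover have "0 \<le> L\<^sup>2" by simp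
    ultimately show ?thesis unfolding distrib_left distrib_right mult_1_right mult.assoc
      by linarith
  qed
  have dt: "(real d * L * t)\<^sup>2 \<le> L\<^sup>2 * (1 + (norm x)\<^sup>2)"
  proof -
    have "real d * L * t \<le> L" using t constants mult_left_mono[of "real d * t" 1 L] by (simp add: mult_ac)
    then have "(real d * L * t)\<^sup>2 \<le> L\<^sup>2" using t constants by (intro power_mono) auto
    also have "\<dots> \<le> L\<^sup>2 * (1 + (norm x)\<^sup>2)" by (simp add: algebra_simps)
    finally show ?thesis .
  qed
  have s1: "\<sigma>1\<^sup>2 \<le> \<sigma>1\<^sup>2 * (1 + (norm x)\<^sup>2)" by (simp add: algebra_simps)
  have "(\<integral>p. (norm (est t i x p))\<^sup>2 \<partial>law i)
      \<le> 5/4 * real d * ((1 + \<sigma>0\<^sup>2) * (norm (lgrad i x))\<^sup>2 + \<sigma>1\<^sup>2) + 5/4 * (real d * L * t)\<^sup>2"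
    by (rule est_second_moment(2)[OF i x t(1)])
  also have "\<dots> \<le> 5/4 * real d * ((1 + \<sigma>0\<^sup>2) * ((2 * (\<Sum>i=1..n. (norm (lgrad i 0))\<^sup>2) + 2 * L\<^sup>2) * (1 + (norm x)\<^sup>2))
      + \<sigma>1\<^sup>2 * (1 + (norm x)\<^sup>2)) + 5/4 * (L\<^sup>2 * (1 + (norm x)\<^sup>2))"
    by (intro add_mono mult_left_mono g s1 dt) auto
  also have "\<dots> = est_growth * (1 + (norm x)\<^sup>2)"
    unfolding est_growth_def by (simp only: distrib_left distrib_right mult_ac)
  finally show ?thesis .
qed

end

context dzovr_analysis
begin

lemma radius_pos: "0 < t k"
  by (rule parameters)

lemma beta_le_1: "\<beta> \<le> 1"
  using parameters by simp

lemma d_radius_le: "real d * t k \<le> \<beta> / real d"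
  using radius_le[of k] d_pos by (simp add: field_simps power2_eq_square)

lemma d_radius_le_beta: "real d * t k \<le> \<beta>"
proof -
  have "\<beta> / real d \<le> \<beta>" using d_pos beta_pos by (simp add: field_simps)
  then show ?thesis using d_radius_le[of k] by simp
qed

lemma d_radius_le_1: "real d * t k \<le> 1"
  using d_radius_le_beta[of k] beta_le_1 by simp

lemma est_frozen_measurable:
  assumes i: "fst p = i" "i \<in> {1..n}" and y: "y \<in> borel_measurable (filt Q)"
  shows "(\<lambda>q. est r i (y (fst q)) (snd q)) \<in> borel_measurable (filt Q \<Otimes>\<^sub>M zspace p)"
proof (rule est_measurable_compose[OF i(2)])
  show "(\<lambda>q. y (fst q)) \<in> borel_measurable (filt Q \<Otimes>\<^sub>M zspace p)"
    by (rule measurable_compose[OF measurable_fst y])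
  show "snd \<in> measurable (filt Q \<Otimes>\<^sub>M zspace p) (borel \<Otimes>\<^sub>M \<Xi> i)"
    using i(1) by simp
qed

lemma est_run_moment:
  assumes p: "p \<in> I" "p \<notin> Q" and Q: "Q \<subseteq> I" and i: "fst p = i"
    and y: "y \<in> borel_measurable (filt Q)" "sq_integrable M y" "\<And>\<omega>. \<omega> \<in> space M \<Longrightarrow> y \<omega> \<in> euclid d"
    and r: "0 < r" "real d * r \<le> 1"
  shows "sq_integrable M (\<lambda>\<omega>. est r i (y \<omega>) (Z p \<omega>))"
    and "expectation (\<lambda>\<omega>. (norm (est r i (y \<omega>) (Z p \<omega>)))\<^sup>2)
      \<le> est_growth * (1 + expectation (\<lambda>\<omega>. (norm (y \<omega>))\<^sup>2))"
proof -
  have i': "i \<in> {1..n}" using index_node[OF p(1)] i by simp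
  let ?H = "\<lambda>q. est r i (y (fst q)) (snd q)"
  have b: "integrable M (\<lambda>\<omega>. est_growth * (1 + (norm (y \<omega>))\<^sup>2))"
    using sq_integrable_integrable[OF y(2)] by simp
  have le: "sq_integrable (law (fst p)) (\<lambda>z. ?H (\<omega>, z)) \<and>
      (\<integral>z. (norm (?H (\<omega>, z)))\<^sup>2 \<partial>law (fst p)) \<le> est_growth * (1 + (norm (y \<omega>))\<^sup>2)"
    if "\<omega> \<in> space M" for \<omega>
    using est_second_moment(1)[OF i' y(3)[OF that] r(1)] est_growth[OF i' y(3)[OF that] r] i by simp
  note * = fresh_sample_second_moment[OF p Q est_frozen_measurable[OF i i' y(1)] b le]
  show "sq_integrable M (\<lambda>\<omega>. est r i (y \<omega>) (Z p \<omega>))" using *(1) by simp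
  show "expectation (\<lambda>\<omega>. (norm (est r i (y \<omega>) (Z p \<omega>)))\<^sup>2)
      \<le> est_growth * (1 + expectation (\<lambda>\<omega>. (norm (y \<omega>))\<^sup>2))"
    using *(2) sq_integrable_integrable[OF y(2)] by (simp add: prob_space)
qed

lemma past_fresh: "(i, k, s) \<notin> past k" "p \<in> past k \<Longrightarrow> p \<in> past (Suc k)"
  by (auto simp: past_def)

definition crude :: "nat \<Rightarrow> real" where
  "crude k = crude_bound est_growth (real n) \<alpha> (\<Sum>i=1..n. (norm (x0 i))\<^sup>2) k"

lemma crude_nonneg: "0 \<le> crude k"
  unfolding crude_def by (intro crude_bound_nonneg est_growth_nonneg sum_nonneg) auto

lemma sq_integrable_mix:
  "(\<And>j. j \<in> {1..n} \<Longrightarrow> sq_integrable M (f j)) \<Longrightarrow> sq_integrable M (\<lambda>\<omega>. mix (\<lambda>j. f j \<omega>) i)"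
  unfolding mix_def by (intro sq_integrable_sum sq_integrable_scaleR)

lemma expectation_mix_le:
  assumes i: "i \<in> {1..n}" and f: "\<And>j. j \<in> {1..n} \<Longrightarrow> sq_integrable M (f j)"
    and c: "\<And>j. j \<in> {1..n} \<Longrightarrow> expectation (\<lambda>\<omega>. (norm (f j \<omega>))\<^sup>2) \<le> c"
  shows "expectation (\<lambda>\<omega>. (norm (mix (\<lambda>j. f j \<omega>) i))\<^sup>2) \<le> (real n)\<^sup>2 * c"
proof -
  have "expectation (\<lambda>\<omega>. (norm (mix (\<lambda>j. f j \<omega>) i))\<^sup>2)
      \<le> expectation (\<lambda>\<omega>. real n * (\<Sum>j=1..n. (norm (f j \<omega>))\<^sup>2))"
    using f i by (intro integral_mono norm_mix_sq_le sq_integrable_integrable[OF sq_integrable_mix]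
        integrable_mult_right Bochner_Integration.integrable_sum sq_integrable_integrable) auto
  also have "\<dots> = real n * (\<Sum>j=1..n. expectation (\<lambda>\<omega>. (norm (f j \<omega>))\<^sup>2))"
    using f by (simp add: Bochner_Integration.integral_sum sq_integrable_integrable)
  also have "\<dots> \<le> real n * (\<Sum>j=1..n. c)"
    using c by (intro mult_left_mono sum_mono) auto
  finally show ?thesis by (simp add: power2_eq_square)
qed

text \<open>
  Crude bounds that depend on nothing but the problem, the step size and the iteration number. They
  give square integrability of all iterates, and they settle the finitely many horizons for which the
  step size is not small.
\<close>

lemma iterates_crude:
  "\<forall>i\<in>{1..n}. \<forall>y\<in>{x k i, g k i, m k i, mprev k i}.
     sq_integrable M y \<and> expectation (\<lambda>\<omega>. (norm (y \<omega>))\<^sup>2) \<le> crude k"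
proof (induction k)
  case 0
  let ?X = "\<Sum>i=1..n. (norm (x0 i))\<^sup>2"
  have X: "0 \<le> ?X" by (simp add: sum_nonneg)
  have x0: "sq_integrable M (x 0 i) \<and> expectation (\<lambda>\<omega>. (norm (x 0 i \<omega>))\<^sup>2) = (norm (x0 i))\<^sup>2"
    and x0_le: "(norm (x0 i))\<^sup>2 \<le> ?X" if i: "i \<in> {1..n}" for i
  proof -
    have eq: "x 0 i \<omega> = x0 i" if "\<omega> \<in> space M" for \<omega> using x_init[OF i that] .
    have "expectation (\<lambda>\<omega>. (norm (x 0 i \<omega>))\<^sup>2) = expectation (\<lambda>\<omega>. (norm (x0 i))\<^sup>2)"
      by (rule Bochner_Integration.integral_cong) (simp_all add: eq)
    moreover have "sq_integrable M (x 0 i)"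
      using sq_integrable_const[of "x0 i"] sq_integrable_cong[of M "x 0 i" "\<lambda>_. x0 i"] eq by simp
    ultimately show "sq_integrable M (x 0 i) \<and> expectation (\<lambda>\<omega>. (norm (x 0 i \<omega>))\<^sup>2) = (norm (x0 i))\<^sup>2"
      by (simp add: prob_space)
    show "(norm (x0 i))\<^sup>2 \<le> ?X" using i by (intro member_le_sum) auto
  qed
  have zero: "sq_integrable M y \<and> expectation (\<lambda>\<omega>. (norm (y \<omega>))\<^sup>2) = 0"
    if "\<And>\<omega>. \<omega> \<in> space M \<Longrightarrow> y \<omega> = 0" for y :: "'w \<Rightarrow> rvec"
  proof
    show "sq_integrable M y" using sq_integrable_cong[of M y "\<lambda>_. 0"] that by simp
    have "expectation (\<lambda>\<omega>. (norm (y \<omega>))\<^sup>2) = expectation (\<lambda>\<omega>. 0)"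
      by (rule Bochner_Integration.integral_cong) (simp_all add: that)
    then show "expectation (\<lambda>\<omega>. (norm (y \<omega>))\<^sup>2) = 0" by simp
  qed
  have m0: "sq_integrable M (m 0 i) \<and> expectation (\<lambda>\<omega>. (norm (m 0 i \<omega>))\<^sup>2) \<le> est_growth * (1 + ?X)"
    if i: "i \<in> {1..n}" for i
  proof -
    let ?e = "\<lambda>s \<omega>. est (t 0) i (x0 i) (Z (i, 0, s) \<omega>)"
    have e: "sq_integrable M (?e s)" "expectation (\<lambda>\<omega>. (norm (?e s \<omega>))\<^sup>2) \<le> est_growth * (1 + ?X)"
      if s: "s \<in> {1..b0}" for s
    proof -
      note r = est_run_moment[OF init_index[OF i s] past_fresh(1) past_subset, of i "\<lambda>_. x0 i" "t 0"]
      show "sq_integrable M (?e s)"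
        using r(1) x0_euclid[OF i] radius_pos d_radius_le_1 sq_integrable_const by simp
      have "expectation (\<lambda>\<omega>. (norm (?e s \<omega>))\<^sup>2) \<le> est_growth * (1 + (norm (x0 i))\<^sup>2)"
        using r(2) x0_euclid[OF i] radius_pos d_radius_le_1 sq_integrable_const by (simp add: prob_space)
      also have "\<dots> \<le> est_growth * (1 + ?X)"
        using x0_le[OF i] by (intro mult_left_mono est_growth_nonneg) auto
      finally show "expectation (\<lambda>\<omega>. (norm (?e s \<omega>))\<^sup>2) \<le> est_growth * (1 + ?X)" .
    qed
    have jensen: "(norm (m 0 i \<omega>))\<^sup>2 \<le> 1 / real b0 * (\<Sum>s=1..b0. (norm (?e s \<omega>))\<^sup>2)" if "\<omega> \<in> space M" for \<omega>
    proof -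
      have "0 \<le> (\<Sum>s=1..b0. (norm (?e s \<omega> - m 0 i \<omega>))\<^sup>2)" by (simp add: sum_nonneg)
      also have "\<dots> = (\<Sum>s=1..b0. (norm (?e s \<omega>))\<^sup>2) - real b0 * (norm (m 0 i \<omega>))\<^sup>2"
        using sum_deviation_sq[of "{1..b0}" "\<lambda>s. ?e s \<omega>"] parameters(1)
        unfolding m_init_est[OF i that] by simp
      finally show ?thesis using parameters(1) by (simp add: field_simps)
    qed
    have sq: "sq_integrable M (m 0 i)"
    proof -
      have "sq_integrable M (\<lambda>\<omega>. (1 / real b0) *\<^sub>R (\<Sum>s=1..b0. ?e s \<omega>))"
        by (intro sq_integrable_scaleR sq_integrable_sum e)
      moreover have "sq_integrable M (m 0 i) \<longleftrightarrow> sq_integrable M (\<lambda>\<omega>. (1 / real b0) *\<^sub>R (\<Sum>s=1..b0. ?e s \<omega>))"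
        by (rule sq_integrable_cong) (rule m_init_est[OF i])
      ultimately show ?thesis by blast
    qed
    have "expectation (\<lambda>\<omega>. (norm (m 0 i \<omega>))\<^sup>2)
        \<le> expectation (\<lambda>\<omega>. 1 / real b0 * (\<Sum>s=1..b0. (norm (?e s \<omega>))\<^sup>2))"
      by (intro integral_mono jensen sq_integrable_integrable sq integrable_mult_right
          Bochner_Integration.integrable_sum e)
    also have "\<dots> = 1 / real b0 * (\<Sum>s=1..b0. expectation (\<lambda>\<omega>. (norm (?e s \<omega>))\<^sup>2))"
      using e(1) by (simp add: Bochner_Integration.integral_sum sq_integrable_integrable)
    also have "\<dots> \<le> 1 / real b0 * (\<Sum>s=1..b0. est_growth * (1 + ?X))"
      by (intro mult_left_mono sum_mono e) auto
    also have "\<dots> = est_growth * (1 + ?X)" using parameters(1) by simp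
    finally show ?thesis using sq by blast
  qed
  have c0: "crude 0 = 1 + ?X + est_growth * (1 + ?X)" by (simp add: crude_def algebra_simps)
  have nn: "0 \<le> est_growth * (1 + ?X)" using X est_growth_nonneg by simp
  show ?case
  proof (intro ballI)
    fix i y assume i: "i \<in> {1..n}" and y: "y \<in> {x 0 i, g 0 i, m 0 i, mprev 0 i}"
    have gz: "sq_integrable M (g 0 i) \<and> expectation (\<lambda>\<omega>. (norm (g 0 i \<omega>))\<^sup>2) = 0"
      by (rule zero) (rule g_init[OF i])
    have pz: "sq_integrable M (mprev 0 i) \<and> expectation (\<lambda>\<omega>. (norm (mprev 0 i \<omega>))\<^sup>2) = 0"
      by (rule zero) simp
    show "sq_integrable M y \<and> expectation (\<lambda>\<omega>. (norm (y \<omega>))\<^sup>2) \<le> crude 0"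
      using y x0[OF i] x0_le[OF i] gz pz m0[OF i] X nn unfolding c0 by auto
  qed
next
  case (Suc k)
  let ?B = "crude k" let ?Y = "(real n)\<^sup>2 * (2 + 20 * \<alpha>\<^sup>2 * (real n)\<^sup>2) * ?B"
  have B: "0 \<le> ?B" by (rule crude_nonneg)
  have Y: "0 \<le> ?Y" using B by simp
  have IH: "sq_integrable M (x k i)" "sq_integrable M (g k i)" "sq_integrable M (m k i)" "sq_integrable M (mprev k i)"
    "expectation (\<lambda>\<omega>. (norm (x k i \<omega>))\<^sup>2) \<le> ?B" "expectation (\<lambda>\<omega>. (norm (g k i \<omega>))\<^sup>2) \<le> ?B"
    "expectation (\<lambda>\<omega>. (norm (m k i \<omega>))\<^sup>2) \<le> ?B" "expectation (\<lambda>\<omega>. (norm (mprev k i \<omega>))\<^sup>2) \<le> ?B"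
    if "i \<in> {1..n}" for i using Suc that by blast+
  have g': "sq_integrable M (g (Suc k) i) \<and> expectation (\<lambda>\<omega>. (norm (g (Suc k) i \<omega>))\<^sup>2) \<le> 10 * (real n)\<^sup>2 * ?B"
    if i: "i \<in> {1..n}" for i
  proof -
    let ?f = "\<lambda>j \<omega>. g k j \<omega> + (m k j \<omega> - mprev k j \<omega>)"
    have f: "sq_integrable M (?f j)" "expectation (\<lambda>\<omega>. (norm (?f j \<omega>))\<^sup>2) \<le> 10 * ?B" if j: "j \<in> {1..n}" for j
    proof -
      show "sq_integrable M (?f j)" by (intro sq_integrable_add sq_integrable_diff IH j)
      have "expectation (\<lambda>\<omega>. (norm (?f j \<omega>))\<^sup>2)
          \<le> 2 * expectation (\<lambda>\<omega>. (norm (g k j \<omega>))\<^sup>2) + 2 * expectation (\<lambda>\<omega>. (norm (m k j \<omega> - mprev k j \<omega>))\<^sup>2)"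
        by (intro integral_norm_add_sq_le sq_integrable_diff IH j)
      moreover have "expectation (\<lambda>\<omega>. (norm (m k j \<omega> - mprev k j \<omega>))\<^sup>2)
          \<le> 2 * expectation (\<lambda>\<omega>. (norm (m k j \<omega>))\<^sup>2) + 2 * expectation (\<lambda>\<omega>. (norm (mprev k j \<omega>))\<^sup>2)"
        by (intro integral_norm_diff_sq_le IH j)
      ultimately show "expectation (\<lambda>\<omega>. (norm (?f j \<omega>))\<^sup>2) \<le> 10 * ?B"
        using IH[OF j] by linarith
    qed
    have "sq_integrable M (g (Suc k) i) \<longleftrightarrow> sq_integrable M (\<lambda>\<omega>. mix (\<lambda>j. ?f j \<omega>) i)"
      by (rule sq_integrable_cong) (rule g_Suc[OF i])
    moreover have "expectation (\<lambda>\<omega>. (norm (g (Suc k) i \<omega>))\<^sup>2) = expectation (\<lambda>\<omega>. (norm (mix (\<lambda>j. ?f j \<omega>) i))\<^sup>2)"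
      by (rule Bochner_Integration.integral_cong) (use g_Suc[OF i] in simp_all)
    ultimately show ?thesis
      using sq_integrable_mix[of ?f i] f expectation_mix_le[OF i, of ?f "10 * ?B"] by (simp add: mult_ac)
  qed
  have x': "sq_integrable M (x (Suc k) i) \<and> expectation (\<lambda>\<omega>. (norm (x (Suc k) i \<omega>))\<^sup>2) \<le> ?Y"
    if i: "i \<in> {1..n}" for i
  proof -
    let ?f = "\<lambda>j \<omega>. x k j \<omega> + (- \<alpha>) *\<^sub>R g (Suc k) j \<omega>"
    have f: "sq_integrable M (?f j)" "expectation (\<lambda>\<omega>. (norm (?f j \<omega>))\<^sup>2) \<le> (2 + 20 * \<alpha>\<^sup>2 * (real n)\<^sup>2) * ?B"
      if j: "j \<in> {1..n}" for j
    proof -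
      show "sq_integrable M (?f j)" using g'[OF j] by (intro sq_integrable_add sq_integrable_scaleR IH j) auto
      have "expectation (\<lambda>\<omega>. (norm (?f j \<omega>))\<^sup>2)
          \<le> 2 * expectation (\<lambda>\<omega>. (norm (x k j \<omega>))\<^sup>2) + 2 * expectation (\<lambda>\<omega>. (norm ((- \<alpha>) *\<^sub>R g (Suc k) j \<omega>))\<^sup>2)"
        using g'[OF j] by (intro integral_norm_add_sq_le sq_integrable_scaleR IH j) auto
      also have "expectation (\<lambda>\<omega>. (norm ((- \<alpha>) *\<^sub>R g (Suc k) j \<omega>))\<^sup>2)
          = \<alpha>\<^sup>2 * expectation (\<lambda>\<omega>. (norm (g (Suc k) j \<omega>))\<^sup>2)"
        by (simp add: power_mult_distrib)
      also have "\<dots> \<le> \<alpha>\<^sup>2 * (10 * (real n)\<^sup>2 * ?B)"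
        using g'[OF j] by (intro mult_left_mono) auto
      finally show "expectation (\<lambda>\<omega>. (norm (?f j \<omega>))\<^sup>2) \<le> (2 + 20 * \<alpha>\<^sup>2 * (real n)\<^sup>2) * ?B"
        using IH(5)[OF j] by (simp add: algebra_simps)
    qed
    have "sq_integrable M (x (Suc k) i) \<longleftrightarrow> sq_integrable M (\<lambda>\<omega>. mix (\<lambda>j. ?f j \<omega>) i)"
      by (rule sq_integrable_cong) (rule x_Suc[OF i])
    moreover have "expectation (\<lambda>\<omega>. (norm (x (Suc k) i \<omega>))\<^sup>2) = expectation (\<lambda>\<omega>. (norm (mix (\<lambda>j. ?f j \<omega>) i))\<^sup>2)"
      by (rule Bochner_Integration.integral_cong) (use x_Suc[OF i] in simp_all)
    ultimately show ?thesis
      using sq_integrable_mix[of ?f i] f expectation_mix_le[OF i, of ?f "(2 + 20 * \<alpha>\<^sup>2 * (real n)\<^sup>2) * ?B"]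
      by (simp add: mult_ac)
  qed
  have m': "sq_integrable M (m (Suc k) i) \<and> expectation (\<lambda>\<omega>. (norm (m (Suc k) i \<omega>))\<^sup>2)
      \<le> 2 * est_growth * (1 + ?Y) + 4 * ?B + 4 * est_growth * (1 + ?B)"
    if i: "i \<in> {1..n}" for i
  proof -
    let ?p = "(i, Suc k, 1::nat)" let ?r = "t (Suc k)"
    let ?a = "\<lambda>\<omega>. est ?r i (x (Suc k) i \<omega>) (Z ?p \<omega>)" let ?b = "\<lambda>\<omega>. est ?r i (x k i \<omega>) (Z ?p \<omega>)"
    let ?c = "\<lambda>\<omega>. (1 - \<beta>) *\<^sub>R (m k i \<omega> - ?b \<omega>)"
    note a = est_run_moment[OF step_index[OF i] past_fresh(1) past_subset fst_conv x_adapted[OF i]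
        conjunct1[OF x'[OF i]] iterates_euclid(1)[OF _ i] radius_pos[of "Suc k"] d_radius_le_1]
    note b = est_run_moment[OF step_index[OF i] past_fresh(1) past_subset fst_conv
        filt_mono[OF past_mono[of k "Suc k"] x_adapted[OF i]]
        IH(1)[OF i] iterates_euclid(1)[OF _ i] radius_pos[of "Suc k"] d_radius_le_1, OF le_SucI[OF order_refl]]

    have c: "sq_integrable M ?c" by (intro sq_integrable_scaleR sq_integrable_diff IH i b)
    have "expectation (\<lambda>\<omega>. (norm (?c \<omega>))\<^sup>2) = (1 - \<beta>)\<^sup>2 * expectation (\<lambda>\<omega>. (norm (m k i \<omega> - ?b \<omega>))\<^sup>2)"
      by (simp add: power_mult_distrib)
    also have "\<dots> \<le> 1 * expectation (\<lambda>\<omega>. (norm (m k i \<omega> - ?b \<omega>))\<^sup>2)"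
      using parameters by (intro mult_right_mono Bochner_Integration.integral_nonneg) (auto simp: power_le_one)
    also have "\<dots> \<le> 2 * expectation (\<lambda>\<omega>. (norm (m k i \<omega>))\<^sup>2) + 2 * expectation (\<lambda>\<omega>. (norm (?b \<omega>))\<^sup>2)"
      using integral_norm_diff_sq_le[OF IH(3)[OF i] b(1)] by simp
    also have "\<dots> \<le> 2 * ?B + 2 * (est_growth * (1 + ?B))"
      using IH(5,7)[OF i] b(2) mult_left_mono[OF IH(5)[OF i] est_growth_nonneg] by (simp add: algebra_simps)
    finally have cle: "expectation (\<lambda>\<omega>. (norm (?c \<omega>))\<^sup>2) \<le> 2 * ?B + 2 * (est_growth * (1 + ?B))" .
    have ale: "expectation (\<lambda>\<omega>. (norm (?a \<omega>))\<^sup>2) \<le> est_growth * (1 + ?Y)"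
      using a(2) mult_left_mono[OF conjunct2[OF x'[OF i]] est_growth_nonneg] by (simp add: algebra_simps)
    have "sq_integrable M (m (Suc k) i) \<longleftrightarrow> sq_integrable M (\<lambda>\<omega>. ?a \<omega> + ?c \<omega>)"
      by (rule sq_integrable_cong) (rule m_Suc_est[OF i])
    moreover have "expectation (\<lambda>\<omega>. (norm (m (Suc k) i \<omega>))\<^sup>2) = expectation (\<lambda>\<omega>. (norm (?a \<omega> + ?c \<omega>))\<^sup>2)"
      by (rule Bochner_Integration.integral_cong) (use m_Suc_est[OF i] in simp_all)
    ultimately show ?thesis
      using sq_integrable_add[OF a(1) c] integral_norm_add_sq_le[OF a(1) c] ale cle by simp
  qed
  have cS: "crude (Suc k) = ?B + 10 * (real n)\<^sup>2 * ?B + ?Y + 2 * est_growth * (1 + ?Y) + 4 * ?B + 4 * est_growth * (1 + ?B)"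
    by (simp add: crude_def Let_def)
  have nn: "0 \<le> 10 * (real n)\<^sup>2 * ?B" "0 \<le> 2 * est_growth * (1 + ?Y)" "0 \<le> 4 * est_growth * (1 + ?B)"
    using B Y est_growth_nonneg by simp_all
  show ?case
  proof (intro ballI)
    fix i y assume i: "i \<in> {1..n}" and y: "y \<in> {x (Suc k) i, g (Suc k) i, m (Suc k) i, mprev (Suc k) i}"
    have mp: "mprev (Suc k) i = m k i" by (rule ext) simp
    have "expectation (\<lambda>\<omega>. (norm (x (Suc k) i \<omega>))\<^sup>2) \<le> crude (Suc k)"
      unfolding cS using conjunct2[OF x'[OF i]] B Y nn by linarith
    moreover have "expectation (\<lambda>\<omega>. (norm (g (Suc k) i \<omega>))\<^sup>2) \<le> crude (Suc k)"
      unfolding cS using conjunct2[OF g'[OF i]] B Y nn by linarith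
    moreover have "expectation (\<lambda>\<omega>. (norm (m (Suc k) i \<omega>))\<^sup>2) \<le> crude (Suc k)"
      unfolding cS using conjunct2[OF m'[OF i]] B Y nn by linarith
    moreover have "expectation (\<lambda>\<omega>. (norm (m k i \<omega>))\<^sup>2) \<le> crude (Suc k)"
      unfolding cS using IH(7)[OF i] B Y nn by linarith
    ultimately show "sq_integrable M y \<and> expectation (\<lambda>\<omega>. (norm (y \<omega>))\<^sup>2) \<le> crude (Suc k)"
      using y x'[OF i] g'[OF i] m'[OF i] IH(3)[OF i] unfolding mp by blast
  qed
qed

lemma iterates_sq_integrable:
  assumes "i \<in> {1..n}"
  shows "sq_integrable M (x k i)" "sq_integrable M (g k i)" "sq_integrable M (m k i)"
    "sq_integrable M (mprev k i)"
  using iterates_crude[of k] assms by blast+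

end

section \<open>Gradient averages and descent\<close>

context decentralized_problem
begin

lemma continuous_on_lgrad: "i \<in> {1..n} \<Longrightarrow> continuous_on (euclid d) (lgrad i)"
  unfolding lgrad_def[abs_def] by (rule grad_continuous[OF local_smooth])

lemma continuous_on_ggrad: "continuous_on (euclid d) ggrad"
  unfolding ggrad_def[abs_def] by (rule grad_continuous[OF global_smooth])

lemma (in prob_space) sq_integrable_lipschitz:
  assumes f: "continuous_on (euclid d) f"
    "\<And>y. y \<in> euclid d \<Longrightarrow> (norm (f y))\<^sup>2 \<le> a + c * (norm y)\<^sup>2"
    and y: "sq_integrable M y" "\<And>\<omega>. \<omega> \<in> space M \<Longrightarrow> y \<omega> \<in> euclid d"
  shows "sq_integrable M (\<lambda>\<omega>. f (y \<omega>))"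
proof (rule sq_integrable_bound)
  have "y \<in> measurable M (restrict_space borel (euclid d))"
    using y by (intro measurable_restrict_space2) (auto simp: sq_integrable_def)
  then show "(\<lambda>\<omega>. f (y \<omega>)) \<in> borel_measurable M"
    by (rule measurable_compose) (rule borel_measurable_continuous_on_restrict[OF f(1)])
  show "integrable M (\<lambda>\<omega>. a + c * (norm (y \<omega>))\<^sup>2)"
    using sq_integrable_integrable[OF y(1)] by simp
  show "AE \<omega> in M. (norm (f (y \<omega>)))\<^sup>2 \<le> a + c * (norm (y \<omega>))\<^sup>2"
    using f(2) y(2) by (intro AE_I2) auto
qed

lemma avg_const: "1 / real n * (\<Sum>i=1..n. c) = (c::real)"
  using n_pos by simp

lemma avg_mono: "(\<And>i. i \<in> {1..n} \<Longrightarrow> f i \<le> (g i :: real)) \<Longrightarrow> 1 / real n * (\<Sum>i=1..n. f i) \<le> 1 / real n * (\<Sum>i=1..n. g i)"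
  by (intro mult_left_mono sum_mono) auto

lemma avg_affine: "1 / real n * (\<Sum>i=1..n. a * f i + b) = a * (1 / real n * (\<Sum>i=1..n. f i)) + (b::real)"
  using n_pos by (simp add: sum.distrib sum_distrib_left[symmetric] field_simps)

text \<open>
  At a common point the mean of the local gradients is the global gradient, so heterogeneity only adds
  its variance.
\<close>

lemma avg_lgrad_common_sq:
  assumes x: "x \<in> euclid d"
  shows "1 / real n * (\<Sum>i=1..n. (norm (lgrad i x))\<^sup>2) \<le> (1 + \<sigma>2\<^sup>2) * (norm (ggrad x))\<^sup>2 + \<sigma>3\<^sup>2"
proof -
  have g: "ggrad x = (1 / real n) *\<^sub>R (\<Sum>i=1..n. lgrad i x)"
    using x by (simp add: ggrad_eq node_avg_def)
  have "1 / real n * (\<Sum>i=1..n. (norm (lgrad i x - ggrad x))\<^sup>2)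
      \<le> 1 / real n * (\<Sum>i=1..n. \<sigma>2\<^sup>2 * (norm (ggrad x))\<^sup>2 + \<sigma>3\<^sup>2)"
    using heterogeneity x by (intro avg_mono) (auto simp: lgrad_def ggrad_def)
  also have "\<dots> = \<sigma>2\<^sup>2 * (norm (ggrad x))\<^sup>2 + \<sigma>3\<^sup>2" by (rule avg_const)
  finally have "1 / real n * (\<Sum>i=1..n. (norm (lgrad i x - ggrad x))\<^sup>2) \<le> \<sigma>2\<^sup>2 * (norm (ggrad x))\<^sup>2 + \<sigma>3\<^sup>2" .
  moreover have "(\<Sum>i=1..n. (norm (lgrad i x - ggrad x))\<^sup>2)
      = (\<Sum>i=1..n. (norm (lgrad i x))\<^sup>2) - real n * (norm (ggrad x))\<^sup>2"
    using sum_deviation_sq[of "{1..n}" "\<lambda>i. lgrad i x"] n_pos by (simp add: g)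
  ultimately show ?thesis using n_pos by (simp add: field_simps)
qed

lemma avg_lgrad_sq:
  assumes y: "\<And>i. i \<in> {1..n} \<Longrightarrow> y i \<in> euclid d"
  shows "1 / real n * (\<Sum>i=1..n. (norm (lgrad i (y i)))\<^sup>2)
    \<le> 5/4 * ((1 + \<sigma>2\<^sup>2) * (norm (ggrad (node_avg n y)))\<^sup>2 + \<sigma>3\<^sup>2) + 5 * L\<^sup>2 * spread y"
proof -
  let ?a = "node_avg n y"
  have a: "?a \<in> euclid d" by (rule node_avg_euclid[OF y])
  have "(norm (lgrad i (y i)))\<^sup>2 \<le> 5/4 * (norm (lgrad i ?a))\<^sup>2 + 5 * L\<^sup>2 * (norm (y i - ?a))\<^sup>2"
    if i: "i \<in> {1..n}" for i
  proof -
    have "(norm (lgrad i (y i)))\<^sup>2 \<le> 5/4 * (norm (lgrad i ?a))\<^sup>2 + 5 * (norm (lgrad i (y i) - lgrad i ?a))\<^sup>2"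
      using norm_add_sq_54[of "lgrad i ?a" "lgrad i (y i) - lgrad i ?a"] by simp
    moreover have "(norm (lgrad i (y i) - lgrad i ?a))\<^sup>2 \<le> (L * norm (y i - ?a))\<^sup>2"
      by (intro power_mono lgrad_lipschitz i y a) simp
    ultimately show ?thesis by (simp add: power_mult_distrib)
  qed
  then have "1 / real n * (\<Sum>i=1..n. (norm (lgrad i (y i)))\<^sup>2)
      \<le> 1 / real n * (\<Sum>i=1..n. 5/4 * (norm (lgrad i ?a))\<^sup>2 + 5 * L\<^sup>2 * (norm (y i - ?a))\<^sup>2)"
    by (rule avg_mono)
  also have "\<dots> = 5/4 * (1 / real n * (\<Sum>i=1..n. (norm (lgrad i ?a))\<^sup>2)) + 5 * L\<^sup>2 * spread y"
    unfolding spread_def sum.distrib sum_distrib_left[symmetric] by (simp add: distrib_left)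
  also have "\<dots> \<le> 5/4 * ((1 + \<sigma>2\<^sup>2) * (norm (ggrad ?a))\<^sup>2 + \<sigma>3\<^sup>2) + 5 * L\<^sup>2 * spread y"
    by (intro add_right_mono mult_left_mono avg_lgrad_common_sq[OF a]) simp
  finally show ?thesis .
qed

text \<open>
  The mean of the increments and their deviations from it are orthogonal. Only the part of the mean has
  to be kept with factor one.
\<close>

lemma avg_increment_sq:
  "1 / real n * (\<Sum>i=1..n. (norm (y' i - y i))\<^sup>2)
    \<le> 2 * spread y' + 2 * spread y + (norm (node_avg n y' - node_avg n y))\<^sup>2"
proof -
  let ?w = "\<lambda>i. y' i - y i"
  have "(\<Sum>i=1..n. (norm (?w i - node_avg n ?w))\<^sup>2)
      = (\<Sum>i=1..n. (norm (?w i))\<^sup>2) - real n * (norm (node_avg n ?w))\<^sup>2"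
    using sum_deviation_sq[of "{1..n}" ?w] n_pos by (simp add: node_avg_def)
  then have "1 / real n * (\<Sum>i=1..n. (norm (?w i))\<^sup>2) = spread ?w + (norm (node_avg n ?w))\<^sup>2"
    using n_pos by (simp add: spread_def field_simps)
  also have "spread ?w \<le> 1 / real n * (\<Sum>i=1..n. 2 * (norm (y' i - node_avg n y'))\<^sup>2 + 2 * (norm (y i - node_avg n y))\<^sup>2)"
    unfolding spread_def node_avg_diff
  proof (rule avg_mono)
    fix i
    show "(norm (y' i - y i - (node_avg n y' - node_avg n y)))\<^sup>2
        \<le> 2 * (norm (y' i - node_avg n y'))\<^sup>2 + 2 * (norm (y i - node_avg n y))\<^sup>2"
      using norm_diff_sq[of "y' i - node_avg n y'" "y i - node_avg n y"]
      by (simp add: algebra_simps)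
  qed
  also have "\<dots> = 2 * spread y' + 2 * spread y"
    unfolding spread_def sum.distrib sum_distrib_left[symmetric] by (simp add: distrib_left)
  finally show ?thesis by (simp add: node_avg_diff)
qed

text \<open>
  A gradient step of length \<open>1 / L\<close> decreases the objective by \<open>norm (ggrad x) ^ 2 / (2 * L)\<close>, but not
  below \<open>l\<close>.
\<close>

lemma gradient_sq_le_gap:
  assumes x: "x \<in> euclid d" and inf: "\<And>y. y \<in> euclid d \<Longrightarrow> l \<le> global_obj n \<Xi> F y"
  shows "(norm (ggrad x))\<^sup>2 \<le> 2 * L * (global_obj n \<Xi> F x - l)"
proof -
  let ?h = "(- (1 / L)) *\<^sub>R ggrad x"
  have h: "?h \<in> euclid d" using x by (intro euclid_scaleR) auto
  have "\<bar>global_obj n \<Xi> F (x + ?h) - global_obj n \<Xi> F x - grad d (global_obj n \<Xi> F) x \<bullet> ?h\<bar> \<le> L / 2 * (norm ?h)\<^sup>2"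
    by (rule smooth_fun_taylor[OF global_smooth x h])
  moreover have "grad d (global_obj n \<Xi> F) x \<bullet> ?h = - ((norm (ggrad x))\<^sup>2 / L)"
    by (simp add: ggrad_def[symmetric] power2_norm_eq_inner)
  moreover have "L / 2 * (norm ?h)\<^sup>2 = (norm (ggrad x))\<^sup>2 / (2 * L)"
    using constants by (simp add: power_divide power2_eq_square field_simps)
  moreover have "l \<le> global_obj n \<Xi> F (x + ?h)" using x h by (intro inf) auto
  ultimately have "(norm (ggrad x))\<^sup>2 / L - (norm (ggrad x))\<^sup>2 / (2 * L) \<le> global_obj n \<Xi> F x - l"
    by linarith
  then have "(norm (ggrad x))\<^sup>2 / (2 * L) \<le> global_obj n \<Xi> F x - l" by (simp add: field_simps)
  then show ?thesis using constants by (simp add: field_simps)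
qed

text \<open>
  The inner product of the gradient with the direction \<open>v\<close> is expressed through the square of their
  difference. The quadratic Taylor term takes half of \<open>norm v ^ 2\<close>, as \<open>a * L \<le> 1/2\<close>; the other half
  is kept in order to absorb the moves of the mean iterate.
\<close>

lemma descent_step:
  assumes x: "x \<in> euclid d" and v: "v \<in> euclid d" and a: "0 < a" "a * L \<le> 1/2"
  shows "a / 2 * ((norm (ggrad x))\<^sup>2 + 1/2 * (norm v)\<^sup>2)
    \<le> global_obj n \<Xi> F x - global_obj n \<Xi> F (x - a *\<^sub>R v) + a / 2 * (norm (v - ggrad x))\<^sup>2"
proof -
  have h: "(- a) *\<^sub>R v \<in> euclid d" using v by (rule euclid_scaleR)
  let ?P = "global_obj n \<Xi> F (x + (- a) *\<^sub>R v)" and ?Q = "global_obj n \<Xi> F x"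
  have "?P - ?Q - grad d (global_obj n \<Xi> F) x \<bullet> ((- a) *\<^sub>R v) \<le> L / 2 * (norm ((- a) *\<^sub>R v))\<^sup>2"
    using smooth_fun_taylor[OF global_smooth x h] by (rule abs_le_D1)
  moreover have "grad d (global_obj n \<Xi> F) x \<bullet> ((- a) *\<^sub>R v) = - (a * (ggrad x \<bullet> v))"
    by (simp add: ggrad_def)
  moreover have "L / 2 * (norm ((- a) *\<^sub>R v))\<^sup>2 = a / 2 * (a * L) * (norm v)\<^sup>2"
    by (simp add: power_mult_distrib power2_eq_square)
  moreover have "a / 2 * (a * L) * (norm v)\<^sup>2 \<le> a / 2 * (1/2) * (norm v)\<^sup>2"
    using a by (intro mult_right_mono mult_left_mono) auto
  moreover have sq: "(norm (v - ggrad x))\<^sup>2 = (norm v)\<^sup>2 - 2 * (ggrad x \<bullet> v) + (norm (ggrad x))\<^sup>2"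
    by (simp add: power2_norm_eq_inner inner_diff_left inner_diff_right inner_commute)
  have "a / 2 * (norm (v - ggrad x))\<^sup>2 = a / 2 * (norm v)\<^sup>2 - a * (ggrad x \<bullet> v) + a / 2 * (norm (ggrad x))\<^sup>2"
    unfolding sq by (simp add: algebra_simps)
  moreover have "a / 2 * ((norm (ggrad x))\<^sup>2 + 1/2 * (norm v)\<^sup>2)
      = a / 2 * (norm (ggrad x))\<^sup>2 + a / 2 * (1/2) * (norm v)\<^sup>2"
    "a / 2 * (norm v)\<^sup>2 = a / 2 * (1/2) * (norm v)\<^sup>2 + a / 2 * (1/2) * (norm v)\<^sup>2"
    by (simp_all add: algebra_simps)
  ultimately have "a / 2 * ((norm (ggrad x))\<^sup>2 + 1/2 * (norm v)\<^sup>2) \<le> ?Q - ?P + a / 2 * (norm (v - ggrad x))\<^sup>2"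
    by linarith
  then show ?thesis by simp
qed

end

section \<open>The gradient tracking error\<close>

context dzovr_analysis
begin

definition xbar :: "nat \<Rightarrow> 'w \<Rightarrow> rvec" where "xbar k \<omega> = node_avg n (\<lambda>i. x k i \<omega>)"
definition mbar :: "nat \<Rightarrow> 'w \<Rightarrow> rvec" where "mbar k \<omega> = node_avg n (\<lambda>i. m k i \<omega>)"

text \<open>
  The reference is the mean of the estimator at the current radius. Relative to the gradient the
  recursion would have a bias of the order of the radius in every step, and the factor \<open>1 / \<beta>\<close> lost in
  the contraction would make it dominate; relative to \<^const>\<open>est_mean\<close> only the change of the radius
  enters.
\<close>

definition err :: "nat \<Rightarrow> nat \<Rightarrow> 'w \<Rightarrow> rvec" where
  "err k i \<omega> = m k i \<omega> - est_mean (t k) i (x k i \<omega>)"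

definition errbar :: "nat \<Rightarrow> 'w \<Rightarrow> rvec" where "errbar k \<omega> = node_avg n (\<lambda>i. err k i \<omega>)"

text \<open>
  The innovation of node \<open>i\<close> in step \<open>Suc k\<close>, as a function of the past and of the fresh sample.
\<close>

definition innov :: "nat \<Rightarrow> nat \<Rightarrow> 'w \<times> (rvec \<times> 'x) \<Rightarrow> rvec" where
  "innov k i q = (let r = t (Suc k) in
     (est r i (x (Suc k) i (fst q)) (snd q) - (1 - \<beta>) *\<^sub>R est r i (x k i (fst q)) (snd q))
     - (est_mean r i (x (Suc k) i (fst q)) - (1 - \<beta>) *\<^sub>R est_mean r i (x k i (fst q))))"

definition noise :: "nat \<Rightarrow> nat \<Rightarrow> 'w \<Rightarrow> rvec" where
  "noise k i \<omega> = innov k i (\<omega>, Z (i, Suc k, 1) \<omega>)"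

definition carried :: "nat \<Rightarrow> nat \<Rightarrow> 'w \<Rightarrow> rvec" where
  "carried k i \<omega> = (1 - \<beta>) *\<^sub>R (err k i \<omega>
     + (est_mean (t k) i (x k i \<omega>) - est_mean (t (Suc k)) i (x k i \<omega>)))"

lemma err_Suc:
  "i \<in> {1..n} \<Longrightarrow> \<omega> \<in> space M \<Longrightarrow> err (Suc k) i \<omega> = carried k i \<omega> + noise k i \<omega>"
  unfolding err_def carried_def noise_def innov_def Let_def
  by (simp add: m_Suc_est algebra_simps)

lemma est_mean_sq_le:
  assumes i: "i \<in> {1..n}" and y: "y \<in> euclid d" and r: "0 < r" "real d * r \<le> 1"
  shows "(norm (est_mean r i y))\<^sup>2 \<le> est_growth + est_growth * (norm y)\<^sup>2"
  using norm_est_mean_sq_le[OF i y r(1)] est_growth[OF i y r] by (simp add: algebra_simps)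

lemma sq_integrable_est_mean:
  assumes i: "i \<in> {1..n}"
  shows "sq_integrable M (\<lambda>\<omega>. est_mean (t l) i (x k i \<omega>))"
proof (rule sq_integrable_bound)
  show "(\<lambda>\<omega>. est_mean (t l) i (x k i \<omega>)) \<in> borel_measurable M"
    by (rule measurable_compose[OF iterates_measurable(1)[OF i] est_mean_measurable[OF i]])
  show "integrable M (\<lambda>\<omega>. est_growth + est_growth * (norm (x k i \<omega>))\<^sup>2)"
    using sq_integrable_integrable[OF iterates_sq_integrable(1)[OF i]] by simp
  show "AE \<omega> in M. (norm (est_mean (t l) i (x k i \<omega>)))\<^sup>2 \<le> est_growth + est_growth * (norm (x k i \<omega>))\<^sup>2"
    using est_mean_sq_le[OF i iterates_euclid(1)[OF _ i] radius_pos d_radius_le_1] by auto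
qed

lemma sq_integrable_err: "i \<in> {1..n} \<Longrightarrow> sq_integrable M (err k i)"
  unfolding err_def[abs_def] by (intro sq_integrable_diff iterates_sq_integrable sq_integrable_est_mean)

lemma sq_integrable_carried: "i \<in> {1..n} \<Longrightarrow> sq_integrable M (carried k i)"
  unfolding carried_def[abs_def]
  by (intro sq_integrable_scaleR sq_integrable_add sq_integrable_diff sq_integrable_err sq_integrable_est_mean)

lemma sq_integrable_node_avg:
  "(\<And>i. i \<in> {1..n} \<Longrightarrow> sq_integrable M (f i)) \<Longrightarrow> sq_integrable M (\<lambda>\<omega>. node_avg n (\<lambda>i. f i \<omega>))"
  unfolding node_avg_def by (intro sq_integrable_scaleR sq_integrable_sum)

lemma x_adapted_Suc: "i \<in> {1..n} \<Longrightarrow> x k i \<in> borel_measurable (filt (past (Suc k)))"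
  by (rule filt_mono[OF past_mono x_adapted]) auto

lemma est_mean_adapted:
  "i \<in> {1..n} \<Longrightarrow> y \<in> borel_measurable (filt Q) \<Longrightarrow> (\<lambda>\<omega>. est_mean r i (y \<omega>)) \<in> borel_measurable (filt Q)"
  by (rule measurable_compose[OF _ est_mean_measurable])

lemma carried_adapted: "i \<in> {1..n} \<Longrightarrow> carried k i \<in> borel_measurable (filt (past (Suc k)))"
  unfolding carried_def[abs_def] err_def
  by (intro borel_measurable_scaleR borel_measurable_const borel_measurable_add borel_measurable_diff
      m_adapted est_mean_adapted x_adapted_Suc)

lemma innov_measurable:
  assumes i: "i \<in> {1..n}" and Q: "past (Suc k) \<subseteq> Q"
  shows "innov k i \<in> borel_measurable (filt Q \<Otimes>\<^sub>M zspace (i, Suc k, 1))"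
proof -
  have x: "x (Suc k) i \<in> borel_measurable (filt Q)" "x k i \<in> borel_measurable (filt Q)"
    by (rule filt_mono[OF Q], rule x_adapted[OF i]) (rule filt_mono[OF Q], rule x_adapted_Suc[OF i])
  show ?thesis
    unfolding innov_def[abs_def] Let_def
    by (intro borel_measurable_scaleR borel_measurable_const borel_measurable_diff
        est_frozen_measurable x i fst_conv measurable_compose[OF measurable_fst est_mean_adapted])
qed

lemma innov_frozen:
  fixes k :: nat
  assumes i: "i \<in> {1..n}" and \<omega>: "\<omega> \<in> space M"
  defines "A \<equiv> (\<lambda>z. est (t (Suc k)) i (x (Suc k) i \<omega>) z - (1 - \<beta>) *\<^sub>R est (t (Suc k)) i (x k i \<omega>) z)"
  shows "sq_integrable (law i) A" and "innov k i (\<omega>, z) = A z - vec_mean d (law i) A"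
proof -
  interpret law: prob_space "law i" by (rule prob_space_law[OF i])
  note xe = iterates_euclid(1)[OF \<omega> i]
  note e = est_second_moment(1)[OF i xe[of "Suc k"] radius_pos[of "Suc k"]]
    est_second_moment(1)[OF i xe[of k] radius_pos[of "Suc k"]]
  show "sq_integrable (law i) A" unfolding A_def by (intro sq_integrable_diff sq_integrable_scaleR e)
  show "innov k i (\<omega>, z) = A z - vec_mean d (law i) A"
    unfolding A_def innov_def Let_def
    by (simp add: law.vec_mean_diff[OF e(1) sq_integrable_scaleR[OF e(2)]] law.vec_mean_scaleR est_mean_def)
qed

text \<open>
  The radius is so small that its contribution to the variance has the form of an additional sampling
  variance \<open>L\<^sup>2\<close>, multiplied by \<open>\<beta>\<^sup>2 d\<close> like the true one.
\<close>

lemma d_L_radius_sq_le: "(real d * L * t k)\<^sup>2 \<le> \<beta>\<^sup>2 * real d * L\<^sup>2"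
proof -
  have "real d * L * t k \<le> L * \<beta>"
    using mult_left_mono[OF d_radius_le_beta[of k], of L] constants by (simp add: mult_ac)
  then have "(real d * L * t k)\<^sup>2 \<le> (L * \<beta>)\<^sup>2"
    using constants radius_pos[of k] by (intro power_mono) (auto intro: mult_nonneg_nonneg less_imp_le)
  also have "\<dots> = 1 * (\<beta>\<^sup>2 * L\<^sup>2)" by (simp add: power_mult_distrib mult.commute)
  also have "\<dots> \<le> real d * (\<beta>\<^sup>2 * L\<^sup>2)" using d_pos by (intro mult_right_mono) auto
  finally show ?thesis by (simp add: mult_ac)
qed

lemma est_radius_moment:
  assumes i: "i \<in> {1..n}" and y: "y \<in> euclid d"
  shows "(\<integral>p. (norm (est (t k) i y p))\<^sup>2 \<partial>law i)
    \<le> 5/4 * real d * ((1 + \<sigma>0\<^sup>2) * (norm (lgrad i y))\<^sup>2 + \<sigma>1\<^sup>2 + L\<^sup>2)"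
proof -
  have "\<beta>\<^sup>2 * real d * L\<^sup>2 \<le> 1 * real d * L\<^sup>2"
    using beta_pos beta_le_1 by (intro mult_right_mono) (auto simp: power_le_one)
  then have "5/4 * (real d * L * t k)\<^sup>2 \<le> 5/4 * real d * L\<^sup>2"
    using d_L_radius_sq_le[of k] by simp
  then show ?thesis
    using est_second_moment(2)[OF i y radius_pos[of k]] by (simp add: distrib_left)
qed

lemma est_radius_difference:
  assumes i: "i \<in> {1..n}" and y: "y \<in> euclid d" "y' \<in> euclid d"
  shows "(\<integral>p. (norm (est (t k) i y' p - est (t k) i y p))\<^sup>2 \<partial>law i)
    \<le> 2 * real d * L\<^sup>2 * (norm (y' - y))\<^sup>2 + 2 * \<beta>\<^sup>2 * real d * L\<^sup>2"
  using est_difference_moment[OF i y(2,1) radius_pos[of k]] d_L_radius_sq_le[of k] by simp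

definition grad_moment :: "nat \<Rightarrow> nat \<Rightarrow> 'w \<Rightarrow> real" where
  "grad_moment k i \<omega> = (1 + \<sigma>0\<^sup>2) * (norm (lgrad i (x k i \<omega>)))\<^sup>2 + \<sigma>1\<^sup>2 + L\<^sup>2"

definition move_sq :: "nat \<Rightarrow> nat \<Rightarrow> 'w \<Rightarrow> real" where
  "move_sq k i \<omega> = (norm (x (Suc k) i \<omega> - x k i \<omega>))\<^sup>2"

text \<open>
  The innovation is the centred version of \<open>\<beta>\<close> times the estimator at the new point plus \<open>1 - \<beta>\<close> times
  a difference of two estimators, and centring does not increase the second moment.
\<close>

lemma innov_second_moment:
  assumes i: "i \<in> {1..n}" and \<omega>: "\<omega> \<in> space M"
  shows "sq_integrable (law i) (\<lambda>z. innov k i (\<omega>, z)) \<and>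
    (\<integral>z. (norm (innov k i (\<omega>, z)))\<^sup>2 \<partial>law i)
      \<le> 25/16 * \<beta>\<^sup>2 * real d * grad_moment (Suc k) i \<omega>
        + (10 * real d * L\<^sup>2 * move_sq k i \<omega> + 10 * \<beta>\<^sup>2 * real d * L\<^sup>2)"
proof
  interpret law: prob_space "law i" by (rule prob_space_law[OF i])
  let ?e' = "est (t (Suc k)) i (x (Suc k) i \<omega>)" and ?e = "est (t (Suc k)) i (x k i \<omega>)"
  let ?A = "\<lambda>z. ?e' z - (1 - \<beta>) *\<^sub>R ?e z"
  note fr = innov_frozen[OF i \<omega>, of k]
  note xe = iterates_euclid(1)[OF \<omega> i]
  note e = est_second_moment(1)[OF i xe[of "Suc k"] radius_pos[of "Suc k"]]
    est_second_moment(1)[OF i xe[of k] radius_pos[of "Suc k"]]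
  show "sq_integrable (law i) (\<lambda>z. innov k i (\<omega>, z))"
    unfolding fr(2) by (intro sq_integrable_diff fr(1) law.sq_integrable_const)
  have "(\<integral>z. (norm (innov k i (\<omega>, z)))\<^sup>2 \<partial>law i) \<le> (\<integral>z. (norm (?A z))\<^sup>2 \<partial>law i)"
    unfolding fr(2) by (rule law.vec_mean_variance_le[OF fr(1)])
  also have "\<dots> \<le> (\<integral>z. 5/4 * \<beta>\<^sup>2 * (norm (?e' z))\<^sup>2 + 5 * (norm (?e' z - ?e z))\<^sup>2 \<partial>law i)"
  proof (intro integral_mono sq_integrable_integrable[OF fr(1)])
    show "integrable (law i) (\<lambda>z. 5/4 * \<beta>\<^sup>2 * (norm (?e' z))\<^sup>2 + 5 * (norm (?e' z - ?e z))\<^sup>2)"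
      using sq_integrable_integrable[OF e(1)] sq_integrable_integrable[OF sq_integrable_diff[OF e]] by simp
    fix z
    have "(norm (?A z))\<^sup>2 = (norm (\<beta> *\<^sub>R ?e' z + (1 - \<beta>) *\<^sub>R (?e' z - ?e z)))\<^sup>2"
      by (simp add: algebra_simps)
    also have "\<dots> \<le> 5/4 * (norm (\<beta> *\<^sub>R ?e' z))\<^sup>2 + 5 * (norm ((1 - \<beta>) *\<^sub>R (?e' z - ?e z)))\<^sup>2"
      by (rule norm_add_sq_54)
    also have "(norm ((1 - \<beta>) *\<^sub>R (?e' z - ?e z)))\<^sup>2 \<le> (norm (?e' z - ?e z))\<^sup>2"
      using beta_pos beta_le_1 by (intro power_mono) (auto intro: mult_left_le_one_le)
    finally show "(norm (?A z))\<^sup>2 \<le> 5/4 * \<beta>\<^sup>2 * (norm (?e' z))\<^sup>2 + 5 * (norm (?e' z - ?e z))\<^sup>2"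
      by (simp add: power_mult_distrib)
  qed
  also have "\<dots> = 5/4 * \<beta>\<^sup>2 * (\<integral>z. (norm (?e' z))\<^sup>2 \<partial>law i) + 5 * (\<integral>z. (norm (?e' z - ?e z))\<^sup>2 \<partial>law i)"
    using sq_integrable_integrable[OF e(1)] sq_integrable_integrable[OF sq_integrable_diff[OF e]] by simp
  also have "\<dots> \<le> 5/4 * \<beta>\<^sup>2 * (5/4 * real d * grad_moment (Suc k) i \<omega>)
      + 5 * (2 * real d * L\<^sup>2 * move_sq k i \<omega> + 2 * \<beta>\<^sup>2 * real d * L\<^sup>2)"
    unfolding grad_moment_def move_sq_def
    by (intro add_mono mult_left_mono est_radius_moment est_radius_difference i xe) auto
  finally show "(\<integral>z. (norm (innov k i (\<omega>, z)))\<^sup>2 \<partial>law i)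
      \<le> 25/16 * \<beta>\<^sup>2 * real d * grad_moment (Suc k) i \<omega>
        + (10 * real d * L\<^sup>2 * move_sq k i \<omega> + 10 * \<beta>\<^sup>2 * real d * L\<^sup>2)"
    by (simp add: algebra_simps)
qed

lemma sq_integrable_lgrad: "i \<in> {1..n} \<Longrightarrow> sq_integrable M (\<lambda>\<omega>. lgrad i (x k i \<omega>))"
  by (rule sq_integrable_lipschitz[OF continuous_on_lgrad lipschitz_growth[OF lgrad_lipschitz]])
    (auto intro: iterates_sq_integrable iterates_euclid)

lemma integrable_grad_moment: "i \<in> {1..n} \<Longrightarrow> integrable M (grad_moment k i)"
  unfolding grad_moment_def[abs_def] using sq_integrable_integrable[OF sq_integrable_lgrad] by simp

lemma integrable_move_sq: "i \<in> {1..n} \<Longrightarrow> integrable M (move_sq k i)"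
  unfolding move_sq_def[abs_def] by (intro sq_integrable_integrable sq_integrable_diff iterates_sq_integrable)

lemma noise_second_moment:
  assumes i: "i \<in> {1..n}"
  shows "sq_integrable M (noise k i)"
    and "expectation (\<lambda>\<omega>. (norm (noise k i \<omega>))\<^sup>2)
      \<le> 25/16 * \<beta>\<^sup>2 * real d * expectation (grad_moment (Suc k) i)
        + (10 * real d * L\<^sup>2 * expectation (move_sq k i) + 10 * \<beta>\<^sup>2 * real d * L\<^sup>2)"
proof -
  let ?b = "\<lambda>\<omega>. 25/16 * \<beta>\<^sup>2 * real d * grad_moment (Suc k) i \<omega>
        + (10 * real d * L\<^sup>2 * move_sq k i \<omega> + 10 * \<beta>\<^sup>2 * real d * L\<^sup>2)"
  have b: "integrable M ?b" using integrable_grad_moment[OF i] integrable_move_sq[OF i] by simp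
  note * = fresh_sample_second_moment[OF step_index[OF i] past_fresh(1) past_subset
      innov_measurable[OF i order_refl] b, unfolded fst_conv, OF innov_second_moment[OF i]]
  show "sq_integrable M (noise k i)" using *(1) by (simp add: noise_def[abs_def])
  show "expectation (\<lambda>\<omega>. (norm (noise k i \<omega>))\<^sup>2)
      \<le> 25/16 * \<beta>\<^sup>2 * real d * expectation (grad_moment (Suc k) i)
        + (10 * real d * L\<^sup>2 * expectation (move_sq k i) + 10 * \<beta>\<^sup>2 * real d * L\<^sup>2)"
    using *(2) integrable_grad_moment[OF i] integrable_move_sq[OF i]
    by (simp add: noise_def prob_space)
qed

lemma noise_orthogonal:
  assumes i: "i \<in> {1..n}" and Q: "past (Suc k) \<subseteq> Q" "Q \<subseteq> I" "(i, Suc k, 1) \<notin> Q"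
    and V: "V \<in> borel_measurable (filt Q)" "sq_integrable M V" "\<And>\<omega>. \<omega> \<in> space M \<Longrightarrow> V \<omega> \<in> euclid d"
  shows "expectation (\<lambda>\<omega>. V \<omega> \<bullet> noise k i \<omega>) = 0"
  unfolding noise_def
proof (rule fresh_sample_orthogonal[OF step_index[OF i] Q(3,2) innov_measurable[OF i Q(1)] _ V(1,2)])
  show "sq_integrable M (\<lambda>\<omega>. innov k i (\<omega>, Z (i, Suc k, 1) \<omega>))"
    using noise_second_moment(1)[OF i] by (simp add: noise_def[abs_def])
  fix \<omega> assume \<omega>: "\<omega> \<in> space M"
  interpret law: prob_space "law i" by (rule prob_space_law[OF i])
  show "(\<integral>z. V \<omega> \<bullet> innov k i (\<omega>, z) \<partial>law (fst (i, Suc k, 1))) = 0"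
    unfolding innov_frozen(2)[OF i \<omega>] fst_conv
    by (rule law.inner_vec_mean_centred[OF innov_frozen(1)[OF i \<omega>] V(3)[OF \<omega>]])
qed

lemma noise_adapted: "i \<in> {1..n} \<Longrightarrow> noise k i \<in> borel_measurable (filt (insert (i, Suc k, 1) (past (Suc k))))"
  unfolding noise_def[abs_def]
proof (rule measurable_compose[OF _ innov_measurable])
  assume i: "i \<in> {1..n}"
  have "insert (i, Suc k, 1) (past (Suc k)) \<subseteq> I" using step_index[OF i] past_subset by auto
  then show "(\<lambda>\<omega>. (\<omega>, Z (i, Suc k, 1) \<omega>)) \<in> measurable (filt (insert (i, Suc k, 1) (past (Suc k))))
      (filt (insert (i, Suc k, 1) (past (Suc k))) \<Otimes>\<^sub>M zspace (i, Suc k, 1))"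
    by (intro measurable_Pair Z_measurable_filt) (auto simp: measurable_ident[unfolded id_def])
qed auto

lemma noise_euclid: "noise k i \<omega> \<in> euclid d"
  unfolding noise_def innov_def Let_def by (auto intro!: euclid_diff euclid_scaleR)

lemma carried_euclid: "i \<in> {1..n} \<Longrightarrow> \<omega> \<in> space M \<Longrightarrow> carried k i \<omega> \<in> euclid d"
  unfolding carried_def err_def by (auto intro!: euclid_diff euclid_add euclid_scaleR iterates_euclid)

text \<open>
  The sample of node \<open>i\<close> is added to the past, with respect to which the sample of node \<open>j\<close> is still
  fresh.
\<close>

lemma noise_pairwise_orthogonal:
  assumes ij: "i \<in> {1..n}" "j \<in> {1..n}" "i \<noteq> j"
  shows "expectation (\<lambda>\<omega>. noise k i \<omega> \<bullet> noise k j \<omega>) = 0"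
proof (rule noise_orthogonal[OF ij(2) _ _ _ noise_adapted[OF ij(1)] noise_second_moment(1)[OF ij(1)] noise_euclid])
  show "past (Suc k) \<subseteq> insert (i, Suc k, 1) (past (Suc k))" by auto
  show "insert (i, Suc k, 1) (past (Suc k)) \<subseteq> I" using step_index[OF ij(1)] past_subset by auto
  show "(j, Suc k, 1) \<notin> insert (i, Suc k, 1) (past (Suc k))"
    using past_fresh(1)[of j "Suc k" 1] ij by auto
qed

definition drift :: "nat \<Rightarrow> real" where "drift k = real d * L * (t k - t (Suc k))"

lemma drift_nonneg: "0 \<le> drift k"
  unfolding drift_def using radius_decreasing[of k] constants by simp

text \<open>
  The radii decrease, so that the squared changes are at most the first radius times the changes, which
  telescope.
\<close>

lemma sum_drift_sq: "(\<Sum>k<K. (drift k)\<^sup>2) \<le> L\<^sup>2 * \<beta>\<^sup>2"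
proof -
  have dec: "t k \<le> t 0" for k by (induction k) (auto intro: order_trans radius_decreasing)
  have "(\<Sum>k<K. (drift k)\<^sup>2) \<le> (\<Sum>k<K. (real d * L * t 0) * (real d * L * (t k - t (Suc k))))"
  proof (rule sum_mono)
    fix k
    have "t k - t (Suc k) \<le> t 0" using dec[of k] radius_pos[of "Suc k"] by simp
    then have "drift k \<le> real d * L * t 0"
      unfolding drift_def using constants by (intro mult_left_mono) auto
    then have "drift k * drift k \<le> (real d * L * t 0) * drift k"
      by (rule mult_right_mono) (rule drift_nonneg)
    then show "(drift k)\<^sup>2 \<le> (real d * L * t 0) * (real d * L * (t k - t (Suc k)))"
      by (simp add: drift_def power2_eq_square)
  qed
  also have "\<dots> = (real d * L * t 0) * (real d * L * (t 0 - t K))"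
    unfolding sum_distrib_left[symmetric] by (simp only: sum_lessThan_telescope')
  also have "\<dots> \<le> (real d * L * t 0) * (real d * L * t 0)"
    using constants radius_pos[of 0] radius_pos[of K]
    by (intro mult_left_mono) (auto intro!: mult_nonneg_nonneg)
  also have "\<dots> \<le> (L * \<beta>) * (L * \<beta>)"
  proof -
    have "real d * L * t 0 \<le> L * \<beta>"
      using mult_left_mono[OF d_radius_le_beta[of 0], of L] constants by (simp add: mult_ac)
    from mult_mono[OF this this] show ?thesis
      using constants radius_pos[of 0] beta_pos by auto
  qed
  finally show ?thesis by (simp add: power2_eq_square mult_ac)
qed

text \<open>
  Young's inequality with weight \<open>\<beta>\<close>, and \<open>(1 - \<beta>)\<^sup>2 * (1 + \<beta>) \<le> 1 - \<beta>\<close>.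
\<close>

lemma carried_sq_le:
  fixes e v :: rvec
  assumes "norm v \<le> \<delta>"
  shows "(norm ((1 - \<beta>) *\<^sub>R (e + v)))\<^sup>2 \<le> (1 - \<beta>) * (norm e)\<^sup>2 + \<delta>\<^sup>2 / \<beta>"
proof -
  have "(norm ((1 - \<beta>) *\<^sub>R (e + v)))\<^sup>2 = (1 - \<beta>)\<^sup>2 * (norm (e + v))\<^sup>2" by (simp add: power_mult_distrib)
  also have "\<dots> \<le> (1 - \<beta>)\<^sup>2 * ((1 + \<beta>) * (norm e)\<^sup>2 + (1 + 1 / \<beta>) * (norm v)\<^sup>2)"
    by (intro mult_left_mono norm_add_sq_young beta_pos) simp
  also have "\<dots> = ((1 - \<beta>)\<^sup>2 * (1 + \<beta>)) * (norm e)\<^sup>2 + ((1 - \<beta>)\<^sup>2 * (1 + 1 / \<beta>)) * (norm v)\<^sup>2"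
    by (simp add: algebra_simps)
  also have "\<dots> \<le> (1 - \<beta>) * (norm e)\<^sup>2 + (1 / \<beta>) * \<delta>\<^sup>2"
  proof (intro add_mono mult_mono)
    have b: "(1 - \<beta>) * (1 + \<beta>) \<le> 1" by (simp add: algebra_simps)
    have "(1 - \<beta>)\<^sup>2 * (1 + \<beta>) = (1 - \<beta>) * ((1 - \<beta>) * (1 + \<beta>))" by (simp add: power2_eq_square)
    also have "\<dots> \<le> (1 - \<beta>) * 1" using b beta_le_1 by (intro mult_left_mono) auto
    finally show 1: "(1 - \<beta>)\<^sup>2 * (1 + \<beta>) \<le> 1 - \<beta>" by simp
    have "(1 - \<beta>)\<^sup>2 * (1 + 1 / \<beta>) = ((1 - \<beta>)\<^sup>2 * (1 + \<beta>)) / \<beta>" using beta_pos by (simp add: field_simps)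
    also have "\<dots> \<le> 1 / \<beta>" using 1 beta_pos by (intro divide_right_mono) auto
    finally show "(1 - \<beta>)\<^sup>2 * (1 + 1 / \<beta>) \<le> 1 / \<beta>" .
    show "(norm v)\<^sup>2 \<le> \<delta>\<^sup>2" using assms by (intro power_mono) auto
  qed (use beta_pos beta_le_1 in auto)
  finally show ?thesis by simp
qed

lemma est_mean_drift:
  assumes i: "i \<in> {1..n}" and y: "y \<in> euclid d"
  shows "norm (est_mean (t k) i y - est_mean (t (Suc k)) i y) \<le> drift k"
  using est_mean_radius[OF i y radius_pos[of k] radius_pos[of "Suc k"]] radius_decreasing[of k]
  by (simp add: drift_def)

lemma expectation_mono_norm_sq:
  assumes f: "sq_integrable M f" and h: "integrable M h"
    and le: "\<And>\<omega>. \<omega> \<in> space M \<Longrightarrow> (norm (f \<omega>))\<^sup>2 \<le> h \<omega>"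
  shows "expectation (\<lambda>\<omega>. (norm (f \<omega>))\<^sup>2) \<le> expectation h"
  by (rule integral_mono[OF sq_integrable_integrable[OF f] h le])

lemma err_recursion:
  assumes i: "i \<in> {1..n}"
  shows "expectation (\<lambda>\<omega>. (norm (err (Suc k) i \<omega>))\<^sup>2)
    \<le> (1 - \<beta>) * expectation (\<lambda>\<omega>. (norm (err k i \<omega>))\<^sup>2) + ((drift k)\<^sup>2 / \<beta>
      + expectation (\<lambda>\<omega>. (norm (noise k i \<omega>))\<^sup>2))"
proof -
  have e1: "expectation (\<lambda>\<omega>. (norm (err (Suc k) i \<omega>))\<^sup>2)
      = expectation (\<lambda>\<omega>. (norm (carried k i \<omega> + (\<Sum>j\<in>{i}. noise k j \<omega>)))\<^sup>2)"
    by (rule Bochner_Integration.integral_cong) (simp_all add: err_Suc[OF i])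
  have e2: "expectation (\<lambda>\<omega>. (norm (carried k i \<omega> + (\<Sum>j\<in>{i}. noise k j \<omega>)))\<^sup>2)
      = expectation (\<lambda>\<omega>. (norm (carried k i \<omega>))\<^sup>2) + (\<Sum>j\<in>{i}. expectation (\<lambda>\<omega>. (norm (noise k j \<omega>))\<^sup>2))"
  proof (rule expectation_norm_add_orthogonal)
    fix j assume j: "j \<in> {i}"
    then show "sq_integrable M (noise k j)" using noise_second_moment(1)[OF i] by simp
    show "expectation (\<lambda>\<omega>. carried k i \<omega> \<bullet> noise k j \<omega>) = 0"
      using j i past_fresh(1)[of i "Suc k" 1]
      by (intro noise_orthogonal[OF _ order_refl past_subset] carried_adapted sq_integrable_carried carried_euclid) auto
  qed (use i in \<open>auto intro: sq_integrable_carried\<close>)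
  have "expectation (\<lambda>\<omega>. (norm (carried k i \<omega>))\<^sup>2)
      \<le> expectation (\<lambda>\<omega>. (1 - \<beta>) * (norm (err k i \<omega>))\<^sup>2 + (drift k)\<^sup>2 / \<beta>)"
  proof (rule expectation_mono_norm_sq[OF sq_integrable_carried[OF i]])
    show "integrable M (\<lambda>\<omega>. (1 - \<beta>) * (norm (err k i \<omega>))\<^sup>2 + (drift k)\<^sup>2 / \<beta>)"
      using sq_integrable_integrable[OF sq_integrable_err[OF i]] by simp
    show "(norm (carried k i \<omega>))\<^sup>2 \<le> (1 - \<beta>) * (norm (err k i \<omega>))\<^sup>2 + (drift k)\<^sup>2 / \<beta>"
      if "\<omega> \<in> space M" for \<omega>
      unfolding carried_def by (intro carried_sq_le est_mean_drift i iterates_euclid that)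
  qed
  also have "\<dots> = (1 - \<beta>) * expectation (\<lambda>\<omega>. (norm (err k i \<omega>))\<^sup>2) + (drift k)\<^sup>2 / \<beta>"
    using sq_integrable_integrable[OF sq_integrable_err[OF i]] by (simp add: prob_space)
  finally show ?thesis unfolding e1 e2 by simp
qed

text \<open>Averaging over the nodes divides the variance of the innovations by \<open>n\<close>.\<close>

lemma errbar_recursion:
  "expectation (\<lambda>\<omega>. (norm (errbar (Suc k) \<omega>))\<^sup>2)
    \<le> (1 - \<beta>) * expectation (\<lambda>\<omega>. (norm (errbar k \<omega>))\<^sup>2) + ((drift k)\<^sup>2 / \<beta>
      + 1 / real n * (1 / real n * (\<Sum>i=1..n. expectation (\<lambda>\<omega>. (norm (noise k i \<omega>))\<^sup>2))))"
proof -
  let ?c = "\<lambda>\<omega>. node_avg n (\<lambda>i. carried k i \<omega>)"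
  let ?\<nu> = "\<lambda>i \<omega>. (1 / real n) *\<^sub>R noise k i \<omega>"
  have c: "sq_integrable M ?c" by (intro sq_integrable_node_avg sq_integrable_carried)
  have cm: "?c \<in> borel_measurable (filt (past (Suc k)))"
    unfolding node_avg_def
    by (intro borel_measurable_scaleR borel_measurable_const borel_measurable_sum carried_adapted)
  have ebar: "sq_integrable M (errbar k)"
    unfolding errbar_def[abs_def] by (intro sq_integrable_node_avg sq_integrable_err)
  have e1: "expectation (\<lambda>\<omega>. (norm (errbar (Suc k) \<omega>))\<^sup>2)
      = expectation (\<lambda>\<omega>. (norm (?c \<omega> + (\<Sum>i\<in>{1..n}. ?\<nu> i \<omega>)))\<^sup>2)"
  proof (rule Bochner_Integration.integral_cong[OF refl])
    fix \<omega> assume "\<omega> \<in> space M"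
    then have "errbar (Suc k) \<omega> = node_avg n (\<lambda>i. carried k i \<omega> + noise k i \<omega>)"
      unfolding errbar_def by (intro node_avg_cong err_Suc)
    also have "\<dots> = ?c \<omega> + (\<Sum>i\<in>{1..n}. ?\<nu> i \<omega>)"
      by (simp add: node_avg_add) (simp add: node_avg_def scaleR_sum_right)
    finally show "(norm (errbar (Suc k) \<omega>))\<^sup>2 = (norm (?c \<omega> + (\<Sum>i\<in>{1..n}. ?\<nu> i \<omega>)))\<^sup>2" by simp
  qed
  have e2: "expectation (\<lambda>\<omega>. (norm (?c \<omega> + (\<Sum>i\<in>{1..n}. ?\<nu> i \<omega>)))\<^sup>2)
      = expectation (\<lambda>\<omega>. (norm (?c \<omega>))\<^sup>2) + (\<Sum>i\<in>{1..n}. expectation (\<lambda>\<omega>. (norm (?\<nu> i \<omega>))\<^sup>2))"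
  proof (rule expectation_norm_add_orthogonal[OF _ c])
    fix i assume i: "i \<in> {1..n}"
    show "sq_integrable M (?\<nu> i)" by (intro sq_integrable_scaleR noise_second_moment i)
    have "expectation (\<lambda>\<omega>. ?c \<omega> \<bullet> noise k i \<omega>) = 0"
      using past_fresh(1)[of i "Suc k" 1]
      by (intro noise_orthogonal[OF i order_refl past_subset _ cm c] node_avg_euclid carried_euclid) auto
    then show "expectation (\<lambda>\<omega>. ?c \<omega> \<bullet> ?\<nu> i \<omega>) = 0" by simp
    fix j assume "j \<in> {1..n}" "i \<noteq> j"
    then show "expectation (\<lambda>\<omega>. ?\<nu> i \<omega> \<bullet> ?\<nu> j \<omega>) = 0"
      using noise_pairwise_orthogonal[OF i, of j k] by simp
  qed simp
  have e3: "(\<Sum>i\<in>{1..n}. expectation (\<lambda>\<omega>. (norm (?\<nu> i \<omega>))\<^sup>2))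
      = 1 / real n * (1 / real n * (\<Sum>i=1..n. expectation (\<lambda>\<omega>. (norm (noise k i \<omega>))\<^sup>2)))"
    by (simp add: power_divide power2_eq_square sum_divide_distrib)
  have "expectation (\<lambda>\<omega>. (norm (?c \<omega>))\<^sup>2)
      \<le> expectation (\<lambda>\<omega>. (1 - \<beta>) * (norm (errbar k \<omega>))\<^sup>2 + (drift k)\<^sup>2 / \<beta>)"
  proof (rule expectation_mono_norm_sq[OF c])
    show "integrable M (\<lambda>\<omega>. (1 - \<beta>) * (norm (errbar k \<omega>))\<^sup>2 + (drift k)\<^sup>2 / \<beta>)"
      using sq_integrable_integrable[OF ebar] by simp
    fix \<omega> assume \<omega>: "\<omega> \<in> space M"
    let ?v = "node_avg n (\<lambda>i. est_mean (t k) i (x k i \<omega>) - est_mean (t (Suc k)) i (x k i \<omega>))"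
    have "norm ?v \<le> drift k"
      using \<omega> by (intro norm_node_avg_le est_mean_drift iterates_euclid)
    moreover have "?c \<omega> = (1 - \<beta>) *\<^sub>R (errbar k \<omega> + ?v)"
      by (simp add: carried_def node_avg_scaleR node_avg_add errbar_def)
    ultimately show "(norm (?c \<omega>))\<^sup>2 \<le> (1 - \<beta>) * (norm (errbar k \<omega>))\<^sup>2 + (drift k)\<^sup>2 / \<beta>"
      by (simp only: carried_sq_le)
  qed
  also have "\<dots> = (1 - \<beta>) * expectation (\<lambda>\<omega>. (norm (errbar k \<omega>))\<^sup>2) + (drift k)\<^sup>2 / \<beta>"
    using sq_integrable_integrable[OF ebar] by (simp add: prob_space)
  finally show ?thesis unfolding e1 e2 e3 by simp
qed

end

section \<open>Summed inequalities\<close>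

context dzovr_analysis
begin

definition grad_sq :: "nat \<Rightarrow> real" where "grad_sq k = expectation (\<lambda>\<omega>. (norm (ggrad (xbar k \<omega>)))\<^sup>2)"
definition dir_sq :: "nat \<Rightarrow> real" where "dir_sq k = expectation (\<lambda>\<omega>. (norm (mbar k \<omega>))\<^sup>2)"
definition x_spread :: "nat \<Rightarrow> real" where "x_spread k = expectation (\<lambda>\<omega>. spread (\<lambda>i. x k i \<omega>))"
definition g_spread :: "nat \<Rightarrow> real" where "g_spread k = expectation (\<lambda>\<omega>. spread (\<lambda>i. g k i \<omega>))"
definition change_sq :: "nat \<Rightarrow> real" where
  "change_sq k = 1 / real n * (\<Sum>i=1..n. expectation (\<lambda>\<omega>. (norm (m k i \<omega> - mprev k i \<omega>))\<^sup>2))"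
definition avg_err_sq :: "nat \<Rightarrow> real" where "avg_err_sq k = expectation (\<lambda>\<omega>. (norm (errbar k \<omega>))\<^sup>2)"
definition node_err_sq :: "nat \<Rightarrow> real" where
  "node_err_sq k = 1 / real n * (\<Sum>i=1..n. expectation (\<lambda>\<omega>. (norm (err k i \<omega>))\<^sup>2))"
definition noise_sq :: "nat \<Rightarrow> real" where
  "noise_sq k = 1 / real n * (\<Sum>i=1..n. expectation (\<lambda>\<omega>. (norm (noise k i \<omega>))\<^sup>2))"

lemma expectation_sq_nonneg: "0 \<le> expectation (\<lambda>\<omega>. (norm (f \<omega> :: rvec))\<^sup>2)"
  by (rule Bochner_Integration.integral_nonneg) simp

lemma quantities_nonneg: "0 \<le> grad_sq k" "0 \<le> dir_sq k" "0 \<le> x_spread k" "0 \<le> g_spread k" "0 \<le> change_sq k" "0 \<le> avg_err_sq k" "0 \<le> node_err_sq k" "0 \<le> noise_sq k"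
  unfolding grad_sq_def dir_sq_def x_spread_def g_spread_def change_sq_def avg_err_sq_def node_err_sq_def noise_sq_def
  by (intro mult_nonneg_nonneg sum_nonneg expectation_sq_nonneg Bochner_Integration.integral_nonneg
      spread_nonneg divide_nonneg_nonneg of_nat_0_le_iff zero_le_one)+

lemma xbar_euclid: "\<omega> \<in> space M \<Longrightarrow> xbar k \<omega> \<in> euclid d"
  and mbar_euclid: "\<omega> \<in> space M \<Longrightarrow> mbar k \<omega> \<in> euclid d"
  unfolding xbar_def mbar_def by (intro node_avg_euclid iterates_euclid; simp)+

lemma sq_integrable_xbar: "sq_integrable M (xbar k)"
  and sq_integrable_mbar: "sq_integrable M (mbar k)"
  and sq_integrable_errbar: "sq_integrable M (errbar k)"
  unfolding xbar_def[abs_def] mbar_def[abs_def] errbar_def[abs_def]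
  by (intro sq_integrable_node_avg iterates_sq_integrable sq_integrable_err; simp)+

lemma sq_integrable_ggrad: "sq_integrable M (\<lambda>\<omega>. ggrad (xbar k \<omega>))"
  by (rule sq_integrable_lipschitz[OF continuous_on_ggrad lipschitz_growth[OF ggrad_lipschitz]])
    (auto intro: sq_integrable_xbar xbar_euclid)

lemma integrable_spread:
  "(\<And>i. i \<in> {1..n} \<Longrightarrow> sq_integrable M (f i)) \<Longrightarrow> integrable M (\<lambda>\<omega>. spread (\<lambda>i. f i \<omega>))"
  unfolding spread_def
  by (intro integrable_mult_right Bochner_Integration.integrable_sum sq_integrable_integrable
      sq_integrable_diff sq_integrable_node_avg)

lemma integrable_spread_x: "integrable M (\<lambda>\<omega>. spread (\<lambda>i. x k i \<omega>))"
  and integrable_spread_g: "integrable M (\<lambda>\<omega>. spread (\<lambda>i. g k i \<omega>))"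
  by (intro integrable_spread iterates_sq_integrable; simp)+

lemma avg_expectation:
  assumes "\<And>i. i \<in> {1..n} \<Longrightarrow> integrable M (f i)"
  shows "1 / real n * (\<Sum>i=1..n. expectation (f i)) = expectation (\<lambda>\<omega>. 1 / real n * (\<Sum>i=1..n. f i \<omega>))"
    and "integrable M (\<lambda>\<omega>. 1 / real n * (\<Sum>i=1..n. f i \<omega>))"
proof -
  show "1 / real n * (\<Sum>i=1..n. expectation (f i)) = expectation (\<lambda>\<omega>. 1 / real n * (\<Sum>i=1..n. f i \<omega>))"
    using assms by (simp add: Bochner_Integration.integral_sum)
  show "integrable M (\<lambda>\<omega>. 1 / real n * (\<Sum>i=1..n. f i \<omega>))"
    by (intro integrable_mult_right Bochner_Integration.integrable_sum assms)
qed

text \<open>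
  Gradient tracking: mixing preserves the mean, and the increments \<open>m k - m (k - 1)\<close> telescope from the
  initial value zero.
\<close>

lemma node_avg_g_Suc:
  assumes \<omega>: "\<omega> \<in> space M"
  shows "node_avg n (\<lambda>i. g (Suc k) i \<omega>) = mbar k \<omega>"
proof (induction k)
  case 0
  have "node_avg n (\<lambda>i. g (Suc 0) i \<omega>) = node_avg n (mix (\<lambda>j. g 0 j \<omega> + (m 0 j \<omega> - mprev 0 j \<omega>)))"
    by (rule node_avg_cong) (rule g_Suc[OF _ \<omega>])
  also have "\<dots> = mbar 0 \<omega>"
    unfolding node_avg_mix mbar_def by (rule node_avg_cong) (simp add: g_init \<omega>)
  finally show ?case .
next
  case (Suc k)
  have "node_avg n (\<lambda>i. g (Suc (Suc k)) i \<omega>)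
      = node_avg n (mix (\<lambda>j. g (Suc k) j \<omega> + (m (Suc k) j \<omega> - mprev (Suc k) j \<omega>)))"
    by (rule node_avg_cong) (rule g_Suc[OF _ \<omega>])
  also have "\<dots> = mbar (Suc k) \<omega>"
    unfolding node_avg_mix node_avg_add node_avg_diff Suc.IH by (simp add: mbar_def)
  finally show ?case .
qed

lemma xbar_Suc:
  assumes \<omega>: "\<omega> \<in> space M"
  shows "xbar (Suc k) \<omega> = xbar k \<omega> - \<alpha> *\<^sub>R mbar k \<omega>"
proof -
  have "xbar (Suc k) \<omega> = node_avg n (mix (\<lambda>j. x k j \<omega> + (- \<alpha>) *\<^sub>R g (Suc k) j \<omega>))"
    unfolding xbar_def by (rule node_avg_cong) (rule x_Suc[OF _ \<omega>])
  also have "\<dots> = xbar k \<omega> + (- \<alpha>) *\<^sub>R mbar k \<omega>"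
    unfolding node_avg_mix node_avg_add node_avg_scaleR node_avg_g_Suc[OF \<omega>] by (simp add: xbar_def)
  finally show ?thesis by simp
qed

definition grad_moment_bound :: "nat \<Rightarrow> real" where
  "grad_moment_bound k = (1 + \<sigma>0\<^sup>2) * (5/4 * ((1 + \<sigma>2\<^sup>2) * grad_sq k + \<sigma>3\<^sup>2) + 5 * L\<^sup>2 * x_spread k) + (\<sigma>1\<^sup>2 + L\<^sup>2)"

definition move_bound :: "nat \<Rightarrow> real" where
  "move_bound k = 2 * x_spread (Suc k) + 2 * x_spread k + \<alpha>\<^sup>2 * dir_sq k"

lemma avg_lgrad_moment:
  "1 / real n * (\<Sum>i=1..n. expectation (\<lambda>\<omega>. (norm (lgrad i (x k i \<omega>)))\<^sup>2))
    \<le> 5/4 * ((1 + \<sigma>2\<^sup>2) * grad_sq k + \<sigma>3\<^sup>2) + 5 * L\<^sup>2 * x_spread k"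
proof -
  let ?f = "\<lambda>i \<omega>. (norm (lgrad i (x k i \<omega>)))\<^sup>2"
  have f: "integrable M (?f i)" if "i \<in> {1..n}" for i
    by (rule sq_integrable_integrable[OF sq_integrable_lgrad[OF that]])
  have G: "integrable M (\<lambda>\<omega>. (norm (ggrad (xbar k \<omega>)))\<^sup>2)"
    by (rule sq_integrable_integrable[OF sq_integrable_ggrad])
  have "expectation (\<lambda>\<omega>. 1 / real n * (\<Sum>i=1..n. ?f i \<omega>))
      \<le> expectation (\<lambda>\<omega>. 5/4 * ((1 + \<sigma>2\<^sup>2) * (norm (ggrad (xbar k \<omega>)))\<^sup>2 + \<sigma>3\<^sup>2) + 5 * L\<^sup>2 * spread (\<lambda>i. x k i \<omega>))"
  proof (rule integral_mono)
    show "integrable M (\<lambda>\<omega>. 1 / real n * (\<Sum>i=1..n. ?f i \<omega>))"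
      by (rule avg_expectation(2)[of ?f, OF f])
    show "integrable M (\<lambda>\<omega>. 5/4 * ((1 + \<sigma>2\<^sup>2) * (norm (ggrad (xbar k \<omega>)))\<^sup>2 + \<sigma>3\<^sup>2) + 5 * L\<^sup>2 * spread (\<lambda>i. x k i \<omega>))"
      using G integrable_spread_x[of k] by simp
    show "1 / real n * (\<Sum>i=1..n. ?f i \<omega>)
        \<le> 5/4 * ((1 + \<sigma>2\<^sup>2) * (norm (ggrad (xbar k \<omega>)))\<^sup>2 + \<sigma>3\<^sup>2) + 5 * L\<^sup>2 * spread (\<lambda>i. x k i \<omega>)"
      if "\<omega> \<in> space M" for \<omega>
      unfolding xbar_def by (rule avg_lgrad_sq) (rule iterates_euclid(1)[OF that])
  qed
  also have "\<dots> = 5/4 * ((1 + \<sigma>2\<^sup>2) * grad_sq k + \<sigma>3\<^sup>2) + 5 * L\<^sup>2 * x_spread k"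
    using G integrable_spread_x[of k] by (simp add: grad_sq_def x_spread_def prob_space)
  finally show ?thesis by (simp only: avg_expectation(1)[of ?f, OF f])
qed

lemma avg_grad_moment: "1 / real n * (\<Sum>i=1..n. expectation (grad_moment k i)) \<le> grad_moment_bound k"
proof -
  have "expectation (grad_moment k i)
      = (1 + \<sigma>0\<^sup>2) * expectation (\<lambda>\<omega>. (norm (lgrad i (x k i \<omega>)))\<^sup>2) + (\<sigma>1\<^sup>2 + L\<^sup>2)" if "i \<in> {1..n}" for i
    using sq_integrable_integrable[OF sq_integrable_lgrad[OF that, of k]]
    unfolding grad_moment_def by (simp add: prob_space add.assoc)
  then have "1 / real n * (\<Sum>i=1..n. expectation (grad_moment k i))
      = 1 / real n * (\<Sum>i=1..n. (1 + \<sigma>0\<^sup>2) * expectation (\<lambda>\<omega>. (norm (lgrad i (x k i \<omega>)))\<^sup>2) + (\<sigma>1\<^sup>2 + L\<^sup>2))"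
    by simp
  also have "\<dots> = (1 + \<sigma>0\<^sup>2) * (1 / real n * (\<Sum>i=1..n. expectation (\<lambda>\<omega>. (norm (lgrad i (x k i \<omega>)))\<^sup>2))) + (\<sigma>1\<^sup>2 + L\<^sup>2)"
    by (rule avg_affine)
  also have "\<dots> \<le> grad_moment_bound k"
    unfolding grad_moment_bound_def by (intro add_right_mono mult_left_mono avg_lgrad_moment) simp
  finally show ?thesis .
qed

lemma avg_move_sq: "1 / real n * (\<Sum>i=1..n. expectation (move_sq k i)) \<le> move_bound k"
proof -
  have f: "integrable M (move_sq k i)" if "i \<in> {1..n}" for i by (rule integrable_move_sq[OF that])
  have "expectation (\<lambda>\<omega>. 1 / real n * (\<Sum>i=1..n. move_sq k i \<omega>))
      \<le> expectation (\<lambda>\<omega>. 2 * spread (\<lambda>i. x (Suc k) i \<omega>) + 2 * spread (\<lambda>i. x k i \<omega>) + \<alpha>\<^sup>2 * (norm (mbar k \<omega>))\<^sup>2)"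
  proof (rule integral_mono)
    show "integrable M (\<lambda>\<omega>. 1 / real n * (\<Sum>i=1..n. move_sq k i \<omega>))"
      by (rule avg_expectation(2)[of "move_sq k", OF f])
    show "integrable M (\<lambda>\<omega>. 2 * spread (\<lambda>i. x (Suc k) i \<omega>) + 2 * spread (\<lambda>i. x k i \<omega>) + \<alpha>\<^sup>2 * (norm (mbar k \<omega>))\<^sup>2)"
      using integrable_spread_x[of k] integrable_spread_x[of "Suc k"]
        sq_integrable_integrable[OF sq_integrable_mbar[of k]] by simp
    fix \<omega> assume \<omega>: "\<omega> \<in> space M"
    have "norm (xbar (Suc k) \<omega> - xbar k \<omega>) = \<bar>\<alpha>\<bar> * norm (mbar k \<omega>)"
      unfolding xbar_Suc[OF \<omega>] by simp
    then have "(norm (xbar (Suc k) \<omega> - xbar k \<omega>))\<^sup>2 = \<alpha>\<^sup>2 * (norm (mbar k \<omega>))\<^sup>2"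
      by (simp add: power_mult_distrib)
    then show "1 / real n * (\<Sum>i=1..n. move_sq k i \<omega>)
        \<le> 2 * spread (\<lambda>i. x (Suc k) i \<omega>) + 2 * spread (\<lambda>i. x k i \<omega>) + \<alpha>\<^sup>2 * (norm (mbar k \<omega>))\<^sup>2"
      using avg_increment_sq[of "\<lambda>i. x (Suc k) i \<omega>" "\<lambda>i. x k i \<omega>"]
      by (simp add: move_sq_def xbar_def)
  qed
  also have "\<dots> = move_bound k"
    using integrable_spread_x[of k] integrable_spread_x[of "Suc k"]
      sq_integrable_integrable[OF sq_integrable_mbar[of k]] by (simp add: move_bound_def x_spread_def dir_sq_def)
  finally show ?thesis by (simp only: avg_expectation(1)[of "move_sq k", OF f])
qed

lemma avg_affine2:
  "1 / real n * (\<Sum>i=1..n. a * f i + (b * h i + c))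
    = a * (1 / real n * (\<Sum>i=1..n. f i)) + (b * (1 / real n * (\<Sum>i=1..n. h i)) + (c::real))"
  using n_pos by (simp add: sum.distrib sum_distrib_left[symmetric] field_simps)

lemma noise_le: "noise_sq k \<le> 25/16 * \<beta>\<^sup>2 * real d * grad_moment_bound (Suc k) + (10 * real d * L\<^sup>2 * move_bound k + 10 * \<beta>\<^sup>2 * real d * L\<^sup>2)"
proof -
  have "noise_sq k \<le> 1 / real n * (\<Sum>i=1..n. 25/16 * \<beta>\<^sup>2 * real d * expectation (grad_moment (Suc k) i)
        + (10 * real d * L\<^sup>2 * expectation (move_sq k i) + 10 * \<beta>\<^sup>2 * real d * L\<^sup>2))"
    unfolding noise_sq_def by (intro avg_mono noise_second_moment)
  also have "\<dots> \<le> 25/16 * \<beta>\<^sup>2 * real d * grad_moment_bound (Suc k) + (10 * real d * L\<^sup>2 * move_bound k + 10 * \<beta>\<^sup>2 * real d * L\<^sup>2)"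
    unfolding avg_affine2
    by (intro add_mono mult_left_mono avg_grad_moment avg_move_sq order_refl) auto
  finally show ?thesis .
qed

lemma est_step_moments:
  assumes i: "i \<in> {1..n}"
  shows "sq_integrable M (\<lambda>\<omega>. est (t (Suc k)) i (x (Suc k) i \<omega>) (Z (i, Suc k, 1) \<omega>))" (is "sq_integrable M ?e'")
    and "expectation (\<lambda>\<omega>. (norm (est (t (Suc k)) i (x (Suc k) i \<omega>) (Z (i, Suc k, 1) \<omega>)))\<^sup>2)
      \<le> 5/4 * real d * expectation (grad_moment (Suc k) i)"
    and "sq_integrable M (\<lambda>\<omega>. est (t (Suc k)) i (x (Suc k) i \<omega>) (Z (i, Suc k, 1) \<omega>)
        - est (t (Suc k)) i (x k i \<omega>) (Z (i, Suc k, 1) \<omega>))"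
    and "expectation (\<lambda>\<omega>. (norm (est (t (Suc k)) i (x (Suc k) i \<omega>) (Z (i, Suc k, 1) \<omega>)
        - est (t (Suc k)) i (x k i \<omega>) (Z (i, Suc k, 1) \<omega>)))\<^sup>2)
      \<le> 2 * real d * L\<^sup>2 * expectation (move_sq k i) + 2 * \<beta>\<^sup>2 * real d * L\<^sup>2"
proof -
  let ?p = "(i, Suc k, 1::nat)" and ?r = "t (Suc k)"
  let ?H = "\<lambda>q. est ?r i (x (Suc k) i (fst q)) (snd q)"
  let ?D = "\<lambda>q. est ?r i (x (Suc k) i (fst q)) (snd q) - est ?r i (x k i (fst q)) (snd q)"
  have mH: "?H \<in> borel_measurable (filt (past (Suc k)) \<Otimes>\<^sub>M zspace ?p)"
    by (rule est_frozen_measurable[OF fst_conv i x_adapted[OF i]])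
  have mH': "(\<lambda>q. est ?r i (x k i (fst q)) (snd q)) \<in> borel_measurable (filt (past (Suc k)) \<Otimes>\<^sub>M zspace ?p)"
    by (rule est_frozen_measurable[OF fst_conv i x_adapted_Suc[OF i]])
  note e = est_second_moment(1)[OF i iterates_euclid(1)[OF _ i] radius_pos[of "Suc k"]]
  have b: "integrable M (\<lambda>\<omega>. 5/4 * real d * grad_moment (Suc k) i \<omega>)"
    using integrable_grad_moment[OF i] by simp
  have le: "sq_integrable (law (fst ?p)) (\<lambda>z. ?H (\<omega>, z)) \<and>
      (\<integral>z. (norm (?H (\<omega>, z)))\<^sup>2 \<partial>law (fst ?p)) \<le> 5/4 * real d * grad_moment (Suc k) i \<omega>"
    if "\<omega> \<in> space M" for \<omega>
    using e[OF that, of "Suc k"] est_radius_moment[OF i iterates_euclid(1)[OF that i], of "Suc k" "Suc k"]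
    by (simp add: grad_moment_def)
  note 1 = fresh_sample_second_moment[OF step_index[OF i] past_fresh(1) past_subset mH b le]
  show "sq_integrable M ?e'" using 1(1) by simp
  show "expectation (\<lambda>\<omega>. (norm (?e' \<omega>))\<^sup>2) \<le> 5/4 * real d * expectation (grad_moment (Suc k) i)"
    using 1(2) by simp
  have b2: "integrable M (\<lambda>\<omega>. 2 * real d * L\<^sup>2 * move_sq k i \<omega> + 2 * \<beta>\<^sup>2 * real d * L\<^sup>2)"
    using integrable_move_sq[OF i] by simp
  have le2: "sq_integrable (law (fst ?p)) (\<lambda>z. ?D (\<omega>, z)) \<and>
      (\<integral>z. (norm (?D (\<omega>, z)))\<^sup>2 \<partial>law (fst ?p)) \<le> 2 * real d * L\<^sup>2 * move_sq k i \<omega> + 2 * \<beta>\<^sup>2 * real d * L\<^sup>2"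
    if "\<omega> \<in> space M" for \<omega>
    using sq_integrable_diff[OF e[OF that, of "Suc k"] e[OF that, of k]]
      est_radius_difference[OF i iterates_euclid(1)[OF that i, of k] iterates_euclid(1)[OF that i, of "Suc k"], of "Suc k"]
    by (simp add: move_sq_def)
  note 2 = fresh_sample_second_moment[OF step_index[OF i] past_fresh(1) past_subset
      borel_measurable_diff[OF mH mH'] b2 le2]
  show "sq_integrable M (\<lambda>\<omega>. ?e' \<omega> - est ?r i (x k i \<omega>) (Z ?p \<omega>))" using 2(1) by simp
  show "expectation (\<lambda>\<omega>. (norm (?e' \<omega> - est ?r i (x k i \<omega>) (Z ?p \<omega>)))\<^sup>2)
      \<le> 2 * real d * L\<^sup>2 * expectation (move_sq k i) + 2 * \<beta>\<^sup>2 * real d * L\<^sup>2"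
    using 2(2) integrable_move_sq[OF i] by (simp add: prob_space)
qed

lemma norm_add4_sq:
  fixes a b c e :: "'a::real_inner"
  shows "(norm (a + b + (c + e)))\<^sup>2 \<le> 4 * ((norm a)\<^sup>2 + (norm b)\<^sup>2 + ((norm c)\<^sup>2 + (norm e)\<^sup>2))"
  using norm_add_sq[of "a + b" "c + e"] norm_add_sq[of a b] norm_add_sq[of c e] by simp

text \<open>
  The change of \<open>m\<close> is split into \<open>\<beta>\<close> times the new estimate, a difference of two estimates with the same
  sample, and \<open>- \<beta>\<close> times the old \<open>m\<close>, which is its error plus its reference value. Every part is
  small: either with \<open>\<beta>\<close> or with the move of the iterate.
\<close>

lemma difference_moment:
  assumes i: "i \<in> {1..n}"
  shows "expectation (\<lambda>\<omega>. (norm (m (Suc k) i \<omega> - m k i \<omega>))\<^sup>2)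
    \<le> 4 * (\<beta>\<^sup>2 * (5/4 * real d * expectation (grad_moment (Suc k) i))
      + (2 * real d * L\<^sup>2 * expectation (move_sq k i) + 2 * \<beta>\<^sup>2 * real d * L\<^sup>2)
      + (\<beta>\<^sup>2 * expectation (\<lambda>\<omega>. (norm (err k i \<omega>))\<^sup>2)
        + \<beta>\<^sup>2 * (5/4 * real d * expectation (grad_moment k i))))"
proof -
  let ?p = "(i, Suc k, 1::nat)" and ?r = "t (Suc k)"
  let ?e' = "\<lambda>\<omega>. est ?r i (x (Suc k) i \<omega>) (Z ?p \<omega>)" and ?e = "\<lambda>\<omega>. est ?r i (x k i \<omega>) (Z ?p \<omega>)"
  let ?G = "\<lambda>\<omega>. est_mean (t k) i (x k i \<omega>)"
  note es = est_step_moments[OF i, of k]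
  note ints = sq_integrable_integrable[OF es(1)] sq_integrable_integrable[OF es(3)]
    sq_integrable_integrable[OF sq_integrable_err[OF i, of k]]
    sq_integrable_integrable[OF sq_integrable_est_mean[OF i, of k k]]
  have G: "expectation (\<lambda>\<omega>. (norm (?G \<omega>))\<^sup>2) \<le> 5/4 * real d * expectation (grad_moment k i)"
  proof -
    have "expectation (\<lambda>\<omega>. (norm (?G \<omega>))\<^sup>2) \<le> expectation (\<lambda>\<omega>. 5/4 * real d * grad_moment k i \<omega>)"
    proof (rule expectation_mono_norm_sq[OF sq_integrable_est_mean[OF i]])
      show "integrable M (\<lambda>\<omega>. 5/4 * real d * grad_moment k i \<omega>)"
        using integrable_grad_moment[OF i] by simp
      fix \<omega> assume \<omega>: "\<omega> \<in> space M"
      show "(norm (?G \<omega>))\<^sup>2 \<le> 5/4 * real d * grad_moment k i \<omega>"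
        using norm_est_mean_sq_le[OF i iterates_euclid(1)[OF \<omega> i, of k] radius_pos[of k]]
          est_radius_moment[OF i iterates_euclid(1)[OF \<omega> i, of k], of k]
        by (simp add: grad_moment_def)
    qed
    then show ?thesis by simp
  qed
  have "expectation (\<lambda>\<omega>. (norm (m (Suc k) i \<omega> - m k i \<omega>))\<^sup>2)
      \<le> expectation (\<lambda>\<omega>. 4 * (\<beta>\<^sup>2 * (norm (?e' \<omega>))\<^sup>2 + (norm (?e' \<omega> - ?e \<omega>))\<^sup>2
        + (\<beta>\<^sup>2 * (norm (err k i \<omega>))\<^sup>2 + \<beta>\<^sup>2 * (norm (?G \<omega>))\<^sup>2)))"
  proof (rule expectation_mono_norm_sq)
    show "sq_integrable M (\<lambda>\<omega>. m (Suc k) i \<omega> - m k i \<omega>)"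
      by (intro sq_integrable_diff iterates_sq_integrable i)
    show "integrable M (\<lambda>\<omega>. 4 * (\<beta>\<^sup>2 * (norm (?e' \<omega>))\<^sup>2 + (norm (?e' \<omega> - ?e \<omega>))\<^sup>2
        + (\<beta>\<^sup>2 * (norm (err k i \<omega>))\<^sup>2 + \<beta>\<^sup>2 * (norm (?G \<omega>))\<^sup>2)))"
      using ints by simp
    fix \<omega> assume \<omega>: "\<omega> \<in> space M"
    have "m (Suc k) i \<omega> - m k i \<omega> = \<beta> *\<^sub>R ?e' \<omega> + (1 - \<beta>) *\<^sub>R (?e' \<omega> - ?e \<omega>)
        + ((- \<beta>) *\<^sub>R err k i \<omega> + (- \<beta>) *\<^sub>R ?G \<omega>)"
      unfolding m_Suc_est[OF i \<omega>] err_def by (simp add: algebra_simps)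
    then have "(norm (m (Suc k) i \<omega> - m k i \<omega>))\<^sup>2
        \<le> 4 * ((norm (\<beta> *\<^sub>R ?e' \<omega>))\<^sup>2 + (norm ((1 - \<beta>) *\<^sub>R (?e' \<omega> - ?e \<omega>)))\<^sup>2
          + ((norm ((- \<beta>) *\<^sub>R err k i \<omega>))\<^sup>2 + (norm ((- \<beta>) *\<^sub>R ?G \<omega>))\<^sup>2))"
      by (simp only: norm_add4_sq)
    moreover have "(norm ((1 - \<beta>) *\<^sub>R (?e' \<omega> - ?e \<omega>)))\<^sup>2 \<le> (norm (?e' \<omega> - ?e \<omega>))\<^sup>2"
      using beta_pos beta_le_1 by (intro power_mono) (auto intro: mult_left_le_one_le)
    ultimately show "(norm (m (Suc k) i \<omega> - m k i \<omega>))\<^sup>2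
        \<le> 4 * (\<beta>\<^sup>2 * (norm (?e' \<omega>))\<^sup>2 + (norm (?e' \<omega> - ?e \<omega>))\<^sup>2
        + (\<beta>\<^sup>2 * (norm (err k i \<omega>))\<^sup>2 + \<beta>\<^sup>2 * (norm (?G \<omega>))\<^sup>2))"
      by (simp add: power_mult_distrib)
  qed
  also have "\<dots> = 4 * (\<beta>\<^sup>2 * expectation (\<lambda>\<omega>. (norm (?e' \<omega>))\<^sup>2) + expectation (\<lambda>\<omega>. (norm (?e' \<omega> - ?e \<omega>))\<^sup>2)
      + (\<beta>\<^sup>2 * expectation (\<lambda>\<omega>. (norm (err k i \<omega>))\<^sup>2) + \<beta>\<^sup>2 * expectation (\<lambda>\<omega>. (norm (?G \<omega>))\<^sup>2)))"
    using ints by simp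
  also have "\<dots> \<le> 4 * (\<beta>\<^sup>2 * (5/4 * real d * expectation (grad_moment (Suc k) i))
      + (2 * real d * L\<^sup>2 * expectation (move_sq k i) + 2 * \<beta>\<^sup>2 * real d * L\<^sup>2)
      + (\<beta>\<^sup>2 * expectation (\<lambda>\<omega>. (norm (err k i \<omega>))\<^sup>2)
        + \<beta>\<^sup>2 * (5/4 * real d * expectation (grad_moment k i))))"
    by (intro mult_left_mono add_mono es(2,4) G order_refl) auto
  finally show ?thesis .
qed

lemma avg_affine4:
  "1 / real n * (\<Sum>i=1..n. a * f i + (b * h i + (c * p i + (e * q i + w))))
    = a * (1 / real n * (\<Sum>i=1..n. f i)) + (b * (1 / real n * (\<Sum>i=1..n. h i))
      + (c * (1 / real n * (\<Sum>i=1..n. p i)) + (e * (1 / real n * (\<Sum>i=1..n. q i)) + (w::real))))"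
  using n_pos by (simp add: sum.distrib sum_distrib_left[symmetric] field_simps)

lemma difference_le:
  "change_sq (Suc k) \<le> 4 * (\<beta>\<^sup>2 * (5/4 * real d * grad_moment_bound (Suc k)) + (2 * real d * L\<^sup>2 * move_bound k + 2 * \<beta>\<^sup>2 * real d * L\<^sup>2)
      + (\<beta>\<^sup>2 * node_err_sq k + \<beta>\<^sup>2 * (5/4 * real d * grad_moment_bound k)))"
proof -
  let ?g = "\<lambda>k i. expectation (grad_moment k i)" and ?v = "\<lambda>i. expectation (move_sq k i)"
    and ?e = "\<lambda>i. expectation (\<lambda>\<omega>. (norm (err k i \<omega>))\<^sup>2)"
  have "change_sq (Suc k) \<le> 1 / real n * (\<Sum>i=1..n. 4 * (\<beta>\<^sup>2 * (5/4 * real d * ?g (Suc k) i)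
      + (2 * real d * L\<^sup>2 * ?v i + 2 * \<beta>\<^sup>2 * real d * L\<^sup>2)
      + (\<beta>\<^sup>2 * ?e i + \<beta>\<^sup>2 * (5/4 * real d * ?g k i))))"
    unfolding change_sq_def mprev_Suc by (intro avg_mono difference_moment)
  also have "\<dots> = 1 / real n * (\<Sum>i=1..n. (5 * \<beta>\<^sup>2 * real d) * ?g (Suc k) i + ((8 * real d * L\<^sup>2) * ?v i
      + ((4 * \<beta>\<^sup>2) * ?e i + ((5 * \<beta>\<^sup>2 * real d) * ?g k i + 8 * \<beta>\<^sup>2 * real d * L\<^sup>2))))"
    by (intro arg_cong[where f = "\<lambda>s. 1 / real n * s"] sum.cong refl) (simp add: algebra_simps)
  also have "\<dots> \<le> (5 * \<beta>\<^sup>2 * real d) * grad_moment_bound (Suc k) + ((8 * real d * L\<^sup>2) * move_bound k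
      + ((4 * \<beta>\<^sup>2) * node_err_sq k + ((5 * \<beta>\<^sup>2 * real d) * grad_moment_bound k + 8 * \<beta>\<^sup>2 * real d * L\<^sup>2)))"
    unfolding avg_affine4 node_err_sq_def
    by (intro mult_left_mono add_mono avg_grad_moment avg_move_sq order_refl) auto
  finally show ?thesis by (simp add: algebra_simps)
qed

lemma avg_err_sq_Suc: "avg_err_sq (Suc k) \<le> (1 - \<beta>) * avg_err_sq k + ((drift k)\<^sup>2 / \<beta> + 1 / real n * noise_sq k)"
  unfolding avg_err_sq_def noise_sq_def by (rule errbar_recursion)

lemma node_err_sq_Suc: "node_err_sq (Suc k) \<le> (1 - \<beta>) * node_err_sq k + ((drift k)\<^sup>2 / \<beta> + noise_sq k)"
proof -
  let ?e = "\<lambda>k i. expectation (\<lambda>\<omega>. (norm (err k i \<omega>))\<^sup>2)" and ?\<nu> = "\<lambda>i. expectation (\<lambda>\<omega>. (norm (noise k i \<omega>))\<^sup>2)"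
  have "node_err_sq (Suc k) \<le> 1 / real n * (\<Sum>i=1..n. (1 - \<beta>) * ?e k i + ((drift k)\<^sup>2 / \<beta> + ?\<nu> i))"
    unfolding node_err_sq_def by (intro avg_mono err_recursion)
  also have "\<dots> = 1 / real n * (\<Sum>i=1..n. (1 - \<beta>) * ?e k i + (1 * ?\<nu> i + (drift k)\<^sup>2 / \<beta>))"
    by (simp add: add_ac)
  also have "\<dots> = (1 - \<beta>) * node_err_sq k + (1 * noise_sq k + (drift k)\<^sup>2 / \<beta>)"
    unfolding node_err_sq_def noise_sq_def by (rule avg_affine2)
  finally show ?thesis by (simp add: add_ac)
qed

lemma sum_drop_last_le:
  fixes f :: "nat \<Rightarrow> real"
  shows "(\<And>k. 0 \<le> f k) \<Longrightarrow> (\<Sum>k<K - 1. f k) \<le> (\<Sum>k<K. f k)"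
  by (rule sum_mono2) auto

lemma sum_shift_le:
  assumes "\<And>k. 0 \<le> f k" "K \<ge> 1"
  shows "(\<Sum>k<K - 1. f (Suc k)) \<le> (\<Sum>k<K. f k :: real)"
proof -
  have "(\<Sum>k<K. f k) = f 0 + (\<Sum>k<K - 1. f (Suc k))"
    using sum.lessThan_Suc_shift[of f "K - 1"] assms(2) by simp
  then show ?thesis using assms(1)[of 0] by simp
qed

abbreviation total :: "(nat \<Rightarrow> real) \<Rightarrow> nat \<Rightarrow> real" where "total f K \<equiv> \<Sum>k<K. f k"

lemma sum_avg_err_sq:
  assumes "K \<ge> 1"
  shows "\<beta> * total avg_err_sq K \<le> avg_err_sq 0 + L\<^sup>2 * \<beta> + 1 / real n * total noise_sq (K - 1)"
proof -
  have "\<beta> * total avg_err_sq K \<le> avg_err_sq 0 + (\<Sum>k<K - 1. (drift k)\<^sup>2 / \<beta> + 1 / real n * noise_sq k)"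
    by (rule sum_contraction[where a = avg_err_sq, OF avg_err_sq_Suc beta_le_1 assms quantities_nonneg(6)])
  also have "(\<Sum>k<K - 1. (drift k)\<^sup>2 / \<beta> + 1 / real n * noise_sq k) = (\<Sum>k<K - 1. (drift k)\<^sup>2) / \<beta> + 1 / real n * total noise_sq (K - 1)"
    by (simp add: sum.distrib sum_divide_distrib sum_distrib_left)
  also have "(\<Sum>k<K - 1. (drift k)\<^sup>2) / \<beta> \<le> L\<^sup>2 * \<beta>\<^sup>2 / \<beta>"
    using beta_pos by (intro divide_right_mono sum_drift_sq) auto
  also have "L\<^sup>2 * \<beta>\<^sup>2 / \<beta> = L\<^sup>2 * \<beta>" using beta_pos by (simp add: power2_eq_square)
  finally show ?thesis by simp
qed

lemma sum_node_err_sq: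
  assumes "K \<ge> 1"
  shows "\<beta> * total node_err_sq K \<le> node_err_sq 0 + L\<^sup>2 * \<beta> + total noise_sq (K - 1)"
proof -
  have "\<beta> * total node_err_sq K \<le> node_err_sq 0 + (\<Sum>k<K - 1. (drift k)\<^sup>2 / \<beta> + noise_sq k)"
    by (rule sum_contraction[where a = node_err_sq, OF node_err_sq_Suc beta_le_1 assms quantities_nonneg(7)])
  also have "(\<Sum>k<K - 1. (drift k)\<^sup>2 / \<beta> + noise_sq k) = (\<Sum>k<K - 1. (drift k)\<^sup>2) / \<beta> + total noise_sq (K - 1)"
    by (simp add: sum.distrib sum_divide_distrib)
  also have "(\<Sum>k<K - 1. (drift k)\<^sup>2) / \<beta> \<le> L\<^sup>2 * \<beta>\<^sup>2 / \<beta>"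
    using beta_pos by (intro divide_right_mono sum_drift_sq) auto
  also have "L\<^sup>2 * \<beta>\<^sup>2 / \<beta> = L\<^sup>2 * \<beta>" using beta_pos by (simp add: power2_eq_square)
  finally show ?thesis by simp
qed

lemma grad_moment_bound_nonneg: "0 \<le> grad_moment_bound k" and move_bound_nonneg: "0 \<le> move_bound k"
  unfolding grad_moment_bound_def move_bound_def using quantities_nonneg by (auto intro!: add_nonneg_nonneg mult_nonneg_nonneg)

lemma sum_grad_moment_bound: "total grad_moment_bound K = (1 + \<sigma>0\<^sup>2) * (5/4 * ((1 + \<sigma>2\<^sup>2) * total grad_sq K + real K * \<sigma>3\<^sup>2) + 5 * L\<^sup>2 * total x_spread K)
    + real K * (\<sigma>1\<^sup>2 + L\<^sup>2)"
  by (induction K) (simp_all add: grad_moment_bound_def algebra_simps)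

lemma sum_move_bound:
  assumes "K \<ge> 1"
  shows "total move_bound (K - 1) \<le> 4 * total x_spread K + \<alpha>\<^sup>2 * total dir_sq K"
proof -
  have "total move_bound (K - 1) = 2 * (\<Sum>k<K - 1. x_spread (Suc k)) + 2 * total x_spread (K - 1) + \<alpha>\<^sup>2 * total dir_sq (K - 1)"
    by (simp add: move_bound_def sum.distrib sum_distrib_left)
  also have "\<dots> \<le> 2 * total x_spread K + 2 * total x_spread K + \<alpha>\<^sup>2 * total dir_sq K"
    using assms quantities_nonneg by (intro add_mono mult_left_mono sum_shift_le sum_drop_last_le) auto
  finally show ?thesis by simp
qed

lemma sum_noise:
  assumes "K \<ge> 1"
  shows "total noise_sq (K - 1) \<le> 25/16 * \<beta>\<^sup>2 * real d * total grad_moment_bound K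
    + 10 * real d * L\<^sup>2 * (4 * total x_spread K + \<alpha>\<^sup>2 * total dir_sq K) + 10 * real K * \<beta>\<^sup>2 * real d * L\<^sup>2"
proof -
  have "total noise_sq (K - 1) \<le> (\<Sum>k<K - 1. 25/16 * \<beta>\<^sup>2 * real d * grad_moment_bound (Suc k) + (10 * real d * L\<^sup>2 * move_bound k + 10 * \<beta>\<^sup>2 * real d * L\<^sup>2))"
    by (intro sum_mono noise_le)
  also have "\<dots> = 25/16 * \<beta>\<^sup>2 * real d * (\<Sum>k<K - 1. grad_moment_bound (Suc k)) + (10 * real d * L\<^sup>2 * total move_bound (K - 1)
      + real (K - 1) * (10 * \<beta>\<^sup>2 * real d * L\<^sup>2))"
    by (simp add: sum.distrib sum_distrib_left)
  also have "\<dots> \<le> 25/16 * \<beta>\<^sup>2 * real d * total grad_moment_bound K + (10 * real d * L\<^sup>2 * (4 * total x_spread K + \<alpha>\<^sup>2 * total dir_sq K)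
      + real K * (10 * \<beta>\<^sup>2 * real d * L\<^sup>2))"
    using assms grad_moment_bound_nonneg by (intro add_mono mult_left_mono mult_right_mono sum_shift_le sum_move_bound) auto
  finally show ?thesis by (simp add: mult_ac)
qed

lemma sum_difference:
  assumes "K \<ge> 1"
  shows "total change_sq K \<le> change_sq 0 + (10 * \<beta>\<^sup>2 * real d * total grad_moment_bound K
    + 8 * real d * L\<^sup>2 * (4 * total x_spread K + \<alpha>\<^sup>2 * total dir_sq K) + 8 * real K * \<beta>\<^sup>2 * real d * L\<^sup>2 + 4 * \<beta>\<^sup>2 * total node_err_sq K)"
proof -
  have first: "total change_sq K = change_sq 0 + (\<Sum>k<K - 1. change_sq (Suc k))"
    using sum.lessThan_Suc_shift[of change_sq "K - 1"] assms by simp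
  have "(\<Sum>k<K - 1. change_sq (Suc k)) \<le> (\<Sum>k<K - 1. 4 * (\<beta>\<^sup>2 * (5/4 * real d * grad_moment_bound (Suc k))
      + (2 * real d * L\<^sup>2 * move_bound k + 2 * \<beta>\<^sup>2 * real d * L\<^sup>2) + (\<beta>\<^sup>2 * node_err_sq k + \<beta>\<^sup>2 * (5/4 * real d * grad_moment_bound k))))"
    by (intro sum_mono difference_le)
  also have "\<dots> = 4 * (\<beta>\<^sup>2 * (5/4 * real d * (\<Sum>k<K - 1. grad_moment_bound (Suc k)))
      + (2 * real d * L\<^sup>2 * total move_bound (K - 1) + real (K - 1) * (2 * \<beta>\<^sup>2 * real d * L\<^sup>2))
      + (\<beta>\<^sup>2 * total node_err_sq (K - 1) + \<beta>\<^sup>2 * (5/4 * real d * total grad_moment_bound (K - 1))))"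
    by (simp add: sum.distrib sum_distrib_left)
  also have "\<dots> \<le> 4 * (\<beta>\<^sup>2 * (5/4 * real d * total grad_moment_bound K)
      + (2 * real d * L\<^sup>2 * (4 * total x_spread K + \<alpha>\<^sup>2 * total dir_sq K) + real K * (2 * \<beta>\<^sup>2 * real d * L\<^sup>2))
      + (\<beta>\<^sup>2 * total node_err_sq K + \<beta>\<^sup>2 * (5/4 * real d * total grad_moment_bound K)))"
    using assms grad_moment_bound_nonneg quantities_nonneg(7)
    by (intro mult_left_mono add_mono mult_right_mono sum_shift_le sum_drop_last_le sum_move_bound) auto
  finally show ?thesis unfolding first by (simp add: algebra_simps)
qed

lemma spread_x_Suc:
  defines "\<rho> \<equiv> consensus_rho n W"
  defines "r \<equiv> (1 - \<rho>\<^sup>2) / 2"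
  shows "x_spread (Suc k) \<le> (1 - r) * x_spread k + \<rho>\<^sup>2 / r * (\<alpha>\<^sup>2 * g_spread (Suc k))"
    and "g_spread (Suc k) \<le> (1 - r) * g_spread k + \<rho>\<^sup>2 / r * change_sq k"
proof -
  have r: "0 < r" unfolding r_def \<rho>_def using consensus_rho_bounds by (simp add: power_less_one_iff)
  have "x_spread (Suc k) \<le> expectation (\<lambda>\<omega>. (1 - r) * spread (\<lambda>i. x k i \<omega>) + \<rho>\<^sup>2 / r * (\<alpha>\<^sup>2 * spread (\<lambda>i. g (Suc k) i \<omega>)))"
    unfolding x_spread_def
  proof (rule integral_mono[OF integrable_spread_x])
    show "integrable M (\<lambda>\<omega>. (1 - r) * spread (\<lambda>i. x k i \<omega>) + \<rho>\<^sup>2 / r * (\<alpha>\<^sup>2 * spread (\<lambda>i. g (Suc k) i \<omega>)))"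
      using integrable_spread_x[of k] integrable_spread_g[of "Suc k"] by simp
    fix \<omega> assume \<omega>: "\<omega> \<in> space M"
    have "spread (\<lambda>i. x (Suc k) i \<omega>) = spread (mix (\<lambda>j. x k j \<omega> + (- \<alpha>) *\<^sub>R g (Suc k) j \<omega>))"
      by (rule spread_cong) (rule x_Suc[OF _ \<omega>])
    also have "\<dots> \<le> (1 - r) * spread (\<lambda>j. x k j \<omega>) + \<rho>\<^sup>2 / r * spread (\<lambda>j. (- \<alpha>) *\<^sub>R g (Suc k) j \<omega>)"
      unfolding r_def \<rho>_def by (intro spread_mix_add euclid_scaleR iterates_euclid \<omega>)
    finally show "spread (\<lambda>i. x (Suc k) i \<omega>)
        \<le> (1 - r) * spread (\<lambda>i. x k i \<omega>) + \<rho>\<^sup>2 / r * (\<alpha>\<^sup>2 * spread (\<lambda>i. g (Suc k) i \<omega>))"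
      unfolding spread_scaleR by simp
  qed
  then show "x_spread (Suc k) \<le> (1 - r) * x_spread k + \<rho>\<^sup>2 / r * (\<alpha>\<^sup>2 * g_spread (Suc k))"
    using integrable_spread_x[of k] integrable_spread_g[of "Suc k"] by (simp add: x_spread_def g_spread_def)
  let ?w = "\<lambda>i \<omega>. m k i \<omega> - mprev k i \<omega>"
  let ?D = "\<lambda>\<omega>. 1 / real n * (\<Sum>i=1..n. (norm (?w i \<omega>))\<^sup>2)"
  have w: "integrable M (\<lambda>\<omega>. (norm (?w i \<omega>))\<^sup>2)" if "i \<in> {1..n}" for i
    by (intro sq_integrable_integrable sq_integrable_diff iterates_sq_integrable that)
  have D: "integrable M ?D" "expectation ?D = change_sq k"
    unfolding change_sq_def
    by (rule avg_expectation(2)[of "\<lambda>i \<omega>. (norm (?w i \<omega>))\<^sup>2", OF w], assumption)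
      (rule avg_expectation(1)[of "\<lambda>i \<omega>. (norm (?w i \<omega>))\<^sup>2", OF w, symmetric], assumption)
  have "g_spread (Suc k) \<le> expectation (\<lambda>\<omega>. (1 - r) * spread (\<lambda>i. g k i \<omega>) + \<rho>\<^sup>2 / r * ?D \<omega>)"
    unfolding g_spread_def
  proof (rule integral_mono[OF integrable_spread_g])
    show "integrable M (\<lambda>\<omega>. (1 - r) * spread (\<lambda>i. g k i \<omega>) + \<rho>\<^sup>2 / r * ?D \<omega>)"
      by (rule Bochner_Integration.integrable_add[OF integrable_mult_right[OF integrable_spread_g]
          integrable_mult_right[OF D(1)]])
    fix \<omega> assume \<omega>: "\<omega> \<in> space M"
    have "spread (\<lambda>i. g (Suc k) i \<omega>) = spread (mix (\<lambda>j. g k j \<omega> + ?w j \<omega>))"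
      by (rule spread_cong) (rule g_Suc[OF _ \<omega>])
    also have "\<dots> \<le> (1 - r) * spread (\<lambda>j. g k j \<omega>) + \<rho>\<^sup>2 / r * spread (\<lambda>j. ?w j \<omega>)"
      unfolding r_def \<rho>_def by (intro spread_mix_add euclid_diff iterates_euclid \<omega>)
    also have "\<dots> \<le> (1 - r) * spread (\<lambda>j. g k j \<omega>) + \<rho>\<^sup>2 / r * ?D \<omega>"
      using r by (intro add_left_mono mult_left_mono spread_le) auto
    finally show "spread (\<lambda>i. g (Suc k) i \<omega>) \<le> (1 - r) * spread (\<lambda>i. g k i \<omega>) + \<rho>\<^sup>2 / r * ?D \<omega>" .
  qed
  also have "\<dots> = (1 - r) * expectation (\<lambda>\<omega>. spread (\<lambda>i. g k i \<omega>)) + \<rho>\<^sup>2 / r * expectation ?D"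
    using Bochner_Integration.integral_add[OF integrable_mult_right[OF integrable_spread_g[of k], of "1 - r"]
        integrable_mult_right[OF D(1), of "\<rho>\<^sup>2 / r"]]
    by (simp only: integral_mult_right_zero)
  finally show "g_spread (Suc k) \<le> (1 - r) * g_spread k + \<rho>\<^sup>2 / r * change_sq k" by (simp only: g_spread_def D(2))
qed

text \<open>
  The disagreement of \<open>g\<close> is driven by the changes of \<open>m\<close>, and that of \<open>x\<close> by \<open>\<alpha>\<close> times the disagreement of
  \<open>g\<close>. Each of the two contractions costs \<open>\<rho>\<^sup>2 / r\<^sup>2\<close> with \<open>r = (1 - \<rho>\<^sup>2) / 2\<close>.
\<close>

lemma sum_spread:
  assumes K: "K \<ge> 1"
  defines "\<rho> \<equiv> consensus_rho n W"
  shows "total x_spread K \<le> 2 * x_spread 0 / (1 - \<rho>\<^sup>2) + 16 * \<rho> ^ 4 / (1 - \<rho>\<^sup>2) ^ 4 * \<alpha>\<^sup>2 * total change_sq K"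
proof -
  define r where "r = (1 - \<rho>\<^sup>2) / 2"
  have r: "0 < r" unfolding r_def \<rho>_def using consensus_rho_bounds by (simp add: power_less_one_iff)
  moreover have "r \<le> 1"
    using zero_le_power2[of \<rho>] order_trans[of "-1" 0 "\<rho>\<^sup>2"] by (simp add: r_def)
  ultimately have r: "0 < r" "r \<le> 1" by simp_all
  note st = spread_x_Suc[folded \<rho>_def, folded r_def]
  have G0: "g_spread 0 = 0"
  proof -
    have "g_spread 0 = expectation (\<lambda>\<omega>. 0)"
      unfolding g_spread_def
      by (rule Bochner_Integration.integral_cong) (simp_all add: spread_def node_avg_def g_init)
    then show ?thesis by simp
  qed
  have "r * total g_spread K \<le> g_spread 0 + (\<Sum>k<K - 1. \<rho>\<^sup>2 / r * change_sq k)"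
    by (rule sum_contraction[where a = g_spread, OF st(2) r(2) K quantities_nonneg(4)])
  also have "\<dots> = \<rho>\<^sup>2 / r * total change_sq (K - 1)" by (simp add: G0 sum_distrib_left)
  also have "\<dots> \<le> \<rho>\<^sup>2 / r * total change_sq K"
    using r quantities_nonneg(5) by (intro mult_left_mono sum_drop_last_le) auto
  finally have Gsum: "total g_spread K \<le> \<rho>\<^sup>2 / r\<^sup>2 * total change_sq K"
    using r by (simp add: field_simps power2_eq_square)
  have "r * total x_spread K \<le> x_spread 0 + (\<Sum>k<K - 1. \<rho>\<^sup>2 / r * (\<alpha>\<^sup>2 * g_spread (Suc k)))"
    by (rule sum_contraction[where a = x_spread, OF st(1) r(2) K quantities_nonneg(3)])
  also have "\<dots> = x_spread 0 + \<rho>\<^sup>2 / r * \<alpha>\<^sup>2 * (\<Sum>k<K - 1. g_spread (Suc k))"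
    by (simp only: sum_distrib_left mult.assoc)
  also have "\<dots> \<le> x_spread 0 + \<rho>\<^sup>2 / r * \<alpha>\<^sup>2 * total g_spread K"
    using r quantities_nonneg(4) K by (intro add_left_mono mult_left_mono sum_shift_le) auto
  also have "\<dots> \<le> x_spread 0 + \<rho>\<^sup>2 / r * \<alpha>\<^sup>2 * (\<rho>\<^sup>2 / r\<^sup>2 * total change_sq K)"
    using r Gsum by (intro add_left_mono mult_left_mono) auto
  finally have "r * total x_spread K \<le> x_spread 0 + \<rho>\<^sup>2 / r * \<alpha>\<^sup>2 * (\<rho>\<^sup>2 / r\<^sup>2 * total change_sq K)" .
  then have "total x_spread K \<le> (x_spread 0 + \<rho>\<^sup>2 / r * \<alpha>\<^sup>2 * (\<rho>\<^sup>2 / r\<^sup>2 * total change_sq K)) / r"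
    using r by (simp add: pos_le_divide_eq mult.commute)
  also have "\<dots> = x_spread 0 / r + \<rho> ^ 4 / r ^ 4 * \<alpha>\<^sup>2 * total change_sq K"
    using r by (simp add: field_simps power2_eq_square power4_eq_xxxx)
  also have "x_spread 0 / r = 2 * x_spread 0 / (1 - \<rho>\<^sup>2)" by (simp add: r_def)
  also have "\<rho> ^ 4 / r ^ 4 = 16 * \<rho> ^ 4 / (1 - \<rho>\<^sup>2) ^ 4" by (simp add: r_def power_divide)
  finally show ?thesis .
qed

text \<open>
  The distance of the mean direction from the gradient consists of the mean error, which keeps a factor
  close to one, the bias of the estimator and the effect of evaluating at different points.
\<close>

lemma tracking:
  "expectation (\<lambda>\<omega>. (norm (mbar k \<omega> - ggrad (xbar k \<omega>)))\<^sup>2) \<le> 5/4 * avg_err_sq k + 10 * L\<^sup>2 * x_spread k + 5/2 * L\<^sup>2 * \<beta>\<^sup>2"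
proof -
  have "expectation (\<lambda>\<omega>. (norm (mbar k \<omega> - ggrad (xbar k \<omega>)))\<^sup>2)
      \<le> expectation (\<lambda>\<omega>. 5/4 * (norm (errbar k \<omega>))\<^sup>2 + 10 * L\<^sup>2 * spread (\<lambda>i. x k i \<omega>) + 5/2 * L\<^sup>2 * \<beta>\<^sup>2)"
  proof (rule expectation_mono_norm_sq)
    show "sq_integrable M (\<lambda>\<omega>. mbar k \<omega> - ggrad (xbar k \<omega>))"
      by (intro sq_integrable_diff sq_integrable_mbar sq_integrable_ggrad)
    show "integrable M (\<lambda>\<omega>. 5/4 * (norm (errbar k \<omega>))\<^sup>2 + 10 * L\<^sup>2 * spread (\<lambda>i. x k i \<omega>) + 5/2 * L\<^sup>2 * \<beta>\<^sup>2)"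
      using integrable_spread_x[of k] sq_integrable_integrable[OF sq_integrable_errbar[of k]] by simp
    fix \<omega> assume \<omega>: "\<omega> \<in> space M"
    let ?x = "\<lambda>i. x k i \<omega>" and ?a = "xbar k \<omega>"
    let ?b = "node_avg n (\<lambda>i. est_mean (t k) i (?x i) - lgrad i (?x i))"
    let ?c = "node_avg n (\<lambda>i. lgrad i (?x i) - lgrad i ?a)"
    note xe = iterates_euclid(1)[OF \<omega>] and ae = xbar_euclid[OF \<omega>]
    have split: "mbar k \<omega> - ggrad ?a = errbar k \<omega> + (?b + ?c)"
      unfolding mbar_def errbar_def err_def ggrad_eq[OF ae] node_avg_add node_avg_diff by simp
    have "norm ?b \<le> L * \<beta> / 2"
    proof (rule norm_node_avg_le)
      fix i assume i: "i \<in> {1..n}"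
      have "norm (est_mean (t k) i (?x i) - lgrad i (?x i)) \<le> real d * L * t k / 2"
        by (rule est_mean_bias[OF i xe[OF i] radius_pos])
      also have "\<dots> \<le> L * \<beta> / 2"
        using mult_left_mono[OF d_radius_le_beta[of k], of L] constants by (simp add: mult_ac)
      finally show "norm (est_mean (t k) i (?x i) - lgrad i (?x i)) \<le> L * \<beta> / 2" .
    qed
    then have b: "(norm ?b)\<^sup>2 \<le> (L * \<beta> / 2)\<^sup>2" by (rule power_mono) simp
    have "(norm ?c)\<^sup>2 \<le> 1 / real n * (\<Sum>i=1..n. (norm (lgrad i (?x i) - lgrad i ?a))\<^sup>2)"
      by (rule norm_node_avg_sq_le)
    also have "\<dots> \<le> 1 / real n * (\<Sum>i=1..n. (L * norm (?x i - ?a))\<^sup>2)"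
      using lgrad_lipschitz xe ae by (intro avg_mono power_mono) auto
    also have "\<dots> = L\<^sup>2 * spread ?x"
      by (simp add: spread_def xbar_def power_mult_distrib sum_distrib_left[symmetric])
    finally have c: "(norm ?c)\<^sup>2 \<le> L\<^sup>2 * spread ?x" .
    have "(norm (mbar k \<omega> - ggrad ?a))\<^sup>2 \<le> 5/4 * (norm (errbar k \<omega>))\<^sup>2 + 5 * (norm (?b + ?c))\<^sup>2"
      unfolding split by (rule norm_add_sq_54)
    moreover have "(norm (?b + ?c))\<^sup>2 \<le> 2 * (L * \<beta> / 2)\<^sup>2 + 2 * (L\<^sup>2 * spread ?x)"
      using norm_add_sq[of ?b ?c] b c by linarith
    moreover have "2 * (L * \<beta> / 2)\<^sup>2 = 1/2 * (L\<^sup>2 * \<beta>\<^sup>2)" by (simp add: power_mult_distrib power_divide)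
    ultimately show "(norm (mbar k \<omega> - ggrad ?a))\<^sup>2
        \<le> 5/4 * (norm (errbar k \<omega>))\<^sup>2 + 10 * L\<^sup>2 * spread ?x + 5/2 * L\<^sup>2 * \<beta>\<^sup>2"
      by linarith
  qed
  also have "\<dots> = 5/4 * avg_err_sq k + 10 * L\<^sup>2 * x_spread k + 5/2 * L\<^sup>2 * \<beta>\<^sup>2"
    using integrable_spread_x[of k] sq_integrable_integrable[OF sq_integrable_errbar[of k]]
    by (simp add: avg_err_sq_def x_spread_def prob_space)
  finally show ?thesis .
qed

text \<open>
  The descent inequality is summed for each outcome before taking expectations. The objective then
  occurs only at the deterministic starting point and through its lower bound.
\<close>

lemma sum_descent:
  assumes a: "\<alpha> * L \<le> 1/2" and l: "\<And>y. y \<in> euclid d \<Longrightarrow> l \<le> global_obj n \<Xi> F y"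
  shows "total grad_sq K + 1/2 * total dir_sq K \<le> 2 / \<alpha> * (global_obj n \<Xi> F (node_avg n x0) - l)
    + (5/4 * total avg_err_sq K + 10 * L\<^sup>2 * total x_spread K + 5/2 * real K * L\<^sup>2 * \<beta>\<^sup>2)"
proof -
  let ?f = "global_obj n \<Xi> F"
  let ?q = "\<lambda>k \<omega>. (norm (ggrad (xbar k \<omega>)))\<^sup>2 + 1/2 * (norm (mbar k \<omega>))\<^sup>2"
  let ?e = "\<lambda>k \<omega>. (norm (mbar k \<omega> - ggrad (xbar k \<omega>)))\<^sup>2"
  have \<alpha>: "0 < \<alpha>" by (rule parameters)
  have path: "(\<Sum>k<K. ?q k \<omega>) \<le> 2 / \<alpha> * (?f (node_avg n x0) - l) + (\<Sum>k<K. ?e k \<omega>)" if \<omega>: "\<omega> \<in> space M" for \<omega>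
  proof -
    have "\<alpha> / 2 * (\<Sum>k<K. ?q k \<omega>) = (\<Sum>k<K. \<alpha> / 2 * ?q k \<omega>)" by (simp add: sum_distrib_left)
    also have "\<dots> \<le> (\<Sum>k<K. ?f (xbar k \<omega>) - ?f (xbar (Suc k) \<omega>) + \<alpha> / 2 * ?e k \<omega>)"
      using descent_step[OF xbar_euclid[OF \<omega>] mbar_euclid[OF \<omega>] \<alpha> a]
      by (intro sum_mono) (simp only: xbar_Suc[OF \<omega>])
    also have "\<dots> = ?f (xbar 0 \<omega>) - ?f (xbar K \<omega>) + \<alpha> / 2 * (\<Sum>k<K. ?e k \<omega>)"
      using sum_lessThan_telescope'[of "\<lambda>k. ?f (xbar k \<omega>)" K]
      by (simp add: sum.distrib sum_distrib_left)
    also have "\<dots> \<le> ?f (xbar 0 \<omega>) - l + \<alpha> / 2 * (\<Sum>k<K. ?e k \<omega>)"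
      using l[OF xbar_euclid[OF \<omega>, of K]] by simp
    also have "xbar 0 \<omega> = node_avg n x0"
      unfolding xbar_def by (rule node_avg_cong) (simp add: x_init \<omega>)
    finally show ?thesis using \<alpha> by (simp add: field_simps)
  qed
  have i: "integrable M (\<lambda>\<omega>. (norm (ggrad (xbar k \<omega>)))\<^sup>2)" "integrable M (\<lambda>\<omega>. (norm (mbar k \<omega>))\<^sup>2)"
    "integrable M (?e k)" for k
    by (intro sq_integrable_integrable sq_integrable_ggrad sq_integrable_mbar sq_integrable_diff)+
  have "total grad_sq K + 1/2 * total dir_sq K = expectation (\<lambda>\<omega>. \<Sum>k<K. ?q k \<omega>)"
    using i by (simp add: grad_sq_def dir_sq_def Bochner_Integration.integral_sum sum.distrib sum_distrib_left)
  also have "\<dots> \<le> expectation (\<lambda>\<omega>. 2 / \<alpha> * (?f (node_avg n x0) - l) + (\<Sum>k<K. ?e k \<omega>))"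
    using i by (intro integral_mono path Bochner_Integration.integrable_add
        Bochner_Integration.integrable_sum integrable_mult_right) auto
  also have "\<dots> = 2 / \<alpha> * (?f (node_avg n x0) - l) + (\<Sum>k<K. expectation (?e k))"
    using i by (simp add: Bochner_Integration.integral_sum Bochner_Integration.integrable_sum prob_space)
  also have "(\<Sum>k<K. expectation (?e k)) \<le> (\<Sum>k<K. 5/4 * avg_err_sq k + 10 * L\<^sup>2 * x_spread k + 5/2 * L\<^sup>2 * \<beta>\<^sup>2)"
    by (intro sum_mono tracking)
  also have "\<dots> = 5/4 * total avg_err_sq K + 10 * L\<^sup>2 * total x_spread K + 5/2 * real K * L\<^sup>2 * \<beta>\<^sup>2"
    by (simp add: sum.distrib sum_distrib_left mult_ac)
  finally show ?thesis by simp
qed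

text \<open>
  The contribution of one batch member to the error of the first iteration. The contributions of all
  nodes and batch members are orthogonal, which divides the variance of the mean by \<open>n * b0\<close>.
\<close>

definition noise0 :: "nat \<times> nat \<Rightarrow> 'w \<Rightarrow> rvec" where
  "noise0 q \<omega> = est (t 0) (fst q) (x0 (fst q)) (Z (fst q, 0, snd q) \<omega>) - est_mean (t 0) (fst q) (x0 (fst q))"

lemma err_0:
  assumes i: "i \<in> {1..n}" and \<omega>: "\<omega> \<in> space M"
  shows "err 0 i \<omega> = (1 / real b0) *\<^sub>R (\<Sum>s=1..b0. noise0 (i, s) \<omega>)"
proof -
  have "(\<Sum>s=1..b0. est_mean (t 0) i (x0 i)) = real b0 *\<^sub>R est_mean (t 0) i (x0 i)"
    by (simp add: sum_constant_scaleR)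
  then show ?thesis
    using parameters(1) unfolding err_def m_init_est[OF i \<omega>] x_init[OF i \<omega>] noise0_def
    by (simp add: sum_subtractf scaleR_diff_right)
qed

lemma noise0_moments:
  assumes q: "fst q \<in> {1..n}" "snd q \<in> {1..b0}"
  shows "sq_integrable M (noise0 q)"
    and "expectation (\<lambda>\<omega>. (norm (noise0 q \<omega>))\<^sup>2) \<le> 5/4 * real d * expectation (grad_moment 0 (fst q))"
    and "Q \<subseteq> I \<Longrightarrow> (fst q, 0, snd q) \<notin> Q \<Longrightarrow> V \<in> borel_measurable (filt Q) \<Longrightarrow> sq_integrable M V \<Longrightarrow>
      (\<And>\<omega>. \<omega> \<in> space M \<Longrightarrow> V \<omega> \<in> euclid d) \<Longrightarrow> expectation (\<lambda>\<omega>. V \<omega> \<bullet> noise0 q \<omega>) = 0"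
    and "noise0 q \<in> borel_measurable (filt {(fst q, 0, snd q)})"
    and "noise0 q \<omega> \<in> euclid d"
proof -
  let ?i = "fst q" and ?p = "(fst q, 0::nat, snd q)"
  let ?H = "\<lambda>w. est (t 0) ?i (x0 ?i) (snd w) - est_mean (t 0) ?i (x0 ?i)"
  have p: "?p \<in> I" using init_index[OF q] by simp
  have xe: "x0 ?i \<in> euclid d" by (rule x0_euclid[OF q(1)])
  interpret law: prob_space "law ?i" by (rule prob_space_law[OF q(1)])
  have e: "sq_integrable (law ?i) (est (t 0) ?i (x0 ?i))" by (rule est_second_moment(1)[OF q(1) xe radius_pos])
  have H: "?H \<in> borel_measurable (filt Q \<Otimes>\<^sub>M zspace ?p)" for Q
    by (intro borel_measurable_diff borel_measurable_const
        est_frozen_measurable[OF fst_conv q(1), where y = "\<lambda>_. x0 ?i"])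
  have gm: "expectation (grad_moment 0 ?i) = (1 + \<sigma>0\<^sup>2) * (norm (lgrad ?i (x0 ?i)))\<^sup>2 + \<sigma>1\<^sup>2 + L\<^sup>2"
  proof -
    have "expectation (grad_moment 0 ?i) = expectation (\<lambda>\<omega>. (1 + \<sigma>0\<^sup>2) * (norm (lgrad ?i (x0 ?i)))\<^sup>2 + \<sigma>1\<^sup>2 + L\<^sup>2)"
      by (rule Bochner_Integration.integral_cong) (simp_all add: grad_moment_def x_init q(1)[simplified])
    then show ?thesis by (simp add: prob_space)
  qed
  have le: "sq_integrable (law (fst ?p)) (\<lambda>z. ?H (\<omega>, z)) \<and>
      (\<integral>z. (norm (?H (\<omega>, z)))\<^sup>2 \<partial>law (fst ?p)) \<le> 5/4 * real d * expectation (grad_moment 0 ?i)" for \<omega> :: 'w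
  proof
    show "sq_integrable (law (fst ?p)) (\<lambda>z. ?H (\<omega>, z))"
      using sq_integrable_diff[OF e law.sq_integrable_const] by simp
    have "(\<integral>z. (norm (?H (\<omega>, z)))\<^sup>2 \<partial>law (fst ?p)) \<le> (\<integral>z. (norm (est (t 0) ?i (x0 ?i) z))\<^sup>2 \<partial>law ?i)"
      using law.vec_mean_variance_le[OF e] by (simp add: est_mean_def)
    also have "\<dots> \<le> 5/4 * real d * expectation (grad_moment 0 ?i)"
      unfolding gm by (rule est_radius_moment[OF q(1) xe])
    finally show "(\<integral>z. (norm (?H (\<omega>, z)))\<^sup>2 \<partial>law (fst ?p)) \<le> 5/4 * real d * expectation (grad_moment 0 ?i)" .
  qed
  \<comment> \<open>Nothing precedes the first iteration: the past is generated by the empty set of samples.\<close>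
  note 1 = fresh_sample_second_moment[OF p _ _ H _ le, of "{}"]
  show sq: "sq_integrable M (noise0 q)" using 1(1) by (simp add: noise0_def[abs_def])
  show "expectation (\<lambda>\<omega>. (norm (noise0 q \<omega>))\<^sup>2) \<le> 5/4 * real d * expectation (grad_moment 0 ?i)"
    using 1(2) by (simp add: noise0_def prob_space)
  show "noise0 q \<in> borel_measurable (filt {?p})"
    unfolding noise0_def[abs_def] using p
    by (intro borel_measurable_diff borel_measurable_const est_measurable_compose[OF q(1)])
      (use Z_measurable_filt[of ?p "{?p}"] in auto)
  show "noise0 q \<omega> \<in> euclid d" unfolding noise0_def by (intro euclid_diff) auto
  show "expectation (\<lambda>\<omega>. V \<omega> \<bullet> noise0 q \<omega>) = 0"
    if Q: "Q \<subseteq> I" "?p \<notin> Q" and V: "V \<in> borel_measurable (filt Q)" "sq_integrable M V"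
      "\<And>\<omega>. \<omega> \<in> space M \<Longrightarrow> V \<omega> \<in> euclid d"
  proof -
    have "expectation (\<lambda>\<omega>. V \<omega> \<bullet> ?H (\<omega>, Z ?p \<omega>)) = 0"
    proof (rule fresh_sample_orthogonal[OF p Q(2,1) H _ V(1,2)])
      show "sq_integrable M (\<lambda>\<omega>. ?H (\<omega>, Z ?p \<omega>))" using sq by (simp add: noise0_def[abs_def])
      fix \<omega> assume "\<omega> \<in> space M"
      then show "(\<integral>z. V \<omega> \<bullet> ?H (\<omega>, z) \<partial>law (fst ?p)) = 0"
        using law.inner_vec_mean_centred[OF e V(3)] by (simp add: est_mean_def)
    qed
    then show ?thesis by (simp add: noise0_def)
  qed
qed

lemma noise0_sum_moment:
  assumes J: "finite J" "\<And>q. q \<in> J \<Longrightarrow> fst q \<in> {1..n} \<and> snd q \<in> {1..b0}"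
  shows "expectation (\<lambda>\<omega>. (norm (c *\<^sub>R (\<Sum>q\<in>J. noise0 q \<omega>)))\<^sup>2)
    \<le> c\<^sup>2 * (\<Sum>q\<in>J. 5/4 * real d * expectation (grad_moment 0 (fst q)))"
proof -
  have "expectation (\<lambda>\<omega>. (norm (0 + (\<Sum>q\<in>J. noise0 q \<omega>)))\<^sup>2)
      = expectation (\<lambda>\<omega>. (norm (0::rvec))\<^sup>2) + (\<Sum>q\<in>J. expectation (\<lambda>\<omega>. (norm (noise0 q \<omega>))\<^sup>2))"
  proof (rule expectation_norm_add_orthogonal[OF J(1)])
    fix q assume q: "q \<in> J"
    then show "sq_integrable M (noise0 q)" using noise0_moments(1) J(2) by blast
    fix q' assume q': "q' \<in> J" "q \<noteq> q'"
    have "(fst q, 0::nat, snd q) \<in> I" using J(2)[OF q] init_index by simp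
    then show "expectation (\<lambda>\<omega>. noise0 q \<omega> \<bullet> noise0 q' \<omega>) = 0"
      using J(2)[OF q] J(2)[OF q'(1)] q'
      by (intro noise0_moments(3)[of q' "{(fst q, 0, snd q)}"] noise0_moments) (auto simp: prod_eq_iff)
  qed auto
  also have "\<dots> \<le> (\<Sum>q\<in>J. 5/4 * real d * expectation (grad_moment 0 (fst q)))"
    using J(2) noise0_moments(2) by (auto intro!: sum_mono)
  finally have "expectation (\<lambda>\<omega>. (norm (\<Sum>q\<in>J. noise0 q \<omega>))\<^sup>2)
      \<le> (\<Sum>q\<in>J. 5/4 * real d * expectation (grad_moment 0 (fst q)))" by simp
  then have "c\<^sup>2 * expectation (\<lambda>\<omega>. (norm (\<Sum>q\<in>J. noise0 q \<omega>))\<^sup>2)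
      \<le> c\<^sup>2 * (\<Sum>q\<in>J. 5/4 * real d * expectation (grad_moment 0 (fst q)))"
    by (intro mult_left_mono) auto
  then show ?thesis by (simp add: power_mult_distrib)
qed

lemma node_err_sq_0: "node_err_sq 0 \<le> 5/4 * real d * grad_moment_bound 0 / real b0"
proof -
  have "expectation (\<lambda>\<omega>. (norm (err 0 i \<omega>))\<^sup>2) \<le> 5/4 * real d / real b0 * expectation (grad_moment 0 i)"
    if i: "i \<in> {1..n}" for i
  proof -
    let ?J = "(\<lambda>s. (i, s)) ` {1..b0}"
    have inj: "inj_on (\<lambda>s. (i, s)) {1..b0}" by (auto simp: inj_on_def)
    have "expectation (\<lambda>\<omega>. (norm (err 0 i \<omega>))\<^sup>2)
        = expectation (\<lambda>\<omega>. (norm ((1 / real b0) *\<^sub>R (\<Sum>q\<in>?J. noise0 q \<omega>)))\<^sup>2)"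
      by (rule Bochner_Integration.integral_cong[OF refl])
        (simp only: err_0[OF i] sum.reindex[OF inj] o_def)
    also have "\<dots> \<le> (1 / real b0)\<^sup>2 * (\<Sum>q\<in>?J. 5/4 * real d * expectation (grad_moment 0 (fst q)))"
      by (rule noise0_sum_moment) (use i in auto)
    also have "\<dots> = 5/4 * real d / real b0 * expectation (grad_moment 0 i)"
      using parameters(1) by (subst sum.reindex[OF inj]) (simp add: power2_eq_square)
    finally show ?thesis .
  qed
  then have "node_err_sq 0 \<le> 1 / real n * (\<Sum>i=1..n. 5/4 * real d / real b0 * expectation (grad_moment 0 i))"
    unfolding node_err_sq_def by (rule avg_mono)
  also have "\<dots> = 5/4 * real d / real b0 * (1 / real n * (\<Sum>i=1..n. expectation (grad_moment 0 i)))"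
    unfolding sum_distrib_left[symmetric] by (simp only: mult_ac)
  also have "\<dots> \<le> 5/4 * real d / real b0 * grad_moment_bound 0"
    by (intro mult_left_mono avg_grad_moment) auto
  finally show ?thesis by simp
qed

lemma avg_err_sq_0: "avg_err_sq 0 \<le> 5/4 * real d * grad_moment_bound 0 / (real n * real b0)"
proof -
  let ?J = "{1..n} \<times> {1..b0}"
  have "avg_err_sq 0 = expectation (\<lambda>\<omega>. (norm ((1 / (real n * real b0)) *\<^sub>R (\<Sum>q\<in>?J. noise0 q \<omega>)))\<^sup>2)"
    unfolding avg_err_sq_def
  proof (rule Bochner_Integration.integral_cong[OF refl])
    fix \<omega> assume \<omega>: "\<omega> \<in> space M"
    have "errbar 0 \<omega> = node_avg n (\<lambda>i. (1 / real b0) *\<^sub>R (\<Sum>s=1..b0. noise0 (i, s) \<omega>))"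
      unfolding errbar_def by (rule node_avg_cong) (rule err_0[OF _ \<omega>])
    also have "\<dots> = (1 / (real n * real b0)) *\<^sub>R (\<Sum>i=1..n. \<Sum>s=1..b0. noise0 (i, s) \<omega>)"
      unfolding node_avg_def scaleR_sum_right[symmetric] by simp
    also have "(\<Sum>i=1..n. \<Sum>s=1..b0. noise0 (i, s) \<omega>) = (\<Sum>q\<in>?J. noise0 q \<omega>)"
      by (subst sum.cartesian_product) (simp add: case_prod_beta')
    finally show "(norm (errbar 0 \<omega>))\<^sup>2 = (norm ((1 / (real n * real b0)) *\<^sub>R (\<Sum>q\<in>?J. noise0 q \<omega>)))\<^sup>2" by simp
  qed
  also have "\<dots> \<le> (1 / (real n * real b0))\<^sup>2 * (\<Sum>q\<in>?J. 5/4 * real d * expectation (grad_moment 0 (fst q)))"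
    by (rule noise0_sum_moment) auto
  also have "(\<Sum>q\<in>?J. 5/4 * real d * expectation (grad_moment 0 (fst q)))
      = (\<Sum>i=1..n. \<Sum>s=1..b0. 5/4 * real d * expectation (grad_moment 0 i))"
    by (subst sum.cartesian_product) (simp add: case_prod_beta')
  also have "\<dots> = real b0 * (5/4 * real d) * (\<Sum>i=1..n. expectation (grad_moment 0 i))"
    by (simp add: sum_distrib_left mult_ac)
  also have "(1 / (real n * real b0))\<^sup>2 * \<dots>
      = 5/4 * real d / (real n * real b0) * (1 / real n * (\<Sum>i=1..n. expectation (grad_moment 0 i)))"
    using parameters(1) n_pos by (simp add: power2_eq_square field_simps)
  also have "\<dots> \<le> 5/4 * real d / (real n * real b0) * grad_moment_bound 0"
    by (intro mult_left_mono avg_grad_moment) auto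
  finally show ?thesis by simp
qed

lemma change_sq_0: "change_sq 0 \<le> 4 * (5/4 * ((1 + \<sigma>2\<^sup>2) * grad_sq 0 + \<sigma>3\<^sup>2) + 5 * L\<^sup>2 * x_spread 0) + L\<^sup>2 + 2 * node_err_sq 0"
proof -
  have "expectation (\<lambda>\<omega>. (norm (m 0 i \<omega> - mprev 0 i \<omega>))\<^sup>2)
      \<le> 4 * expectation (\<lambda>\<omega>. (norm (lgrad i (x 0 i \<omega>)))\<^sup>2) + (2 * expectation (\<lambda>\<omega>. (norm (err 0 i \<omega>))\<^sup>2) + L\<^sup>2)"
    if i: "i \<in> {1..n}" for i
  proof -
    note ints = sq_integrable_integrable[OF sq_integrable_lgrad[OF i, of 0]]
      sq_integrable_integrable[OF sq_integrable_err[OF i, of 0]]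
    have "expectation (\<lambda>\<omega>. (norm (m 0 i \<omega> - mprev 0 i \<omega>))\<^sup>2)
        \<le> expectation (\<lambda>\<omega>. 4 * (norm (lgrad i (x 0 i \<omega>)))\<^sup>2 + (2 * (norm (err 0 i \<omega>))\<^sup>2 + L\<^sup>2))"
    proof (rule expectation_mono_norm_sq)
      show "sq_integrable M (\<lambda>\<omega>. m 0 i \<omega> - mprev 0 i \<omega>)"
        by (intro sq_integrable_diff iterates_sq_integrable i)
      show "integrable M (\<lambda>\<omega>. 4 * (norm (lgrad i (x 0 i \<omega>)))\<^sup>2 + (2 * (norm (err 0 i \<omega>))\<^sup>2 + L\<^sup>2))"
        using ints by simp
      fix \<omega> assume \<omega>: "\<omega> \<in> space M"
      let ?G = "est_mean (t 0) i (x 0 i \<omega>)" and ?g = "lgrad i (x 0 i \<omega>)"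
      have "norm (?G - ?g) \<le> real d * t 0 * L / 2"
        using est_mean_bias[OF i iterates_euclid(1)[OF \<omega> i] radius_pos, of 0] by (simp add: mult_ac)
      also have "\<dots> \<le> L / 2"
        using mult_right_mono[OF d_radius_le_1[of 0], of L] constants by simp
      finally have "(norm (?G - ?g))\<^sup>2 \<le> (L / 2)\<^sup>2" by (rule power_mono) simp
      then have "(norm ?G)\<^sup>2 \<le> 2 * (norm ?g)\<^sup>2 + 2 * (L / 2)\<^sup>2"
        using norm_add_sq[of ?g "?G - ?g"] by simp
      moreover have "(norm (m 0 i \<omega>))\<^sup>2 \<le> 2 * (norm ?G)\<^sup>2 + 2 * (norm (err 0 i \<omega>))\<^sup>2"
        using norm_add_sq[of ?G "err 0 i \<omega>"] by (simp add: err_def)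
      moreover have "2 * (2 * (L / 2)\<^sup>2) = L\<^sup>2" by (simp add: power2_eq_square)
      ultimately show "(norm (m 0 i \<omega> - mprev 0 i \<omega>))\<^sup>2 \<le> 4 * (norm ?g)\<^sup>2 + (2 * (norm (err 0 i \<omega>))\<^sup>2 + L\<^sup>2)"
        by simp
    qed
    also have "\<dots> = 4 * expectation (\<lambda>\<omega>. (norm (lgrad i (x 0 i \<omega>)))\<^sup>2) + (2 * expectation (\<lambda>\<omega>. (norm (err 0 i \<omega>))\<^sup>2) + L\<^sup>2)"
      using ints by (simp add: prob_space)
    finally show ?thesis .
  qed
  then have "change_sq 0 \<le> 1 / real n * (\<Sum>i=1..n. 4 * expectation (\<lambda>\<omega>. (norm (lgrad i (x 0 i \<omega>)))\<^sup>2)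
      + (2 * expectation (\<lambda>\<omega>. (norm (err 0 i \<omega>))\<^sup>2) + L\<^sup>2))"
    unfolding change_sq_def by (rule avg_mono)
  also have "\<dots> \<le> 4 * (5/4 * ((1 + \<sigma>2\<^sup>2) * grad_sq 0 + \<sigma>3\<^sup>2) + 5 * L\<^sup>2 * x_spread 0) + (2 * node_err_sq 0 + L\<^sup>2)"
    unfolding avg_affine2 node_err_sq_def by (intro add_mono mult_left_mono avg_lgrad_moment order_refl) auto
  finally show ?thesis by simp
qed

lemma initial_values:
  assumes l: "\<And>y. y \<in> euclid d \<Longrightarrow> l \<le> global_obj n \<Xi> F y"
  shows "x_spread 0 = spread x0" and "grad_sq 0 \<le> 2 * L * (global_obj n \<Xi> F (node_avg n x0) - l)"
proof -
  have "x_spread 0 = expectation (\<lambda>\<omega>. spread x0)"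
    unfolding x_spread_def
    by (rule Bochner_Integration.integral_cong[OF refl]) (rule spread_cong, rule x_init)
  then show "x_spread 0 = spread x0" by (simp add: prob_space)
  have xb: "xbar 0 \<omega> = node_avg n x0" if "\<omega> \<in> space M" for \<omega>
    unfolding xbar_def by (rule node_avg_cong) (rule x_init[OF _ that])
  have "grad_sq 0 = expectation (\<lambda>\<omega>. (norm (ggrad (node_avg n x0)))\<^sup>2)"
    unfolding grad_sq_def by (rule Bochner_Integration.integral_cong[OF refl]) (simp add: xb)
  then show "grad_sq 0 \<le> 2 * L * (global_obj n \<Xi> F (node_avg n x0) - l)"
    using gradient_sq_le_gap[OF node_avg_euclid[OF x0_euclid] l] by (simp add: prob_space)
qed

lemma mean_sq_grad_eq: "mean_sq_grad n d \<Xi> F M x K = ennreal (1 / real K * total grad_sq K)"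
proof -
  have "(\<integral>\<^sup>+\<omega>. ennreal ((norm (grad d (global_obj n \<Xi> F) (node_avg n (\<lambda>i. x k i \<omega>))))\<^sup>2) \<partial>M) = ennreal (grad_sq k)" for k
    unfolding grad_sq_def ggrad_def[symmetric] xbar_def[symmetric]
    by (rule nn_integral_eq_integral[OF sq_integrable_integrable[OF sq_integrable_ggrad]]) simp
  then show ?thesis
    unfolding mean_sq_grad_def
    by (simp only: sum_ennreal quantities_nonneg) (rule ennreal_mult''[symmetric], simp add: sum_nonneg quantities_nonneg)
qed

lemma grad_sq_crude: "grad_sq k \<le> 2 * (norm (ggrad 0))\<^sup>2 + 2 * L\<^sup>2 * crude k"
proof -
  have "(norm (ggrad (xbar k \<omega>)))\<^sup>2 \<le> 2 * (norm (ggrad 0))\<^sup>2 + 2 * L\<^sup>2 * (1 / real n * (\<Sum>i=1..n. (norm (x k i \<omega>))\<^sup>2))"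
    if "\<omega> \<in> space M" for \<omega>
  proof -
    have "(norm (ggrad (xbar k \<omega>)))\<^sup>2 \<le> 2 * (norm (ggrad 0))\<^sup>2 + 2 * L\<^sup>2 * (norm (xbar k \<omega>))\<^sup>2"
      by (rule lipschitz_growth[OF ggrad_lipschitz xbar_euclid[OF that]])
    also have "\<dots> \<le> 2 * (norm (ggrad 0))\<^sup>2 + 2 * L\<^sup>2 * (1 / real n * (\<Sum>i=1..n. (norm (x k i \<omega>))\<^sup>2))"
      unfolding xbar_def by (intro add_left_mono mult_left_mono norm_node_avg_sq_le) simp
    finally show ?thesis .
  qed
  moreover have f: "integrable M (\<lambda>\<omega>. (norm (x k i \<omega>))\<^sup>2)" if "i \<in> {1..n}" for i
    by (intro sq_integrable_integrable iterates_sq_integrable that)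
  note av = avg_expectation[of "\<lambda>i \<omega>. (norm (x k i \<omega>))\<^sup>2", OF f]
  ultimately have "grad_sq k \<le> expectation (\<lambda>\<omega>. 2 * (norm (ggrad 0))\<^sup>2
      + 2 * L\<^sup>2 * (1 / real n * (\<Sum>i=1..n. (norm (x k i \<omega>))\<^sup>2)))"
    unfolding grad_sq_def
    by (intro expectation_mono_norm_sq[OF sq_integrable_ggrad
        Bochner_Integration.integrable_add[OF integrable_const integrable_mult_right[OF av(2)]]])
  also have "\<dots> = 2 * (norm (ggrad 0))\<^sup>2 + 2 * L\<^sup>2 * expectation (\<lambda>\<omega>. 1 / real n * (\<Sum>i=1..n. (norm (x k i \<omega>))\<^sup>2))"
    using Bochner_Integration.integral_add[OF integrable_const[of "2 * (norm (ggrad 0))\<^sup>2"]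
        integrable_mult_right[OF av(2), of "2 * L\<^sup>2"]]
    by (simp only: integral_mult_right_zero) (simp add: prob_space)
  also have "expectation (\<lambda>\<omega>. 1 / real n * (\<Sum>i=1..n. (norm (x k i \<omega>))\<^sup>2))
      = 1 / real n * (\<Sum>i=1..n. expectation (\<lambda>\<omega>. (norm (x k i \<omega>))\<^sup>2))" by (rule av(1)[symmetric])
  also have "2 * (norm (ggrad 0))\<^sup>2 + 2 * L\<^sup>2 * \<dots>
      \<le> 2 * (norm (ggrad 0))\<^sup>2 + 2 * L\<^sup>2 * (1 / real n * (\<Sum>i=1..n. crude k))"
    using iterates_crude[of k] by (intro add_left_mono mult_left_mono avg_mono) auto
  also have "\<dots> = 2 * (norm (ggrad 0))\<^sup>2 + 2 * L\<^sup>2 * crude k" by (simp only: avg_const)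
  finally show ?thesis .
qed

end

section \<open>The step size closes the estimates\<close>

text \<open>
  The inequalities for the sums \<open>S\<gamma>\<close> (gradients), \<open>S\<mu>\<close> (directions), \<open>SX\<close> (disagreement), \<open>S\<epsilon>\<close> and \<open>S\<eta>\<close>
  (mean and individual errors), \<open>SN\<close> (innovations) and \<open>SD\<close> (changes of \<open>m\<close>) form a linear system with
  nonnegative feedback. In units where the disagreement is \<open>Y = SX / \<alpha>\<^sup>2\<close>, the feedback has three
  weights: \<open>q\<close> for gradients through the mean error, \<open>w\<close> for gradients through the disagreement, and \<open>y\<close>
  for moves through the disagreement. The only one that is not tiny is \<open>q \<le> 10000 / 73728\<close>; it enters
  the descent multiplied by \<open>5/4 * 125/64\<close>, which leaves about two thirds of \<open>S\<gamma>\<close> on the left.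
\<close>

lemma feedback_closed:
  fixes \<alpha> \<beta> L n d K s0 s2 R H q3 q1 \<Phi> \<epsilon>0 \<eta>0 D0 X0 :: real
  assumes pos: "0 < \<alpha>" "0 < \<beta>" "\<beta> \<le> 1" "0 < L" "1 \<le> n" "1 \<le> d" "0 \<le> K" "1 \<le> s0" "1 \<le> s2" "0 \<le> R" "0 \<le> q3" "0 \<le> q1"
    and sums: "0 \<le> S\<gamma>" "0 \<le> S\<mu>" "0 \<le> SX" "0 \<le> SN"
    and init: "0 \<le> \<Phi>" "0 \<le> \<epsilon>0" "0 \<le> \<eta>0" "0 \<le> D0" "0 \<le> X0"
    and \<beta>: "\<beta> = 10000 * \<alpha>\<^sup>2 * L\<^sup>2 * d / n"
    and step: "\<alpha> * L \<le> 1/2"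
      "73728 * (\<alpha>\<^sup>2 * L\<^sup>2 * d\<^sup>2 / n\<^sup>2 * (s0 * s2)) \<le> 1"
      "55296 * (\<alpha>\<^sup>2 * L\<^sup>2 * d / n) \<le> 1"
      "1098752000 * (\<alpha>\<^sup>2 * L\<^sup>2 * d ^ 3 * R * (s0 * s2) / n) \<le> 1"
      "80656 * (\<alpha>\<^sup>2 * L\<^sup>2 * d * R) \<le> 1"
    and J1: "S\<gamma> + 1/2 * S\<mu> \<le> 2 / \<alpha> * \<Phi> + (5/4 * S\<epsilon> + 10 * L\<^sup>2 * SX + 5/2 * K * L\<^sup>2 * \<beta>\<^sup>2)"
    and J2: "\<beta> * S\<epsilon> \<le> \<epsilon>0 + L\<^sup>2 * \<beta> + 1 / n * SN"
    and J3: "\<beta> * S\<eta> \<le> \<eta>0 + L\<^sup>2 * \<beta> + SN"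
    and SA: "SA = s0 * (5/4 * (s2 * S\<gamma> + K * q3) + 5 * L\<^sup>2 * SX) + K * (q1 + L\<^sup>2)"
    and J4: "SN \<le> 25/16 * \<beta>\<^sup>2 * d * SA + 10 * d * L\<^sup>2 * (4 * SX + \<alpha>\<^sup>2 * S\<mu>) + 10 * K * \<beta>\<^sup>2 * d * L\<^sup>2"
    and J5: "SD \<le> D0 + (10 * \<beta>\<^sup>2 * d * SA + 8 * d * L\<^sup>2 * (4 * SX + \<alpha>\<^sup>2 * S\<mu>) + 8 * K * \<beta>\<^sup>2 * d * L\<^sup>2 + 4 * \<beta>\<^sup>2 * S\<eta>)"
    and J6: "SX \<le> X0 + 16 * R * \<alpha>\<^sup>2 * SD"
    and H: "H = 25/16 * (5/4 * s0 * q3 + q1 + L\<^sup>2) + 10 * L\<^sup>2"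
  shows "S\<gamma> \<le> 2 * (2 / \<alpha> * \<Phi> + 5/4 * (\<epsilon>0 / \<beta> + L\<^sup>2 + K * (\<beta> * d / n) * H) + 5/2 * K * L\<^sup>2 * \<beta>\<^sup>2)
    + 5 * (X0 / \<alpha>\<^sup>2 + 16 * R * (D0 + 4 * \<beta> * \<eta>0 + 4 * L\<^sup>2) + 21 * (K * (\<beta> * d / n) * H))"
proof -
  define Y where "Y = SX / \<alpha>\<^sup>2"
  have SX: "SX = \<alpha>\<^sup>2 * Y" using pos by (simp add: Y_def)
  have Y0: "0 \<le> Y" using sums by (simp add: Y_def)
  define v where "v = K * (\<beta> * d / n) * H"
  have H0: "0 \<le> H" unfolding H using pos by (intro add_nonneg_nonneg mult_nonneg_nonneg) auto
  have v0: "0 \<le> v" unfolding v_def using pos H0 by (intro mult_nonneg_nonneg divide_nonneg_nonneg) auto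
  define q where "q = \<beta> * d / n * (s0 * s2)"
  define y where "y = \<alpha>\<^sup>2 * L\<^sup>2 * d * R"
  define w where "w = R * \<beta>\<^sup>2 * d * (s0 * s2)"
  have q: "0 \<le> q" "q \<le> 10000 / 73728"
  proof -
    show "0 \<le> q" unfolding q_def using pos by simp
    have "q = 10000 * (\<alpha>\<^sup>2 * L\<^sup>2 * d\<^sup>2 / n\<^sup>2 * (s0 * s2))"
      unfolding q_def \<beta> by (simp add: power2_eq_square)
    then show "q \<le> 10000 / 73728" using step(2) by simp
  qed
  have y: "0 \<le> y" "y \<le> 1 / 80656" unfolding y_def using pos step(5) by auto
  have L4: "L\<^sup>2 * \<alpha>\<^sup>2 \<le> 1/4"
  proof -
    have "(\<alpha> * L)\<^sup>2 \<le> (1/2)\<^sup>2" using step(1) pos by (intro power_mono) auto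
    then show ?thesis by (simp add: power_mult_distrib power_divide mult.commute)
  qed
  have w: "0 \<le> w" "w \<le> 2 / 1000000"
  proof -
    show "0 \<le> w" unfolding w_def using pos by simp
    have "w = 100000000 * (\<alpha>\<^sup>2 * L\<^sup>2 / n) * (\<alpha>\<^sup>2 * L\<^sup>2 * d ^ 3 * R * (s0 * s2) / n)"
      unfolding w_def \<beta> by (simp add: power2_eq_square power3_eq_cube)
    also have "\<dots> \<le> 100000000 * (1 / 55296) * (1 / 1098752000)"
    proof (intro mult_mono)
      have "\<alpha>\<^sup>2 * L\<^sup>2 / n * 1 \<le> \<alpha>\<^sup>2 * L\<^sup>2 / n * d" using pos by (intro mult_left_mono) auto
      also have "\<alpha>\<^sup>2 * L\<^sup>2 / n * d = \<alpha>\<^sup>2 * L\<^sup>2 * d / n" by simp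
      finally show "\<alpha>\<^sup>2 * L\<^sup>2 / n \<le> 1 / 55296" using step(3) by linarith
    qed (use pos step(4) in auto)
    finally show "w \<le> 2 / 1000000" by simp
  qed
  have s: "s0 \<le> s0 * s2" using pos mult_left_mono[of 1 s2 s0] by simp
  have A: "SA = s0 * s2 * (5/4 * S\<gamma>) + s0 * (5 * L\<^sup>2 * SX) + K * (5/4 * s0 * q3 + q1 + L\<^sup>2)"
    unfolding SA by (simp add: algebra_simps)
  have SA_le: "SA \<le> s0 * s2 * (5/4 * S\<gamma> + 5/4 * Y) + K * (5/4 * s0 * q3 + q1 + L\<^sup>2)"
  proof -
    have "L\<^sup>2 * SX \<le> 1/4 * Y" unfolding SX using mult_right_mono[OF L4 Y0] by (simp add: mult_ac)
    then have *: "5 * L\<^sup>2 * SX \<le> 5/4 * Y" by linarith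
    have "s0 * (5 * L\<^sup>2 * SX) \<le> (s0 * s2) * (5/4 * Y)"
      by (rule mult_mono[OF s *]) (use pos sums in auto)
    then show ?thesis unfolding A by (simp add: algebra_simps)
  qed
  have N: "25/16 * \<beta>\<^sup>2 * d * SA + 10 * K * \<beta>\<^sup>2 * d * L\<^sup>2
      \<le> \<beta>\<^sup>2 * d * (s0 * s2) * (125/64 * S\<gamma> + 125/64 * Y) + \<beta>\<^sup>2 * d * (K * H)"
  proof -
    have "25/16 * \<beta>\<^sup>2 * d * SA \<le> 25/16 * \<beta>\<^sup>2 * d * (s0 * s2 * (5/4 * S\<gamma> + 5/4 * Y) + K * (5/4 * s0 * q3 + q1 + L\<^sup>2))"
      using pos by (intro mult_left_mono SA_le) auto
    then show ?thesis unfolding H by (simp add: algebra_simps)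
  qed
  have M: "4 * SX + \<alpha>\<^sup>2 * S\<mu> = \<alpha>\<^sup>2 * (4 * Y + S\<mu>)" unfolding SX by (simp add: algebra_simps)
  have SN: "SN \<le> \<beta>\<^sup>2 * d * (s0 * s2) * (125/64 * S\<gamma> + 125/64 * Y) + \<beta>\<^sup>2 * d * (K * H)
      + 10 * d * L\<^sup>2 * (\<alpha>\<^sup>2 * (4 * Y + S\<mu>))"
    using J4 N unfolding M by linarith
  have "S\<epsilon> \<le> (\<epsilon>0 + L\<^sup>2 * \<beta> + 1 / n * SN) / \<beta>"
    using J2 pos by (simp add: pos_le_divide_eq mult.commute)
  also have "\<dots> = \<epsilon>0 / \<beta> + L\<^sup>2 + SN / (n * \<beta>)" using pos by (simp add: add_divide_distrib)
  finally have E1: "S\<epsilon> \<le> \<epsilon>0 / \<beta> + L\<^sup>2 + SN / (n * \<beta>)" .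
  have E2: "SN / (n * \<beta>) \<le> q * (125/64 * S\<gamma> + 125/64 * Y) + v + 1/1000 * (4 * Y + S\<mu>)"
  proof -
    have "SN / (n * \<beta>) \<le> (\<beta>\<^sup>2 * d * (s0 * s2) * (125/64 * S\<gamma> + 125/64 * Y) + \<beta>\<^sup>2 * d * (K * H)
      + 10 * d * L\<^sup>2 * (\<alpha>\<^sup>2 * (4 * Y + S\<mu>))) / (n * \<beta>)"
      using SN pos by (intro divide_right_mono) auto
    also have "\<dots> = \<beta>\<^sup>2 * d * (s0 * s2) * (125/64 * S\<gamma> + 125/64 * Y) / (n * \<beta>) + \<beta>\<^sup>2 * d * (K * H) / (n * \<beta>)
      + 10 * d * L\<^sup>2 * (\<alpha>\<^sup>2 * (4 * Y + S\<mu>)) / (n * \<beta>)" by (simp add: add_divide_distrib)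
    also have "\<beta>\<^sup>2 * d * (s0 * s2) * (125/64 * S\<gamma> + 125/64 * Y) / (n * \<beta>) = q * (125/64 * S\<gamma> + 125/64 * Y)"
      using pos by (simp add: q_def power2_eq_square)
    also have "\<beta>\<^sup>2 * d * (K * H) / (n * \<beta>) = v" using pos by (simp add: v_def power2_eq_square)
    also have "10 * d * L\<^sup>2 * (\<alpha>\<^sup>2 * (4 * Y + S\<mu>)) / (n * \<beta>) = 1/1000 * (4 * Y + S\<mu>)"
    proof -
      have nb: "n * \<beta> = 10000 * \<alpha>\<^sup>2 * L\<^sup>2 * d" unfolding \<beta> using pos by simp
      show ?thesis unfolding nb using pos by simp
    qed
    finally show ?thesis .
  qed
  have qb: "q * (125/64 * S\<gamma> + 125/64 * Y) \<le> 10000 / 73728 * (125/64 * S\<gamma> + 125/64 * Y)"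
    using q sums Y0 by (intro mult_right_mono) auto
  have LX: "L\<^sup>2 * SX \<le> 1/4 * Y" unfolding SX using mult_right_mono[OF L4 Y0] by (simp add: mult_ac)
  define E0 where "E0 = \<epsilon>0 / \<beta> + L\<^sup>2 + v"
  define P where "P = 2 / \<alpha> * \<Phi> + 5/4 * E0 + 5/2 * K * L\<^sup>2 * \<beta>\<^sup>2"
  have T: "33/50 * S\<gamma> + 49/100 * S\<mu> \<le> P + 57/20 * Y"
  proof -
    define Q where "Q = q * (125/64 * S\<gamma> + 125/64 * Y)"
    define A where "A = 2 / \<alpha> * \<Phi>"
    define G where "G = 5/2 * K * L\<^sup>2 * \<beta>\<^sup>2"
    define V where "V = SN / (n * \<beta>)"
    define e where "e = \<epsilon>0 / \<beta> + L\<^sup>2"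
    have "10 * L\<^sup>2 * SX \<le> 5/2 * Y" using LX by linarith
    moreover have "Q \<le> 53/200 * S\<gamma> + 53/200 * Y"
      unfolding Q_def by (rule order_trans[OF qb]) (use sums Y0 in \<open>simp add: distrib_left\<close>)
    moreover have "V \<le> Q + v + 1/1000 * (4 * Y + S\<mu>)" using E2 unfolding Q_def V_def .
    moreover have "S\<epsilon> \<le> e + V" using E1 unfolding e_def V_def .
    moreover have "S\<gamma> + 1/2 * S\<mu> \<le> A + (5/4 * S\<epsilon> + 10 * L\<^sup>2 * SX + G)" using J1 unfolding A_def G_def .
    moreover have "P = A + 5/4 * (e + v) + G" by (simp add: P_def E0_def A_def e_def G_def)
    ultimately show ?thesis using sums Y0 unfolding distrib_left by linarith
  qed
  define B where "B = D0 + 4 * \<beta> * \<eta>0 + 4 * L\<^sup>2"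
  have D1: "4 * \<beta>\<^sup>2 * S\<eta> \<le> 4 * \<beta> * \<eta>0 + 4 * L\<^sup>2 + 4 * SN"
  proof -
    have "4 * \<beta> * (\<beta> * S\<eta>) \<le> 4 * \<beta> * (\<eta>0 + L\<^sup>2 * \<beta> + SN)" using pos J3 by (intro mult_left_mono) auto
    moreover have "\<beta> * (L\<^sup>2 * \<beta>) \<le> 1 * (L\<^sup>2 * 1)" using pos by (intro mult_mono) auto
    moreover have "\<beta> * SN \<le> 1 * SN" using pos sums by (intro mult_right_mono) auto
    ultimately show ?thesis by (simp add: algebra_simps power2_eq_square)
  qed
  have D2: "10 * \<beta>\<^sup>2 * d * SA + 8 * K * \<beta>\<^sup>2 * d * L\<^sup>2
      \<le> \<beta>\<^sup>2 * d * (s0 * s2) * (25/2 * S\<gamma> + 25/2 * Y) + 32/5 * (\<beta>\<^sup>2 * d * (K * H))"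
  proof -
    have "0 \<le> K * \<beta>\<^sup>2 * d * L\<^sup>2" using pos by simp
    then show ?thesis using mult_left_mono[OF N, of "32/5"] by (simp add: algebra_simps)
  qed
  have SD: "SD \<le> B + (\<beta>\<^sup>2 * d * (s0 * s2) * (41/2 * S\<gamma> + 41/2 * Y) + 52/5 * (\<beta>\<^sup>2 * d * (K * H))
      + 48 * d * L\<^sup>2 * (\<alpha>\<^sup>2 * (4 * Y + S\<mu>)))"
  proof -
    have "0 \<le> \<beta>\<^sup>2 * d * (s0 * s2) * (S\<gamma> + Y)" using pos sums Y0 by (intro mult_nonneg_nonneg) auto
    then show ?thesis using J5 D1 D2 SN unfolding M B_def by (simp add: algebra_simps)
  qed
  have Y1: "Y \<le> X0 / \<alpha>\<^sup>2 + 16 * R * SD"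
    using J6 pos unfolding Y_def by (simp add: field_simps)
  also have "16 * R * SD \<le> 16 * R * (B + (\<beta>\<^sup>2 * d * (s0 * s2) * (41/2 * S\<gamma> + 41/2 * Y) + 52/5 * (\<beta>\<^sup>2 * d * (K * H))
      + 48 * d * L\<^sup>2 * (\<alpha>\<^sup>2 * (4 * Y + S\<mu>))))"
    using pos by (intro mult_left_mono SD) auto
  also have "\<dots> = 16 * R * B + 328 * (w * (S\<gamma> + Y)) + 832/5 * (R * \<beta>\<^sup>2 * d * (K * H)) + 768 * (y * (4 * Y + S\<mu>))"
    by (simp add: w_def y_def algebra_simps)
  finally have Y2: "Y \<le> X0 / \<alpha>\<^sup>2 + (16 * R * B + 328 * (w * (S\<gamma> + Y)) + 832/5 * (R * \<beta>\<^sup>2 * d * (K * H)) + 768 * (y * (4 * Y + S\<mu>)))"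
    by simp
  have wb: "w * (S\<gamma> + Y) \<le> 2 / 1000000 * (S\<gamma> + Y)" using w sums Y0 by (intro mult_right_mono) auto
  have yb: "y * (4 * Y + S\<mu>) \<le> 1 / 80656 * (4 * Y + S\<mu>)" using y sums Y0 by (intro mult_right_mono) auto
  have vb: "R * \<beta>\<^sup>2 * d * (K * H) \<le> 10000 / 80656 * v"
  proof -
    have nb: "n * \<beta> = 10000 * \<alpha>\<^sup>2 * L\<^sup>2 * d" unfolding \<beta> using pos by simp
    have "R * \<beta>\<^sup>2 * d * (K * H) = (R * (n * \<beta>)) * v" using pos by (simp add: v_def power2_eq_square)
    also have "R * (n * \<beta>) = 10000 * y" unfolding nb y_def by simp
    also have "10000 * y * v \<le> 10000 / 80656 * v" using y v0 by (intro mult_right_mono) auto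
    finally show ?thesis .
  qed
  have Y3: "24/25 * Y \<le> X0 / \<alpha>\<^sup>2 + 16 * R * B + 207/10 * v + 33/50000 * S\<gamma> + 6/625 * S\<mu>"
    using Y2 wb yb vb sums Y0 v0 unfolding distrib_left[of "2 / 1000000"] distrib_left[of "1 / 80656"] by linarith
  define U where "U = X0 / \<alpha>\<^sup>2 + 16 * R * B + 21 * v"
  have U0: "0 \<le> X0 / \<alpha>\<^sup>2" "0 \<le> 16 * R * B" and P0: "0 \<le> P"
    unfolding B_def P_def E0_def using pos init v0
    by (auto intro!: add_nonneg_nonneg mult_nonneg_nonneg divide_nonneg_nonneg)
  have "13/20 * S\<gamma> \<le> P + 3 * U"
    using T Y3 sums Y0 v0 U0 unfolding U_def distrib_left by linarith
  then have "S\<gamma> \<le> 2 * P + 5 * U"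
    using P0 U0 v0 unfolding U_def distrib_left by linarith
  then show ?thesis unfolding P_def U_def E0_def B_def v_def by simp
qed

lemma le_a0_iff:
  "\<alpha>' \<le> a0 n d L \<sigma>0 \<sigma>2 \<rho> \<alpha> \<longleftrightarrow> (\<forall>y\<in>{1, 1 / (2 * L),
       1 / (2 * sqrt (c3 n d L \<rho>)),
       L * d / (2 * sqrt (n * c0 n d L \<sigma>0 * c3 n d L \<rho>)),
       1 / (4 * sqrt (c1 n d L \<sigma>0 \<sigma>2 \<rho> \<alpha> * c3 n d L \<rho>)),
       sqrt (c4 \<sigma>0 \<rho> / (4 * c3 n d L \<rho>))}
      \<union> (if \<rho> = 0 then {}
         else {(1 - \<rho>\<^sup>2) / (sqrt (360 * d) * L * \<rho>\<^sup>2),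
               (1 - \<rho>\<^sup>2)\<^sup>2 / (284 * sqrt d * L * \<rho>\<^sup>2)}). \<alpha>' \<le> y)"
  unfolding a0_def by (subst Min_ge_iff) auto

text \<open>
  The entry of \<^const>\<open>a0\<close> with \<open>c1 * c3\<close> yields three conditions, one for each product of a lower bound
  for \<open>c1\<close> (\<open>64 d s / n\<close> or \<open>48\<close>) with a summand of \<open>c3\<close>. The last condition comes from the entry with
  \<open>(1 - \<rho>\<^sup>2)\<^sup>2\<close>; for \<open>\<rho> = 0\<close> that entry is absent and \<open>R = 0\<close>.
\<close>

lemma step_conditions:
  fixes n d :: nat and L \<rho> \<alpha> \<sigma>0 \<sigma>2 :: real
  assumes pos: "0 < L" "1 \<le> n" "1 \<le> d" "0 \<le> \<rho>" "\<rho> < 1" "0 < \<alpha>"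
    and le: "\<alpha> \<le> a0 n d L \<sigma>0 \<sigma>2 \<rho> \<alpha>"
  defines "R \<equiv> \<rho> ^ 4 / (1 - \<rho>\<^sup>2) ^ 4" and "s \<equiv> (1 + \<sigma>0\<^sup>2) * (1 + \<sigma>2\<^sup>2)"
  shows "\<alpha> \<le> 1" "\<alpha> * L \<le> 1/2"
    and "73728 * (\<alpha>\<^sup>2 * L\<^sup>2 * (real d)\<^sup>2 / (real n)\<^sup>2 * s) \<le> 1"
    and "55296 * (\<alpha>\<^sup>2 * L\<^sup>2 * real d / real n) \<le> 1"
    and "1098752000 * (\<alpha>\<^sup>2 * L\<^sup>2 * real d ^ 3 * R * s / real n) \<le> 1"
    and "80656 * (\<alpha>\<^sup>2 * L\<^sup>2 * real d * R) \<le> 1"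
proof -
  have r: "0 < 1 - \<rho>\<^sup>2" using pos by (simp add: power_less_one_iff)
  have nd: "0 < real n" "0 < real d" using pos by auto
  have R0: "0 \<le> R" unfolding R_def using r pos by simp
  have s0: "0 \<le> s" by (simp add: s_def)
  note mem = le[unfolded le_a0_iff]
  show "\<alpha> \<le> 1" using mem by simp
  have "\<alpha> \<le> 1 / (2 * L)" using mem by simp
  then show "\<alpha> * L \<le> 1/2" using pos by (simp add: field_simps)
  let ?c1 = "c1 n d L \<sigma>0 \<sigma>2 \<rho> \<alpha>" and ?c3 = "c3 n d L \<rho>"
  let ?A = "64 * real d * s / real n" and ?B = "72 * real d * L\<^sup>2 / real n"
    and ?E = "1073000 * (real d)\<^sup>2 * L\<^sup>2 * R"
  have A0: "0 \<le> ?A" and B0: "0 < ?B" and E0: "0 \<le> ?E"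
    using pos nd R0 s0 by (auto intro!: mult_nonneg_nonneg divide_nonneg_nonneg)
  have c3: "?c3 = ?B + ?E" by (simp add: c3_def R_def)
  have "?c1 = ?A + 48 + 3277000 * \<alpha>\<^sup>2 * (real d)\<^sup>2 * L\<^sup>2 * R * s"
    by (simp add: c1_def R_def s_def algebra_simps)
  moreover have "0 \<le> 3277000 * \<alpha>\<^sup>2 * (real d)\<^sup>2 * L\<^sup>2 * R * s"
    using R0 s0 by (intro mult_nonneg_nonneg) auto
  ultimately have c1: "?A \<le> ?c1" "48 \<le> ?c1" using A0 by simp_all
  have c3': "?B \<le> ?c3" "?E \<le> ?c3" "0 < ?c3"
    unfolding c3 using less_imp_le[OF B0] E0 add_pos_nonneg[OF B0 E0] by simp_all
  have prod0: "0 < ?c1 * ?c3" using c1(2) c3'(3) by (intro mult_pos_pos) auto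
  have "\<alpha> \<le> 1 / (4 * sqrt (?c1 * ?c3))" using mem by simp
  then have "4 * \<alpha> * sqrt (?c1 * ?c3) \<le> 1" using prod0 by (simp add: field_simps)
  then have "(4 * \<alpha> * sqrt (?c1 * ?c3))\<^sup>2 \<le> 1\<^sup>2" using pos prod0 by (intro power_mono) auto
  then have main: "16 * \<alpha>\<^sup>2 * (?c1 * ?c3) \<le> 1" using prod0 by (simp add: power_mult_distrib)
  have use: "16 * \<alpha>\<^sup>2 * (p * q) \<le> 1" if "0 \<le> p" "p \<le> ?c1" "0 \<le> q" "q \<le> ?c3" for p q
  proof -
    have "16 * \<alpha>\<^sup>2 * (p * q) \<le> 16 * \<alpha>\<^sup>2 * (?c1 * ?c3)"
      using that c1(2) by (intro mult_left_mono mult_mono) auto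
    with main show ?thesis by simp
  qed
  show "73728 * (\<alpha>\<^sup>2 * L\<^sup>2 * (real d)\<^sup>2 / (real n)\<^sup>2 * s) \<le> 1"
    using use[OF A0 c1(1) less_imp_le[OF B0] c3'(1)] by (simp add: power2_eq_square mult_ac)
  show "55296 * (\<alpha>\<^sup>2 * L\<^sup>2 * real d / real n) \<le> 1"
    using use[of 48, OF _ c1(2) less_imp_le[OF B0] c3'(1)] by (simp add: mult_ac)
  show "1098752000 * (\<alpha>\<^sup>2 * L\<^sup>2 * real d ^ 3 * R * s / real n) \<le> 1"
    using use[OF A0 c1(1) E0 c3'(2)] by (simp add: power2_eq_square power3_eq_cube mult_ac)
  show "80656 * (\<alpha>\<^sup>2 * L\<^sup>2 * real d * R) \<le> 1"
  proof (cases "\<rho> = 0")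
    case True
    then show ?thesis by (simp add: R_def)
  next
    case False
    have "\<alpha> \<le> (1 - \<rho>\<^sup>2)\<^sup>2 / (284 * sqrt d * L * \<rho>\<^sup>2)" using mem False by simp
    then have "284 * \<alpha> * sqrt d * L * \<rho>\<^sup>2 \<le> (1 - \<rho>\<^sup>2)\<^sup>2"
      using False pos nd by (simp add: field_simps)
    then have "(284 * \<alpha> * sqrt d * L * \<rho>\<^sup>2)\<^sup>2 \<le> ((1 - \<rho>\<^sup>2)\<^sup>2)\<^sup>2"
      using pos by (intro power_mono) auto
    then have "80656 * (\<alpha>\<^sup>2 * L\<^sup>2 * real d) * \<rho> ^ 4 \<le> (1 - \<rho>\<^sup>2) ^ 4"
      using nd by (simp add: power_mult_distrib flip: power_mult)
        (simp add: mult_ac)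
    then show ?thesis unfolding R_def using r by (simp add: field_simps)
  qed
qed

lemma a0_pos:
  fixes n d :: nat and L \<rho> \<alpha> \<sigma>0 \<sigma>2 :: real
  assumes pos: "0 < L" "1 \<le> n" "1 \<le> d" "0 \<le> \<rho>" "\<rho> < 1"
  shows "0 < a0 n d L \<sigma>0 \<sigma>2 \<rho> \<alpha>"
proof -
  have r: "0 < 1 - \<rho>\<^sup>2" using pos by (simp add: power_less_one_iff)
  have c3: "0 < c3 n d L \<rho>"
    unfolding c3_def using pos r by (intro add_pos_nonneg) auto
  have c0: "0 < c0 n d L \<sigma>0"
    unfolding c0_def using pos by (intro add_pos_nonneg) auto
  have c1: "0 < c1 n d L \<sigma>0 \<sigma>2 \<rho> \<alpha>"
    unfolding c1_def using pos r by (intro add_pos_nonneg add_nonneg_pos) auto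
  have c4: "0 < c4 \<sigma>0 \<rho>"
    unfolding c4_def using r by (auto intro!: mult_pos_pos add_pos_nonneg)
  show ?thesis
    unfolding a0_def using pos r c0 c1 c3 c4
    by (subst Min_gr_iff) auto
qed

text \<open>
  The step size enters its own bound through \<open>c1\<close> alone. So every \<open>\<alpha> \<le> 1\<close> below the fixed number \<open>a0\<close>
  at \<open>\<alpha> = 1\<close> satisfies the implicit condition \<open>\<alpha> \<le> a0\<close>.
\<close>

lemma a0_antimono:
  fixes n d :: nat and L \<rho> \<alpha> \<sigma>0 \<sigma>2 :: real
  assumes pos: "0 < L" "1 \<le> n" "1 \<le> d" "0 \<le> \<rho>" "\<rho> < 1" "0 < \<alpha>" "\<alpha> \<le> 1"
  shows "a0 n d L \<sigma>0 \<sigma>2 \<rho> 1 \<le> a0 n d L \<sigma>0 \<sigma>2 \<rho> \<alpha>"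
proof -
  have r: "0 < 1 - \<rho>\<^sup>2" using pos by (simp add: power_less_one_iff)
  have c3: "0 < c3 n d L \<rho>"
    unfolding c3_def using pos r by (intro add_pos_nonneg) auto
  have c1: "0 < c1 n d L \<sigma>0 \<sigma>2 \<rho> \<alpha>"
    unfolding c1_def using pos r by (intro add_pos_nonneg add_nonneg_pos) auto
  have "\<alpha>\<^sup>2 \<le> 1\<^sup>2" using pos by (intro power_mono) auto
  then have c1_le: "c1 n d L \<sigma>0 \<sigma>2 \<rho> \<alpha> \<le> c1 n d L \<sigma>0 \<sigma>2 \<rho> 1"
    unfolding c1_def using r pos
    by (intro add_left_mono divide_right_mono mult_right_mono mult_left_mono) auto
  have "1 / (4 * sqrt (c1 n d L \<sigma>0 \<sigma>2 \<rho> 1 * c3 n d L \<rho>)) \<le> 1 / (4 * sqrt (c1 n d L \<sigma>0 \<sigma>2 \<rho> \<alpha> * c3 n d L \<rho>))"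
    using c1 c3 c1_le by (intro divide_left_mono mult_left_mono real_sqrt_le_mono mult_right_mono mult_pos_pos) auto
  moreover have "a0 n d L \<sigma>0 \<sigma>2 \<rho> 1 \<le> a0 n d L \<sigma>0 \<sigma>2 \<rho> 1" by simp
  note this[unfolded le_a0_iff[of "a0 n d L \<sigma>0 \<sigma>2 \<rho> 1"]]
  ultimately show ?thesis unfolding le_a0_iff by fastforce
qed

lemma parameters_cube_roots:
  fixes n d K :: nat and L :: real
  assumes pos: "0 < L" "1 \<le> n" "1 \<le> d" "1 \<le> K"
  obtains a b c :: real where "0 < a" "0 < b" "0 < c" "real n = a ^ 3" "real d = b ^ 3" "real K = c ^ 3"
    "alpha_par L n d K = a\<^sup>2 / (100 * L * (b\<^sup>2 * c))" "beta_par n d K = a / (b * c\<^sup>2)"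
    "(real d / (real n * real K)) powr (2/3) = b\<^sup>2 / (a\<^sup>2 * c\<^sup>2)"
    "b\<^sup>2 * (a * c) \<le> real (b0_par n d K)"
proof -
  define a where "a = real n powr (1/3)"
  define b where "b = real d powr (1/3)"
  define c where "c = real K powr (1/3)"
  have p: "0 < a" "0 < b" "0 < c" using pos by (auto simp: a_def b_def c_def)
  have cube: "(y powr (1/3)) ^ 3 = y" "y powr (2/3) = (y powr (1/3))\<^sup>2" if "0 < y" for y :: real
    using that by (simp_all flip: powr_realpow add: powr_powr)
  have e: "real n = a ^ 3" "real d = b ^ 3" "real K = c ^ 3"
    using pos by (simp_all add: a_def b_def c_def cube)
  have f: "real n powr (2/3) = a\<^sup>2" "real d powr (2/3) = b\<^sup>2" "real K powr (2/3) = c\<^sup>2"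
    using pos by (simp_all add: a_def b_def c_def cube)
  show ?thesis
  proof (rule that[OF p e])
    show "alpha_par L n d K = a\<^sup>2 / (100 * L * (b\<^sup>2 * c))"
      unfolding alpha_par_def f by (simp add: c_def)
    show "beta_par n d K = a / (b * c\<^sup>2)"
      unfolding beta_par_def f by (simp add: a_def b_def)
    show "(real d / (real n * real K)) powr (2/3) = b\<^sup>2 / (a\<^sup>2 * c\<^sup>2)"
      by (simp add: powr_divide powr_mult f)
    have "b\<^sup>2 * (a * c) = real d powr (2/3) * (real n * real K) powr (1/3)"
      unfolding f by (simp add: powr_mult a_def c_def)
    also have "\<dots> \<le> real (b0_par n d K)"
      unfolding b0_par_def by (rule of_nat_ceiling)
    finally show "b\<^sup>2 * (a * c) \<le> real (b0_par n d K)" .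
  qed
qed

section \<open>The rate\<close>

text \<open>
  A bound for the average of \<open>grad_moment\<close> over the nodes at the starting points, where \<open>\<Delta>\<close> bounds the
  initial gap and \<open>D\<close> the initial disagreement.
\<close>

definition moment_const :: "real \<Rightarrow> real \<Rightarrow> real \<Rightarrow> real \<Rightarrow> real \<Rightarrow> real \<Rightarrow> real \<Rightarrow> real" where
  "moment_const L \<sigma>0 \<sigma>1 \<sigma>2 \<sigma>3 \<Delta> D =
     (1 + \<sigma>0\<^sup>2) * (5/4 * ((1 + \<sigma>2\<^sup>2) * (2 * L * \<Delta>) + \<sigma>3\<^sup>2) + 5 * L\<^sup>2 * D) + (\<sigma>1\<^sup>2 + L\<^sup>2)"

text \<open>
  The variance that persists at a stationary point: the coefficient of \<open>\<beta>\<^sup>2 d\<close> in the innovations.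
\<close>

definition noise_const :: "real \<Rightarrow> real \<Rightarrow> real \<Rightarrow> real \<Rightarrow> real" where
  "noise_const L \<sigma>0 \<sigma>1 \<sigma>3 = 25/16 * (5/4 * (1 + \<sigma>0\<^sup>2) * \<sigma>3\<^sup>2 + \<sigma>1\<^sup>2 + L\<^sup>2) + 10 * L\<^sup>2"

text \<open>
  The first line stems from the descent and the mean error, the second one from the disagreement. The
  large numbers stem from \<open>100 * \<alpha> * L \<le> 50\<close>, which bounds \<open>1 / K\<close> by \<open>50\<close> and \<open>\<beta>\<^sup>2\<close> by \<open>50\<^sup>2\<close> times the rate.
\<close>

definition rate_const :: "real \<Rightarrow> real \<Rightarrow> real \<Rightarrow> real \<Rightarrow> real \<Rightarrow> real \<Rightarrow> real \<Rightarrow> real \<Rightarrow> real" where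
  "rate_const L \<sigma>0 \<sigma>1 \<sigma>2 \<sigma>3 \<rho> \<Delta> D =
    (let V = moment_const L \<sigma>0 \<sigma>1 \<sigma>2 \<sigma>3 \<Delta> D; H = noise_const L \<sigma>0 \<sigma>1 \<sigma>3; R = \<rho> ^ 4 / (1 - \<rho>\<^sup>2) ^ 4 in
     2 * (200 * L * \<Delta> + 5/4 * (5/4 * V + 50 * L\<^sup>2 + H) + 6250 * L\<^sup>2)
     + 5 * (200 * L * D / (1 - \<rho>\<^sup>2) + 16 * R * (200 * V + 250 * L\<^sup>2 + 15/2 * V) + 21 * H))"

text \<open>
  In terms of the cube roots of \<open>n\<close>, \<open>d\<close> and \<open>K\<close> all parameters are monomials, and each contribution
  to the averaged bound is a constant times the rate.
\<close>

lemma rate_monomials: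
  fixes a b c L :: real
  assumes pos: "0 < a" "0 < b" "0 < c" "0 < L"
  defines "\<alpha> \<equiv> a\<^sup>2 / (100 * L * (b\<^sup>2 * c))" and "\<beta> \<equiv> a / (b * c\<^sup>2)" and "\<rho> \<equiv> b\<^sup>2 / (a\<^sup>2 * c\<^sup>2)"
  shows "\<beta> = 10000 * \<alpha>\<^sup>2 * L\<^sup>2 * b ^ 3 / a ^ 3"
    and "1 / (\<alpha> * c ^ 3) = 100 * L * \<rho>"
    and "\<beta> * b ^ 3 / a ^ 3 = \<rho>"
    and "1 / c ^ 3 = 100 * (\<alpha> * L) * \<rho>"
    and "\<beta>\<^sup>2 = (100 * (\<alpha> * L))\<^sup>2 * \<rho>"
    and "b ^ 3 / ((b\<^sup>2 * (a * c)) * c ^ 3) = \<beta> * \<rho>"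
  using pos unfolding \<alpha>_def \<beta>_def \<rho>_def
  by (simp_all add: field_simps power2_eq_square power3_eq_cube)

context dzovr_analysis
begin

lemma rate_bound:
  fixes K :: nat
  assumes K: "K \<ge> 1"
    and \<alpha>: "\<alpha> = alpha_par L n d K" and \<beta>: "\<beta> = beta_par n d K" and b0: "b0 = b0_par n d K"
    and \<rho>: "\<rho> = consensus_rho n W"
    and le: "\<alpha> \<le> a0 n d L \<sigma>0 \<sigma>2 \<rho> \<alpha>"
    and D: "spread x0 \<le> D * \<alpha>"
    and \<Delta>: "global_obj n \<Xi> F (node_avg n x0) - l \<le> \<Delta>"
    and l: "\<And>y. y \<in> euclid d \<Longrightarrow> l \<le> global_obj n \<Xi> F y"
  shows "1 / real K * total grad_sq K \<le> rate_const L \<sigma>0 \<sigma>1 \<sigma>2 \<sigma>3 \<rho> \<Delta> D * (real d / (real n * real K)) powr (2/3)"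
proof -
  have L: "0 < L" using constants by simp
  have \<alpha>0: "0 < \<alpha>" by (rule parameters)
  note \<rho>b = consensus_rho_bounds[folded \<rho>]
  have r: "0 < 1 - \<rho>\<^sup>2" using \<rho>b by (simp add: power_less_one_iff)
  define R where "R = \<rho> ^ 4 / (1 - \<rho>\<^sup>2) ^ 4"
  have R0: "0 \<le> R" unfolding R_def using r by simp
  note st = step_conditions[OF L n_pos d_pos \<rho>b \<alpha>0 le, folded R_def]
  obtain a b c where p: "0 < a" "0 < b" "0 < c" "real n = a ^ 3" "real d = b ^ 3" "real K = c ^ 3"
    and \<alpha>': "\<alpha> = a\<^sup>2 / (100 * L * (b\<^sup>2 * c))" and \<beta>': "\<beta> = a / (b * c\<^sup>2)"
    and rate': "(real d / (real n * real K)) powr (2/3) = b\<^sup>2 / (a\<^sup>2 * c\<^sup>2)"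
    and b0': "b\<^sup>2 * (a * c) \<le> real b0"
    using parameters_cube_roots[OF L n_pos d_pos K] unfolding \<alpha> \<beta> b0 by metis
  define e where "e = (real d / (real n * real K)) powr (2/3)"
  have e': "e = b\<^sup>2 / (a\<^sup>2 * c\<^sup>2)" using rate' by (simp add: e_def)
  have e0: "0 \<le> e" unfolding e' by simp
  note mono = rate_monomials[OF p(1-3) L, folded \<alpha>' \<beta>' e', folded p(4-6)]
  have K0: "0 < real K" using K by simp
  have n0: "1 \<le> real n" "1 \<le> real d" using n_pos d_pos by auto
  have \<beta>0: "0 < \<beta>" "\<beta> \<le> 1" by (rule beta_pos, rule beta_le_1)
  have gap0: "0 \<le> global_obj n \<Xi> F (node_avg n x0) - l"
    using l[OF node_avg_euclid[OF x0_euclid]] by simp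
  have \<Delta>0: "0 \<le> \<Delta>" using gap0 \<Delta> by simp
  have D0: "0 \<le> D"
  proof -
    have "0 \<le> D * \<alpha>" using D spread_nonneg[of x0] by linarith
    then show ?thesis using \<alpha>0 by (simp add: zero_le_mult_iff)
  qed
  have Sp0: "x_spread 0 \<le> D * \<alpha>" "x_spread 0 \<le> D"
    using D initial_values(1)[OF l] mult_left_mono[OF st(1) D0] by auto
  have Ga0: "grad_sq 0 \<le> 2 * L * \<Delta>"
  proof -
    have "0 \<le> 2 * L" using L by simp
    from mult_left_mono[OF \<Delta> this] show ?thesis using initial_values(2)[OF l] by linarith
  qed
  define V where "V = moment_const L \<sigma>0 \<sigma>1 \<sigma>2 \<sigma>3 \<Delta> D"
  define H where "H = noise_const L \<sigma>0 \<sigma>1 \<sigma>3"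
  have inner: "5/4 * ((1 + \<sigma>2\<^sup>2) * grad_sq 0 + \<sigma>3\<^sup>2) + 5 * L\<^sup>2 * x_spread 0 \<le> 5/4 * ((1 + \<sigma>2\<^sup>2) * (2 * L * \<Delta>) + \<sigma>3\<^sup>2) + 5 * L\<^sup>2 * D"
    using Ga0 Sp0(2) by (intro add_mono mult_left_mono order_refl) auto
  have AG0: "grad_moment_bound 0 \<le> V"
    unfolding grad_moment_bound_def V_def moment_const_def
    by (intro add_right_mono mult_left_mono inner) simp
  have V0: "0 \<le> V" using AG0 grad_moment_bound_nonneg[of 0] by simp
  have H0: "0 \<le> H" unfolding H_def noise_const_def by (intro add_nonneg_nonneg mult_nonneg_nonneg) auto
  have innerV: "5/4 * ((1 + \<sigma>2\<^sup>2) * (2 * L * \<Delta>) + \<sigma>3\<^sup>2) + 5 * L\<^sup>2 * D \<le> V"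
  proof -
    let ?i = "5/4 * ((1 + \<sigma>2\<^sup>2) * (2 * L * \<Delta>) + \<sigma>3\<^sup>2) + 5 * L\<^sup>2 * D"
    have "0 \<le> ?i" using L \<Delta>0 D0 by (intro add_nonneg_nonneg mult_nonneg_nonneg) auto
    then have "1 * ?i \<le> (1 + \<sigma>0\<^sup>2) * ?i" by (intro mult_right_mono) auto
    then have "?i \<le> (1 + \<sigma>0\<^sup>2) * ?i" by (simp only: mult_1)
    then show ?thesis unfolding V_def moment_const_def by (rule add_increasing2[rotated]) simp
  qed
  have b0pos: "0 < real b0" using parameters(1) by simp
  have batch: "real d / (real b0 * real K) \<le> \<beta> * e"
  proof -
    have "real d / (real b0 * real K) \<le> real d / ((b\<^sup>2 * (a * c)) * real K)"
      using p K0 b0' b0pos n0 by (intro divide_left_mono mult_right_mono mult_pos_pos) auto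
    then show ?thesis using mono(6) by simp
  qed
  have Et0: "node_err_sq 0 / real K \<le> 5/4 * V * (\<beta> * e)"
  proof -
    have "node_err_sq 0 \<le> 5/4 * real d * V / real b0"
      using node_err_sq_0 AG0 b0pos by (auto intro!: order_trans[OF node_err_sq_0] divide_right_mono mult_left_mono)
    then have "node_err_sq 0 / real K \<le> 5/4 * real d * V / real b0 / real K" using K0 by (intro divide_right_mono) auto
    also have "\<dots> = 5/4 * V * (real d / (real b0 * real K))" by (simp add: mult_ac)
    also have "\<dots> \<le> 5/4 * V * (\<beta> * e)" using V0 by (intro mult_left_mono batch) auto
    finally show ?thesis .
  qed
  have be: "\<beta> * e \<le> e" using mult_right_mono[OF \<beta>0(2) e0] by simp
  have Et0': "node_err_sq 0 / real K \<le> 5/4 * V * e"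
    using Et0 mult_left_mono[OF be, of "5/4 * V"] V0 by simp
  have Ee0: "avg_err_sq 0 / \<beta> / real K \<le> 5/4 * V * e"
  proof -
    have "avg_err_sq 0 \<le> 5/4 * real d * V / (real n * real b0)"
      using AG0 b0pos n0 by (auto intro!: order_trans[OF avg_err_sq_0] divide_right_mono mult_left_mono)
    also have "\<dots> \<le> 5/4 * real d * V / (1 * real b0)"
      using b0pos n0 V0 by (intro divide_left_mono mult_right_mono mult_pos_pos) auto
    finally have "avg_err_sq 0 / \<beta> / real K \<le> 5/4 * real d * V / (1 * real b0) / \<beta> / real K"
      using K0 \<beta>0 by (intro divide_right_mono) auto
    also have "\<dots> = 5/4 * V * (real d / (real b0 * real K)) / \<beta>" by (simp add: mult_ac)
    also have "\<dots> \<le> 5/4 * V * (\<beta> * e) / \<beta>" using V0 \<beta>0 by (intro divide_right_mono mult_left_mono batch) auto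
    also have "\<dots> = 5/4 * V * e" using \<beta>0 by simp
    finally show ?thesis .
  qed
  have invK: "1 / real K \<le> 50 * e"
    unfolding mono(4) using mult_right_mono[OF st(2), of "100 * e"] e0 by (simp add: mult_ac)
  have Df0: "change_sq 0 / real K \<le> (200 * V + 50 * L\<^sup>2) * e + 5/2 * V * e"
  proof -
    have "change_sq 0 \<le> 4 * V + L\<^sup>2 + 2 * node_err_sq 0"
      by (rule order_trans[OF change_sq_0]) (intro add_right_mono mult_left_mono order_trans[OF inner innerV], simp)
    then have "change_sq 0 / real K \<le> (4 * V + L\<^sup>2 + 2 * node_err_sq 0) / real K" using K0 by (intro divide_right_mono) auto
    also have "\<dots> = (4 * V + L\<^sup>2) * (1 / real K) + 2 * (node_err_sq 0 / real K)" by (simp add: add_divide_distrib)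
    also have "\<dots> \<le> (4 * V + L\<^sup>2) * (50 * e) + 2 * (5/4 * V * e)"
      using V0 by (intro add_mono mult_left_mono invK Et0') auto
    finally show ?thesis by (simp add: algebra_simps)
  qed
  have \<beta>eq: "\<beta> = 10000 * \<alpha>\<^sup>2 * L\<^sup>2 * real d / real n" using mono(1) .
  let ?X = "2 * x_spread 0 / (1 - \<rho>\<^sup>2)"
  have sums: "0 \<le> total grad_sq K" "0 \<le> total dir_sq K" "0 \<le> total x_spread K" "0 \<le> total noise_sq (K - 1)"
    by (intro sum_nonneg quantities_nonneg)+
  have J6: "total x_spread K \<le> ?X + 16 * R * \<alpha>\<^sup>2 * total change_sq K"
    using sum_spread[OF K, folded \<rho>] by (simp add: R_def)
  have X0: "0 \<le> ?X" using r quantities_nonneg(3)[of 0] by simp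
  have "total grad_sq K \<le> 2 * (2 / \<alpha> * (global_obj n \<Xi> F (node_avg n x0) - l)
        + 5/4 * (avg_err_sq 0 / \<beta> + L\<^sup>2 + real K * (\<beta> * real d / real n) * H) + 5/2 * real K * L\<^sup>2 * \<beta>\<^sup>2)
      + 5 * (?X / \<alpha>\<^sup>2 + 16 * R * (change_sq 0 + 4 * \<beta> * node_err_sq 0 + 4 * L\<^sup>2) + 21 * (real K * (\<beta> * real d / real n) * H))"
    by (rule feedback_closed[where ?s0.0 = "1 + \<sigma>0\<^sup>2" and ?s2.0 = "1 + \<sigma>2\<^sup>2" and ?q3.0 = "\<sigma>3\<^sup>2" and ?q1.0 = "\<sigma>1\<^sup>2",
          OF \<alpha>0 \<beta>0 L n0 _ _ _ R0 _ _ sums gap0 quantities_nonneg(6) quantities_nonneg(7) quantities_nonneg(5) X0 \<beta>eq st(2-6)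
          sum_descent[OF st(2) l] sum_avg_err_sq[OF K] sum_node_err_sq[OF K] sum_grad_moment_bound sum_noise[OF K] sum_difference[OF K] J6])
      (simp_all add: H_def noise_const_def)
  then have "total grad_sq K / real K \<le> (2 * (2 / \<alpha> * (global_obj n \<Xi> F (node_avg n x0) - l)
        + 5/4 * (avg_err_sq 0 / \<beta> + L\<^sup>2 + real K * (\<beta> * real d / real n) * H) + 5/2 * real K * L\<^sup>2 * \<beta>\<^sup>2)
      + 5 * (?X / \<alpha>\<^sup>2 + 16 * R * (change_sq 0 + 4 * \<beta> * node_err_sq 0 + 4 * L\<^sup>2) + 21 * (real K * (\<beta> * real d / real n) * H))) / real K"
    using K0 by (intro divide_right_mono) auto
  also have "\<dots> = 2 * (2 * (1 / (\<alpha> * real K)) * (global_obj n \<Xi> F (node_avg n x0) - l)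
        + 5/4 * (avg_err_sq 0 / \<beta> / real K + L\<^sup>2 * (1 / real K) + e * H) + 5/2 * L\<^sup>2 * \<beta>\<^sup>2)
      + 5 * (?X / \<alpha>\<^sup>2 / real K + 16 * R * (change_sq 0 / real K + 4 * \<beta> * (node_err_sq 0 / real K) + 4 * L\<^sup>2 * (1 / real K)) + 21 * (e * H))"
  proof -
    have "(2 * (2 / \<alpha> * p + 5/4 * (q + L\<^sup>2 + real K * e * H) + 5/2 * real K * L\<^sup>2 * \<beta>\<^sup>2)
        + 5 * (y + 16 * R * (v + 4 * \<beta> * w + 4 * L\<^sup>2) + 21 * (real K * e * H))) / real K
      = 2 * (2 * (1 / (\<alpha> * real K)) * p + 5/4 * (q / real K + L\<^sup>2 * (1 / real K) + e * H) + 5/2 * L\<^sup>2 * \<beta>\<^sup>2)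
        + 5 * (y / real K + 16 * R * (v / real K + 4 * \<beta> * (w / real K) + 4 * L\<^sup>2 * (1 / real K)) + 21 * (e * H))"
      for p q y v w :: real
      using K0 \<alpha>0 by (simp add: field_simps)
    then show ?thesis unfolding mono(3) by blast
  qed
  also have "\<dots> \<le> 2 * (2 * (100 * L * e) * \<Delta>
        + 5/4 * (5/4 * V * e + L\<^sup>2 * (50 * e) + e * H) + 5/2 * L\<^sup>2 * (2500 * e))
      + 5 * (200 * L * D / (1 - \<rho>\<^sup>2) * e + 16 * R * ((200 * V + 50 * L\<^sup>2) * e + 5/2 * V * e + 4 * 1 * (5/4 * V * e)
        + 4 * L\<^sup>2 * (50 * e)) + 21 * (e * H))"
  proof (intro add_mono mult_left_mono Ee0 invK Df0 order_refl)
    show "2 * (1 / (\<alpha> * real K)) * (global_obj n \<Xi> F (node_avg n x0) - l) \<le> 2 * (100 * L * e) * \<Delta>"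
      unfolding mono(2) using L e0 by (intro mult_left_mono \<Delta>) auto
    show "\<beta>\<^sup>2 \<le> 2500 * e"
    proof -
      have "100 * (\<alpha> * L) \<le> 50" "0 \<le> 100 * (\<alpha> * L)" using st(2) \<alpha>0 L by (linarith, simp)
      then have "(100 * (\<alpha> * L))\<^sup>2 \<le> 50\<^sup>2" by (rule power_mono)
      then show ?thesis unfolding mono(5) using e0 by (intro mult_right_mono) auto
    qed
    show "?X / \<alpha>\<^sup>2 / real K \<le> 200 * L * D / (1 - \<rho>\<^sup>2) * e"
    proof -
      have "?X / \<alpha>\<^sup>2 / real K \<le> 2 * (D * \<alpha>) / (1 - \<rho>\<^sup>2) / \<alpha>\<^sup>2 / real K"
        using r K0 Sp0(1) by (intro divide_right_mono mult_left_mono) auto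
      also have "\<dots> = 2 * D / (1 - \<rho>\<^sup>2) * (1 / (\<alpha> * real K))" using \<alpha>0 by (simp add: power2_eq_square)
      also have "\<dots> = 200 * L * D / (1 - \<rho>\<^sup>2) * e" unfolding mono(2) by simp
      finally show ?thesis .
    qed
    show "4 * \<beta> * (node_err_sq 0 / real K) \<le> 4 * 1 * (5/4 * V * e)"
      using \<beta>0 Et0' quantities_nonneg(7)[of 0] K0 by (intro mult_mono mult_left_mono) auto
  qed (use R0 e0 in auto)
  also have "\<dots> = rate_const L \<sigma>0 \<sigma>1 \<sigma>2 \<sigma>3 \<rho> \<Delta> D * e"
    unfolding rate_const_def Let_def V_def[symmetric] H_def[symmetric] R_def[symmetric] by (simp add: algebra_simps)
  finally show ?thesis by (simp add: e_def)
qed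

end

lemma alpha_par_eventually_small:
  fixes n d :: nat and L :: real
  assumes pos: "0 < L" "1 \<le> n" "1 \<le> d" "0 < y"
  obtains K0 where "\<And>K. K \<ge> K0 \<Longrightarrow> K \<ge> 1 \<Longrightarrow> alpha_par L n d K \<le> y"
proof -
  define B where "B = 1 / (100 * L) * (real n powr (2/3) / real d powr (2/3))"
  have B: "0 < B" using pos by (simp add: B_def)
  show ?thesis
  proof (rule that[of "nat \<lceil>(B / y) ^ 3\<rceil>"])
    fix K assume K: "nat \<lceil>(B / y) ^ 3\<rceil> \<le> K" "1 \<le> K"
    have "(B / y) ^ 3 \<le> real K" using K(1) by linarith
    then have "((B / y) ^ 3) powr (1/3) \<le> real K powr (1/3)"
      using B pos by (intro powr_mono2) auto
    moreover have "((B / y) ^ 3) powr (1/3) = B / y"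
    proof -
      have z: "0 < B / y" using B pos by simp
      have "(B / y) ^ 3 = (B / y) powr 3" using powr_realpow[OF z, of 3] by simp
      then show ?thesis using B pos by (simp only: powr_powr) simp
    qed
    ultimately have "B / y \<le> real K powr (1/3)" by (simp only:)
    then have "B / real K powr (1/3) \<le> y"
      using pos K by (simp add: field_simps)
    moreover have "alpha_par L n d K = B / real K powr (1/3)"
      by (simp add: alpha_par_def B_def)
    ultimately show "alpha_par L n d K \<le> y" by simp
  qed
qed

theorem corollary1:
  fixes L \<sigma>0 \<sigma>1 \<sigma>2 \<sigma>3 \<rho> \<Delta> D :: real
  shows "\<exists>C::real.
    \<forall>n d E W (\<Xi> :: nat \<Rightarrow> 'x measure) F x0.
      decentralized_problem n d E W \<Xi> F L \<sigma>0 \<sigma>1 \<sigma>2 \<sigma>3 \<longrightarrow>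
      consensus_rho n W = \<rho> \<longrightarrow>
      (\<forall>i\<in>{1..n}. x0 i \<in> euclid d) \<longrightarrow>
      global_obj n \<Xi> F (node_avg n x0) - (INF y\<in>euclid d. global_obj n \<Xi> F y) \<le> \<Delta> \<longrightarrow>
      (\<exists>C'::real. \<forall>K (M :: 'w measure) u \<xi> x g m.
        let \<alpha> = alpha_par L n d K; \<beta> = beta_par n d K; a = a0 n d L \<sigma>0 \<sigma>2 \<rho> \<alpha>;
            rate = (real d / (real n * real K)) powr (2/3)
        in
          K \<ge> 1 \<longrightarrow>
          real K \<ge> (100 * L) ^ 3 * real n ^ 2 / (real d ^ 2 * a ^ 3) \<longrightarrow>
          1 / real n * (\<Sum>i=1..n. (norm (x0 i - node_avg n x0))\<^sup>2) \<le> D * \<alpha> \<longrightarrow>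
          dzovr_run M n d W \<Xi> F x0 (b0_par n d K) \<alpha> \<beta> (t_par n d K) u \<xi> x g m \<longrightarrow>
            mean_sq_grad n d \<Xi> F M x K \<le> ennreal (C' * rate) \<and>
            (\<alpha> \<le> a \<longrightarrow> mean_sq_grad n d \<Xi> F M x K \<le> ennreal (C * rate)))"
proof (rule exI[of _ "rate_const L \<sigma>0 \<sigma>1 \<sigma>2 \<sigma>3 \<rho> \<Delta> D"], intro allI impI)
  fix n d E W and \<Xi> :: "nat \<Rightarrow> 'x measure" and F x0
  let ?C = "rate_const L \<sigma>0 \<sigma>1 \<sigma>2 \<sigma>3 \<rho> \<Delta> D"
  let ?rate = "\<lambda>K::nat. (real d / (real n * real K)) powr (2/3)"
  let ?l = "INF y\<in>euclid d. global_obj n \<Xi> F y"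
  assume P: "decentralized_problem n d E W \<Xi> F L \<sigma>0 \<sigma>1 \<sigma>2 \<sigma>3" and \<rho>: "consensus_rho n W = \<rho>"
    and x0: "\<forall>i\<in>{1..n}. x0 i \<in> euclid d"
    and gap: "global_obj n \<Xi> F (node_avg n x0) - ?l \<le> \<Delta>"
  interpret decentralized_problem n d E W \<Xi> F L \<sigma>0 \<sigma>1 \<sigma>2 \<sigma>3 by (rule P)
  have L: "0 < L" using constants by simp
  note \<rho>b = consensus_rho_bounds[unfolded \<rho>]
  have l: "?l \<le> global_obj n \<Xi> F y" if "y \<in> euclid d" for y
    using bounded_below that by (rule cINF_lower)
  have analysis: "dzovr_analysis n d E W \<Xi> F L \<sigma>0 \<sigma>1 \<sigma>2 \<sigma>3 M x0 (b0_par n d K)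
      (alpha_par L n d K) (beta_par n d K) (t_par n d K) u \<xi> x g m"
    if K: "K \<ge> 1" and run: "dzovr_run M n d W \<Xi> F x0 (b0_par n d K)
      (alpha_par L n d K) (beta_par n d K) (t_par n d K) u \<xi> x g m"
    for K and M :: "'w measure" and u \<xi> x g m
  proof (intro dzovr_analysis.intro P run dzovr_analysis_axioms.intro)
    have nd: "0 < real n" "0 < real d" using n_pos d_pos by auto
    show \<beta>: "0 < beta_par n d K" using nd K by (simp add: beta_par_def)
    fix k
    have root: "1 \<le> (real k + 1) powr (1/4)" by (rule ge_one_powr_ge_zero) auto
    have "beta_par n d K / ((real d)\<^sup>2 * (real k + 1) powr (1/4)) \<le> beta_par n d K / ((real d)\<^sup>2 * 1)"
      using \<beta> nd root by (intro divide_left_mono mult_left_mono mult_pos_pos) auto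
    then show "t_par n d K k \<le> beta_par n d K / (real d)\<^sup>2" by (simp add: t_par_def)
    have "(real k + 1) powr (1/4) \<le> (real (Suc k) + 1) powr (1/4)" by (rule powr_mono2) auto
    then have "beta_par n d K / ((real d)\<^sup>2 * (real (Suc k) + 1) powr (1/4))
        \<le> beta_par n d K / ((real d)\<^sup>2 * (real k + 1) powr (1/4))"
      using \<beta> nd root by (intro divide_left_mono mult_left_mono mult_pos_pos) auto
    then show "t_par n d K (Suc k) \<le> t_par n d K k" by (simp add: t_par_def)
  qed (use x0 in auto)
  have main: "mean_sq_grad n d \<Xi> F M x K \<le> ennreal (?C * ?rate K)"
    if K: "K \<ge> 1" and run: "dzovr_run M n d W \<Xi> F x0 (b0_par n d K)
        (alpha_par L n d K) (beta_par n d K) (t_par n d K) u \<xi> x g m"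
      and disp: "1 / real n * (\<Sum>i=1..n. (norm (x0 i - node_avg n x0))\<^sup>2) \<le> D * alpha_par L n d K"
      and le: "alpha_par L n d K \<le> a0 n d L \<sigma>0 \<sigma>2 \<rho> (alpha_par L n d K)"
    for K and M :: "'w measure" and u \<xi> x g m
  proof -
    interpret dzovr_analysis n d E W \<Xi> F L \<sigma>0 \<sigma>1 \<sigma>2 \<sigma>3 M x0 "b0_par n d K"
      "alpha_par L n d K" "beta_par n d K" "t_par n d K" u \<xi> x g m
      by (rule analysis[OF K run])
    show ?thesis
      unfolding mean_sq_grad_eq
      by (intro ennreal_leI rate_bound[where l = ?l, OF K refl refl refl \<rho>[symmetric] le _ gap l])
        (use disp in \<open>simp_all add: spread_def\<close>)
  qed
  let ?X = "\<Sum>i=1..n. (norm (x0 i))\<^sup>2"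
  define crude_sum where "crude_sum K = 1 / real K * (\<Sum>k<K. 2 * (norm (ggrad 0))\<^sup>2
      + 2 * L\<^sup>2 * crude_bound est_growth (real n) (alpha_par L n d K) ?X k)" for K
  have crude0: "0 \<le> crude_sum K" for K
    unfolding crude_sum_def
    by (intro mult_nonneg_nonneg sum_nonneg add_nonneg_nonneg crude_bound_nonneg est_growth_nonneg) auto
  have crude: "mean_sq_grad n d \<Xi> F M x K \<le> ennreal (crude_sum K)"
    if K: "K \<ge> 1" and run: "dzovr_run M n d W \<Xi> F x0 (b0_par n d K)
        (alpha_par L n d K) (beta_par n d K) (t_par n d K) u \<xi> x g m"
    for K and M :: "'w measure" and u \<xi> x g m
  proof -
    interpret dzovr_analysis n d E W \<Xi> F L \<sigma>0 \<sigma>1 \<sigma>2 \<sigma>3 M x0 "b0_par n d K"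
      "alpha_par L n d K" "beta_par n d K" "t_par n d K" u \<xi> x g m
      by (rule analysis[OF K run])
    show ?thesis
      unfolding mean_sq_grad_eq crude_sum_def
      using grad_sq_crude unfolding crude_def by (intro ennreal_leI mult_left_mono sum_mono) auto
  qed
  have a1: "0 < a0 n d L \<sigma>0 \<sigma>2 \<rho> 1" by (rule a0_pos[OF L n_pos d_pos \<rho>b])
  obtain K0 where K0: "\<And>K. K \<ge> K0 \<Longrightarrow> K \<ge> 1 \<Longrightarrow> alpha_par L n d K \<le> a0 n d L \<sigma>0 \<sigma>2 \<rho> 1"
    using alpha_par_eventually_small[OF L n_pos d_pos a1] by blast
  have late: "alpha_par L n d K \<le> a0 n d L \<sigma>0 \<sigma>2 \<rho> (alpha_par L n d K)" if K: "K0 \<le> K" "1 \<le> K" for K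
  proof -
    have "0 < alpha_par L n d K" using L n_pos d_pos K by (simp add: alpha_par_def)
    moreover have "a0 n d L \<sigma>0 \<sigma>2 \<rho> 1 \<le> 1"
      using order_refl[of "a0 n d L \<sigma>0 \<sigma>2 \<rho> 1"] unfolding le_a0_iff[of "a0 n d L \<sigma>0 \<sigma>2 \<rho> 1"] by simp
    ultimately show ?thesis
      using K0[OF K] a0_antimono[OF L n_pos d_pos \<rho>b, of "alpha_par L n d K" \<sigma>0 \<sigma>2] by linarith
  qed
  \<comment> \<open>For each of the finitely many small horizons the quotient is the same for all runs.\<close>
  define C' where "C' = \<bar>?C\<bar> + (\<Sum>K<K0. crude_sum K / ?rate K)"
  have rate0: "0 < ?rate K" if "K \<ge> 1" for K using n_pos d_pos that by simp
  have summand: "0 \<le> crude_sum K / ?rate K" for K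
    using crude0[of K] by (intro divide_nonneg_nonneg) auto
  have small: "crude_sum K \<le> C' * ?rate K" if "K < K0" "K \<ge> 1" for K
  proof -
    have "crude_sum K / ?rate K \<le> (\<Sum>K<K0. crude_sum K / ?rate K)"
      using that summand by (intro member_le_sum) auto
    then have "crude_sum K / ?rate K \<le> C'" by (simp add: C'_def)
    then show ?thesis using rate0[OF that(2)] by (simp only: pos_divide_le_eq)
  qed
  have large: "?C * ?rate K \<le> C' * ?rate K" for K
    unfolding C'_def using sum_nonneg[of "{..<K0}" "\<lambda>K. crude_sum K / ?rate K"] summand
    by (intro mult_right_mono) (auto intro: order_trans[OF abs_ge_self])
  show "\<exists>C'::real. \<forall>K (M :: 'w measure) u \<xi> x g m.
        let \<alpha> = alpha_par L n d K; \<beta> = beta_par n d K; a = a0 n d L \<sigma>0 \<sigma>2 \<rho> \<alpha>;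
            rate = (real d / (real n * real K)) powr (2/3)
        in
          K \<ge> 1 \<longrightarrow>
          real K \<ge> (100 * L) ^ 3 * real n ^ 2 / (real d ^ 2 * a ^ 3) \<longrightarrow>
          1 / real n * (\<Sum>i=1..n. (norm (x0 i - node_avg n x0))\<^sup>2) \<le> D * \<alpha> \<longrightarrow>
          dzovr_run M n d W \<Xi> F x0 (b0_par n d K) \<alpha> \<beta> (t_par n d K) u \<xi> x g m \<longrightarrow>
            mean_sq_grad n d \<Xi> F M x K \<le> ennreal (C' * rate) \<and>
            (\<alpha> \<le> a \<longrightarrow> mean_sq_grad n d \<Xi> F M x K \<le> ennreal (?C * rate))"
    unfolding Let_def
  proof (intro exI[of _ C'] allI impI conjI)
    fix K and M :: "'w measure" and u \<xi> x g m
    assume K: "1 \<le> K"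
      and disp: "1 / real n * (\<Sum>i=1..n. (norm (x0 i - node_avg n x0))\<^sup>2) \<le> D * alpha_par L n d K"
      and run: "dzovr_run M n d W \<Xi> F x0 (b0_par n d K) (alpha_par L n d K) (beta_par n d K)
        (t_par n d K) u \<xi> x g m"
    show "mean_sq_grad n d \<Xi> F M x K \<le> ennreal (?C * ?rate K)"
      if "alpha_par L n d K \<le> a0 n d L \<sigma>0 \<sigma>2 \<rho> (alpha_par L n d K)"
      by (rule main[OF K run disp that])
    show "mean_sq_grad n d \<Xi> F M x K \<le> ennreal (C' * ?rate K)"
    proof (cases "K < K0")
      case True
      then show ?thesis
        by (rule order_trans[OF crude[OF K run] ennreal_leI[OF small[OF _ K]]])
    next
      case False
      then show ?thesis
        using order_trans[OF main[OF K run disp late[OF _ K]] ennreal_leI[OF large]] by simp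
    qed
  qed
qed

end
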